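(* Let $\lambda>1$, $\nu>0$, $x\in\ell^2$, $\alpha_1\in(0,\frac12)$, and for $N\ge1$ put $\varepsilon_N=\big(\sum_{j=1}^Nj^{-2\alpha_1}\big)^{-1}$. Let $X^N$ be an ($L^\infty$-)weak solution, with $X^N(0)=x$, to $$dX^N= B(X^N)\,dt + \sqrt{2\nu \varepsilon_N} \sum_i \lambda^i\sum_{j=1}^N j^{-\alpha_1} A_{i,i+j} X^N \, dW_{i,j} + \nu S_{\theta^N} X^N \, dt,$$ where $\theta^N_j=\sqrt{\varepsilon_N}\,j^{-\alpha_1}$ for $1\le j\le N$ and $\theta^N_j=0$ for $j>N$. Let $\tilde X$ be the unique weak solution to $\frac{d\tilde X}{dt}=B(\tilde X)+\nu S\tilde X$, $\tilde X(0)=x$, and define $\xi^N=(X^N-\tilde X)/\sqrt{\varepsilon_N}$. Let $\xi$ be the unique solution, driven by the same Brownian motions $\{W_{i,j}\}_{i,j\ge1}$ as $X^N$, to $$d\xi=\big[B(\xi,\tilde X)+B(\tilde X,\xi)\big]dt+\nu S\xi\,dt+\sqrt{2\nu}\sum_i\lambda^i\sum_{j=1}^\infty j^{-\alpha_1}A_{i,i+j}\tilde X\,dW_{i,j},\qquad \xi(0)=0.$$ Then for any $\beta\in(0,1)$ and $T>0$, $$\lim_{N\to\infty}\sup_{t\in[0,T]}\mathbb E\,\|\xi^N(t)-\xi(t)\|_{H^{-\beta}}^2=0.$$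
   Context: $\ell^2$ is the space of square summable real sequences $x=(x_n)_{n\ge1}$, with the convention $x_0=0$. For $s\in\mathbb R$, $H^s$ is the space of real sequences with $\|x\|_{H^s}=(\sum_n\lambda^{2ns}x_n^2)^{1/2}<\infty$. $B(X)=B(X,X)$ with $B(X,Y)_n=\lambda^{n-1}X_{n-1}Y_{n-1}-\lambda^nX_nY_{n+1}$. $S=-\mathrm{diag}(\lambda^2,\lambda^4,\ldots)$. For $1\le i<k$, $A_{i,k}$ is the infinite skew-symmetric matrix whose only nonzero entries are $-1$ at $(i,k)$ and $1$ at $(k,i)$. For $\theta\in\ell^2$, $S_\theta$ is the diagonal matrix with $n$-th entry $-\big(\lambda^{2n}+\sum_{j=1}^{n-1}\theta_j^2\lambda^{2(n-j)}\big)$. Weak solution to the stochastic model with coefficients $\theta$ (here $\theta=\theta^N$, $\|\theta^N\|_{\ell^2}=1$): a filtered probability space $(\Omega,\mathcal F,\mathcal F_t,\mathbb P)$ (which may depend on $N$), independent real Brownian motions $\{W_{i,j}\}_{i,j\ge1}$ on it, and an $\ell^2$-valued process $X=(X_n)_{n\ge1}$ with continuous adapted components such that for each $n\ge1$ (with $X_0\equiv0$) $$\begin{aligned}X_n(t)&=x_n+\int_0^t\big(\lambda^{n-1}X_{n-1}^2-\lambda^nX_nX_{n+1}\big)ds-\nu\int_0^t\Big(\lambda^{2n}+\sum_{j=1}^{n-1}\theta_j^2\lambda^{2(n-j)}\Big)X_n\,ds\\&\quad+\sqrt{2\nu}\int_0^t\sum_{j=1}^{n-1}\lambda^j\theta_{n-j}X_j\,dW_{j,n-j}-\sqrt{2\nu}\,\lambda^n\int_0^t\sum_{j=1}^\infty\theta_jX_{n+j}\,dW_{n,j}.\end{aligned}$$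 It is an $L^\infty$-weak solution if $\|X(t)\|_{\ell^2}$ is bounded by a constant for a.e. $(\omega,t)\in\Omega\times[0,T]$; the solutions $X^N$ satisfy $\|X^N(t)\|_{\ell^2}\le\|x\|_{\ell^2}$ for all $t\in[0,T]$ a.s. A weak solution $\tilde X$ of the deterministic equation is $\tilde X\in L^\infty(0,T;\ell^2)$ with $\tilde X_n\in C^1([0,T])$ and the $n$-th component equation holding pointwise on $[0,T]$ for each $n$; it is unique and satisfies $\|\tilde X(t)\|_{\ell^2}\le\|x\|_{\ell^2}$. The equation for $\xi$ is understood in mild form: $\xi$ has continuous paths in $H^{-\beta}$ and $$\xi_t=\int_0^te^{\nu(t-r)S}\big[B(\xi_r,\tilde X_r)+B(\tilde X_r,\xi_r)\big]dr+\sqrt{2\nu}\sum_i\lambda^i\sum_{j=1}^\infty j^{-\alpha_1}\int_0^te^{\nu(t-r)S}A_{i,i+j}\tilde X_r\,dW_{i,j}(r).$$ On any filtered probability space carrying the Brownian motions this has a unique solution. *)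

theory Defs
  imports "HOL-Probability.Probability"
begin

text \<open>A sequence $(x_n)_{n \ge 1}$ is a function on \<^typ>\<open>nat\<close> with \<open>x 0 = 0\<close>, which is also the
  convention $x_0 = 0$ used in the nonlinearity.\<close>

definition ell2 :: "(nat \<Rightarrow> real) set" where
  "ell2 = {x. x 0 = 0 \<and> summable (\<lambda>n. (x n)\<^sup>2)}"

definition ell2_norm :: "(nat \<Rightarrow> real) \<Rightarrow> real" where
  "ell2_norm x = sqrt (\<Sum>n. (x n)\<^sup>2)"

text \<open>The squared $H^s$ norm takes the value \<open>\<infinity>\<close> on sequences outside $H^s$.\<close>

definition Hs_norm_sq :: "real \<Rightarrow> real \<Rightarrow> (nat \<Rightarrow> real) \<Rightarrow> ennreal" where
  "Hs_norm_sq lam s x =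
     (\<Sum>n. ennreal (lam powr (2 * real (Suc n) * s) * (x (Suc n))\<^sup>2))"

definition Hs :: "real \<Rightarrow> real \<Rightarrow> (nat \<Rightarrow> real) set" where
  "Hs lam s = {x. x 0 = 0 \<and> Hs_norm_sq lam s x < \<infinity>}"

definition B :: "real \<Rightarrow> (nat \<Rightarrow> real) \<Rightarrow> (nat \<Rightarrow> real) \<Rightarrow> nat \<Rightarrow> real" where
  "B lam X Y n =
     (if n = 0 then 0
      else lam ^ (n - 1) * X (n - 1) * Y (n - 1) - lam ^ n * X n * Y (n + 1))"

definition S :: "real \<Rightarrow> (nat \<Rightarrow> real) \<Rightarrow> nat \<Rightarrow> real" where
  "S lam x n = - (lam ^ (2 * n) * x n)"

definition exp_S :: "real \<Rightarrow> real \<Rightarrow> (nat \<Rightarrow> real) \<Rightarrow> nat \<Rightarrow> real" where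
  "exp_S lam t x n = exp (- (t * lam ^ (2 * n))) * x n"

definition S_theta :: "real \<Rightarrow> (nat \<Rightarrow> real) \<Rightarrow> (nat \<Rightarrow> real) \<Rightarrow> nat \<Rightarrow> real" where
  "S_theta lam \<theta> x n =
     - ((lam ^ (2 * n) + (\<Sum>j=1..<n. (\<theta> j)\<^sup>2 * lam ^ (2 * (n - j)))) * x n)"

definition skew_mat :: "nat \<Rightarrow> nat \<Rightarrow> nat \<Rightarrow> nat \<Rightarrow> real" where
  "skew_mat i k m n =
     (if m = i \<and> n = k then - 1 else if m = k \<and> n = i then 1 else 0)"

definition mat_apply :: "(nat \<Rightarrow> nat \<Rightarrow> real) \<Rightarrow> (nat \<Rightarrow> real) \<Rightarrow> nat \<Rightarrow> real" where
  "mat_apply A x m = (\<Sum>n. A m n * x n)"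

definition eps :: "real \<Rightarrow> nat \<Rightarrow> real" where
  "eps \<alpha> N = inverse (\<Sum>j=1..N. real j powr (- 2 * \<alpha>))"

definition theta :: "real \<Rightarrow> nat \<Rightarrow> nat \<Rightarrow> real" where
  "theta \<alpha> N j =
     (if 1 \<le> j \<and> j \<le> N then sqrt (eps \<alpha> N) * real j powr (- \<alpha>) else 0)"

text \<open>Time is \<^typ>\<open>real\<close>; the members of the filtration at negative times play no role.
  Completeness and right continuity of the filtration are not required.\<close>

definition filtered_prob_space :: "'a measure \<Rightarrow> (real \<Rightarrow> 'a measure) \<Rightarrow> bool" where
  "filtered_prob_space M F \<longleftrightarrow>
     prob_space M \<and> filtration (space M) F \<and> (\<forall>t. subalgebra M (F t))"

definition brownian_motion ::
  "'a measure \<Rightarrow> (real \<Rightarrow> 'a measure) \<Rightarrow> (real \<Rightarrow> 'a \<Rightarrow> real) \<Rightarrow> bool" where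
  "brownian_motion M F W \<longleftrightarrow>
     (AE \<omega> in M. W 0 \<omega> = 0) \<and>
     (\<forall>\<omega>\<in>space M. continuous_on {0..} (\<lambda>t. W t \<omega>)) \<and>
     (\<forall>t\<ge>0. W t \<in> borel_measurable (F t)) \<and>
     (\<forall>s t. 0 \<le> s \<and> s < t \<longrightarrow>
        distributed M lborel (\<lambda>\<omega>. W t \<omega> - W s \<omega>) (\<lambda>y. ennreal (normal_density 0 (sqrt (t - s)) y)) \<and>
        prob_space.indep_set M (sets (F s))
          {(\<lambda>\<omega>. W t \<omega> - W s \<omega>) -` A \<inter> space M | A. A \<in> sets borel})"

definition indep_brownian_family ::
  "'a measure \<Rightarrow> (real \<Rightarrow> 'a measure) \<Rightarrow> (nat \<Rightarrow> nat \<Rightarrow> real \<Rightarrow> 'a \<Rightarrow> real) \<Rightarrow> bool" where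
  "indep_brownian_family M F W \<longleftrightarrow>
     (\<forall>i\<ge>1. \<forall>j\<ge>1. brownian_motion M F (W i j)) \<and>
     prob_space.indep_vars M (\<lambda>_. \<Pi>\<^sub>M t\<in>{0..}. borel)
       (\<lambda>(i, j) \<omega>. restrict (\<lambda>t. W i j t \<omega>) {0..}) ({1..} \<times> {1..})"

text \<open>A simple process $\sum_{k<m} \psi_k 1_{(\tau_k, \tau_{k+1}]}$ with bounded
  $\mathcal F_{\tau_k}$-measurable $\psi_k$ is given by the data \<open>m\<close>, \<open>\<tau>\<close>, \<open>\<psi>\<close>.\<close>

definition simple_process ::
  "(real \<Rightarrow> 'a measure) \<Rightarrow> nat \<Rightarrow> (nat \<Rightarrow> real) \<Rightarrow> (nat \<Rightarrow> 'a \<Rightarrow> real) \<Rightarrow> bool" where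
  "simple_process F m \<tau> \<psi> \<longleftrightarrow>
     0 \<le> \<tau> 0 \<and> (\<forall>k<m. \<tau> k \<le> \<tau> (Suc k)) \<and>
     (\<forall>k<m. \<psi> k \<in> borel_measurable (F (\<tau> k)) \<and> (\<exists>C. \<forall>\<omega>\<in>space (F (\<tau> k)). \<bar>\<psi> k \<omega>\<bar> \<le> C))"

definition simple_eval ::
  "nat \<Rightarrow> (nat \<Rightarrow> real) \<Rightarrow> (nat \<Rightarrow> 'a \<Rightarrow> real) \<Rightarrow> real \<Rightarrow> 'a \<Rightarrow> real" where
  "simple_eval m \<tau> \<psi> r \<omega> = (\<Sum>k<m. \<psi> k \<omega> * indicator {\<tau> k<..\<tau> (Suc k)} r)"

definition simple_ito ::
  "(real \<Rightarrow> 'a \<Rightarrow> real) \<Rightarrow> nat \<Rightarrow> (nat \<Rightarrow> real) \<Rightarrow> (nat \<Rightarrow> 'a \<Rightarrow> real) \<Rightarrow> real \<Rightarrow> 'a \<Rightarrow> real" where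
  "simple_ito W m \<tau> \<psi> t \<omega> =
     (\<Sum>k<m. \<psi> k \<omega> * (W (min t (\<tau> (Suc k))) \<omega> - W (min t (\<tau> k)) \<omega>))"

text \<open>\<open>has_ito_integral M F W f t Y\<close>: almost surely $Y = \int_0^t f(r)\,dW_r$, for integrands in
  $L^2(\Omega \times [0,t])$. The integral is the $L^2(\Omega)$ limit of the integrals of simple
  processes converging to \<open>f\<close> in $L^2(\Omega \times [0,t])$; by the Ito isometry it is determined
  up to null sets. The approximation forces \<open>f\<close> to be square integrable and, up to a null set,
  predictable.\<close>

definition has_ito_integral ::
  "'a measure \<Rightarrow> (real \<Rightarrow> 'a measure) \<Rightarrow> (real \<Rightarrow> 'a \<Rightarrow> real) \<Rightarrow> (real \<Rightarrow> 'a \<Rightarrow> real) \<Rightarrow>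
     real \<Rightarrow> ('a \<Rightarrow> real) \<Rightarrow> bool" where
  "has_ito_integral M F W f t Y \<longleftrightarrow>
     (\<lambda>(r, \<omega>). f r \<omega>) \<in> borel_measurable (restrict_space lborel {0..t} \<Otimes>\<^sub>M M) \<and>
     Y \<in> borel_measurable M \<and>
     (\<exists>(m :: nat \<Rightarrow> nat) (\<tau> :: nat \<Rightarrow> nat \<Rightarrow> real) (\<psi> :: nat \<Rightarrow> nat \<Rightarrow> 'a \<Rightarrow> real).
        (\<forall>k. simple_process F (m k) (\<tau> k) (\<psi> k)) \<and>
        (\<lambda>k. \<integral>\<^sup>+ \<omega>. (\<integral>\<^sup>+ r\<in>{0..t}.
               ennreal ((f r \<omega> - simple_eval (m k) (\<tau> k) (\<psi> k) r \<omega>)\<^sup>2) \<partial>lborel) \<partial>M)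
          \<longlonglongrightarrow> 0 \<and>
        (\<lambda>k. \<integral>\<^sup>+ \<omega>. ennreal ((Y \<omega> - simple_ito W (m k) (\<tau> k) (\<psi> k) t \<omega>)\<^sup>2) \<partial>M)
          \<longlonglongrightarrow> 0)"

text \<open>$Z = \sum_{j \ge 1} Y_j$ with convergence in $L^2(\Omega)$, respectively in
  $L^2(\Omega; H^s)$.\<close>

definition L2_sums :: "'a measure \<Rightarrow> (nat \<Rightarrow> 'a \<Rightarrow> real) \<Rightarrow> ('a \<Rightarrow> real) \<Rightarrow> bool" where
  "L2_sums M Y Z \<longleftrightarrow>
     Z \<in> borel_measurable M \<and>
     (\<lambda>m. \<integral>\<^sup>+ \<omega>. ennreal ((Z \<omega> - (\<Sum>j=1..m. Y j \<omega>))\<^sup>2) \<partial>M) \<longlonglongrightarrow> 0"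

definition L2_Hs_sums ::
  "real \<Rightarrow> real \<Rightarrow> 'a measure \<Rightarrow> (nat \<Rightarrow> 'a \<Rightarrow> nat \<Rightarrow> real) \<Rightarrow> ('a \<Rightarrow> nat \<Rightarrow> real) \<Rightarrow> bool" where
  "L2_Hs_sums lam s M Y Z \<longleftrightarrow>
     (\<forall>n. (\<lambda>\<omega>. Z \<omega> n) \<in> borel_measurable M) \<and>
     (\<forall>\<omega>\<in>space M. Z \<omega> 0 = 0) \<and>
     (\<lambda>m. \<integral>\<^sup>+ \<omega>. Hs_norm_sq lam s (\<lambda>n. Z \<omega> n - (\<Sum>j=1..m. Y j \<omega> n)) \<partial>M) \<longlonglongrightarrow> 0"

text \<open>For \<open>n \<ge> 1\<close>, \<open>I j\<close> is the stochastic integral against $W_{j,n-j}$ and \<open>J j\<close> the one against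
  $W_{n,j}$. The identity holds almost surely for each \<open>t\<close>, which by path continuity is the same
  as almost surely for all \<open>t\<close>. Stochastic integrals are taken in the $L^2$ sense, which is no
  restriction for the $L^\infty$ solutions considered below.\<close>

definition weak_solution ::
  "real \<Rightarrow> real \<Rightarrow> (nat \<Rightarrow> real) \<Rightarrow> (nat \<Rightarrow> real) \<Rightarrow> real \<Rightarrow>
     'a measure \<Rightarrow> (real \<Rightarrow> 'a measure) \<Rightarrow> (nat \<Rightarrow> nat \<Rightarrow> real \<Rightarrow> 'a \<Rightarrow> real) \<Rightarrow>
     (real \<Rightarrow> 'a \<Rightarrow> nat \<Rightarrow> real) \<Rightarrow> bool" where
  "weak_solution lam \<nu> \<theta> x T M F W X \<longleftrightarrow>
     filtered_prob_space M F \<and> indep_brownian_family M F W \<and>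
     (\<forall>t\<in>{0..T}. \<forall>\<omega>\<in>space M. X t \<omega> \<in> ell2) \<and>
     (\<forall>n. \<forall>t\<in>{0..T}. (\<lambda>\<omega>. X t \<omega> n) \<in> borel_measurable (F t)) \<and>
     (\<forall>n. \<forall>\<omega>\<in>space M. continuous_on {0..T} (\<lambda>t. X t \<omega> n)) \<and>
     (\<forall>n\<ge>1. \<forall>t\<in>{0..T}. \<exists>I J Z.
        (\<forall>j\<in>{1..<n}.
           has_ito_integral M F (W j (n - j)) (\<lambda>r \<omega>. lam ^ j * \<theta> (n - j) * X r \<omega> j) t (I j)) \<and>
        (\<forall>j\<ge>1. has_ito_integral M F (W n j) (\<lambda>r \<omega>. \<theta> j * X r \<omega> (n + j)) t (J j)) \<and>
        L2_sums M J Z \<and>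
        (AE \<omega> in M. X t \<omega> n =
           x n + (LINT s:{0..t}|lborel. B lam (X s \<omega>) (X s \<omega>) n)
           + \<nu> * (LINT s:{0..t}|lborel. S_theta lam \<theta> (X s \<omega>) n)
           + sqrt (2 * \<nu>) * (\<Sum>j=1..<n. I j \<omega>)
           - sqrt (2 * \<nu>) * lam ^ n * Z \<omega>))"

definition Linf_weak_solution ::
  "real \<Rightarrow> real \<Rightarrow> (nat \<Rightarrow> real) \<Rightarrow> (nat \<Rightarrow> real) \<Rightarrow> real \<Rightarrow>
     'a measure \<Rightarrow> (real \<Rightarrow> 'a measure) \<Rightarrow> (nat \<Rightarrow> nat \<Rightarrow> real \<Rightarrow> 'a \<Rightarrow> real) \<Rightarrow>
     (real \<Rightarrow> 'a \<Rightarrow> nat \<Rightarrow> real) \<Rightarrow> bool" where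
  "Linf_weak_solution lam \<nu> \<theta> x T M F W X \<longleftrightarrow>
     weak_solution lam \<nu> \<theta> x T M F W X \<and>
     (\<exists>C. AE p in M \<Otimes>\<^sub>M restrict_space lborel {0..T}. ell2_norm (X (snd p) (fst p)) \<le> C)"

definition det_weak_solution ::
  "real \<Rightarrow> real \<Rightarrow> (nat \<Rightarrow> real) \<Rightarrow> real \<Rightarrow> (real \<Rightarrow> nat \<Rightarrow> real) \<Rightarrow> bool" where
  "det_weak_solution lam \<nu> x T X \<longleftrightarrow>
     (\<exists>C. AE t in restrict_space lborel {0..T}. X t \<in> ell2 \<and> ell2_norm (X t) \<le> C) \<and>
     (\<forall>t\<in>{0..T}. X t 0 = 0) \<and> (\<forall>n. X 0 n = x n) \<and>
     (\<forall>n\<ge>1. continuous_on {0..T} (\<lambda>t. B lam (X t) (X t) n + \<nu> * S lam (X t) n) \<and>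
        (\<forall>t\<in>{0..T}. ((\<lambda>t. X t n) has_real_derivative
           (B lam (X t) (X t) n + \<nu> * S lam (X t) n)) (at t within {0..T})))"

text \<open>\<open>Y\<close> is the solution of the deterministic equation, \<open>I i j\<close> is the $H^{-\beta}$-valued integral
  $\int_0^t e^{\nu(t-r)S} A_{i,i+j} Y_r\,dW_{i,j}(r)$, which like the drift integral is computed
  componentwise, and \<open>G i\<close> is the inner series over \<open>j\<close>. The initial condition
  $\xi(0) = 0$ is the case \<open>t = 0\<close> of the identity. Adaptedness of \<open>\<xi>\<close> is not part of the
  definition: being determined by the stochastic convolution, \<open>\<xi>\<close> is adapted up to null sets.\<close>

definition mild_solution ::
  "real \<Rightarrow> real \<Rightarrow> real \<Rightarrow> real \<Rightarrow> real \<Rightarrow>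
     'a measure \<Rightarrow> (real \<Rightarrow> 'a measure) \<Rightarrow> (nat \<Rightarrow> nat \<Rightarrow> real \<Rightarrow> 'a \<Rightarrow> real) \<Rightarrow>
     (real \<Rightarrow> nat \<Rightarrow> real) \<Rightarrow> (real \<Rightarrow> 'a \<Rightarrow> nat \<Rightarrow> real) \<Rightarrow> bool" where
  "mild_solution lam \<nu> \<alpha> \<beta> T M F W Y \<xi> \<longleftrightarrow>
     (\<forall>n. \<forall>t\<in>{0..T}. (\<lambda>\<omega>. \<xi> t \<omega> n) \<in> borel_measurable M) \<and>
     (\<forall>\<omega>\<in>space M. \<forall>t\<in>{0..T}. \<xi> t \<omega> \<in> Hs lam (- \<beta>) \<and>
        ((\<lambda>s. Hs_norm_sq lam (- \<beta>) (\<lambda>n. \<xi> s \<omega> n - \<xi> t \<omega> n)) \<longlongrightarrow> 0) (at t within {0..T})) \<and>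
     (\<forall>t\<in>{0..T}. \<exists>I G Z.
        (\<forall>i\<ge>1. \<forall>j\<ge>1. \<forall>n. has_ito_integral M F (W i j)
           (\<lambda>r _. exp_S lam (\<nu> * (t - r)) (mat_apply (skew_mat i (i + j)) (Y r)) n)
           t (\<lambda>\<omega>. I i j \<omega> n)) \<and>
        (\<forall>i\<ge>1. L2_Hs_sums lam (- \<beta>) M (\<lambda>j \<omega> n. real j powr (- \<alpha>) * I i j \<omega> n) (G i)) \<and>
        L2_Hs_sums lam (- \<beta>) M (\<lambda>i \<omega> n. lam ^ i * G i \<omega> n) Z \<and>
        (AE \<omega> in M. \<forall>n. \<xi> t \<omega> n =
           (LINT r:{0..t}|lborel. exp_S lam (\<nu> * (t - r))
              (\<lambda>k. B lam (\<xi> r \<omega>) (Y r) k + B lam (Y r) (\<xi> r \<omega>) k) n)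
           + sqrt (2 * \<nu>) * Z \<omega> n))"

end

theory Submission
  imports Defs
begin

text \<open>Put \<open>D = X\<^sup>N - X_tilde\<close> and \<open>\<eta> = D / \<surd>\<epsilon>\<^sub>N - \<xi>\<close>. Since convolving the \<open>n\<close>-th component with
  \<open>exp (- \<nu> \<lambda>\<^sup>2\<^sup>n t)\<close> gains the factor \<open>\<lambda>\<^sup>-\<^sup>2\<^sup>n\<close>, the drift \<open>B(u, P) + B(Q, u)\<close> with bounded \<open>P\<close>, \<open>Q\<close> is
  absorbed by Gronwall's inequality in every sequence norm with slowly decreasing weights: a mild
  solution is bounded in mean square by its forcing. The forcing of \<open>\<eta>\<close> consists of the convolution of
  \<open>B(\<xi>, D)\<close>, an Ito correction of order \<open>\<surd>\<epsilon>\<^sub>N\<close>, and the stochastic convolution with the integrands of \<open>X\<^sup>N\<close>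
  minus those of the deterministic solution.

  All three are bounded uniformly in \<open>N\<close>, so \<open>\<eta>\<close> is bounded in mean square, whence \<open>E D\<^sub>k\<^sup>2 = O(\<epsilon>\<^sub>N)\<close> for
  each \<open>k\<close>. By the Ito isometry this makes the noise difference small on every fixed mode, and the high
  modes are small through the weights. The term \<open>B(\<xi>, D)\<close> requires \<open>E [D\<^sub>k\<^sup>2 |\<xi>|\<^sup>2]\<close> to be small. For that the
  Gronwall estimate for \<open>\<xi>\<close> is repeated with the bounded random weight \<open>D\<^sub>k\<^sup>2\<close>: the forcing of \<open>\<xi>\<close> has
  deterministic integrands, so up to a small error in mean square it is a finite combination, the same for
  every \<open>N\<close>, of Brownian increments, whose fourth moments are finite.

  Stochastic integrals are treated only through pairs (integrand, integral) in the closed linear span of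
  the elementary ones, on which the Ito isometry holds; passing to stochastic convolutions is a limit of
  Riemann sums.\<close>

section \<open>Exponential convolutions and the Gronwall inequality\<close>

text \<open>The obstacle is the product \<open>B(\<xi>, D)\<close>. The difference \<open>D\<close>
  is small only in mean square and \<open>\<xi>\<close> is controlled only in mean square, so the
  expectation of the product cannot be split by Cauchy-Schwarz. A bounded random weight that is
  frozen in time passes through the pathwise drift estimate untouched; only the forcing meets it,
  and there higher moments are required of finitely many Gaussian increments instead of
  \<open>\<xi>\<close> itself. The weight is taken from \<open>X\<close> at one time and used at all
  earlier times, so it anticipates; for this reason no martingale argument is applied to weighted
  quantities.

  The probability space may change with N, so a smallness threshold must be found before the space
  is fixed. The key estimates therefore quantify over all spaces and keep only deterministic data
  outside: the solution \<open>X_tilde\<close> and the constants.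

  The two exponents enter separately: \<beta> through the weights, which must be summable over the
  modes and may lose at most lam^2 from one mode to the next, and \<alpha> < 1/2 through the
  divergence of the sum that defines \<open>eps\<close>.\<close>

definition conv :: "real \<Rightarrow> (real \<Rightarrow> real) \<Rightarrow> real \<Rightarrow> real" where
  "conv c g t = (LINT r:{0..t}|lborel. exp (- (c * (t - r))) * g r)"

text \<open>The weight exp (-2Ks) makes the integral term a contraction of factor 1/2 for the
  weighted supremum \<open>S\<close>, so that it can be absorbed on the left. Finiteness of the
  integral makes \<open>S\<close> finite, without which the absorption would say nothing. The
  function is replaced by its exponential bound before an integral is evaluated, so monotonicity of
  the integral is enough.\<close>

lemma gronwall_nn_integral:
  fixes \<phi> :: "real \<Rightarrow> ennreal"
  assumes fin: "(\<integral>\<^sup>+t\<in>{0..T}. \<phi> t \<partial>lborel) < \<infinity>" and K: "K > 0" and b: "b \<ge> 0"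
    and le: "\<And>t. t \<in> {0..T} \<Longrightarrow> \<phi> t \<le> ennreal b + ennreal K * (\<integral>\<^sup>+s\<in>{0..t}. \<phi> s \<partial>lborel)"
    and t: "t \<in> {0..T}"
  shows "\<phi> t \<le> ennreal (2 * b * exp (2 * K * T))"
proof -
  define S where "S = (SUP s\<in>{0..T}. \<phi> s * ennreal (exp (- 2 * K * s)))"
  have int_le: "(\<integral>\<^sup>+s\<in>{0..r}. \<phi> s \<partial>lborel) \<le> (\<integral>\<^sup>+s\<in>{0..T}. \<phi> s \<partial>lborel)" if "r \<in> {0..T}" for r
    using that by (intro nn_integral_mono) (auto simp: indicator_def)
  have "S \<le> ennreal b + ennreal K * (\<integral>\<^sup>+s\<in>{0..T}. \<phi> s \<partial>lborel)"
    unfolding S_def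
  proof (rule SUP_least)
    fix s assume s: "s \<in> {0..T}"
    have "\<phi> s * ennreal (exp (- 2 * K * s)) \<le> \<phi> s * 1"
      using s K by (intro mult_left_mono) (auto simp: ennreal_le_1)
    also have "\<dots> \<le> ennreal b + ennreal K * (\<integral>\<^sup>+s\<in>{0..T}. \<phi> s \<partial>lborel)"
      using le[OF s] by (simp, elim order.trans) (intro add_left_mono mult_left_mono int_le[OF s], simp)
    finally show "\<phi> s * ennreal (exp (- 2 * K * s)) \<le> \<dots>" .
  qed
  also have "\<dots> < \<infinity>" using fin by (simp add: ennreal_mult_less_top)
  finally have "S < \<infinity>" .
  then obtain s0 where s0: "S = ennreal s0" "s0 \<ge> 0" by (cases S) auto
  have phi_le: "\<phi> s \<le> S * ennreal (exp (2 * K * s))" if s: "s \<in> {0..T}" for s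
  proof -
    have "\<phi> s = \<phi> s * ennreal (exp (- 2 * K * s)) * ennreal (exp (2 * K * s))"
      by (simp add: mult.assoc flip: ennreal_mult exp_add)
    also have "\<dots> \<le> S * ennreal (exp (2 * K * s))"
      unfolding S_def using s by (intro mult_right_mono SUP_upper) auto
    finally show ?thesis .
  qed
  have "S \<le> ennreal (b + s0 / 2)"
    unfolding S_def
  proof (rule SUP_least)
    fix r assume r: "r \<in> {0..T}"
    have "(\<integral>\<^sup>+s\<in>{0..r}. \<phi> s \<partial>lborel) \<le> (\<integral>\<^sup>+s. S * (ennreal (exp (2 * K * s)) * indicator {0..r} s) \<partial>lborel)"
      using r phi_le by (intro nn_integral_mono) (auto simp: indicator_def)
    also have "\<dots> = S * (\<integral>\<^sup>+s. ennreal (exp (2 * K * s)) * indicator {0..r} s \<partial>lborel)"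
      by (intro nn_integral_cmult) auto
    also have "(\<integral>\<^sup>+s. ennreal (exp (2 * K * s)) * indicator {0..r} s \<partial>lborel)
        = ennreal (exp (2 * K * r) / (2 * K) - exp (2 * K * 0) / (2 * K))"
      using r K by (intro nn_integral_FTC_Icc) (auto intro!: derivative_eq_intros)
    also have "S * \<dots> \<le> S * ennreal (exp (2 * K * r) / (2 * K))"
      using K by (intro mult_left_mono ennreal_leI) auto
    also have "\<dots> = ennreal (s0 * (exp (2 * K * r) / (2 * K)))"
      using s0 K by (simp only: s0(1)) (subst ennreal_mult, auto)
    finally have *: "(\<integral>\<^sup>+s\<in>{0..r}. \<phi> s \<partial>lborel) \<le> ennreal (s0 * (exp (2 * K * r) / (2 * K)))" .
    have "\<phi> r \<le> ennreal b + ennreal K * (\<integral>\<^sup>+s\<in>{0..r}. \<phi> s \<partial>lborel)"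
      by (rule le[OF r])
    also have "\<dots> \<le> ennreal b + ennreal K * ennreal (s0 * (exp (2 * K * r) / (2 * K)))"
      using * by (intro add_left_mono mult_left_mono) auto
    also have "\<dots> = ennreal (b + s0 * exp (2 * K * r) / 2)"
      using K b s0 by (simp flip: ennreal_mult ennreal_plus)
    finally have "\<phi> r * ennreal (exp (- 2 * K * r)) \<le> ennreal (b + s0 * exp (2 * K * r) / 2) * ennreal (exp (- 2 * K * r))"
      by (intro mult_right_mono) auto
    also have "\<dots> = ennreal (b * exp (- 2 * K * r) + s0 / 2)"
      using b s0 by (simp add: algebra_simps flip: ennreal_mult exp_add)
    also have "\<dots> \<le> ennreal (b + s0 / 2)"
      using b K r by (intro ennreal_leI add_right_mono) (auto simp: mult_left_le)
    finally show "\<phi> r * ennreal (exp (- 2 * K * r)) \<le> ennreal (b + s0 / 2)" .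
  qed
  then have "s0 \<le> b + s0 / 2" using s0 b by (simp add: ennreal_le_iff del: ennreal_plus)
  then have "s0 \<le> 2 * b" by simp
  have "\<phi> t \<le> S * ennreal (exp (2 * K * t))" by (rule phi_le[OF t])
  also have "\<dots> \<le> ennreal (2 * b * exp (2 * K * T))"
    using s0 \<open>s0 \<le> 2 * b\<close> b t K by (auto simp flip: ennreal_mult intro!: ennreal_leI mult_mono)
  finally show ?thesis .
qed

section \<open>Smoothing by the exponential kernel\<close>

lemma Cauchy_Schwarz_integral:
  fixes f g :: "'a \<Rightarrow> real"
  assumes [measurable]: "f \<in> borel_measurable M" "g \<in> borel_measurable M"
    and f: "integrable M (\<lambda>x. (f x)\<^sup>2)" and g: "integrable M (\<lambda>x. (g x)\<^sup>2)"
  shows "integrable M (\<lambda>x. f x * g x)"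
    and "(\<integral>x. f x * g x \<partial>M)\<^sup>2 \<le> (\<integral>x. (f x)\<^sup>2 \<partial>M) * (\<integral>x. (g x)\<^sup>2 \<partial>M)"
proof -
  show fg: "integrable M (\<lambda>x. f x * g x)"
  proof (rule Bochner_Integration.integrable_bound[of _ "\<lambda>x. (f x)\<^sup>2 + (g x)\<^sup>2"])
    show "AE x in M. norm (f x * g x) \<le> norm ((f x)\<^sup>2 + (g x)\<^sup>2)"
    proof (rule AE_I2)
      fix x
      have "2 * (\<bar>f x\<bar> * \<bar>g x\<bar>) \<le> (f x)\<^sup>2 + (g x)\<^sup>2"
        using sum_squares_bound[of "\<bar>f x\<bar>" "\<bar>g x\<bar>"] by simp
      moreover have "0 \<le> \<bar>f x\<bar> * \<bar>g x\<bar>" by simp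
      ultimately show "norm (f x * g x) \<le> norm ((f x)\<^sup>2 + (g x)\<^sup>2)"
       by (simp only: real_norm_def abs_mult)
    qed
  qed (use f g in auto)
  define A B C where "A = (\<integral>x. (f x)\<^sup>2 \<partial>M)" "B = (\<integral>x. f x * g x \<partial>M)" "C = (\<integral>x. (g x)\<^sup>2 \<partial>M)"
  have q: "0 \<le> A + 2 * s * B + s\<^sup>2 * C" for s
  proof -
    have "0 \<le> (\<integral>x. (f x + s * g x)\<^sup>2 \<partial>M)" by simp
    also have "(\<integral>x. (f x + s * g x)\<^sup>2 \<partial>M) = (\<integral>x. (f x)\<^sup>2 + 2 * s * (f x * g x) + s\<^sup>2 * (g x)\<^sup>2 \<partial>M)"
      by (intro Bochner_Integration.integral_cong) (auto simp: power2_eq_square algebra_simps)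
    also have "\<dots> = A + 2 * s * B + s\<^sup>2 * C"
      using f g fg by (simp add: A_B_C_def)
    finally show ?thesis .
  qed
  have "A \<ge> 0" "C \<ge> 0" by (auto simp: A_B_C_def)
  have "B\<^sup>2 \<le> A * C"
  proof (cases "C = 0")
    case True
    have "B = 0"
    proof (rule ccontr)
      assume "B \<noteq> 0"
      \<comment> \<open>With vanishing quadratic coefficient this argument gives the polynomial the
        value -1.\<close>
      then show False using q[of "- (A + 1) / (2 * B)"] True by (simp add: field_simps)
    qed
    with True show ?thesis by simp
  next
    case False
    then have C: "C > 0" using \<open>C \<ge> 0\<close> by simp
    have "0 \<le> C * (A + 2 * (- B / C) * B + (- B / C)\<^sup>2 * C)"
      using q[of "- B / C"] C by simp
    also have "\<dots> = A * C - B\<^sup>2" using C by (simp add: field_simps power2_eq_square)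
    finally show ?thesis by simp
  qed
  then show "(\<integral>x. f x * g x \<partial>M)\<^sup>2 \<le> (\<integral>x. (f x)\<^sup>2 \<partial>M) * (\<integral>x. (g x)\<^sup>2 \<partial>M)"
    by (simp add: A_B_C_def)
qed

lemma exp_lborel_integral:
  fixes c t :: real
  assumes "c > 0" "t \<ge> 0"
  shows "(LINT r:{0..t}|lborel. exp (- (c * (t - r)))) = (1 - exp (- (c * t))) / c"
proof -
  have "(LINT r:{0..t}|lborel. exp (- (c * (t - r)))) = (\<integral>r. indicator {0..t} r *\<^sub>R exp (- (c * (t - r))) \<partial>lborel)"
    by (simp add: set_lebesgue_integral_def)
  also have "\<dots> = exp (- (c * (t - t))) / c - exp (- (c * (t - 0))) / c"
    using assms
    by (subst integral_FTC_Icc[where F = "\<lambda>r::real. exp (- (c * (t - r))) / c"])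
      (auto intro!: derivative_eq_intros continuous_intros simp: has_real_derivative_iff_has_vector_derivative[symmetric])
  finally show ?thesis by (simp add: diff_divide_distrib)
qed

lemma continuous_on_set_integrable_lborel:
  fixes g :: "real \<Rightarrow> real"
  assumes "continuous_on {a..b} g"
  shows "set_integrable lborel {a..b} g"
  using borel_integrable_atLeastAtMost'[OF assms] .

lemma nn_integral_eq_set_lebesgue:
  fixes g :: "real \<Rightarrow> real"
  assumes "continuous_on {a..b} g" "\<And>r. r \<in> {a..b} \<Longrightarrow> g r \<ge> 0"
  shows "(\<integral>\<^sup>+r\<in>{a..b}. ennreal (g r) \<partial>lborel) = ennreal (LINT r:{a..b}|lborel. g r)"
proof -
  have "(\<integral>\<^sup>+r\<in>{a..b}. ennreal (g r) \<partial>lborel) = (\<integral>\<^sup>+r. ennreal (indicator {a..b} r *\<^sub>R g r) \<partial>lborel)"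
    by (intro nn_integral_cong) (auto simp: indicator_def)
  also have "\<dots> = ennreal (\<integral>r. indicator {a..b} r *\<^sub>R g r \<partial>lborel)"
    using continuous_on_set_integrable_lborel[OF assms(1)] assms(2)
    by (intro nn_integral_eq_integral) (auto simp: set_integrable_def indicator_def)
  finally show ?thesis by (simp add: set_lebesgue_integral_def)
qed

text \<open>Cauchy-Schwarz against the kernel, whose square integrates to at most 1/(2c). The factor
  1/c is the smoothing of the semigroup: for c = \<nu> lam^(2n) it cancels the lam^(2n) that appears
  when \<open>B\<close> is squared on mode n.\<close>

lemma conv_power2_le:
  assumes c: "c > 0" and t: "t \<ge> 0" and g: "continuous_on {0..t} g"
  shows "ennreal ((conv c g t)\<^sup>2) \<le> ennreal (1 / c) * (\<integral>\<^sup>+r\<in>{0..t}. ennreal ((g r)\<^sup>2) \<partial>lborel)"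
proof -
  define f where "f = (\<lambda>r. exp (- (c * (t - r))))"
  have fc: "continuous_on {0..t} f" unfolding f_def by (intro continuous_intros)
  have sq: "integrable lborel (\<lambda>r. (indicator {0..t} r *\<^sub>R h r)\<^sup>2)" and m: "(\<lambda>r. indicator {0..t} r *\<^sub>R h r) \<in> borel_measurable lborel"
    and e: "(\<integral>r. (indicator {0..t} r *\<^sub>R h r)\<^sup>2 \<partial>lborel) = (LINT r:{0..t}|lborel. (h r)\<^sup>2)"
    if h: "continuous_on {0..t} h" for h :: "real \<Rightarrow> real"
  proof -
    have eq: "(indicator {0..t} r *\<^sub>R h r)\<^sup>2 = indicator {0..t} r *\<^sub>R (h r)\<^sup>2" for r by (auto simp: indicator_def)
    show "integrable lborel (\<lambda>r. (indicator {0..t} r *\<^sub>R h r)\<^sup>2)"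
      unfolding eq using continuous_on_set_integrable_lborel[of 0 t "\<lambda>r. (h r)\<^sup>2"] h
      by (auto simp: set_integrable_def intro!: continuous_intros)
    show "(\<lambda>r. indicator {0..t} r *\<^sub>R h r) \<in> borel_measurable lborel"
      using continuous_on_set_integrable_lborel[OF h] by (auto simp: set_integrable_def)
    show "(\<integral>r. (indicator {0..t} r *\<^sub>R h r)\<^sup>2 \<partial>lborel) = (LINT r:{0..t}|lborel. (h r)\<^sup>2)"
      unfolding eq set_lebesgue_integral_def ..
  qed
  have "(conv c g t)\<^sup>2 = (\<integral>r. (indicator {0..t} r *\<^sub>R f r) * (indicator {0..t} r *\<^sub>R g r) \<partial>lborel)\<^sup>2"
    unfolding conv_def set_lebesgue_integral_def f_def
    by (intro arg_cong[where f = "\<lambda>x. x\<^sup>2"] Bochner_Integration.integral_cong) (auto simp: indicator_def)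
  also have "\<dots> \<le> (LINT r:{0..t}|lborel. (f r)\<^sup>2) * (LINT r:{0..t}|lborel. (g r)\<^sup>2)"
    unfolding e[OF fc, symmetric] e[OF g, symmetric]
    by (intro Cauchy_Schwarz_integral m sq fc g)
  also have "(LINT r:{0..t}|lborel. (f r)\<^sup>2) = (LINT r:{0..t}|lborel. exp (- (2 * c * (t - r))))"
    by (intro set_lebesgue_integral_cong) (auto simp: f_def exp_double[symmetric] algebra_simps)
  also have "\<dots> = (1 - exp (- (2 * c * t))) / (2 * c)" using exp_lborel_integral[of "2 * c" t] c t by simp
  also have "\<dots> * (LINT r:{0..t}|lborel. (g r)\<^sup>2) \<le> (1 / c) * (LINT r:{0..t}|lborel. (g r)\<^sup>2)"
  proof (rule mult_right_mono)
    have "(1 - exp (- (2 * c * t))) / (2 * c) \<le> 1 / (2 * c)" using c by (intro divide_right_mono) auto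
    also have "\<dots> \<le> 1 / c" using c by (simp add: field_simps)
    finally show "(1 - exp (- (2 * c * t))) / (2 * c) \<le> 1 / c" .
    show "0 \<le> (LINT r:{0..t}|lborel. (g r)\<^sup>2)" by (simp add: set_lebesgue_integral_def)
  qed
  finally have "ennreal ((conv c g t)\<^sup>2) \<le> ennreal ((1 / c) * (LINT r:{0..t}|lborel. (g r)\<^sup>2))" by (rule ennreal_leI)
  also have "\<dots> = ennreal (1 / c) * ennreal (LINT r:{0..t}|lborel. (g r)\<^sup>2)"
    using c by (intro ennreal_mult) (auto simp: set_lebesgue_integral_def)
  also have "ennreal (LINT r:{0..t}|lborel. (g r)\<^sup>2) = (\<integral>\<^sup>+r\<in>{0..t}. ennreal ((g r)\<^sup>2) \<partial>lborel)"
    using g by (intro nn_integral_eq_set_lebesgue[symmetric]) (auto intro!: continuous_intros)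
  finally show ?thesis .
qed

lemma conv_diff:
  assumes "continuous_on {0..t} f" "continuous_on {0..t} g"
  shows "conv c (\<lambda>r. f r - g r) t = conv c f t - conv c g t"
  unfolding conv_def
  by (subst set_integral_diff(2)[symmetric])
    (auto intro!: continuous_on_set_integrable_lborel continuous_intros assms simp: right_diff_distrib)

lemma conv_cmult: "conv c (\<lambda>r. a * f r) t = a * conv c f t"
  unfolding conv_def by (simp add: mult.left_commute[of _ a])

text \<open>The kernel has total mass at most 1/c. This version serves where bounds hold along
  almost every path and not only in mean square.\<close>

lemma conv_abs_le:
  assumes c: "c > 0" and t: "t \<ge> 0" and g: "continuous_on {0..t} g" and le: "\<And>r. r \<in> {0..t} \<Longrightarrow> \<bar>g r\<bar> \<le> C"
  shows "\<bar>conv c g t\<bar> \<le> C / c"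
proof -
  have C: "C \<ge> 0" using le[of 0] t by auto
  have "\<bar>conv c g t\<bar> \<le> (LINT r:{0..t}|lborel. \<bar>exp (- (c * (t - r))) * g r\<bar>)"
    unfolding conv_def
    using set_integral_norm_bound[OF continuous_on_set_integrable_lborel, of 0 t "\<lambda>r. exp (- (c * (t - r))) * g r"] g
    by (fastforce intro!: continuous_intros)
  also have "\<dots> \<le> (LINT r:{0..t}|lborel. C * exp (- (c * (t - r))))"
    using g le by (intro set_integral_mono continuous_on_set_integrable_lborel continuous_intros) (auto simp: abs_mult mult.commute[of C])
  also have "\<dots> = C * ((1 - exp (- (c * t))) / c)" using exp_lborel_integral[OF c t] by simp
  also have "\<dots> \<le> C * (1 / c)" using C c by (intro mult_left_mono divide_right_mono) auto
  finally show ?thesis by simp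
qed

text \<open>The path y itself need not be differentiable, but z = y - m is, with z' = h - c m - c z
  and z(0) = 0. The bracket \<open>m t - c * conv c m t\<close> is the integral of exp (-c (t - s))
  against dm(s), the value m(0) counting as a jump at time 0, after integration by parts; in this
  form it makes sense for every continuous path m.\<close>

lemma duhamel:
  assumes t: "t \<ge> 0" and cont: "continuous_on {0..t} y" "continuous_on {0..t} h" "continuous_on {0..t} m"
    and eq: "\<And>s. s \<in> {0..t} \<Longrightarrow> y s = (LINT r:{0..s}|lborel. h r) - c * (LINT r:{0..s}|lborel. y r) + m s"
  shows "y t = conv c h t + (m t - c * conv c m t)"
proof -
  define z where "z = (\<lambda>s. integral {0..s} (\<lambda>r. h r - c * y r))"
  have gc: "continuous_on {0..t} (\<lambda>r. h r - c * y r)" by (intro continuous_intros cont)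
  have z: "y s = z s + m s" if s: "s \<in> {0..t}" for s
  proof -
    have sub: "continuous_on {0..s} y" "continuous_on {0..s} h"
      using s cont by (auto intro: continuous_on_subset)
    have "(LINT r:{0..s}|lborel. h r) - c * (LINT r:{0..s}|lborel. y r) = (LINT r:{0..s}|lborel. h r - c * y r)"
      using sub by (subst set_integral_diff(2)) (auto intro!: continuous_on_set_integrable_lborel continuous_intros)
    also have "\<dots> = z s"
      unfolding z_def by (rule set_borel_integral_eq_integral)
        (use sub in \<open>auto intro!: continuous_on_set_integrable_lborel continuous_intros\<close>)
    finally show ?thesis using eq[OF s] by simp
  qed
  have zd: "(z has_real_derivative (h s - c * y s)) (at s within {0..t})" if "s \<in> {0..t}" for s
    unfolding z_def using integral_has_real_derivative[OF gc that] .
  have "(\<integral>r. indicator {0..t} r *\<^sub>R (exp (- (c * (t - r))) * (h r - c * m r)) \<partial>lborel)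
      = exp (- (c * (t - t))) * z t - exp (- (c * (t - 0))) * z 0"
  proof (rule integral_FTC_Icc[OF t])
    fix s assume s: "0 \<le> s" "s \<le> t"
    have "((\<lambda>r. exp (- (c * (t - r))) * z r) has_real_derivative
        exp (- (c * (t - s))) * (h s - c * y s) + exp (- (c * (t - s))) * c * z s) (at s within {0..t})"
      using s by (auto intro!: derivative_eq_intros zd)
    then have "((\<lambda>r. exp (- (c * (t - r))) * z r) has_real_derivative
        exp (- (c * (t - s))) * (h s - c * m s)) (at s within {0..t})"
      using z[of s] s by (simp add: algebra_simps)
    then show "((\<lambda>r. exp (- (c * (t - r))) * z r) has_vector_derivative
        exp (- (c * (t - s))) * (h s - c * m s)) (at s within {0..t})"
      by (simp add: has_real_derivative_iff_has_vector_derivative)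
  qed (intro continuous_intros cont)
  also have "z 0 = 0" by (simp add: z_def)
  finally have "z t = conv c (\<lambda>r. h r - c * m r) t" by (simp add: conv_def set_lebesgue_integral_def)
  also have "\<dots> = conv c h t - c * conv c m t"
    using cont by (subst conv_diff) (auto intro!: continuous_intros simp: conv_cmult)
  finally show ?thesis using z[of t] t by simp
qed

text \<open>Reading the path at the left grid point of mesh 1/(p + 1) decomposes the process into
  countably many measurable pieces, and continuity of the paths lets the mesh tend to zero. Grid
  points are clamped to the interval \<open>{0..T}\<close>, on which measurability and continuity
  are assumed.\<close>

lemma borel_measurable_continuous_paths:
  fixes f :: "real \<Rightarrow> 'a \<Rightarrow> real"
  assumes T: "T \<ge> 0" and meas: "\<And>t. t \<in> {0..T} \<Longrightarrow> f t \<in> borel_measurable M"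
    and cont: "\<And>\<omega>. \<omega> \<in> space M \<Longrightarrow> continuous_on {0..T} (\<lambda>t. f t \<omega>)"
  shows "(\<lambda>(t, \<omega>). indicator {0..T} t * f t \<omega>) \<in> borel_measurable (lborel \<Otimes>\<^sub>M M)"
proof -
  define cl where "cl = (\<lambda>t. max 0 (min T t))"
  have cl: "cl t \<in> {0..T}" for t using T by (auto simp: cl_def)
  define a where "a = (\<lambda>(p::nat) (k::int). cl (of_int k / real (Suc p)))"
  have "(\<lambda>z. f (cl (fst z)) (snd z)) \<in> borel_measurable (lborel \<Otimes>\<^sub>M M)"
  proof (rule borel_measurable_LIMSEQ_real)
    show "(\<lambda>z. f (a p \<lfloor>real (Suc p) * fst z\<rfloor>) (snd z)) \<in> borel_measurable (lborel \<Otimes>\<^sub>M M)" for p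
    proof (rule measurable_compose_countable[where f = "\<lambda>k z. f (a p k) (snd z)"])
      show "(\<lambda>z. f (a p k) (snd z)) \<in> borel_measurable (lborel \<Otimes>\<^sub>M M)" for k
        using meas[OF cl, of "of_int k / real (Suc p)"] unfolding a_def by measurable
    qed measurable
    fix z :: "real \<times> 'a" assume z: "z \<in> space (lborel \<Otimes>\<^sub>M M)"
    obtain t \<omega> where zz: "z = (t, \<omega>)" "\<omega> \<in> space M" using z by (auto simp: space_pair_measure)
    have "(\<lambda>p. real_of_int \<lfloor>real (Suc p) * t\<rfloor> / real (Suc p)) \<longlonglongrightarrow> t"
    proof (rule tendsto_sandwich)
      show "\<forall>\<^sub>F p in sequentially. t - 1 / real (Suc p) \<le> of_int \<lfloor>real (Suc p) * t\<rfloor> / real (Suc p)"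
      proof (rule always_eventually, rule allI)
        fix p
        have "real (Suc p) * t - 1 \<le> of_int \<lfloor>real (Suc p) * t\<rfloor>" by linarith
        then have "(real (Suc p) * t - 1) / real (Suc p) \<le> of_int \<lfloor>real (Suc p) * t\<rfloor> / real (Suc p)"
          by (intro divide_right_mono) auto
        then show "t - 1 / real (Suc p) \<le> of_int \<lfloor>real (Suc p) * t\<rfloor> / real (Suc p)"
          by (simp add: diff_divide_distrib)
      qed
      show "\<forall>\<^sub>F p in sequentially. of_int \<lfloor>real (Suc p) * t\<rfloor> / real (Suc p) \<le> t"
      proof (rule always_eventually, rule allI)
        fix p
        have "of_int \<lfloor>real (Suc p) * t\<rfloor> \<le> real (Suc p) * t" by linarith
        then show "of_int \<lfloor>real (Suc p) * t\<rfloor> / real (Suc p) \<le> t" by (simp add: field_simps)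
      qed
      have "(\<lambda>p. t - 1 / real (Suc p)) \<longlonglongrightarrow> t - 0"
        by (intro tendsto_intros LIMSEQ_Suc[OF lim_1_over_n])
      then show "(\<lambda>p. t - 1 / real (Suc p)) \<longlonglongrightarrow> t" by simp
    qed simp
    then have "(\<lambda>p. a p \<lfloor>real (Suc p) * t\<rfloor>) \<longlonglongrightarrow> cl t"
      unfolding a_def cl_def by (intro tendsto_intros)
    then show "(\<lambda>p. f (a p \<lfloor>real (Suc p) * fst z\<rfloor>) (snd z)) \<longlonglongrightarrow> f (cl (fst z)) (snd z)"
      using zz continuous_on_tendsto_compose[OF cont[OF zz(2)], of "\<lambda>p. a p \<lfloor>real (Suc p) * t\<rfloor>" "cl t" sequentially] cl
      by (auto simp: a_def)
  qed
  then have "(\<lambda>z. indicator {0..T} (fst z) * f (cl (fst z)) (snd z)) \<in> borel_measurable (lborel \<Otimes>\<^sub>M M)"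
    by measurable
  moreover have "(\<lambda>z. indicator {0..T} (fst z) * f (cl (fst z)) (snd z)) = (\<lambda>(t, \<omega>). indicator {0..T} t * f t \<omega>)"
    by (auto simp: fun_eq_iff indicator_def cl_def)
  ultimately show ?thesis by simp
qed

lemma borel_measurable_conv:
  assumes t: "t \<in> {0..T}" and meas: "\<And>t. t \<in> {0..T} \<Longrightarrow> f t \<in> borel_measurable M"
    and cont: "\<And>\<omega>. \<omega> \<in> space M \<Longrightarrow> continuous_on {0..T} (\<lambda>t. f t \<omega>)"
  shows "(\<lambda>\<omega>. conv c (\<lambda>r. f r \<omega>) t) \<in> borel_measurable M"
proof -
  have [measurable]: "(\<lambda>z. indicator {0..T} (fst z) * f (fst z) (snd z)) \<in> borel_measurable (lborel \<Otimes>\<^sub>M M)"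
    using borel_measurable_continuous_paths[OF _ meas cont] t by (auto simp: split_beta')
  have [measurable]: "(\<lambda>(\<omega>, r). indicator {0..T} r * f r \<omega>) \<in> borel_measurable (M \<Otimes>\<^sub>M lborel)"
    using measurable_compose[OF measurable_pair_swap', of "\<lambda>z. indicator {0..T} (fst z) * f (fst z) (snd z)" lborel M borel]
    by (simp add: split_beta')
  have "(\<lambda>\<omega>. \<integral>r. indicator {0..t} r * (exp (- (c * (t - r))) * (indicator {0..T} r * f r \<omega>)) \<partial>lborel) \<in> borel_measurable M"
    by measurable
  also have "(\<lambda>\<omega>. \<integral>r. indicator {0..t} r * (exp (- (c * (t - r))) * (indicator {0..T} r * f r \<omega>)) \<partial>lborel)
      = (\<lambda>\<omega>. conv c (\<lambda>r. f r \<omega>) t)"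
    unfolding conv_def set_lebesgue_integral_def
    using t by (intro ext Bochner_Integration.integral_cong) (auto simp: indicator_def)
  finally show ?thesis .
qed

section \<open>Closed linear spans of isometric pairs\<close>

definition sqint :: "'a measure \<Rightarrow> ('a \<Rightarrow> real) \<Rightarrow> bool" where
  "sqint M f \<longleftrightarrow> f \<in> borel_measurable M \<and> integrable M (\<lambda>x. (f x)\<^sup>2)"

definition L2_tendsto :: "'a measure \<Rightarrow> (nat \<Rightarrow> 'a \<Rightarrow> real) \<Rightarrow> ('a \<Rightarrow> real) \<Rightarrow> bool" where
  "L2_tendsto M fs f \<longleftrightarrow> f \<in> borel_measurable M \<and> (\<lambda>m. \<integral>\<^sup>+x. ennreal ((f x - fs m x)\<^sup>2) \<partial>M) \<longlonglongrightarrow> 0"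

text \<open>Relates integrands to their integrals; a relation and not a map, because an integral is
  fixed only up to null sets. Closure under L2 limits is a rule of the induction, so no completion
  is constructed, and every property that is stable under linear combinations and L2 limits passes
  from the generators to all pairs.\<close>

inductive cspan :: "'a measure \<Rightarrow> 'b measure \<Rightarrow> (('a \<Rightarrow> real) \<times> ('b \<Rightarrow> real)) set \<Rightarrow> ('a \<Rightarrow> real) \<Rightarrow> ('b \<Rightarrow> real) \<Rightarrow> bool"
  for A :: "'a measure" and M :: "'b measure" and G where
  gen: "(f, Y) \<in> G \<Longrightarrow> cspan A M G f Y"
| lin: "cspan A M G f Y \<Longrightarrow> cspan A M G g Z \<Longrightarrow> cspan A M G (\<lambda>x. a * f x + b * g x) (\<lambda>\<omega>. a * Y \<omega> + b * Z \<omega>)"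
| lim: "(\<And>m. cspan A M G (fs m) (Ys m)) \<Longrightarrow> L2_tendsto A fs f \<Longrightarrow> L2_tendsto M Ys Y \<Longrightarrow> cspan A M G f Y"

lemma real_power2_add_le: "((x::real) + y)\<^sup>2 \<le> 2 * x\<^sup>2 + 2 * y\<^sup>2"
  using sum_squares_bound[of x y] by (simp add: power2_sum)

lemma sqint_lin:
  assumes "sqint M f" "sqint M g"
  shows "sqint M (\<lambda>x. a * f x + b * g x)"
proof -
  have [measurable]: "f \<in> borel_measurable M" "g \<in> borel_measurable M" using assms by (auto simp: sqint_def)
  have "integrable M (\<lambda>x. (a * f x + b * g x)\<^sup>2)"
  proof (rule Bochner_Integration.integrable_bound)
    show "integrable M (\<lambda>x. 2 * a\<^sup>2 * (f x)\<^sup>2 + 2 * b\<^sup>2 * (g x)\<^sup>2)"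
      using assms by (auto simp: sqint_def)
    show "AE x in M. norm ((a * f x + b * g x)\<^sup>2) \<le> norm (2 * a\<^sup>2 * (f x)\<^sup>2 + 2 * b\<^sup>2 * (g x)\<^sup>2)"
      using real_power2_add_le[of "a * f _" "b * g _"] by (auto simp: power_mult_distrib algebra_simps)
  qed measurable
  then show ?thesis by (simp add: sqint_def)
qed

lemma sqint_eq_nn: "f \<in> borel_measurable M \<Longrightarrow> sqint M f \<longleftrightarrow> (\<integral>\<^sup>+x. ennreal ((f x)\<^sup>2) \<partial>M) < \<infinity>"
  by (auto simp: sqint_def integrable_iff_bounded)

lemma L2_tendsto_sqint:
  assumes fs: "\<And>m. sqint M (fs m)" and lim: "L2_tendsto M fs f"
  shows "sqint M f"
proof -
  have [measurable]: "f \<in> borel_measurable M" "\<And>m. fs m \<in> borel_measurable M"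
    using assms by (auto simp: L2_tendsto_def sqint_def)
  have "eventually (\<lambda>m. (\<integral>\<^sup>+x. ennreal ((f x - fs m x)\<^sup>2) \<partial>M) < 1) sequentially"
    using lim by (intro order_tendstoD) (auto simp: L2_tendsto_def)
  then obtain m where "(\<integral>\<^sup>+x. ennreal ((f x - fs m x)\<^sup>2) \<partial>M) < 1"
    by (auto simp: eventually_sequentially)
  then have "(\<integral>\<^sup>+x. ennreal ((f x - fs m x)\<^sup>2) \<partial>M) < \<infinity>" by (rule order.strict_trans) simp
  then have "sqint M (\<lambda>x. f x - fs m x)" by (subst sqint_eq_nn) auto
  from sqint_lin[OF this fs[of m], of 1 1] show ?thesis by simp
qed

lemma L2_tendsto_inner:
  assumes fs: "\<And>m. sqint M (fs m)" and lim: "L2_tendsto M fs f" and g: "sqint M g"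
  shows "(\<lambda>m. \<integral>x. fs m x * g x \<partial>M) \<longlonglongrightarrow> (\<integral>x. f x * g x \<partial>M)"
proof -
  have f: "sqint M f" using L2_tendsto_sqint[OF fs lim] .
  have [measurable]: "f \<in> borel_measurable M" "\<And>m. fs m \<in> borel_measurable M" "g \<in> borel_measurable M"
    using f fs g by (auto simp: sqint_def)
  define d where "d = (\<lambda>m. \<integral>x. (f x - fs m x)\<^sup>2 \<partial>M)"
  have sd: "sqint M (\<lambda>x. f x - fs m x)" for m using sqint_lin[OF f fs[of m], of 1 "-1"] by simp
  have "ennreal (d m) = (\<integral>\<^sup>+x. ennreal ((f x - fs m x)\<^sup>2) \<partial>M)" for m
    unfolding d_def using sd[of m] by (intro nn_integral_eq_integral[symmetric]) (auto simp: sqint_def)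
  then have "(\<lambda>m. ennreal (d m)) \<longlonglongrightarrow> ennreal 0" using lim by (simp add: L2_tendsto_def)
  then have d0: "d \<longlonglongrightarrow> 0"
    by (subst (asm) tendsto_ennreal_iff) (auto simp: d_def)
  define e where "e = (\<lambda>m. (\<integral>x. f x * g x \<partial>M) - (\<integral>x. fs m x * g x \<partial>M))"
  have "(e m)\<^sup>2 \<le> d m * (\<integral>x. (g x)\<^sup>2 \<partial>M)" for m
  proof -
    have "e m = (\<integral>x. (f x - fs m x) * g x \<partial>M)"
      unfolding e_def left_diff_distrib using f fs[of m] g
      by (subst Bochner_Integration.integral_diff) (auto simp: sqint_def intro!: Cauchy_Schwarz_integral)
    then show ?thesis
      unfolding d_def using sd[of m] g by (auto simp: sqint_def intro!: Cauchy_Schwarz_integral)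
  qed
  moreover have "(\<lambda>m. d m * (\<integral>x. (g x)\<^sup>2 \<partial>M)) \<longlonglongrightarrow> 0"
    using tendsto_mult_right[OF d0, of "\<integral>x. (g x)\<^sup>2 \<partial>M"] by (simp add: mult.commute)
  ultimately have "(\<lambda>m. (e m)\<^sup>2) \<longlonglongrightarrow> 0"
    by (intro tendsto_sandwich[of "\<lambda>_. 0" "\<lambda>m. (e m)\<^sup>2" sequentially "\<lambda>m. d m * (\<integral>x. (g x)\<^sup>2 \<partial>M)"]) auto
  then have "e \<longlonglongrightarrow> 0"
    using tendsto_real_sqrt[of "\<lambda>m. (e m)\<^sup>2" 0 sequentially] by (simp add: tendsto_rabs_zero_iff)
  then have "(\<lambda>m. (\<integral>x. f x * g x \<partial>M) - e m) \<longlonglongrightarrow> (\<integral>x. f x * g x \<partial>M) - 0" by (intro tendsto_intros)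
  then show ?thesis by (simp add: e_def)
qed

section \<open>Extension of the isometry from generators to the closed span\<close>

locale isometric_pairs =
  fixes A :: "'a measure" and M :: "'b measure" and G :: "(('a \<Rightarrow> real) \<times> ('b \<Rightarrow> real)) set"
  assumes G_sqint: "\<And>f Y. (f, Y) \<in> G \<Longrightarrow> sqint A f \<and> sqint M Y"
    and G_inner: "\<And>f Y g Z. (f, Y) \<in> G \<Longrightarrow> (g, Z) \<in> G \<Longrightarrow> (\<integral>x. f x * g x \<partial>A) = (\<integral>\<omega>. Y \<omega> * Z \<omega> \<partial>M)"
begin

lemma cspan_sqint: "cspan A M G f Y \<Longrightarrow> sqint A f \<and> sqint M Y"
  by (induction rule: cspan.induct) (auto dest: G_sqint intro: sqint_lin L2_tendsto_sqint)

lemma inner_lin: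
  assumes "sqint N f" "sqint N g" "sqint N h"
  shows "(\<integral>x. (a * f x + b * g x) * h x \<partial>N) = a * (\<integral>x. f x * h x \<partial>N) + b * (\<integral>x. g x * h x \<partial>N)"
proof -
  have "integrable N (\<lambda>x. f x * h x)" "integrable N (\<lambda>x. g x * h x)"
    using assms by (auto simp: sqint_def intro!: Cauchy_Schwarz_integral)
  then show ?thesis by (simp add: distrib_right mult.assoc)
qed

text \<open>With one pair frozen, the identity of inner products is linear and continuous in the
  other pair, hence inductive. \<open>cspan_inner\<close> uses this twice: first with a generator
  frozen, then with an arbitrary pair.\<close>

lemma cspan_inner_aux:
  assumes gZ: "sqint A g" "sqint M Z" and G: "\<And>f Y. (f, Y) \<in> G \<Longrightarrow> (\<integral>x. f x * g x \<partial>A) = (\<integral>\<omega>. Y \<omega> * Z \<omega> \<partial>M)"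
    and fY: "cspan A M G f Y"
  shows "(\<integral>x. f x * g x \<partial>A) = (\<integral>\<omega>. Y \<omega> * Z \<omega> \<partial>M)"
  using fY
proof (induction rule: cspan.induct)
  case (gen f Y)
  then show ?case by (rule G)
next
  case (lin f1 Y1 f2 Y2 a b)
  then show ?case using gZ cspan_sqint[OF lin(1)] cspan_sqint[OF lin(2)] by (simp add: inner_lin)
next
  case (lim fs Ys f Y)
  have "(\<lambda>m. \<integral>x. fs m x * g x \<partial>A) \<longlonglongrightarrow> (\<integral>x. f x * g x \<partial>A)"
    using cspan_sqint[OF lim(1)] by (intro L2_tendsto_inner lim gZ) auto
  moreover have "(\<lambda>m. \<integral>x. Ys m x * Z x \<partial>M) \<longlonglongrightarrow> (\<integral>x. Y x * Z x \<partial>M)"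
    using cspan_sqint[OF lim(1)] by (intro L2_tendsto_inner lim gZ) auto
  ultimately show ?case using lim(2) LIMSEQ_unique by (auto simp: lim.IH)
qed

lemma cspan_inner:
  assumes fY: "cspan A M G f Y" and gZ: "cspan A M G g Z"
  shows "(\<integral>x. f x * g x \<partial>A) = (\<integral>\<omega>. Y \<omega> * Z \<omega> \<partial>M)"
proof (rule cspan_inner_aux[OF _ _ _ fY])
  fix f Y assume *: "(f, Y) \<in> G"
  have "(\<integral>x. g x * f x \<partial>A) = (\<integral>\<omega>. Z \<omega> * Y \<omega> \<partial>M)"
    using G_sqint[OF *] G_inner[OF _ *] by (intro cspan_inner_aux[OF _ _ _ gZ]) auto
  then show "(\<integral>x. f x * g x \<partial>A) = (\<integral>\<omega>. Y \<omega> * Z \<omega> \<partial>M)" by (simp add: mult.commute)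
qed (use cspan_sqint[OF gZ] in auto)

lemma cspan_isometry:
  assumes "cspan A M G f Y"
  shows "(\<integral>\<^sup>+\<omega>. ennreal ((Y \<omega>)\<^sup>2) \<partial>M) = (\<integral>\<^sup>+x. ennreal ((f x)\<^sup>2) \<partial>A)"
proof -
  have s: "sqint A f" "sqint M Y" using cspan_sqint[OF assms] by auto
  have "(\<integral>\<^sup>+\<omega>. ennreal ((Y \<omega>)\<^sup>2) \<partial>M) = ennreal (\<integral>\<omega>. (Y \<omega>)\<^sup>2 \<partial>M)"
    using s by (intro nn_integral_eq_integral) (auto simp: sqint_def)
  also have "(\<integral>\<omega>. (Y \<omega>)\<^sup>2 \<partial>M) = (\<integral>x. (f x)\<^sup>2 \<partial>A)"
    using cspan_inner[OF assms assms] by (simp add: power2_eq_square)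
  also have "ennreal \<dots> = (\<integral>\<^sup>+x. ennreal ((f x)\<^sup>2) \<partial>A)"
    using s by (intro nn_integral_eq_integral[symmetric]) (auto simp: sqint_def)
  finally show ?thesis .
qed

end

lemma cspan_scale: "cspan A M G f Y \<Longrightarrow> cspan A M G (\<lambda>x. a * f x) (\<lambda>\<omega>. a * Y \<omega>)"
  using cspan.lin[of A M G f Y f Y a 0] by simp

lemma cspan_add: "cspan A M G f Y \<Longrightarrow> cspan A M G g Z \<Longrightarrow> cspan A M G (\<lambda>x. f x + g x) (\<lambda>\<omega>. Y \<omega> + Z \<omega>)"
  using cspan.lin[of A M G f Y g Z 1 1] by simp

lemma cspan_diff: "cspan A M G f Y \<Longrightarrow> cspan A M G g Z \<Longrightarrow> cspan A M G (\<lambda>x. f x - g x) (\<lambda>\<omega>. Y \<omega> - Z \<omega>)"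
  using cspan.lin[of A M G f Y g Z 1 "-1"] by simp

lemma cspan_sum:
  assumes "finite I" "cspan A M G (\<lambda>_. 0) (\<lambda>_. 0)" "\<And>i. i \<in> I \<Longrightarrow> cspan A M G (f i) (Y i)"
  shows "cspan A M G (\<lambda>x. \<Sum>i\<in>I. f i x) (\<lambda>\<omega>. \<Sum>i\<in>I. Y i \<omega>)"
  using assms by (induction I rule: finite_induct) (auto intro: cspan_add)

text \<open>A constant sequence converges in L2 to every function that agrees with it almost
  everywhere, so the limit rule already contains the passage to another version.\<close>

lemma cspan_AE_cong:
  assumes c: "cspan A M G f Y" and f: "AE x in A. f' x = f x" "f' \<in> borel_measurable A"
    and Y: "AE x in M. Y' x = Y x" "Y' \<in> borel_measurable M"
  shows "cspan A M G f' Y'"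
proof (rule cspan.lim[of A M G "\<lambda>_. f" "\<lambda>_. Y"])
  have "(\<integral>\<^sup>+x. ennreal ((f' x - f x)\<^sup>2) \<partial>A) = (\<integral>\<^sup>+x. 0 \<partial>A)"
    using f(1) by (intro nn_integral_cong_AE) auto
  then show "L2_tendsto A (\<lambda>_. f) f'" using f(2) by (simp add: L2_tendsto_def)
  have "(\<integral>\<^sup>+x. ennreal ((Y' x - Y x)\<^sup>2) \<partial>M) = (\<integral>\<^sup>+x. 0 \<partial>M)"
    using Y(1) by (intro nn_integral_cong_AE) auto
  then show "L2_tendsto M (\<lambda>_. Y) Y'" using Y(2) by (simp add: L2_tendsto_def)
qed (rule c)

section \<open>Increments of the Brownian motions\<close>

locale bm_family =
  fixes M :: "'a measure" and F :: "real \<Rightarrow> 'a measure" and W :: "nat \<Rightarrow> nat \<Rightarrow> real \<Rightarrow> 'a \<Rightarrow> real"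
  assumes fps: "filtered_prob_space M F" and ibf: "indep_brownian_family M F W"

sublocale bm_family \<subseteq> prob_space M
  using fps by (simp add: filtered_prob_space_def)

context bm_family
begin

lemma space_F: "space (F t) = space M" and sets_F: "sets (F t) \<subseteq> sets M"
  using fps by (auto simp: filtered_prob_space_def subalgebra_def)

lemma sets_F_mono: "s \<le> t \<Longrightarrow> sets (F s) \<subseteq> sets (F t)"
  using fps filtration.sets_F_mono[of "space M" F s t] by (simp add: filtered_prob_space_def)

lemma measurable_F: "f \<in> measurable (F t) N \<Longrightarrow> f \<in> measurable M N"
  using space_F[of t] sets_F[of t] unfolding measurable_def by auto

lemma measurable_F_mono: "s \<le> t \<Longrightarrow> f \<in> measurable (F s) N \<Longrightarrow> f \<in> measurable (F t) N"
  using space_F[of t] space_F[of s] sets_F_mono[of s t] unfolding measurable_def by auto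

lemma W_bm: "i \<ge> 1 \<Longrightarrow> j \<ge> 1 \<Longrightarrow> brownian_motion M F (W i j)"
  using ibf by (simp add: indep_brownian_family_def)

lemma W_measurable_F: "i \<ge> 1 \<Longrightarrow> j \<ge> 1 \<Longrightarrow> 0 \<le> t \<Longrightarrow> W i j t \<in> borel_measurable (F t)"
  using W_bm[of i j] by (simp add: brownian_motion_def)

lemma W_measurable: "i \<ge> 1 \<Longrightarrow> j \<ge> 1 \<Longrightarrow> 0 \<le> t \<Longrightarrow> W i j t \<in> borel_measurable M"
  using W_measurable_F measurable_F by blast

lemma increment_moments:
  assumes ij: "i \<ge> 1" "j \<ge> 1" and st: "0 \<le> s" "s \<le> t"
  shows "integrable M (\<lambda>\<omega>. (W i j t \<omega> - W i j s \<omega>) ^ k)"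
    and "expectation (\<lambda>\<omega>. W i j t \<omega> - W i j s \<omega>) = 0"
    and "expectation (\<lambda>\<omega>. (W i j t \<omega> - W i j s \<omega>) ^ 2) = t - s"
    and "expectation (\<lambda>\<omega>. (W i j t \<omega> - W i j s \<omega>) ^ 4) = 3 * (t - s)\<^sup>2"
proof -
  have "integrable M (\<lambda>\<omega>. (W i j t \<omega> - W i j s \<omega>) ^ k) \<and>
    expectation (\<lambda>\<omega>. W i j t \<omega> - W i j s \<omega>) = 0 \<and>
    expectation (\<lambda>\<omega>. (W i j t \<omega> - W i j s \<omega>) ^ 2) = t - s \<and>
    expectation (\<lambda>\<omega>. (W i j t \<omega> - W i j s \<omega>) ^ 4) = 3 * (t - s)\<^sup>2"
  proof (cases "s = t")
    case True
    then show ?thesis by simp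
  next
    case False
    then have lt: "s < t" using st by simp
    define \<sigma> where "\<sigma> = sqrt (t - s)"
    have \<sigma>: "\<sigma> > 0" "\<sigma>\<^sup>2 = t - s" using lt by (auto simp: \<sigma>_def)
    have D: "distributed M lborel (\<lambda>\<omega>. W i j t \<omega> - W i j s \<omega>) (\<lambda>y. ennreal (normal_density 0 \<sigma> y))"
      using W_bm[OF ij] lt st by (auto simp: brownian_motion_def \<sigma>_def)
    have I: "integrable M (\<lambda>\<omega>. (W i j t \<omega> - W i j s \<omega>) ^ k)" for k
      using distributed_integrable[OF D, of "\<lambda>y. y ^ k"] integrable_normal_moment[of \<sigma> 0 k] \<sigma> by simp
    have E: "expectation (\<lambda>\<omega>. (W i j t \<omega> - W i j s \<omega>) ^ k) = integral\<^sup>L lborel (\<lambda>x. normal_density 0 \<sigma> x * x ^ k)" for k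
      using distributed_integral[OF D, of "\<lambda>y. y ^ k"] \<sigma> by simp
    have "\<sigma> ^ 4 = (t - s)\<^sup>2" using \<sigma>(2) by (metis power_mult mult_2_right numeral_Bit0 power2_eq_square power_add)
    moreover have "integral\<^sup>L lborel (\<lambda>x. normal_density 0 \<sigma> x * x ^ 4) = 3 * \<sigma> ^ 4"
      using integral_normal_moment_even[of \<sigma> 0 2] \<sigma>(1) by (simp add: fact_numeral power_divide)
    moreover have "integral\<^sup>L lborel (\<lambda>x. normal_density 0 \<sigma> x * x ^ 2) = \<sigma>\<^sup>2"
      using integral_normal_moment_even[of \<sigma> 0 1] \<sigma>(1) by (simp add: fact_numeral)
    moreover have "integral\<^sup>L lborel (\<lambda>x. normal_density 0 \<sigma> x * x) = 0"
      using integral_normal_moment_odd[of \<sigma> 0 0] \<sigma>(1) by simp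
    ultimately show ?thesis
      using I[of k] E[of 1] E[of 2] E[of 4] \<sigma>(2) by simp
  qed
  then show "integrable M (\<lambda>\<omega>. (W i j t \<omega> - W i j s \<omega>) ^ k)"
    "expectation (\<lambda>\<omega>. W i j t \<omega> - W i j s \<omega>) = 0"
    "expectation (\<lambda>\<omega>. (W i j t \<omega> - W i j s \<omega>) ^ 2) = t - s"
    "expectation (\<lambda>\<omega>. (W i j t \<omega> - W i j s \<omega>) ^ 4) = 3 * (t - s)\<^sup>2" by auto
qed

lemma indep_var_increment:
  assumes ij: "i \<ge> 1" "j \<ge> 1" and st: "0 \<le> s" "s < t" and X: "X \<in> borel_measurable (F s)"
  shows "indep_var borel X borel (\<lambda>\<omega>. W i j t \<omega> - W i j s \<omega>)"
proof -
  define D where "D = (\<lambda>\<omega>. W i j t \<omega> - W i j s \<omega>)"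
  have Dm: "D \<in> borel_measurable M" using W_measurable[of i j t] W_measurable[of i j s] ij st by (auto simp: D_def)
  have Xm: "X \<in> borel_measurable M" using X by (rule measurable_F)
  have ind: "indep_set (sets (F s)) {D -` A \<inter> space M | A. A \<in> sets borel}"
    using W_bm[OF ij] st unfolding brownian_motion_def D_def by blast
  have 1: "sigma_sets (space M) {X -` A \<inter> space M | A. A \<in> sets borel} \<subseteq> sets (F s)"
    unfolding space_F[of s, symmetric]
    using measurable_sets[OF X] by (intro sets.sigma_sets_subset) blast
  \<comment> \<open>The preimages of Borel sets under \<open>D\<close> already form a sigma-algebra,
    so the one they generate is no larger. This links the set form of independence in the definition
    of Brownian motion with independence of random variables.\<close>
  have "sets (vimage_algebra (space M) D borel) = {D -` A \<inter> space M | A. A \<in> sets borel}"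
    by (rule sets_vimage_algebra2) auto
  then have 2: "sigma_sets (space M) {D -` A \<inter> space M | A. A \<in> sets borel} \<subseteq> {D -` A \<inter> space M | A. A \<in> sets borel}"
    using sets.sigma_sets_subset[of "{D -` A \<inter> space M | A. A \<in> sets borel}" "vimage_algebra (space M) D borel"] by simp
  have "indep_set (sigma_sets (space M) {X -` A \<inter> space M | A. A \<in> sets borel})
      (sigma_sets (space M) {D -` A \<inter> space M | A. A \<in> sets borel})"
    unfolding indep_sets2_eq
  proof (intro conjI ballI)
    fix a b assume "a \<in> sigma_sets (space M) {X -` A \<inter> space M | A. A \<in> sets borel}"
      "b \<in> sigma_sets (space M) {D -` A \<inter> space M | A. A \<in> sets borel}"
    then show "prob (a \<inter> b) = prob a * prob b"
      by (intro indep_setD[OF ind] subsetD[OF 1] subsetD[OF 2])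
  qed (rule order.trans[OF 1 indep_setD_ev1[OF ind]], rule order.trans[OF 2 indep_setD_ev2[OF ind]])
  then show ?thesis unfolding indep_var_eq D_def[symmetric] using Dm Xm by simp
qed

section \<open>Second moments of products of weighted increments\<close>

lemma expectation_mult_increment:
  assumes ij: "i \<ge> 1" "j \<ge> 1" and st: "0 \<le> s" "s \<le> t" and X: "X \<in> borel_measurable (F s)" "integrable M X"
  shows "integrable M (\<lambda>\<omega>. X \<omega> * (W i j t \<omega> - W i j s \<omega>) ^ k)"
    and "expectation (\<lambda>\<omega>. X \<omega> * (W i j t \<omega> - W i j s \<omega>) ^ k) = expectation X * expectation (\<lambda>\<omega>. (W i j t \<omega> - W i j s \<omega>) ^ k)"
proof -
  have "integrable M (\<lambda>\<omega>. X \<omega> * (W i j t \<omega> - W i j s \<omega>) ^ k) \<and>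
    expectation (\<lambda>\<omega>. X \<omega> * (W i j t \<omega> - W i j s \<omega>) ^ k) = expectation X * expectation (\<lambda>\<omega>. (W i j t \<omega> - W i j s \<omega>) ^ k)"
  proof (cases "s = t")
    case True
    then show ?thesis using X by (cases k) (auto simp: prob_space)
  next
    case False
    have "indep_var borel ((\<lambda>x. x) \<circ> X) borel ((\<lambda>x. x ^ k) \<circ> (\<lambda>\<omega>. W i j t \<omega> - W i j s \<omega>))"
      using indep_var_increment[OF ij, of s t X] st False X by (intro indep_var_compose) auto
    then have "indep_var borel X borel (\<lambda>\<omega>. (W i j t \<omega> - W i j s \<omega>) ^ k)" by (simp add: comp_def)
    from indep_var_lebesgue_integral[OF this] indep_var_integrable[OF this] show ?thesis
      using X increment_moments(1)[OF ij st] by auto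
  qed
  then show "integrable M (\<lambda>\<omega>. X \<omega> * (W i j t \<omega> - W i j s \<omega>) ^ k)"
    "expectation (\<lambda>\<omega>. X \<omega> * (W i j t \<omega> - W i j s \<omega>) ^ k) = expectation X * expectation (\<lambda>\<omega>. (W i j t \<omega> - W i j s \<omega>) ^ k)"
    by auto
qed

text \<open>A product of two increments of one Brownian motion is a measurable functional
  \<open>\<phi>\<close> of its path, and the paths of different motions are independent.
  Independence of the family enters here; it concerns whole paths and admits no extra factor
  measurable with respect to \<open>F s\<close>.\<close>

lemma expectation_cross:
  assumes ij: "i \<ge> 1" "j \<ge> 1" "i' \<ge> 1" "j' \<ge> 1" "(i, j) \<noteq> (i', j')"
    and ab: "0 \<le> a" "a \<le> b" "0 \<le> c" "c \<le> d"
  shows "integrable M (\<lambda>\<omega>. (W i j b \<omega> - W i j a \<omega>) * (W i j d \<omega> - W i j c \<omega>) *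
           ((W i' j' b \<omega> - W i' j' a \<omega>) * (W i' j' d \<omega> - W i' j' c \<omega>)))"
    and "expectation (\<lambda>\<omega>. (W i j b \<omega> - W i j a \<omega>) * (W i j d \<omega> - W i j c \<omega>) *
           ((W i' j' b \<omega> - W i' j' a \<omega>) * (W i' j' d \<omega> - W i' j' c \<omega>))) =
         expectation (\<lambda>\<omega>. (W i j b \<omega> - W i j a \<omega>) * (W i j d \<omega> - W i j c \<omega>)) *
         expectation (\<lambda>\<omega>. (W i' j' b \<omega> - W i' j' a \<omega>) * (W i' j' d \<omega> - W i' j' c \<omega>))"
proof -
  define \<phi> where "\<phi> = (\<lambda>x::real \<Rightarrow> real. (x b - x a) * (x d - x c))"
  define Q where "Q = (\<lambda>(i, j) \<omega>. (W i j b \<omega> - W i j a \<omega>) * (W i j d \<omega> - W i j c \<omega>))"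
  have "indep_vars (\<lambda>_. \<Pi>\<^sub>M t\<in>{0..}. borel) (\<lambda>(i, j) \<omega>. restrict (\<lambda>t. W i j t \<omega>) {0..}) {(i, j), (i', j')}"
    using conjunct2[OF ibf[unfolded indep_brownian_family_def]] by (rule indep_vars_subset) (use ij in auto)
  then have "indep_vars (\<lambda>_. borel) (\<lambda>p \<omega>. \<phi> ((\<lambda>(i, j) \<omega>. restrict (\<lambda>t. W i j t \<omega>) {0..}) p \<omega>)) {(i, j), (i', j')}"
    by (rule indep_vars_compose2[where Y = "\<lambda>_. \<phi>"])
      (unfold \<phi>_def, intro borel_measurable_times borel_measurable_diff measurable_component_singleton, use ab in auto)
  also have "(\<lambda>p \<omega>. \<phi> ((\<lambda>(i, j) \<omega>. restrict (\<lambda>t. W i j t \<omega>) {0..}) p \<omega>)) = Q"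
    using ab by (auto simp: Q_def \<phi>_def fun_eq_iff)
  finally have iv: "indep_vars (\<lambda>_. borel) Q {(i, j), (i', j')}" .
  have int: "integrable M (Q p)" if "p \<in> {(i, j), (i', j')}" for p
  proof -
    have *: "integrable M (\<lambda>\<omega>. (W i j b \<omega> - W i j a \<omega>) * (W i j d \<omega> - W i j c \<omega>))" if "i \<ge> 1" "j \<ge> 1" for i j
      using increment_moments(1)[OF that, of _ _ 2] ab that
      by (intro Cauchy_Schwarz_integral) (auto intro!: W_measurable borel_measurable_diff)
    show ?thesis using that * ij by (auto simp: Q_def)
  qed
  show "integrable M (\<lambda>\<omega>. (W i j b \<omega> - W i j a \<omega>) * (W i j d \<omega> - W i j c \<omega>) *
           ((W i' j' b \<omega> - W i' j' a \<omega>) * (W i' j' d \<omega> - W i' j' c \<omega>)))"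
    using indep_vars_integrable[OF _ iv int] ij(5) by (simp add: Q_def mult.assoc)
  show "expectation (\<lambda>\<omega>. (W i j b \<omega> - W i j a \<omega>) * (W i j d \<omega> - W i j c \<omega>) *
           ((W i' j' b \<omega> - W i' j' a \<omega>) * (W i' j' d \<omega> - W i' j' c \<omega>))) =
         expectation (\<lambda>\<omega>. (W i j b \<omega> - W i j a \<omega>) * (W i j d \<omega> - W i j c \<omega>)) *
         expectation (\<lambda>\<omega>. (W i' j' b \<omega> - W i' j' a \<omega>) * (W i' j' d \<omega> - W i' j' c \<omega>))"
    using indep_vars_lebesgue_integral[OF _ iv int] ij(5) by (simp add: Q_def mult.assoc)
qed

lemma increment_measurable_F:
  assumes "i \<ge> 1" "j \<ge> 1" "0 \<le> a" "a \<le> b" "b \<le> c"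
  shows "(\<lambda>\<omega>. W i j b \<omega> - W i j a \<omega>) \<in> borel_measurable (F c)"
  using assms by (intro borel_measurable_diff measurable_F_mono[OF _ W_measurable_F]) auto

lemma increment_sqint:
  assumes "i \<ge> 1" "j \<ge> 1" "0 \<le> a" "a \<le> b"
  shows "sqint M (\<lambda>\<omega>. W i j b \<omega> - W i j a \<omega>)"
  using assms increment_moments(1)[of i j a b 2] by (auto simp: sqint_def intro!: borel_measurable_diff W_measurable)

lemma sqint_mult_bounded:
  assumes f: "sqint N f" and \<psi>: "\<psi> \<in> borel_measurable N" "\<And>\<omega>. \<omega> \<in> space N \<Longrightarrow> \<bar>\<psi> \<omega>\<bar> \<le> C"
  shows "sqint N (\<lambda>\<omega>. \<psi> \<omega> * f \<omega>)"
proof -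
  have [measurable]: "f \<in> borel_measurable N" "\<psi> \<in> borel_measurable N" using f \<psi> by (auto simp: sqint_def)
  have "integrable N (\<lambda>x. (\<psi> x * f x)\<^sup>2)"
  proof (rule Bochner_Integration.integrable_bound[of _ "\<lambda>x. C\<^sup>2 * (f x)\<^sup>2"])
    show "AE x in N. norm ((\<psi> x * f x)\<^sup>2) \<le> norm (C\<^sup>2 * (f x)\<^sup>2)"
    proof (rule AE_I2)
      fix x assume "x \<in> space N"
      then have "\<bar>\<psi> x\<bar>\<^sup>2 \<le> C\<^sup>2" using \<psi>(2)[of x] by (intro power_mono) auto
      then show "norm ((\<psi> x * f x)\<^sup>2) \<le> norm (C\<^sup>2 * (f x)\<^sup>2)"
        using mult_right_mono[of "\<bar>\<psi> x\<bar>\<^sup>2" "C\<^sup>2" "(f x)\<^sup>2"] by (simp add: power_mult_distrib)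
    qed
  qed (use f in \<open>auto simp: sqint_def\<close>)
  then show ?thesis by (simp add: sqint_def)
qed

lemma sqint_integrable_mult: "sqint N f \<Longrightarrow> sqint N g \<Longrightarrow> integrable N (\<lambda>x. f x * g x)"
  unfolding sqint_def by (blast intro: Cauchy_Schwarz_integral(1))

lemma sqint_integrable:
  assumes "sqint M f" shows "integrable M f"
  using sqint_integrable_mult[OF assms, of "\<lambda>_. 1"] by (simp add: sqint_def)

definition bounded_on_space :: "('a \<Rightarrow> real) \<Rightarrow> bool" where
  "bounded_on_space \<psi> \<longleftrightarrow> (\<exists>C. \<forall>\<omega>\<in>space M. \<bar>\<psi> \<omega>\<bar> \<le> C)"

lemma bounded_on_space_mult:
  assumes "bounded_on_space f" "bounded_on_space g"
  shows "bounded_on_space (\<lambda>\<omega>. f \<omega> * g \<omega>)"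
proof -
  from assms obtain C D where C: "\<And>\<omega>. \<omega> \<in> space M \<Longrightarrow> \<bar>f \<omega>\<bar> \<le> C" and D: "\<And>\<omega>. \<omega> \<in> space M \<Longrightarrow> \<bar>g \<omega>\<bar> \<le> D"
    by (auto simp: bounded_on_space_def)
  have "\<bar>f \<omega> * g \<omega>\<bar> \<le> C * D" if "\<omega> \<in> space M" for \<omega>
    unfolding abs_mult by (rule mult_mono) (use C[OF that] D[OF that] in auto)
  then show ?thesis by (auto simp: bounded_on_space_def)
qed

lemma integrable_bounded_increments:
  assumes "i \<ge> 1" "j \<ge> 1" "i' \<ge> 1" "j' \<ge> 1" "0 \<le> a" "a \<le> b" "0 \<le> c" "c \<le> d"
    and \<psi>: "\<psi> \<in> borel_measurable M" "bounded_on_space \<psi>"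
  shows "integrable M (\<lambda>\<omega>. \<psi> \<omega> * (W i j b \<omega> - W i j a \<omega>) * (W i' j' d \<omega> - W i' j' c \<omega>))"
proof -
  obtain C where "\<And>\<omega>. \<omega> \<in> space M \<Longrightarrow> \<bar>\<psi> \<omega>\<bar> \<le> C" using \<psi>(2) by (auto simp: bounded_on_space_def)
  then show ?thesis
    using assms by (intro sqint_integrable_mult sqint_mult_bounded[where C = C] increment_sqint) auto
qed

lemma expectation_disjoint_increments:
  assumes ij: "i \<ge> 1" "j \<ge> 1" "i' \<ge> 1" "j' \<ge> 1" and ab: "0 \<le> a" "a \<le> b" "b \<le> c" "c \<le> d"
    and \<psi>: "\<psi> \<in> borel_measurable (F c)" "bounded_on_space \<psi>"
  shows "expectation (\<lambda>\<omega>. \<psi> \<omega> * (W i j b \<omega> - W i j a \<omega>) * (W i' j' d \<omega> - W i' j' c \<omega>)) = 0"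
proof -
  obtain C where C: "\<And>\<omega>. \<omega> \<in> space M \<Longrightarrow> \<bar>\<psi> \<omega>\<bar> \<le> C" using \<psi>(2) by (auto simp: bounded_on_space_def)
  have "(\<lambda>\<omega>. \<psi> \<omega> * (W i j b \<omega> - W i j a \<omega>)) \<in> borel_measurable (F c)"
    using \<psi> ij ab by (intro borel_measurable_times increment_measurable_F) auto
  moreover have "integrable M (\<lambda>\<omega>. \<psi> \<omega> * (W i j b \<omega> - W i j a \<omega>))"
    using \<psi> ij ab C by (intro sqint_integrable sqint_mult_bounded[where C = C] increment_sqint measurable_F[OF \<psi>(1)]) auto
  ultimately show ?thesis
    using expectation_mult_increment(2)[of i' j' c d "\<lambda>\<omega>. \<psi> \<omega> * (W i j b \<omega> - W i j a \<omega>)" 1]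
      increment_moments(2)[of i' j' c d] ij ab by simp
qed

lemma bounded_on_space_const: "bounded_on_space (\<lambda>_. c)"
  by (auto simp: bounded_on_space_def)

text \<open>Each Brownian motion is one with respect to \<open>F\<close>, but their joint increments are not assumed
  independent of \<open>F s\<close>. Orthogonality therefore comes from the vanishing of the quadratic covariation.\<close>

lemma expectation_cross_increments:
  assumes ij: "i \<ge> 1" "j \<ge> 1" "i' \<ge> 1" "j' \<ge> 1" "(i, j) \<noteq> (i', j')" and st: "0 \<le> s" "s \<le> t"
    and \<psi>: "\<psi> \<in> borel_measurable (F s)" "bounded_on_space \<psi>"
  shows "expectation (\<lambda>\<omega>. \<psi> \<omega> * (W i j t \<omega> - W i j s \<omega>) * (W i' j' t \<omega> - W i' j' s \<omega>)) = 0" (is "?E = 0")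
proof -
  define h where "h = t - s"
  have \<psi>M: "\<psi> \<in> borel_measurable M" using \<psi>(1) by (rule measurable_F)
  \<comment> \<open>The interval is cut into n + 1 equal pieces. Products over different pieces have
    mean zero, which leaves the discrete covariation \<open>Q\<close> with second moment h^2/(n +
    1). Cauchy-Schwarz separates \<open>Q\<close> from the weight \<open>\<psi>\<close>, and n is
    arbitrary.\<close>
  have bound: "?E\<^sup>2 \<le> expectation (\<lambda>\<omega>. (\<psi> \<omega>)\<^sup>2) * (h\<^sup>2 / real (Suc n))" for n
  proof -
    define u where "u = (\<lambda>k. s + real k * (h / real (Suc n)))"
    define N where "N = Suc n"
    have u0: "u 0 = s" and uN: "u N = t" by (simp_all add: u_def N_def h_def)
    have h: "h \<ge> 0" using st by (simp add: h_def)
    have us: "s \<le> u k" for k using h by (simp add: u_def)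
    have umono: "u k \<le> u l" if "k \<le> l" for k l
      unfolding u_def using that h by (intro add_left_mono mult_right_mono) auto
    have ustep: "u (Suc k) - u k = h / real N" for k
      unfolding u_def N_def by (simp only: of_nat_Suc distrib_right)
    define D where "D = (\<lambda>i j k \<omega>. W i j (u (Suc k)) \<omega> - W i j (u k) \<omega>)"
    have tel: "W i j t \<omega> - W i j s \<omega> = (\<Sum>k<N. D i j k \<omega>)" for i j \<omega>
      by (simp only: D_def sum_lessThan_telescope[of "\<lambda>k. W i j (u k) \<omega>" N] u0 uN)
    have u0': "0 \<le> u k" for k using us[of k] st by simp
    \<comment> \<open>The weight and the earlier increment are known when the later increment
      starts, and the later one has mean zero. This holds for equal and for different Brownian
      motions.\<close>
    have off: "expectation (\<lambda>\<omega>. \<phi> \<omega> * D i j k \<omega> * D i' j' l \<omega>) = 0"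
      if "k \<noteq> l" "\<phi> \<in> borel_measurable (F s)" "bounded_on_space \<phi>" "i \<ge> 1" "j \<ge> 1" "i' \<ge> 1" "j' \<ge> 1" for k l \<phi> i j i' j'
    proof (cases "k < l")
      case True
      then show ?thesis
        unfolding D_def using that us u0'
        by (intro expectation_disjoint_increments measurable_F_mono[OF us]) (auto intro: umono)
    next
      case False
      then have "expectation (\<lambda>\<omega>. \<phi> \<omega> * D i' j' l \<omega> * D i j k \<omega>) = 0"
        unfolding D_def using that us u0'
        by (intro expectation_disjoint_increments measurable_F_mono[OF us]) (auto intro: umono)
      then show ?thesis by (simp add: mult_ac)
    qed
    have int: "integrable M (\<lambda>\<omega>. \<psi> \<omega> * D i j k \<omega> * D i' j' l \<omega>)" for k l
      unfolding D_def using ij \<psi>M \<psi>(2) by (intro integrable_bounded_increments) (auto intro: u0' umono)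
    define Q where "Q = (\<lambda>\<omega>. \<Sum>k<N. D i j k \<omega> * D i' j' k \<omega>)"
    have tel2: "\<psi> \<omega> * (W i j t \<omega> - W i j s \<omega>) * (W i' j' t \<omega> - W i' j' s \<omega>)
        = (\<Sum>k<N. \<Sum>l<N. \<psi> \<omega> * D i j k \<omega> * D i' j' l \<omega>)" for \<omega>
      unfolding tel mult.assoc sum_product unfolding sum_distrib_left ..
    have "?E = expectation (\<lambda>\<omega>. \<Sum>k<N. \<Sum>l<N. \<psi> \<omega> * D i j k \<omega> * D i' j' l \<omega>)"
      unfolding tel2 ..
    also have "\<dots> = (\<Sum>k<N. \<Sum>l<N. expectation (\<lambda>\<omega>. \<psi> \<omega> * D i j k \<omega> * D i' j' l \<omega>))"
      by (subst Bochner_Integration.integral_sum) (auto intro!: Bochner_Integration.integrable_sum Bochner_Integration.integral_sum sum.cong int)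
    also have "\<dots> = (\<Sum>k<N. \<Sum>l<N. if l = k then expectation (\<lambda>\<omega>. \<psi> \<omega> * D i j k \<omega> * D i' j' k \<omega>) else 0)"
      by (intro sum.cong refl) (simp add: off[OF _ \<psi> ij(1-4)])
    also have "\<dots> = expectation (\<lambda>\<omega>. \<psi> \<omega> * Q \<omega>)"
      unfolding Q_def sum_distrib_left mult.assoc[symmetric]
      by (simp add: sum.delta) (rule Bochner_Integration.integral_sum[symmetric], rule int)
    finally have E: "?E = expectation (\<lambda>\<omega>. \<psi> \<omega> * Q \<omega>)" .
    have DD: "expectation (\<lambda>\<omega>. D i j k \<omega> * D i j l \<omega>) = (if k = l then h / real N else 0)" if "i \<ge> 1" "j \<ge> 1" for i j k l
      using off[of k l "\<lambda>_. 1" i j i j] that bounded_on_space_const increment_moments(3)[of i j "u k" "u (Suc k)"] u0' umono[of k "Suc k"] ustep[of k]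
      by (auto simp: D_def power2_eq_square)
    have Qint: "integrable M (\<lambda>\<omega>. D i j k \<omega> * D i j l \<omega> * (D i' j' k \<omega> * D i' j' l \<omega>))" for k l
      unfolding D_def using ij by (intro expectation_cross) (auto intro: u0' umono)
    have QE: "expectation (\<lambda>\<omega>. D i j k \<omega> * D i j l \<omega> * (D i' j' k \<omega> * D i' j' l \<omega>)) = (if k = l then (h / real N)\<^sup>2 else 0)" for k l
    proof -
      have "expectation (\<lambda>\<omega>. D i j k \<omega> * D i j l \<omega> * (D i' j' k \<omega> * D i' j' l \<omega>))
          = expectation (\<lambda>\<omega>. D i j k \<omega> * D i j l \<omega>) * expectation (\<lambda>\<omega>. D i' j' k \<omega> * D i' j' l \<omega>)"
        unfolding D_def using ij by (intro expectation_cross) (auto intro: u0' umono)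
      then show ?thesis using DD ij by (simp add: power2_eq_square)
    qed
    have Q2: "(Q \<omega>)\<^sup>2 = (\<Sum>k<N. \<Sum>l<N. D i j k \<omega> * D i j l \<omega> * (D i' j' k \<omega> * D i' j' l \<omega>))" for \<omega>
      unfolding Q_def power2_eq_square sum_product by (intro sum.cong) (auto simp: mult_ac)
    have "expectation (\<lambda>\<omega>. (Q \<omega>)\<^sup>2) = real N * (h / real N)\<^sup>2"
      unfolding Q2
      by (subst Bochner_Integration.integral_sum, (intro Bochner_Integration.integrable_sum Qint)[1],
          subst Bochner_Integration.integral_sum, rule Qint) (simp add: QE)
    also have "\<dots> = h\<^sup>2 / real (Suc n)" by (simp add: N_def power2_eq_square)
    finally
    have EQ: "expectation (\<lambda>\<omega>. (Q \<omega>)\<^sup>2) = h\<^sup>2 / real (Suc n)" .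
    have Qm: "Q \<in> borel_measurable M"
      unfolding Q_def D_def using ij u0' by (intro borel_measurable_sum borel_measurable_times borel_measurable_diff W_measurable) auto
    have "integrable M (\<lambda>\<omega>. (Q \<omega>)\<^sup>2)" unfolding Q2 using Qint by simp
    moreover obtain C where "\<And>\<omega>. \<omega> \<in> space M \<Longrightarrow> \<bar>\<psi> \<omega>\<bar> \<le> C" using \<psi>(2) by (auto simp: bounded_on_space_def)
    then have "sqint M (\<lambda>\<omega>. \<psi> \<omega> * 1)" using \<psi>M by (intro sqint_mult_bounded[where C = C]) (auto simp: sqint_def)
    ultimately show ?thesis
      unfolding E EQ[symmetric]
      using Cauchy_Schwarz_integral(2)[OF \<psi>M Qm] by (simp add: sqint_def)
  qed
  have "(\<lambda>n. expectation (\<lambda>\<omega>. (\<psi> \<omega>)\<^sup>2) * (h\<^sup>2 / real (Suc n))) \<longlonglongrightarrow> expectation (\<lambda>\<omega>. (\<psi> \<omega>)\<^sup>2) * 0"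
    by (rule tendsto_mult[OF tendsto_const LIMSEQ_Suc[OF lim_const_over_n]])
  then have "?E\<^sup>2 \<le> expectation (\<lambda>\<omega>. (\<psi> \<omega>)\<^sup>2) * 0"
    by (rule LIMSEQ_le_const) (intro exI allI impI, rule bound)
  moreover have "e\<^sup>2 \<le> x * 0 \<Longrightarrow> e = 0" for e x :: real by simp
  ultimately show ?thesis by blast
qed

lemma expectation_same_increments:
  assumes ij: "i \<ge> 1" "j \<ge> 1" and st: "0 \<le> s" "s \<le> t"
    and \<psi>: "\<psi> \<in> borel_measurable (F s)" "bounded_on_space \<psi>"
  shows "expectation (\<lambda>\<omega>. \<psi> \<omega> * (W i j t \<omega> - W i j s \<omega>) * (W i j t \<omega> - W i j s \<omega>)) = expectation \<psi> * (t - s)"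
proof -
  obtain C where C: "\<And>\<omega>. \<omega> \<in> space M \<Longrightarrow> \<bar>\<psi> \<omega>\<bar> \<le> C" using \<psi>(2) by (auto simp: bounded_on_space_def)
  then have "sqint M (\<lambda>\<omega>. \<psi> \<omega> * 1)" using measurable_F[OF \<psi>(1)] by (intro sqint_mult_bounded[where C = C]) (auto simp: sqint_def)
  then have "integrable M \<psi>" using sqint_integrable by simp
  then show ?thesis
    using expectation_mult_increment(2)[OF ij st \<psi>(1), of 2] increment_moments(3)[OF ij st]
    by (simp add: power2_eq_square mult.assoc)
qed

text \<open>Both intervals are cut at c and at m = min b d. Only the common piece from c to m
  contributes: in every other product one increment starts where the other has ended. The weight may
  be as late as \<open>F c\<close>, the start of the later interval.\<close>

lemma expectation_increments_le:
  assumes ij: "i \<ge> 1" "j \<ge> 1" "i' \<ge> 1" "j' \<ge> 1" and ab: "0 \<le> a" "a \<le> b" "c \<le> d" "a \<le> c"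
    and \<psi>: "\<psi> \<in> borel_measurable (F c)" "bounded_on_space \<psi>"
  shows "expectation (\<lambda>\<omega>. \<psi> \<omega> * (W i j b \<omega> - W i j a \<omega>) * (W i' j' d \<omega> - W i' j' c \<omega>))
     = (if (i, j) = (i', j') then expectation \<psi> * max 0 (min b d - c) else 0)"
proof (cases "b \<le> c")
  case True
  then show ?thesis using expectation_disjoint_increments[of i j i' j' a b c d \<psi>] assms by (auto simp: max_def)
next
  case False
  define m where "m = min b d"
  have cm: "c \<le> m" "m \<le> b" "m \<le> d" "b = m \<or> d = m" using False ab by (auto simp: m_def)
  have \<psi>M: "\<psi> \<in> borel_measurable M" using \<psi>(1) by (rule measurable_F)
  define D where "D = (\<lambda>i j a b \<omega>. W i j b \<omega> - W i j a \<omega>)"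
  have \<psi>m: "\<psi> \<in> borel_measurable (F m)" using \<psi>(1) cm measurable_F_mono by blast
  have I: "integrable M (\<lambda>\<omega>. \<psi> \<omega> * D i j a b \<omega> * D i' j' c d \<omega>)"
    if "0 \<le> a" "a \<le> b" "0 \<le> c" "c \<le> d" for a b c d
    unfolding D_def using that ij \<psi>M \<psi>(2) by (intro integrable_bounded_increments) auto
  have "(\<lambda>\<omega>. \<psi> \<omega> * (W i j b \<omega> - W i j a \<omega>) * (W i' j' d \<omega> - W i' j' c \<omega>)) =
     (\<lambda>\<omega>. \<psi> \<omega> * D i j a c \<omega> * D i' j' c d \<omega> + \<psi> \<omega> * D i j c m \<omega> * D i' j' c m \<omega>
       + \<psi> \<omega> * D i j c m \<omega> * D i' j' m d \<omega> + \<psi> \<omega> * D i j m b \<omega> * D i' j' c m \<omega>)"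
    using cm(4) by (auto simp: D_def algebra_simps fun_eq_iff)
  then have "expectation (\<lambda>\<omega>. \<psi> \<omega> * (W i j b \<omega> - W i j a \<omega>) * (W i' j' d \<omega> - W i' j' c \<omega>)) =
      expectation (\<lambda>\<omega>. \<psi> \<omega> * D i j a c \<omega> * D i' j' c d \<omega>) + expectation (\<lambda>\<omega>. \<psi> \<omega> * D i j c m \<omega> * D i' j' c m \<omega>)
      + expectation (\<lambda>\<omega>. \<psi> \<omega> * D i j c m \<omega> * D i' j' m d \<omega>) + expectation (\<lambda>\<omega>. \<psi> \<omega> * D i j m b \<omega> * D i' j' c m \<omega>)"
    using I cm ab by simp
  also have "expectation (\<lambda>\<omega>. \<psi> \<omega> * D i j a c \<omega> * D i' j' c d \<omega>) = 0"
    unfolding D_def using ab ij \<psi> by (intro expectation_disjoint_increments) auto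
  also have "expectation (\<lambda>\<omega>. \<psi> \<omega> * D i j c m \<omega> * D i' j' m d \<omega>) = 0"
    unfolding D_def using ab ij cm \<psi> \<psi>m by (intro expectation_disjoint_increments) auto
  also have "expectation (\<lambda>\<omega>. \<psi> \<omega> * D i j m b \<omega> * D i' j' c m \<omega>) = expectation (\<lambda>\<omega>. \<psi> \<omega> * D i' j' c m \<omega> * D i j m b \<omega>)"
    by (simp add: mult_ac)
  also have "\<dots> = 0"
    unfolding D_def using ab ij cm \<psi> \<psi>m by (intro expectation_disjoint_increments) auto
  also have "expectation (\<lambda>\<omega>. \<psi> \<omega> * D i j c m \<omega> * D i' j' c m \<omega>) = (if (i, j) = (i', j') then expectation \<psi> * (m - c) else 0)"
    unfolding D_def using expectation_same_increments[of i j c m \<psi>] expectation_cross_increments[of i j i' j' c m \<psi>] ij ab cm \<psi>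
    by auto
  finally show ?thesis using cm by (auto simp: m_def)
qed

lemma expectation_increments:
  assumes ij: "i \<ge> 1" "j \<ge> 1" "i' \<ge> 1" "j' \<ge> 1" and ab: "0 \<le> a" "a \<le> b" "0 \<le> c" "c \<le> d"
    and \<psi>: "\<psi> \<in> borel_measurable (F a)" "bounded_on_space \<psi>" and \<phi>: "\<phi> \<in> borel_measurable (F c)" "bounded_on_space \<phi>"
  shows "expectation (\<lambda>\<omega>. (\<psi> \<omega> * (W i j b \<omega> - W i j a \<omega>)) * (\<phi> \<omega> * (W i' j' d \<omega> - W i' j' c \<omega>)))
     = (if (i, j) = (i', j') then expectation (\<lambda>\<omega>. \<psi> \<omega> * \<phi> \<omega>) * max 0 (min b d - max a c) else 0)"
proof (cases "a \<le> c")
  case True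
  then have "(\<lambda>\<omega>. \<psi> \<omega> * \<phi> \<omega>) \<in> borel_measurable (F c)" using \<psi>(1) \<phi>(1) measurable_F_mono by (intro borel_measurable_times) auto
  then show ?thesis
    using expectation_increments_le[of i j i' j' a b c d "\<lambda>\<omega>. \<psi> \<omega> * \<phi> \<omega>"] assms True bounded_on_space_mult
    by (simp add: mult_ac max_def[of a c])
next
  case False
  then have "(\<lambda>\<omega>. \<psi> \<omega> * \<phi> \<omega>) \<in> borel_measurable (F a)" using \<psi>(1) \<phi>(1) measurable_F_mono[of c a] by (intro borel_measurable_times) auto
  then show ?thesis
    using expectation_increments_le[of i' j' i j c d a b "\<lambda>\<omega>. \<psi> \<omega> * \<phi> \<omega>"] assms False bounded_on_space_mult
    by (auto simp: mult_ac max_def[of a c] min.commute)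
qed

end

section \<open>Stochastic integrals as a closed span\<close>

lemma integrable_pair_mult:
  fixes f :: "'a \<Rightarrow> real" and g :: "'b \<Rightarrow> real"
  assumes M1: "sigma_finite_measure M1" and M2: "sigma_finite_measure M2"
    and f: "integrable M1 f" and g: "integrable M2 g"
  shows "integrable (M1 \<Otimes>\<^sub>M M2) (\<lambda>z. f (fst z) * g (snd z))"
    and "(\<integral>z. f (fst z) * g (snd z) \<partial>(M1 \<Otimes>\<^sub>M M2)) = (\<integral>x. f x \<partial>M1) * (\<integral>y. g y \<partial>M2)"
proof -
  interpret pair_sigma_finite M1 M2 using M1 M2 by (simp add: pair_sigma_finite_def)
  have [measurable]: "f \<in> borel_measurable M1" "g \<in> borel_measurable M2" using f g by auto
  show int: "integrable (M1 \<Otimes>\<^sub>M M2) (\<lambda>z. f (fst z) * g (snd z))"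
    by (rule Fubini_integrable) (use f g in \<open>auto simp: abs_mult\<close>)
  show "(\<integral>z. f (fst z) * g (snd z) \<partial>(M1 \<Otimes>\<^sub>M M2)) = (\<integral>x. f x \<partial>M1) * (\<integral>y. g y \<partial>M2)"
    using integral_fst'[OF int] by simp
qed

lemma measurable_restrict_extend:
  fixes f :: "real \<Rightarrow> 'a \<Rightarrow> real"
  assumes t: "t \<ge> 0" and f: "(\<lambda>(r, \<omega>). f r \<omega>) \<in> borel_measurable (restrict_space lborel {0..t} \<Otimes>\<^sub>M M)"
  shows "(\<lambda>z. indicator {0..t} (fst z) * f (fst z) (snd z)) \<in> borel_measurable (lborel \<Otimes>\<^sub>M M)"
proof -
  have "(\<lambda>z. max 0 (min t (fst z))) \<in> measurable (lborel \<Otimes>\<^sub>M M) (restrict_space lborel {0..t})"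
    using t by (intro measurable_restrict_space2) auto
  then have "(\<lambda>z. (max 0 (min t (fst z)), snd z)) \<in> measurable (lborel \<Otimes>\<^sub>M M) (restrict_space lborel {0..t} \<Otimes>\<^sub>M M)"
    by (intro measurable_Pair) auto
  from measurable_compose[OF this f]
  have [measurable]: "(\<lambda>z. f (max 0 (min t (fst z))) (snd z)) \<in> borel_measurable (lborel \<Otimes>\<^sub>M M)" by simp
  have "(\<lambda>z. indicator {0..t} (fst z) * f (max 0 (min t (fst z))) (snd z)) \<in> borel_measurable (lborel \<Otimes>\<^sub>M M)"
    by measurable
  also have "(\<lambda>z. indicator {0..t} (fst z) * f (max 0 (min t (fst z))) (snd z)) = (\<lambda>z. indicator {0..t} (fst z) * f (fst z) (snd z))"
    by (auto simp: fun_eq_iff indicator_def)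
  finally show ?thesis .
qed

text \<open>The elementary predictable integrands. The index of the Brownian motion is a coordinate
  of the domain, so one function carries the integrands against the whole family, and orthogonality
  of integrals against different motions is part of a single isometry.\<close>

definition cell :: "nat \<times> nat \<Rightarrow> real \<Rightarrow> real \<Rightarrow> ('a \<Rightarrow> real) \<Rightarrow> (nat \<times> nat) \<times> real \<times> 'a \<Rightarrow> real" where
  "cell p a b \<psi> = (\<lambda>z. indicator {p} (fst z) * (indicator {a<..b} (fst (snd z)) * \<psi> (snd (snd z))))"

definition itg :: "(nat \<times> nat) set \<Rightarrow> real \<Rightarrow> (nat \<times> nat \<Rightarrow> real \<Rightarrow> 'a \<Rightarrow> real) \<Rightarrow> (nat \<times> nat) \<times> real \<times> 'a \<Rightarrow> real" where
  "itg P t f = (\<lambda>z. indicator P (fst z) * (indicator {0..t} (fst (snd z)) * f (fst z) (fst (snd z)) (snd (snd z))))"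

text \<open>The Brownian motions that act on mode n. Row n of the matrix A_{i,i+j} is nonzero
  exactly if i = n, and then component n + j is read, or if i + j = n, and then component i is
  read.\<close>

definition noise_idx :: "nat \<Rightarrow> (nat \<times> nat) set" where
  "noise_idx n = {(i, j). i \<ge> 1 \<and> j \<ge> 1 \<and> (i = n \<or> i + j = n)}"

context bm_family
begin

definition ito_measure :: "((nat \<times> nat) \<times> real \<times> 'a) measure" where
  "ito_measure = count_space UNIV \<Otimes>\<^sub>M (lborel \<Otimes>\<^sub>M M)"

definition simple_pairs :: "(((nat \<times> nat) \<times> real \<times> 'a \<Rightarrow> real) \<times> ('a \<Rightarrow> real)) set" where
  "simple_pairs = {(cell (i, j) a b \<psi>, \<lambda>\<omega>. \<psi> \<omega> * (W i j b \<omega> - W i j a \<omega>)) | i j a b \<psi>.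
     i \<ge> 1 \<and> j \<ge> 1 \<and> 0 \<le> a \<and> a \<le> b \<and> \<psi> \<in> borel_measurable (F a) \<and> bounded_on_space \<psi>}"

abbreviation ito_span :: "((nat \<times> nat) \<times> real \<times> 'a \<Rightarrow> real) \<Rightarrow> ('a \<Rightarrow> real) \<Rightarrow> bool" where
  "ito_span \<equiv> cspan ito_measure M simple_pairs"

lemma sigma_finite_M: "sigma_finite_measure M" ..

lemma sigma_finite_prod: "sigma_finite_measure (lborel \<Otimes>\<^sub>M M)"
proof -
  interpret pair_sigma_finite lborel M by unfold_locales
  show ?thesis ..
qed

lemma sigma_finite_count_space: "sigma_finite_measure (count_space (UNIV :: (nat \<times> nat) set))"
  by (rule sigma_finite_measure_count_space_countable) simp

lemma measurable_ito:
  assumes "\<And>p. (\<lambda>y. h (p, y)) \<in> measurable (lborel \<Otimes>\<^sub>M M) K"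
  shows "h \<in> measurable ito_measure K"
  unfolding ito_measure_def using assms by (intro measurable_pair_measure_countable1) auto

text \<open>Two orders of integration for two purposes: the index outermost isolates the integral
  against one motion, time outermost permits a bound at each fixed time, which is then integrated
  against the exponential kernel.\<close>

lemma nn_integral_ito:
  assumes h: "h \<in> borel_measurable ito_measure"
  shows "(\<integral>\<^sup>+z. h z \<partial>ito_measure) = (\<integral>\<^sup>+p. \<integral>\<^sup>+\<omega>. \<integral>\<^sup>+r. h (p, r, \<omega>) \<partial>lborel \<partial>M \<partial>count_space UNIV)"
    and "(\<integral>\<^sup>+z. h z \<partial>ito_measure) = (\<integral>\<^sup>+r. \<integral>\<^sup>+\<omega>. \<integral>\<^sup>+p. h (p, r, \<omega>) \<partial>count_space UNIV \<partial>M \<partial>lborel)"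
proof -
  interpret P: pair_sigma_finite lborel M by unfold_locales
  interpret Q: pair_sigma_finite "count_space (UNIV :: (nat \<times> nat) set)" "lborel \<Otimes>\<^sub>M M"
    using sigma_finite_count_space sigma_finite_prod by (simp add: pair_sigma_finite_def)
  have h': "h \<in> borel_measurable (count_space UNIV \<Otimes>\<^sub>M (lborel \<Otimes>\<^sub>M M))" using h by (simp add: ito_measure_def)
  note [measurable] = h'
  have "(\<integral>\<^sup>+z. h z \<partial>ito_measure) = (\<integral>\<^sup>+p. \<integral>\<^sup>+y. h (p, y) \<partial>(lborel \<Otimes>\<^sub>M M) \<partial>count_space UNIV)"
    unfolding ito_measure_def by (rule sigma_finite_measure.nn_integral_fst[OF sigma_finite_prod, symmetric]) measurable
  also have "\<dots> = (\<integral>\<^sup>+p. \<integral>\<^sup>+\<omega>. \<integral>\<^sup>+r. h (p, r, \<omega>) \<partial>lborel \<partial>M \<partial>count_space UNIV)"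
  proof (rule nn_integral_cong)
    fix p :: "nat \<times> nat"
    have "(\<lambda>y. h (p, y)) \<in> borel_measurable (lborel \<Otimes>\<^sub>M M)" by measurable
    then show "(\<integral>\<^sup>+y. h (p, y) \<partial>(lborel \<Otimes>\<^sub>M M)) = (\<integral>\<^sup>+\<omega>. \<integral>\<^sup>+r. h (p, r, \<omega>) \<partial>lborel \<partial>M)"
      using P.nn_integral_snd[of "\<lambda>y. h (p, y)"] by simp
  qed
  finally show "(\<integral>\<^sup>+z. h z \<partial>ito_measure) = (\<integral>\<^sup>+p. \<integral>\<^sup>+\<omega>. \<integral>\<^sup>+r. h (p, r, \<omega>) \<partial>lborel \<partial>M \<partial>count_space UNIV)" .
  have "(\<integral>\<^sup>+z. h z \<partial>ito_measure) = (\<integral>\<^sup>+y. \<integral>\<^sup>+p. h (p, y) \<partial>count_space UNIV \<partial>(lborel \<Otimes>\<^sub>M M))"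
    unfolding ito_measure_def by (rule Q.nn_integral_snd[symmetric]) measurable
  also have "\<dots> = (\<integral>\<^sup>+r. \<integral>\<^sup>+\<omega>. \<integral>\<^sup>+p. h (p, r, \<omega>) \<partial>count_space UNIV \<partial>M \<partial>lborel)"
  proof (rule nn_integral_fst[symmetric])
    have "(\<lambda>y. \<integral>\<^sup>+p. h' (y, p) \<partial>count_space UNIV) \<in> borel_measurable (lborel \<Otimes>\<^sub>M M)"
      if "h' \<in> borel_measurable ((lborel \<Otimes>\<^sub>M M) \<Otimes>\<^sub>M count_space (UNIV :: (nat \<times> nat) set))" for h' :: "_ \<Rightarrow> ennreal"
      using sigma_finite_measure.borel_measurable_nn_integral_fst[OF sigma_finite_count_space that] .
    from this[of "\<lambda>(y, p). h (p, y)"] show "(\<lambda>y. \<integral>\<^sup>+p. h (p, y) \<partial>count_space UNIV) \<in> borel_measurable (lborel \<Otimes>\<^sub>M M)"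
      using measurable_compose[OF measurable_pair_swap' h'] by (simp add: split_beta')
  qed
  finally show "(\<integral>\<^sup>+z. h z \<partial>ito_measure) = (\<integral>\<^sup>+r. \<integral>\<^sup>+\<omega>. \<integral>\<^sup>+p. h (p, r, \<omega>) \<partial>count_space UNIV \<partial>M \<partial>lborel)" .
qed

lemma cell_integral:
  assumes \<psi>: "integrable M \<psi>"
  shows "integrable ito_measure (cell p a b \<psi>)"
    and "(\<integral>z. cell p a b \<psi> z \<partial>ito_measure) = max 0 (b - a) * expectation \<psi>"
proof -
  have l: "integrable lborel (indicat_real {a<..b})" by (cases "a \<le> b") auto
  have le: "(\<integral>r. indicat_real {a<..b} r \<partial>lborel) = max 0 (b - a)"
    by (cases "a \<le> b") auto
  have c: "integrable (count_space UNIV) (indicat_real {p})" by simp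
  have ce: "(\<integral>q. indicat_real {p} q \<partial>count_space UNIV) = 1" by simp
  note 1 = integrable_pair_mult[OF lborel.sigma_finite_measure_axioms sigma_finite_M l \<psi>]
  note 2 = integrable_pair_mult[OF sigma_finite_count_space sigma_finite_prod c 1(1)]
  show "integrable ito_measure (cell p a b \<psi>)" using 2(1) by (simp add: ito_measure_def cell_def)
  show "(\<integral>z. cell p a b \<psi> z \<partial>ito_measure) = max 0 (b - a) * expectation \<psi>"
    using 2(2) 1(2) le ce by (simp add: ito_measure_def cell_def)
qed

lemma cell_mult: "cell p a b \<psi> z * cell q c d \<phi> z = (if p = q then cell p (max a c) (min b d) (\<lambda>\<omega>. \<psi> \<omega> * \<phi> \<omega>) z else 0)"
  by (auto simp: cell_def indicator_def)

lemma cell_measurable: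
  assumes [measurable]: "\<psi> \<in> borel_measurable M"
  shows "cell p a b \<psi> \<in> borel_measurable ito_measure"
  by (rule measurable_ito) (simp add: cell_def)

lemma bounded_integrable: "\<psi> \<in> borel_measurable M \<Longrightarrow> bounded_on_space \<psi> \<Longrightarrow> integrable M \<psi>"
  unfolding bounded_on_space_def by (elim exE, rule integrable_const_bound) auto

lemma simple_pairs_isometric: "isometric_pairs ito_measure M simple_pairs"
proof
  fix f Y assume "(f, Y) \<in> simple_pairs"
  then obtain i j a b \<psi> where f: "f = cell (i, j) a b \<psi>" and Y: "Y = (\<lambda>\<omega>. \<psi> \<omega> * (W i j b \<omega> - W i j a \<omega>))"
    and ij: "i \<ge> 1" "j \<ge> 1" "0 \<le> a" "a \<le> b" and \<psi>: "\<psi> \<in> borel_measurable (F a)" "bounded_on_space \<psi>"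
    unfolding simple_pairs_def by blast
  have \<psi>M: "\<psi> \<in> borel_measurable M" using \<psi>(1) by (rule measurable_F)
  obtain C where C: "\<And>\<omega>. \<omega> \<in> space M \<Longrightarrow> \<bar>\<psi> \<omega>\<bar> \<le> C" using \<psi>(2) by (auto simp: bounded_on_space_def)
  have "sqint M Y" unfolding Y using C by (intro sqint_mult_bounded[where C = C] increment_sqint \<psi>M ij)
  moreover have "integrable ito_measure (cell (i, j) a b (\<lambda>\<omega>. \<psi> \<omega> * \<psi> \<omega>))"
    by (intro cell_integral bounded_integrable borel_measurable_times \<psi>M bounded_on_space_mult \<psi>(2))
  then have "integrable ito_measure (\<lambda>z. (f z)\<^sup>2)" unfolding f power2_eq_square cell_mult by simp
  then have "sqint ito_measure f" using cell_measurable[OF \<psi>M] by (simp add: sqint_def f)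
  ultimately show "sqint ito_measure f \<and> sqint M Y" by simp
next
  fix f Y g Z assume "(f, Y) \<in> simple_pairs" "(g, Z) \<in> simple_pairs"
  then obtain i j a b \<psi> i' j' c d \<phi> where f: "f = cell (i, j) a b \<psi>" and Y: "Y = (\<lambda>\<omega>. \<psi> \<omega> * (W i j b \<omega> - W i j a \<omega>))"
    and ij: "i \<ge> 1" "j \<ge> 1" "0 \<le> a" "a \<le> b" and \<psi>: "\<psi> \<in> borel_measurable (F a)" "bounded_on_space \<psi>"
    and g: "g = cell (i', j') c d \<phi>" and Z: "Z = (\<lambda>\<omega>. \<phi> \<omega> * (W i' j' d \<omega> - W i' j' c \<omega>))"
    and ij': "i' \<ge> 1" "j' \<ge> 1" "0 \<le> c" "c \<le> d" and \<phi>: "\<phi> \<in> borel_measurable (F c)" "bounded_on_space \<phi>"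
    unfolding simple_pairs_def by blast
  have "integrable M (\<lambda>\<omega>. \<psi> \<omega> * \<phi> \<omega>)"
    using \<psi> \<phi> measurable_F by (intro bounded_integrable borel_measurable_times bounded_on_space_mult) auto
  note cell = cell_integral(2)[OF this]
  show "(\<integral>z. f z * g z \<partial>ito_measure) = (\<integral>\<omega>. Y \<omega> * Z \<omega> \<partial>M)"
    unfolding f g Y Z cell_mult expectation_increments[OF ij(1,2) ij'(1,2) ij(3,4) ij'(3,4) \<psi> \<phi>]
  proof (cases "(i, j) = (i', j')")
    case True
    then show "(\<integral>z. (if (i, j) = (i', j') then cell (i, j) (max a c) (min b d) (\<lambda>\<omega>. \<psi> \<omega> * \<phi> \<omega>) z else 0) \<partial>ito_measure)
      = (if (i, j) = (i', j') then expectation (\<lambda>\<omega>. \<psi> \<omega> * \<phi> \<omega>) * max 0 (min b d - max a c) else 0)"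
      using cell by simp
  next
    case False
    then show "(\<integral>z. (if (i, j) = (i', j') then cell (i, j) (max a c) (min b d) (\<lambda>\<omega>. \<psi> \<omega> * \<phi> \<omega>) z else 0) \<partial>ito_measure)
      = (if (i, j) = (i', j') then expectation (\<lambda>\<omega>. \<psi> \<omega> * \<phi> \<omega>) * max 0 (min b d - max a c) else 0)"
      unfolding if_not_P[OF False] by simp
  qed
qed

lemmas ito_span_isometry = isometric_pairs.cspan_isometry[OF simple_pairs_isometric]
lemmas ito_span_sqint = isometric_pairs.cspan_sqint[OF simple_pairs_isometric]

section \<open>Membership of stochastic integrals in the closed span\<close>

lemma ito_span_cell:
  assumes "i \<ge> 1" "j \<ge> 1" "0 \<le> a" "a \<le> b" "\<psi> \<in> borel_measurable (F a)" "bounded_on_space \<psi>"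
  shows "ito_span (cell (i, j) a b \<psi>) (\<lambda>\<omega>. \<psi> \<omega> * (W i j b \<omega> - W i j a \<omega>))"
  unfolding simple_pairs_def using assms by (intro cspan.gen) blast

lemma ito_span_zero: "ito_span (\<lambda>_. 0) (\<lambda>_. 0)"
  using ito_span_cell[of 1 1 0 0 "\<lambda>_. 0"] bounded_on_space_const[of 0] by (simp add: cell_def)

lemma itg_measurable:
  assumes "\<And>p. p \<in> P \<Longrightarrow> (\<lambda>z. indicator {0..t} (fst z) * f p (fst z) (snd z)) \<in> borel_measurable (lborel \<Otimes>\<^sub>M M)"
  shows "itg P t f \<in> borel_measurable ito_measure"
proof (rule measurable_ito)
  fix p show "(\<lambda>y. itg P t f (p, y)) \<in> borel_measurable (lborel \<Otimes>\<^sub>M M)"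
    using assms[of p] by (cases "p \<in> P") (simp_all add: itg_def)
qed

lemma simple_process_ito_span:
  assumes ij: "i \<ge> 1" "j \<ge> 1" and t: "t \<ge> 0" and sp: "simple_process F m \<tau> \<psi>"
  shows "ito_span (itg {(i, j)} t (\<lambda>_. simple_eval m \<tau> \<psi>)) (simple_ito (W i j) m \<tau> \<psi> t)"
proof -
  have \<tau>: "k \<le> m \<Longrightarrow> 0 \<le> \<tau> k" for k
    using sp by (induction k) (auto simp: simple_process_def intro: order.trans dest: Suc_leD)
  have "ito_span (\<lambda>z. \<Sum>k<m. cell (i, j) (min t (\<tau> k)) (min t (\<tau> (Suc k))) (\<psi> k) z)
      (\<lambda>\<omega>. \<Sum>k<m. \<psi> k \<omega> * (W i j (min t (\<tau> (Suc k))) \<omega> - W i j (min t (\<tau> k)) \<omega>))"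
  proof (rule cspan_sum)
    fix k assume k: "k \<in> {..<m}"
    then have le: "\<tau> k \<le> \<tau> (Suc k)" and \<psi>: "\<psi> k \<in> borel_measurable (F (\<tau> k))" "bounded_on_space (\<psi> k)"
      using sp by (auto simp: simple_process_def bounded_on_space_def space_F)
    show "ito_span (cell (i, j) (min t (\<tau> k)) (min t (\<tau> (Suc k))) (\<psi> k))
      (\<lambda>\<omega>. \<psi> k \<omega> * (W i j (min t (\<tau> (Suc k))) \<omega> - W i j (min t (\<tau> k)) \<omega>))"
    \<comment> \<open>If the step starts by time t, clipping at t preserves its left end, where the
      factor \<open>\<psi> k\<close> is known. If it starts later, the clipped step is empty and
      both slots vanish.\<close>
    proof (cases "\<tau> k \<le> t")
      case True
      then show ?thesis using \<tau>[of k] k le \<psi> t ij by (intro ito_span_cell) auto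
    next
      case False
      then have "cell (i, j) (min t (\<tau> k)) (min t (\<tau> (Suc k))) (\<psi> k) = (\<lambda>_. 0)"
        "(\<lambda>\<omega>. \<psi> k \<omega> * (W i j (min t (\<tau> (Suc k))) \<omega> - W i j (min t (\<tau> k)) \<omega>)) = (\<lambda>_. 0)"
        using le by (auto simp: cell_def fun_eq_iff min_def)
      then show ?thesis using ito_span_zero by simp
    qed
  qed (auto intro: ito_span_zero)
  moreover have "(\<lambda>z. \<Sum>k<m. cell (i, j) (min t (\<tau> k)) (min t (\<tau> (Suc k))) (\<psi> k) z) = itg {(i, j)} t (\<lambda>_. simple_eval m \<tau> \<psi>)"
  proof
    fix z
    have "indicator {min t (\<tau> k)<..min t (\<tau> (Suc k))} r = (indicator {0..t} r * indicator {\<tau> k<..\<tau> (Suc k)} r :: real)"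
      if "k < m" for k and r :: real
      using \<tau>[of k] that by (auto simp: indicator_def min_def)
    then show "(\<Sum>k<m. cell (i, j) (min t (\<tau> k)) (min t (\<tau> (Suc k))) (\<psi> k) z) = itg {(i, j)} t (\<lambda>_. simple_eval m \<tau> \<psi>) z"
      unfolding itg_def simple_eval_def cell_def sum_distrib_left
      by (intro sum.cong) (auto simp: mult_ac)
  qed
  ultimately show ?thesis by (simp add: simple_ito_def[abs_def])
qed

lemma ito_norm_single:
  assumes h: "(\<lambda>z. indicator {0..t} (fst z) * h (fst z) (snd z)) \<in> borel_measurable (lborel \<Otimes>\<^sub>M M)"
  shows "(\<integral>\<^sup>+z. ennreal ((itg {p} t (\<lambda>_. h) z)\<^sup>2) \<partial>ito_measure) = (\<integral>\<^sup>+\<omega>. (\<integral>\<^sup>+r\<in>{0..t}. ennreal ((h r \<omega>)\<^sup>2) \<partial>lborel) \<partial>M)"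
proof -
  have "(\<integral>\<^sup>+z. ennreal ((itg {p} t (\<lambda>_. h) z)\<^sup>2) \<partial>ito_measure)
      = (\<integral>\<^sup>+q. \<integral>\<^sup>+\<omega>. \<integral>\<^sup>+r. ennreal ((itg {p} t (\<lambda>_. h) (q, r, \<omega>))\<^sup>2) \<partial>lborel \<partial>M \<partial>count_space UNIV)"
    by (intro nn_integral_ito(1) measurable_compose[OF itg_measurable measurable_compose[OF _ measurable_ennreal]] h) simp_all
  also have "\<dots> = (\<integral>\<^sup>+q. (\<integral>\<^sup>+\<omega>. (\<integral>\<^sup>+r\<in>{0..t}. ennreal ((h r \<omega>)\<^sup>2) \<partial>lborel) \<partial>M) * indicator {p} q \<partial>count_space UNIV)"
  proof (rule nn_integral_cong)
    fix q
    show "(\<integral>\<^sup>+\<omega>. \<integral>\<^sup>+r. ennreal ((itg {p} t (\<lambda>_. h) (q, r, \<omega>))\<^sup>2) \<partial>lborel \<partial>M)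
       = (\<integral>\<^sup>+\<omega>. (\<integral>\<^sup>+r\<in>{0..t}. ennreal ((h r \<omega>)\<^sup>2) \<partial>lborel) \<partial>M) * indicator {p} q"
      by (cases "q = p") (auto simp: itg_def indicator_def intro!: nn_integral_cong)
  qed
  also have "\<dots> = (\<integral>\<^sup>+\<omega>. (\<integral>\<^sup>+r\<in>{0..t}. ennreal ((h r \<omega>)\<^sup>2) \<partial>lborel) \<partial>M)"
    by (simp add: nn_integral_cmult_indicator)
  finally show ?thesis .
qed

lemma has_ito_integral_measurable:
  assumes t: "t \<ge> 0" and f: "has_ito_integral M F V f t Y"
  shows "(\<lambda>z. indicator {0..t} (fst z) * f (fst z) (snd z)) \<in> borel_measurable (lborel \<Otimes>\<^sub>M M)"
  using measurable_restrict_extend[OF t, of f M] f by (auto simp: has_ito_integral_def)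

text \<open>The definition of the integral already provides simple processes converging in both
  slots. By \<open>ito_norm_single\<close> its convergence of integrands is convergence in the L2
  space of \<open>ito_measure\<close>.\<close>

lemma has_ito_integral_span:
  assumes ij: "i \<ge> 1" "j \<ge> 1" and t: "t \<ge> 0" and f: "has_ito_integral M F (W i j) f t Y"
  shows "ito_span (itg {(i, j)} t (\<lambda>_. f)) Y"
proof -
  from f obtain m :: "nat \<Rightarrow> nat" and \<tau> :: "nat \<Rightarrow> nat \<Rightarrow> real" and \<psi> :: "nat \<Rightarrow> nat \<Rightarrow> 'a \<Rightarrow> real"
    where Ym: "Y \<in> borel_measurable M" and sp: "\<And>k. simple_process F (m k) (\<tau> k) (\<psi> k)"
    and l1: "(\<lambda>k. \<integral>\<^sup>+ \<omega>. (\<integral>\<^sup>+ r\<in>{0..t}. ennreal ((f r \<omega> - simple_eval (m k) (\<tau> k) (\<psi> k) r \<omega>)\<^sup>2) \<partial>lborel) \<partial>M) \<longlonglongrightarrow> 0"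
    and l2: "(\<lambda>k. \<integral>\<^sup>+ \<omega>. ennreal ((Y \<omega> - simple_ito (W i j) (m k) (\<tau> k) (\<psi> k) t \<omega>)\<^sup>2) \<partial>M) \<longlonglongrightarrow> 0"
    unfolding has_ito_integral_def by blast
  have fm: "(\<lambda>z. indicator {0..t} (fst z) * f (fst z) (snd z)) \<in> borel_measurable (lborel \<Otimes>\<^sub>M M)"
    by (rule has_ito_integral_measurable[OF t f])
  have sm: "(\<lambda>z. simple_eval (m k) (\<tau> k) (\<psi> k) (fst z) (snd z)) \<in> borel_measurable (lborel \<Otimes>\<^sub>M M)" for k
  proof -
    have "(\<lambda>z. \<psi> k l (snd z)) \<in> borel_measurable (lborel \<Otimes>\<^sub>M M)" if "l < m k" for l
      using sp[of k] that measurable_F[of "\<psi> k l" "\<tau> k l"]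
      by (intro measurable_compose[OF measurable_snd]) (auto simp: simple_process_def)
    moreover have "(\<lambda>z. indicator {\<tau> k l<..\<tau> k (Suc l)} (fst z) :: real) \<in> borel_measurable (lborel \<Otimes>\<^sub>M M)" for l
      by (rule measurable_compose[OF measurable_fst]) simp
    ultimately show ?thesis
      unfolding simple_eval_def by (intro borel_measurable_sum borel_measurable_times) auto
  qed
  have dm: "(\<lambda>z. indicator {0..t} (fst z) * (f (fst z) (snd z) - simple_eval (m k) (\<tau> k) (\<psi> k) (fst z) (snd z))) \<in> borel_measurable (lborel \<Otimes>\<^sub>M M)" for k
  proof -
    have "(\<lambda>z. indicator {0..t} (fst z) * f (fst z) (snd z) - indicator {0..t} (fst z) * simple_eval (m k) (\<tau> k) (\<psi> k) (fst z) (snd z)) \<in> borel_measurable (lborel \<Otimes>\<^sub>M M)"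
      using fm sm[of k] by measurable
    then show ?thesis by (simp add: right_diff_distrib)
  qed
  show ?thesis
  proof (rule cspan.lim)
    show "ito_span (itg {(i, j)} t (\<lambda>_. simple_eval (m k) (\<tau> k) (\<psi> k))) (simple_ito (W i j) (m k) (\<tau> k) (\<psi> k) t)" for k
      by (rule simple_process_ito_span[OF ij t sp])
    have "itg {(i, j)} t (\<lambda>_. f) z - itg {(i, j)} t (\<lambda>_. g) z = itg {(i, j)} t (\<lambda>_ r \<omega>. f r \<omega> - g r \<omega>) z" for g z
      by (simp add: itg_def right_diff_distrib)
    then show "L2_tendsto ito_measure (\<lambda>k. itg {(i, j)} t (\<lambda>_. simple_eval (m k) (\<tau> k) (\<psi> k))) (itg {(i, j)} t (\<lambda>_. f))"
      unfolding L2_tendsto_def using l1 by (simp add: ito_norm_single[OF dm] itg_measurable fm)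
    show "L2_tendsto M (\<lambda>k. simple_ito (W i j) (m k) (\<tau> k) (\<psi> k) t) Y"
      unfolding L2_tendsto_def using Ym l2 by simp
  qed
qed

text \<open>Mode n is driven by finitely many motions with i + j = n and infinitely many with i = n.
  The partial sums over j are finite sums of pairs. The integrals converge by assumption, the
  integrands by dominated convergence, for which the full integrand has to be square
  integrable.\<close>

lemma noise_span:
  assumes n: "n \<ge> 1"
    and Y: "\<And>p. p \<in> noise_idx n \<Longrightarrow> ito_span (itg {p} t f) (Y p)"
    and Z: "L2_sums M (\<lambda>j. Y (n, j)) Z"
    and fin: "(\<integral>\<^sup>+z. ennreal ((itg (noise_idx n) t f z)\<^sup>2) \<partial>ito_measure) < \<infinity>"
  shows "ito_span (itg (noise_idx n) t f) (\<lambda>\<omega>. (\<Sum>i=1..<n. Y (i, n - i) \<omega>) + Z \<omega>)"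
proof -
  define P where "P = (\<lambda>m. {p \<in> noise_idx n. fst p = n \<longrightarrow> snd p \<le> m})"
  have P: "P m = (\<lambda>i. (i, n - i)) ` {1..<n} \<union> Pair n ` {1..m}" for m
    unfolding P_def noise_idx_def using n by (auto simp: image_iff)
  have span: "finite Q \<Longrightarrow> Q \<subseteq> noise_idx n \<Longrightarrow> ito_span (itg Q t f) (\<lambda>\<omega>. \<Sum>p\<in>Q. Y p \<omega>)" for Q
  proof (induction Q rule: finite_induct)
    case empty
    then show ?case using ito_span_zero by (simp add: itg_def)
  next
    case (insert p Q)
    have "ito_span (itg {p} t f) (Y p)"
      using Y[of p] insert(4) by auto
    from cspan_add[OF this insert.IH]
    have "ito_span (\<lambda>z. itg {p} t f z + itg Q t f z) (\<lambda>\<omega>. Y p \<omega> + (\<Sum>p\<in>Q. Y p \<omega>))"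
      using insert by simp
    moreover have "(\<lambda>z. itg {p} t f z + itg Q t f z) = itg (insert p Q) t f"
      using insert(2) by (auto simp: itg_def fun_eq_iff indicator_def)
    ultimately show ?case using insert by simp
  qed
  have sumP: "(\<Sum>p\<in>P m. Y p \<omega>) = (\<Sum>i=1..<n. Y (i, n - i) \<omega>) + (\<Sum>j=1..m. Y (n, j) \<omega>)" for m \<omega>
  proof -
    have "(\<Sum>p\<in>P m. Y p \<omega>) = (\<Sum>p\<in>(\<lambda>i. (i, n - i)) ` {1..<n}. Y p \<omega>) + (\<Sum>p\<in>Pair n ` {1..m}. Y p \<omega>)"
      unfolding P by (rule sum.union_disjoint) auto
    also have "(\<Sum>p\<in>(\<lambda>i. (i, n - i)) ` {1..<n}. Y p \<omega>) = (\<Sum>i=1..<n. Y (i, n - i) \<omega>)"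
      by (subst sum.reindex) (auto simp: inj_on_def)
    also have "(\<Sum>p\<in>Pair n ` {1..m}. Y p \<omega>) = (\<Sum>j=1..m. Y (n, j) \<omega>)"
      by (subst sum.reindex) (auto simp: inj_on_def)
    finally show ?thesis .
  qed
  have fm: "itg Q t f \<in> borel_measurable ito_measure" if "Q \<subseteq> noise_idx n" for Q
  proof (rule measurable_ito)
    fix p
    show "(\<lambda>y. itg Q t f (p, y)) \<in> borel_measurable (lborel \<Otimes>\<^sub>M M)"
    proof (cases "p \<in> Q")
      case True
      then have "p \<in> noise_idx n" using that by blast
      then have "itg {p} t f \<in> borel_measurable ito_measure"
        using ito_span_sqint[OF Y] unfolding sqint_def by blast
      then have "itg {p} t f \<in> borel_measurable (count_space UNIV \<Otimes>\<^sub>M (lborel \<Otimes>\<^sub>M M))"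
        by (simp add: ito_measure_def)
      from measurable_compose[OF measurable_Pair1' this, of p]
      have "(\<lambda>y. itg {p} t f (p, y)) \<in> borel_measurable (lborel \<Otimes>\<^sub>M M)" by simp
      with True show ?thesis by (simp add: itg_def)
    qed (simp add: itg_def)
  qed
  have PQ: "P m \<subseteq> noise_idx n" for m by (auto simp: P_def)
  have Ym: "Y p \<in> borel_measurable M" if "p \<in> noise_idx n" for p
    using ito_span_sqint[OF Y[OF that]] by (simp add: sqint_def)
  show ?thesis
  proof (rule cspan.lim)
    show "ito_span (itg (P m) t f) (\<lambda>\<omega>. \<Sum>p\<in>P m. Y p \<omega>)" for m
    proof (rule span[OF _ PQ])
      show "finite (P m)" unfolding P by simp
    qed
    have "(\<lambda>m. \<integral>\<^sup>+ x. ennreal ((itg (noise_idx n) t f x - itg (P m) t f x)\<^sup>2) \<partial>ito_measure) \<longlonglongrightarrow> (\<integral>\<^sup>+ x. 0 \<partial>ito_measure)"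
    proof (rule nn_integral_dominated_convergence[where w = "\<lambda>z. ennreal ((itg (noise_idx n) t f z)\<^sup>2)"])
      show "(\<lambda>x. ennreal ((itg (noise_idx n) t f x - itg (P m) t f x)\<^sup>2)) \<in> borel_measurable ito_measure" for m
        using fm[OF order.refl] fm[OF PQ] by measurable
      show "(\<lambda>z. ennreal ((itg (noise_idx n) t f z)\<^sup>2)) \<in> borel_measurable ito_measure"
        using fm[OF order.refl] by measurable
      show "AE x in ito_measure. ennreal ((itg (noise_idx n) t f x - itg (P m) t f x)\<^sup>2) \<le> ennreal ((itg (noise_idx n) t f x)\<^sup>2)" for m
        using PQ[of m] by (intro AE_I2 ennreal_leI) (auto simp: itg_def indicator_def)
      show "AE x in ito_measure. (\<lambda>m. ennreal ((itg (noise_idx n) t f x - itg (P m) t f x)\<^sup>2)) \<longlonglongrightarrow> 0"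
      proof (rule AE_I2, rule tendsto_eventually)
        fix x
        show "\<forall>\<^sub>F m in sequentially. ennreal ((itg (noise_idx n) t f x - itg (P m) t f x)\<^sup>2) = 0"
          using eventually_ge_at_top[of "snd (fst x)"]
          by eventually_elim (auto simp: itg_def indicator_def P_def)
      qed
    qed (use fin in auto)
    then show "L2_tendsto ito_measure (\<lambda>m. itg (P m) t f) (itg (noise_idx n) t f)"
      unfolding L2_tendsto_def using fm[OF order.refl] by simp
    have "Z \<in> borel_measurable M" using Z by (simp add: L2_sums_def)
    then have "(\<lambda>\<omega>. (\<Sum>i=1..<n. Y (i, n - i) \<omega>) + Z \<omega>) \<in> borel_measurable M"
      by (intro borel_measurable_add borel_measurable_sum Ym) (auto simp: noise_idx_def)
    then show "L2_tendsto M (\<lambda>m \<omega>. \<Sum>p\<in>P m. Y p \<omega>) (\<lambda>\<omega>. (\<Sum>i=1..<n. Y (i, n - i) \<omega>) + Z \<omega>)"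
      using Z unfolding L2_tendsto_def L2_sums_def sumP by simp
  qed
qed

end

section \<open>Exponential convolutions of stochastic integrals\<close>

text \<open>On each cell the error is the integral of e' times the oscillation of
  \<open>\<phi>\<close>. As e' is nonnegative this is at most \<delta> times the increment of e, and
  the increments telescope.\<close>

lemma riemann_stieltjes_bound:
  fixes s :: "nat \<Rightarrow> real" and e e' \<phi> :: "real \<Rightarrow> real"
  assumes mono: "\<And>q. q < N \<Longrightarrow> s q \<le> s (Suc q)"
    and cont: "continuous_on {s 0..s N} \<phi>" "continuous_on UNIV e'"
    and e: "\<And>r. (e has_real_derivative e' r) (at r)" "\<And>r. e' r \<ge> 0"
    and osc: "\<And>q r. q < N \<Longrightarrow> r \<in> {s q..s (Suc q)} \<Longrightarrow> \<bar>\<phi> (s (Suc q)) - \<phi> r\<bar> \<le> \<delta>"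
  shows "\<bar>(\<Sum>q<N. (e (s (Suc q)) - e (s q)) * \<phi> (s (Suc q))) - integral {s 0..s N} (\<lambda>r. e' r * \<phi> r)\<bar> \<le> \<delta> * (e (s N) - e (s 0))"
  using mono cont(1) osc
proof (induction N)
  case 0
  then show ?case by simp
next
  case (Suc N)
  have le0: "s 0 \<le> s N"
  proof -
    have "k \<le> N \<Longrightarrow> s 0 \<le> s k" for k
    proof (induction k)
      case (Suc k)
      then show ?case using Suc.prems(1) \<open>\<And>q. q < Suc N \<Longrightarrow> s q \<le> s (Suc q)\<close>[of k] by simp
    qed simp
    then show ?thesis by simp
  qed
  have leN: "s N \<le> s (Suc N)" by (rule Suc.prems(1)) simp
  define g where "g = (\<lambda>r. e' r * \<phi> r)"
  have gc: "continuous_on {s 0..s (Suc N)} g"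
    unfolding g_def using Suc.prems(2) cont(2) by (intro continuous_intros) (auto intro: continuous_on_subset)
  have sub: "continuous_on {s N..s (Suc N)} \<phi>" "continuous_on {s N..s (Suc N)} e'"
    using le0 Suc.prems(2) cont(2) by (auto intro: continuous_on_subset)
  define A where "A = (\<Sum>q<N. (e (s (Suc q)) - e (s q)) * \<phi> (s (Suc q))) - integral {s 0..s N} g"
  have IH: "\<bar>A\<bar> \<le> \<delta> * (e (s N) - e (s 0))"
    unfolding A_def g_def using Suc.prems leN by (intro Suc.IH continuous_on_subset[OF Suc.prems(2)]) auto
  have I: "integral {s 0..s N} g + integral {s N..s (Suc N)} g = integral {s 0..s (Suc N)} g"
    using le0 leN gc by (intro Henstock_Kurzweil_Integration.integral_combine integrable_continuous_interval)
  have E: "(e' has_integral (e (s (Suc N)) - e (s N))) {s N..s (Suc N)}"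
    using leN e(1) by (intro fundamental_theorem_of_calculus)
      (auto simp: has_real_derivative_iff_has_vector_derivative[symmetric] intro: DERIV_subset)
  define R where "R = (e (s (Suc N)) - e (s N)) * \<phi> (s (Suc N)) - integral {s N..s (Suc N)} g"
  have "R = integral {s N..s (Suc N)} (\<lambda>r. e' r * \<phi> (s (Suc N)) - e' r * \<phi> r)"
    unfolding R_def g_def
    using sub E by (subst Henstock_Kurzweil_Integration.integral_diff)
      (auto intro!: integrable_continuous_interval continuous_intros simp: integral_unique)
  also have "\<bar>\<dots>\<bar> \<le> integral {s N..s (Suc N)} (\<lambda>r. e' r * \<delta>)"
  proof -
    have "norm (e' r * \<phi> (s (Suc N)) - e' r * \<phi> r) \<le> e' r * \<delta>" if "r \<in> {s N..s (Suc N)}" for r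
      using Suc.prems(3)[of N r] that e(2)[of r] mult_left_mono[of "\<bar>\<phi> (s (Suc N)) - \<phi> r\<bar>" \<delta> "e' r"]
      by (simp add: right_diff_distrib[symmetric] abs_mult)
    then have "norm (integral {s N..s (Suc N)} (\<lambda>r. e' r * \<phi> (s (Suc N)) - e' r * \<phi> r)) \<le> integral {s N..s (Suc N)} (\<lambda>r. e' r * \<delta>)"
      using sub by (intro integral_norm_bound_integral integrable_continuous_interval continuous_intros) auto
    then show ?thesis by simp
  qed
  also have "\<dots> = (e (s (Suc N)) - e (s N)) * \<delta>" using E by (simp add: integral_unique)
  finally have R: "\<bar>R\<bar> \<le> (e (s (Suc N)) - e (s N)) * \<delta>" .
  have "(\<Sum>q<Suc N. (e (s (Suc q)) - e (s q)) * \<phi> (s (Suc q))) - integral {s 0..s (Suc N)} g = A + R"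
    unfolding A_def R_def using I by simp
  then have "\<bar>(\<Sum>q<Suc N. (e (s (Suc q)) - e (s q)) * \<phi> (s (Suc q))) - integral {s 0..s (Suc N)} g\<bar> \<le> \<delta> * (e (s (Suc N)) - e (s 0))"
    using IH R abs_triangle_ineq[of A R] by (simp add: algebra_simps)
  then show ?case by (simp add: g_def)
qed

section \<open>Uniform grids and Riemann-Stieltjes sums\<close>

definition grid :: "real \<Rightarrow> nat \<Rightarrow> nat \<Rightarrow> real" where
  "grid t m q = real q * (t / real (Suc m))"

lemma grid_0: "grid t m 0 = 0" and grid_end: "grid t m (Suc m) = t"
  by (simp_all add: grid_def)

lemma grid_step: "grid t m (Suc q) = grid t m q + t / real (Suc m)"
  unfolding grid_def by (simp only: of_nat_Suc[of q] distrib_right mult_1_left add.commute)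

lemma grid_mono: "0 \<le> t \<Longrightarrow> q \<le> q' \<Longrightarrow> grid t m q \<le> grid t m q'"
  unfolding grid_def by (intro mult_right_mono) auto

lemma grid_bounds:
  assumes "0 \<le> t" "q \<le> Suc m" shows "grid t m q \<in> {0..t}"
  using grid_mono[of t 0 q m] grid_mono[of t q "Suc m" m] assms by (simp add: grid_0 grid_end)

lemma tendsto_grid_step: "(\<lambda>m. t / real (Suc m)) \<longlonglongrightarrow> 0"
  by (rule LIMSEQ_Suc[OF lim_const_over_n])

lemma riemann_stieltjes_conv:
  assumes c: "c > 0" and t: "t \<ge> 0" and \<phi>: "continuous_on {0..t} \<phi>"
  defines "e \<equiv> (\<lambda>s. exp (- (c * (t - s))))"
  shows "(\<lambda>m. \<Sum>q<Suc m. (e (grid t m (Suc q)) - e (grid t m q)) * \<phi> (grid t m (Suc q))) \<longlonglongrightarrow> c * conv c \<phi> t"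
proof (rule LIMSEQ_I)
  fix \<delta> :: real assume \<delta>: "\<delta> > 0"
  have "uniformly_continuous_on {0..t} \<phi>" using \<phi> by (intro compact_uniformly_continuous) auto
  then obtain \<eta> where \<eta>: "\<eta> > 0" "\<And>x y. x \<in> {0..t} \<Longrightarrow> y \<in> {0..t} \<Longrightarrow> dist y x < \<eta> \<Longrightarrow> dist (\<phi> y) (\<phi> x) < \<delta> / 2"
    unfolding uniformly_continuous_on_def using \<delta> by (metis half_gt_zero)
  have "eventually (\<lambda>m. t / real (Suc m) < \<eta>) sequentially"
    using order_tendstoD(2)[OF tendsto_grid_step \<eta>(1)] .
  then obtain m0 where m0: "\<And>m. m \<ge> m0 \<Longrightarrow> t / real (Suc m) < \<eta>" by (auto simp: eventually_sequentially)
  have conv_eq: "integral {0..t} (\<lambda>r. c * e r * \<phi> r) = c * conv c \<phi> t"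
  proof -
    have "conv c \<phi> t = integral {0..t} (\<lambda>r. e r * \<phi> r)"
      unfolding conv_def e_def
      by (rule set_borel_integral_eq_integral) (intro continuous_on_set_integrable_lborel continuous_intros \<phi>)
    then show ?thesis by (simp add: mult.assoc)
  qed
  show "\<exists>m0. \<forall>m\<ge>m0. norm ((\<Sum>q<Suc m. (e (grid t m (Suc q)) - e (grid t m q)) * \<phi> (grid t m (Suc q))) - c * conv c \<phi> t) < \<delta>"
  proof (intro exI allI impI)
    fix m assume m: "m \<ge> m0"
    have "\<bar>(\<Sum>q<Suc m. (e (grid t m (Suc q)) - e (grid t m q)) * \<phi> (grid t m (Suc q))) - integral {grid t m 0..grid t m (Suc m)} (\<lambda>r. (c * e r) * \<phi> r)\<bar>
       \<le> \<delta> / 2 * (e (grid t m (Suc m)) - e (grid t m 0))"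
    proof (rule riemann_stieltjes_bound)
      show "continuous_on {grid t m 0..grid t m (Suc m)} \<phi>" using \<phi> by (simp add: grid_0 grid_end)
      show "continuous_on UNIV (\<lambda>r. c * e r)" unfolding e_def by (intro continuous_intros)
      show "(e has_real_derivative c * e r) (at r)" for r
        unfolding e_def by (auto intro!: derivative_eq_intros)
      show "0 \<le> c * e r" for r using c by (simp add: e_def)
      show "\<bar>\<phi> (grid t m (Suc q)) - \<phi> r\<bar> \<le> \<delta> / 2" if "q < Suc m" "r \<in> {grid t m q..grid t m (Suc q)}" for q r
      proof -
        have "dist (grid t m (Suc q)) r < \<eta>" using that m0[OF m] grid_step[of t m q] by (auto simp: dist_real_def)
        then have "dist (\<phi> (grid t m (Suc q))) (\<phi> r) < \<delta> / 2"
          using that grid_bounds[OF t, of q m] grid_bounds[OF t, of "Suc q" m] by (intro \<eta>(2)) auto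
        then show ?thesis by (simp add: dist_real_def)
      qed
    qed (use grid_mono[OF t] in auto)
    also have "\<dots> < \<delta>"
    proof -
      have "e t = 1" "e 0 \<ge> 0" by (auto simp: e_def)
      then have "\<delta> / 2 * (e t - e 0) \<le> \<delta> / 2 * 1" using \<delta> by (intro mult_left_mono) auto
      then show ?thesis using \<delta> by (simp add: grid_0 grid_end)
    qed
    finally show "norm ((\<Sum>q<Suc m. (e (grid t m (Suc q)) - e (grid t m q)) * \<phi> (grid t m (Suc q))) - c * conv c \<phi> t) < \<delta>"
      by (simp add: grid_0 grid_end conv_eq)
  qed
qed

text \<open>The weights telescope: with \<open>h\<close> the mesh, \<open>\<Sum>q. (e s\<^sub>q\<^sub>+\<^sub>1 - e s\<^sub>q) [r \<le> s\<^sub>q\<^sub>+\<^sub>1]\<close> lies between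
  \<open>e t - e r\<close> and \<open>e t - e (r - h)\<close> by monotonicity of \<open>e\<close>.\<close>

lemma riemann_indicator_bound:
  assumes c: "c > 0" and t: "t \<ge> 0" and r: "r \<in> {0..t}"
  defines "e \<equiv> (\<lambda>s. exp (- (c * (t - s))))"
  shows "\<bar>1 - (\<Sum>q<Suc m. (e (grid t m (Suc q)) - e (grid t m q)) * indicator {0..grid t m (Suc q)} r) - e r\<bar> \<le> c * (t / real (Suc m))"
proof -
  define s where "s = grid t m"
  define h where "h = t / real (Suc m)"
  have h: "h \<ge> 0" using t by (simp add: h_def)
  have emono: "x \<le> y \<Longrightarrow> e x \<le> e y" for x y using c by (auto simp: e_def)
  have smono: "s q \<le> s (Suc q)" for q unfolding s_def by (rule grid_mono[OF t]) simp
  have step: "s (Suc q) = s q + h" for q unfolding s_def h_def by (rule grid_step)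
  define \<Sigma> where "\<Sigma> = (\<Sum>q<Suc m. (e (s (Suc q)) - e (s q)) * indicator {0..s (Suc q)} r)"
  \<comment> \<open>Clamping the grid points at x from below switches off the cells to the left of
    x, so that a bound by clamped increments is a telescoping sum.\<close>
  have tel: "(\<Sum>q<Suc m. e (max x (s (Suc q))) - e (max x (s q))) = e (max x t) - e (max x 0)" for x
    using sum_lessThan_telescope[of "\<lambda>q. e (max x (s q))" "Suc m"] by (simp add: s_def grid_0 grid_end)
  have lower: "e t - e r \<le> \<Sigma>"
  proof -
    have "e t - e r = (\<Sum>q<Suc m. e (max r (s (Suc q))) - e (max r (s q)))"
    proof -
      have "max r t = t" "max r 0 = r" using r by auto
      then show ?thesis by (simp only: tel)
    qed
    also have "\<dots> \<le> \<Sigma>" unfolding \<Sigma>_def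
    proof (rule sum_mono)
      fix q
      show "e (max r (s (Suc q))) - e (max r (s q)) \<le> (e (s (Suc q)) - e (s q)) * indicator {0..s (Suc q)} r"
      proof (cases "r \<le> s (Suc q)")
        case True
        then show ?thesis using r emono[of "s q" "max r (s q)"] by (simp add: max_def[of r "s (Suc q)"])
      next
        case False
        then show ?thesis using smono[of q] by (simp add: max_def)
      qed
    qed
    finally show ?thesis .
  qed
  have upper: "\<Sigma> \<le> e t - e (r - h)"
  proof -
    have "\<Sigma> \<le> (\<Sum>q<Suc m. e (max (r - h) (s (Suc q))) - e (max (r - h) (s q)))" unfolding \<Sigma>_def
    proof (rule sum_mono)
      fix q
      show "(e (s (Suc q)) - e (s q)) * indicator {0..s (Suc q)} r \<le> e (max (r - h) (s (Suc q))) - e (max (r - h) (s q))"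
      proof (cases "r \<le> s (Suc q)")
        case True
        then have "max (r - h) (s q) = s q" "max (r - h) (s (Suc q)) = s (Suc q)" using step[of q] h by (auto simp: max_def)
        then show ?thesis using r True by simp
      next
        case False
        then show ?thesis using smono[of q] emono[of "max (r - h) (s q)" "max (r - h) (s (Suc q))"] by (simp add: max.coboundedI2 max_def)
      qed
    qed
    also have "\<dots> = e (max (r - h) t) - e (max (r - h) 0)" by (rule tel)
    also have "\<dots> \<le> e t - e (r - h)" using r h emono[of "r - h" "max (r - h) 0"] by (simp add: max_def[of "r - h" t])
    finally show ?thesis .
  qed
  have et: "e t = 1" by (simp add: e_def)
  have "e r - e (r - h) = e r * (1 - exp (- (c * h)))"
    by (simp add: e_def algebra_simps flip: exp_add)
  also have "\<dots> \<le> 1 * (c * h)"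
    using c h r exp_ge_add_one_self[of "- (c * h)"] by (intro mult_mono) (auto simp: e_def)
  finally have "e r - e (r - h) \<le> c * h" by simp
  then show ?thesis using lower upper et unfolding \<Sigma>_def s_def h_def by simp
qed

context bm_family
begin

text \<open>Stochastic integration by parts without Ito's formula. With e(s) = exp (-c (t - s)) and
  w_q = e(s_{q+1}) - e(s_q), the difference of \<mu>(t) and the sum of w_q \<mu>(s_{q+1}) is a
  finite combination of pairs. The factor it puts in front of f tends to e(r) uniformly in r, and
  its integral tends along each path to the convolution expression. The almost sure bound on
  \<open>\<mu>\<close> dominates the second limit.\<close>

lemma ito_span_conv:
  assumes c: "c > 0" and t: "t \<ge> 0"
    and span: "\<And>s. s \<in> {0..t} \<Longrightarrow> ito_span (\<lambda>z. indicator {0..s} (fst (snd z)) * f z) (\<mu> s)"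
    and cont: "\<And>\<omega>. \<omega> \<in> space M \<Longrightarrow> continuous_on {0..t} (\<lambda>s. \<mu> s \<omega>)"
    and bound: "AE \<omega> in M. \<forall>s\<in>{0..t}. \<bar>\<mu> s \<omega>\<bar> \<le> C"
  shows "ito_span (\<lambda>z. indicator {0..t} (fst (snd z)) * (exp (- (c * (t - fst (snd z)))) * f z))
    (\<lambda>\<omega>. \<mu> t \<omega> - c * conv c (\<lambda>s. \<mu> s \<omega>) t)"
proof -
  define e where "e = (\<lambda>s. exp (- (c * (t - s))))"
  define w where "w = (\<lambda>m q. e (grid t m (Suc q)) - e (grid t m q))"
  have w0: "w m q \<ge> 0" for m q
    unfolding w_def e_def using c grid_mono[OF t, of q "Suc q" m] by (auto intro: mult_left_mono)
  have wsum: "(\<Sum>q<Suc m. w m q) \<le> 1" for m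
  proof -
    have "(\<Sum>q<Suc m. w m q) = e t - e 0"
      unfolding w_def using sum_lessThan_telescope[of "\<lambda>q. e (grid t m q)" "Suc m"] by (simp add: grid_0 grid_end)
    also have "\<dots> \<le> 1" by (simp add: e_def)
    finally show ?thesis .
  qed
  have tt: "t \<in> {0..t}" using t by simp
  have gin: "q < Suc m \<Longrightarrow> grid t m (Suc q) \<in> {0..t}" for m q using grid_bounds[OF t, of "Suc q" m] by simp
  define ft where "ft = (\<lambda>z. indicator {0..t} (fst (snd z)) * f z)"
  have ft: "sqint ito_measure ft" unfolding ft_def using ito_span_sqint[OF span[OF tt]] by simp
  then have [measurable]: "ft \<in> borel_measurable ito_measure" by (simp add: sqint_def)
  have \<mu>m: "\<mu> s \<in> borel_measurable M" if "s \<in> {0..t}" for s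
    using ito_span_sqint[OF span[OF that]] by (simp add: sqint_def)
  have sndm: "(\<lambda>z. fst (snd z)) \<in> borel_measurable ito_measure"
    unfolding ito_measure_def by measurable
  define fs where "fs = (\<lambda>m z. ft z - (\<Sum>q<Suc m. w m q * (indicator {0..grid t m (Suc q)} (fst (snd z)) * f z)))"
  define Ys where "Ys = (\<lambda>m \<omega>. \<mu> t \<omega> - (\<Sum>q<Suc m. w m q * \<mu> (grid t m (Suc q)) \<omega>))"
  have fs_eq: "fs m z = ft z * (1 - (\<Sum>q<Suc m. w m q * indicator {0..grid t m (Suc q)} (fst (snd z))))" for m z
  proof (cases "fst (snd z) \<in> {0..t}")
    case True
    then have ft: "ft z = f z" by (simp add: ft_def)
    have "(\<Sum>q<Suc m. w m q * (indicator {0..grid t m (Suc q)} (fst (snd z)) * f z))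
        = f z * (\<Sum>q<Suc m. w m q * indicator {0..grid t m (Suc q)} (fst (snd z)))"
      by (subst sum_distrib_left) (intro sum.cong refl, simp only: mult_ac)
    then show ?thesis unfolding fs_def ft by (simp only: right_diff_distrib mult_1_right)
  next
    case False
    then have "indicator {0..grid t m (Suc q)} (fst (snd z)) = (0::real)" if "q < Suc m" for q
      using gin[OF that] by (auto simp: indicator_def)
    then show ?thesis using False by (simp add: fs_def ft_def del: sum.lessThan_Suc)
  qed
  show ?thesis
  proof (rule cspan.lim)
    show "ito_span (fs m) (Ys m)" for m
      unfolding fs_def Ys_def ft_def
      by (intro cspan_diff cspan_sum cspan_scale span ito_span_zero) (use tt gin in auto)
    have lim_meas: "(\<lambda>z. indicator {0..t} (fst (snd z)) * (exp (- (c * (t - fst (snd z)))) * f z)) = (\<lambda>z. e (fst (snd z)) * ft z)"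
      by (auto simp: ft_def e_def fun_eq_iff)
    have em: "(\<lambda>z. e (fst (snd z)) * ft z) \<in> borel_measurable ito_measure"
      unfolding e_def using sndm by measurable
    have "(\<lambda>m. \<integral>\<^sup>+ z. ennreal ((e (fst (snd z)) * ft z - fs m z)\<^sup>2) \<partial>ito_measure) \<longlonglongrightarrow> 0"
    proof (rule tendsto_sandwich[where f = "\<lambda>_. 0"])
      define I where "I = (\<integral>\<^sup>+ z. ennreal ((ft z)\<^sup>2) \<partial>ito_measure)"
      have I: "I < \<infinity>" unfolding I_def using ft by (subst (asm) sqint_eq_nn) auto
      have "(\<lambda>m. (c * (t / real (Suc m)))\<^sup>2) \<longlonglongrightarrow> (c * 0)\<^sup>2"
        by (intro tendsto_power tendsto_mult tendsto_const tendsto_grid_step)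
      then have "(\<lambda>m. ennreal ((c * (t / real (Suc m)))\<^sup>2)) \<longlonglongrightarrow> ennreal 0" by (intro tendsto_ennrealI) simp
      then show "(\<lambda>m. ennreal ((c * (t / real (Suc m)))\<^sup>2) * I) \<longlonglongrightarrow> 0"
        using ennreal_tendsto_cmult[OF I[unfolded infinity_ennreal_def], of "\<lambda>m. ennreal ((c * (t / real (Suc m)))\<^sup>2)" 0 sequentially] by (simp add: mult.commute)
      show "\<forall>\<^sub>F m in sequentially. (\<integral>\<^sup>+ z. ennreal ((e (fst (snd z)) * ft z - fs m z)\<^sup>2) \<partial>ito_measure) \<le> ennreal ((c * (t / real (Suc m)))\<^sup>2) * I"
      proof (rule always_eventually, rule allI)
        fix m
        have "(\<integral>\<^sup>+ z. ennreal ((e (fst (snd z)) * ft z - fs m z)\<^sup>2) \<partial>ito_measure)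
          \<le> (\<integral>\<^sup>+ z. ennreal ((c * (t / real (Suc m)))\<^sup>2) * ennreal ((ft z)\<^sup>2) \<partial>ito_measure)"
        proof (rule nn_integral_mono)
          fix z :: "(nat \<times> nat) \<times> real \<times> 'a"
          define r where "r = fst (snd z)"
          define D where "D = 1 - (\<Sum>q<Suc m. w m q * indicator {0..grid t m (Suc q)} r) - e r"
          have eq: "e r * ft z - fs m z = - (D * ft z)"
            unfolding fs_eq D_def r_def by (simp add: algebra_simps del: sum.lessThan_Suc)
          show "ennreal ((e (fst (snd z)) * ft z - fs m z)\<^sup>2) \<le> ennreal ((c * (t / real (Suc m)))\<^sup>2) * ennreal ((ft z)\<^sup>2)"
          proof (cases "r \<in> {0..t}")
            case True
            have "\<bar>D\<bar> \<le> c * (t / real (Suc m))"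
              using riemann_indicator_bound[OF c t True, of m] unfolding D_def w_def e_def .
            then have "\<bar>D\<bar>\<^sup>2 \<le> (c * (t / real (Suc m)))\<^sup>2" by (intro power_mono) auto
            then have "(D * ft z)\<^sup>2 \<le> (c * (t / real (Suc m)))\<^sup>2 * (ft z)\<^sup>2"
              unfolding power_mult_distrib[of D] by (intro mult_right_mono) auto
            then show ?thesis using eq unfolding r_def[symmetric] by (simp add: ennreal_mult[symmetric] ennreal_leI)
          next
            case False
            then have "ft z = 0" by (simp add: ft_def r_def)
            then show ?thesis using eq unfolding r_def[symmetric] by simp
          qed
        qed
        also have "\<dots> = ennreal ((c * (t / real (Suc m)))\<^sup>2) * I" unfolding I_def by (rule nn_integral_cmult) measurable
        finally show "(\<integral>\<^sup>+ z. ennreal ((e (fst (snd z)) * ft z - fs m z)\<^sup>2) \<partial>ito_measure) \<le> ennreal ((c * (t / real (Suc m)))\<^sup>2) * I" .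
      qed
    qed auto
    then show "L2_tendsto ito_measure fs (\<lambda>z. indicator {0..t} (fst (snd z)) * (exp (- (c * (t - fst (snd z)))) * f z))"
      unfolding lim_meas L2_tendsto_def using em by simp
    have convm: "(\<lambda>\<omega>. conv c (\<lambda>s. \<mu> s \<omega>) t) \<in> borel_measurable M"
      by (rule borel_measurable_conv[OF tt \<mu>m cont])
    have Ym: "(\<lambda>\<omega>. \<mu> t \<omega> - c * conv c (\<lambda>s. \<mu> s \<omega>) t) \<in> borel_measurable M"
      using convm \<mu>m[OF tt] by measurable
    have Ysm: "Ys m \<in> borel_measurable M" for m
      unfolding Ys_def by (intro borel_measurable_diff borel_measurable_sum borel_measurable_times \<mu>m tt gin) auto
    have conv_lim: "(\<lambda>m. \<Sum>q<Suc m. w m q * \<mu> (grid t m (Suc q)) \<omega>) \<longlonglongrightarrow> c * conv c (\<lambda>s. \<mu> s \<omega>) t" if "\<omega> \<in> space M" for \<omega>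
      unfolding w_def e_def by (rule riemann_stieltjes_conv[OF c t cont[OF that]])
    have "(\<lambda>m. \<integral>\<^sup>+ \<omega>. ennreal ((\<mu> t \<omega> - c * conv c (\<lambda>s. \<mu> s \<omega>) t - Ys m \<omega>)\<^sup>2) \<partial>M) \<longlonglongrightarrow> (\<integral>\<^sup>+ \<omega>. 0 \<partial>M)"
    proof (rule nn_integral_dominated_convergence[where w = "\<lambda>_. ennreal ((2 * C)\<^sup>2)"])
      show "AE \<omega> in M. ennreal ((\<mu> t \<omega> - c * conv c (\<lambda>s. \<mu> s \<omega>) t - Ys m \<omega>)\<^sup>2) \<le> ennreal ((2 * C)\<^sup>2)" for m
        using bound AE_space
      proof eventually_elim
        case (elim \<omega>)
        have "\<bar>conv c (\<lambda>s. \<mu> s \<omega>) t\<bar> \<le> C / c" using elim(1) by (intro conv_abs_le[OF c t cont[OF elim(2)]]) auto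
        then have 1: "\<bar>c * conv c (\<lambda>s. \<mu> s \<omega>) t\<bar> \<le> C" using c by (simp add: abs_mult field_simps)
        have C0: "C \<ge> 0" using elim(1) tt by (metis abs_ge_zero order.trans)
        have "\<bar>\<Sum>q<Suc m. w m q * \<mu> (grid t m (Suc q)) \<omega>\<bar> \<le> (\<Sum>q<Suc m. w m q * C)"
        proof (rule order.trans[OF sum_abs sum_mono])
          fix q assume "q \<in> {..<Suc m}"
          then have "\<bar>\<mu> (grid t m (Suc q)) \<omega>\<bar> \<le> C" using elim(1) gin[of q m] by auto
          then show "\<bar>w m q * \<mu> (grid t m (Suc q)) \<omega>\<bar> \<le> w m q * C"
            using w0[of m q] by (simp add: abs_mult mult_left_mono)
        qed
        also have "\<dots> = (\<Sum>q<Suc m. w m q) * C" by (rule sum_distrib_right[symmetric])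
        also have "\<dots> \<le> 1 * C" using wsum C0 by (rule mult_right_mono)
        finally have 2: "\<bar>\<Sum>q<Suc m. w m q * \<mu> (grid t m (Suc q)) \<omega>\<bar> \<le> C" by simp
        have "\<bar>\<mu> t \<omega> - c * conv c (\<lambda>s. \<mu> s \<omega>) t - Ys m \<omega>\<bar> \<le> 2 * C"
          using 1 2 unfolding Ys_def by linarith
        then have "\<bar>\<mu> t \<omega> - c * conv c (\<lambda>s. \<mu> s \<omega>) t - Ys m \<omega>\<bar>\<^sup>2 \<le> (2 * C)\<^sup>2" by (rule power_mono) simp
        then show ?case by (simp add: ennreal_leI)
      qed
      show "AE \<omega> in M. (\<lambda>m. ennreal ((\<mu> t \<omega> - c * conv c (\<lambda>s. \<mu> s \<omega>) t - Ys m \<omega>)\<^sup>2)) \<longlonglongrightarrow> 0"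
      proof (rule AE_I2)
        fix \<omega> assume \<omega>: "\<omega> \<in> space M"
        have "(\<lambda>m. (\<mu> t \<omega> - c * conv c (\<lambda>s. \<mu> s \<omega>) t - (\<mu> t \<omega> - (\<Sum>q<Suc m. w m q * \<mu> (grid t m (Suc q)) \<omega>)))\<^sup>2)
           \<longlonglongrightarrow> (\<mu> t \<omega> - c * conv c (\<lambda>s. \<mu> s \<omega>) t - (\<mu> t \<omega> - c * conv c (\<lambda>s. \<mu> s \<omega>) t))\<^sup>2"
          by (intro tendsto_power tendsto_diff tendsto_const conv_lim \<omega>)
        then have "(\<lambda>m. (\<mu> t \<omega> - c * conv c (\<lambda>s. \<mu> s \<omega>) t - Ys m \<omega>)\<^sup>2) \<longlonglongrightarrow> 0" by (simp add: Ys_def del: sum.lessThan_Suc)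
        from tendsto_ennrealI[OF this] show "(\<lambda>m. ennreal ((\<mu> t \<omega> - c * conv c (\<lambda>s. \<mu> s \<omega>) t - Ys m \<omega>)\<^sup>2)) \<longlonglongrightarrow> 0" by simp
      qed
      show "(\<integral>\<^sup>+ \<omega>. ennreal ((2 * C)\<^sup>2) \<partial>M) < \<infinity>" by (simp add: emeasure_space_1)
    qed (use Ym Ysm in measurable)
    then show "L2_tendsto M Ys (\<lambda>\<omega>. \<mu> t \<omega> - c * conv c (\<lambda>s. \<mu> s \<omega>) t)"
      unfolding L2_tendsto_def using Ym by simp
  qed
qed

end

section \<open>Weighted second moments of integrals of deterministic functions\<close>

lemma grid_cell:
  assumes t: "0 \<le> t" and r: "0 < r" "r \<le> t"
  shows "\<exists>q0<Suc m. \<forall>q. indicat_real {grid t m q<..grid t m (Suc q)} r = (if q = q0 then 1 else 0)"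
proof -
  define q0 where "q0 = (LEAST q. r \<le> grid t m (Suc q))"
  have ex: "r \<le> grid t m (Suc m)" using r by (simp only: grid_end)
  have up: "r \<le> grid t m (Suc q0)" unfolding q0_def by (rule LeastI, rule ex)
  have le: "q0 \<le> m" unfolding q0_def by (rule Least_le, rule ex)
  have lo: "grid t m q0 < r"
  proof (cases q0)
    case 0
    then show ?thesis using r by (simp only: grid_0)
  next
    case (Suc k)
    then have "\<not> r \<le> grid t m (Suc k)" unfolding q0_def by (intro not_less_Least) simp
    then show ?thesis using Suc by simp
  qed
  have "indicat_real {grid t m q<..grid t m (Suc q)} r = (if q = q0 then 1 else 0)" for q
  proof (cases q q0 rule: linorder_cases)
    case less
    then have "grid t m (Suc q) \<le> grid t m q0" using grid_mono[OF t, of "Suc q" q0 m] by simp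
    then show ?thesis using lo less by (simp add: indicator_def)
  next
    case equal
    then show ?thesis using lo up by (simp add: indicator_def)
  next
    case greater
    then have "grid t m (Suc q0) \<le> grid t m q" using grid_mono[OF t, of "Suc q0" q m] by simp
    then show ?thesis using up greater by (simp add: indicator_def)
  qed
  then show ?thesis using le by (intro exI[of _ q0]) simp
qed

text \<open>Young's inequality with a parameter: \<kappa> trades the square of a factor with small
  mean against the square of a factor whose moments are merely finite.\<close>

lemma real_mult_le_weighted:
  fixes a b \<kappa> :: real
  assumes "\<kappa> > 0"
  shows "a * b \<le> \<kappa> * a\<^sup>2 + b\<^sup>2 / \<kappa>"
proof -
  define S where "S = \<kappa> * a\<^sup>2 + b\<^sup>2 / \<kappa>"
  have "\<kappa> * (2 * (a * b)) \<le> (\<kappa> * a)\<^sup>2 + b\<^sup>2" using sum_squares_bound[of "\<kappa> * a" b] by (simp add: mult_ac)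
  also have "\<dots> = \<kappa> * S" using assms by (simp add: S_def distrib_left power2_eq_square)
  finally have "2 * (a * b) \<le> S" using assms by simp
  moreover have "0 \<le> S" using assms by (simp add: S_def)
  ultimately show ?thesis unfolding S_def by linarith
qed

lemma ennreal_lin:
  assumes "0 \<le> k" "0 \<le> a" "0 \<le> x" "0 \<le> b" "0 \<le> y"
  shows "ennreal (k * (a * x + b * y)) = ennreal k * (ennreal a * ennreal x + ennreal b * ennreal y)"
  using assms by (simp add: ennreal_mult ennreal_plus)

context bm_family
begin

lemma expectation_increment4:
  assumes "i \<ge> 1" "j \<ge> 1" "0 \<le> s" "s \<le> t"
  shows "(\<integral>\<^sup>+\<omega>. ennreal ((W i j t \<omega> - W i j s \<omega>) ^ 4) \<partial>M) = ennreal (3 * (t - s)\<^sup>2)"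
proof -
  have "(\<integral>\<^sup>+\<omega>. ennreal ((W i j t \<omega> - W i j s \<omega>) ^ 4) \<partial>M) = ennreal (expectation (\<lambda>\<omega>. (W i j t \<omega> - W i j s \<omega>) ^ 4))"
    by (rule nn_integral_eq_integral) (use increment_moments(1)[OF assms, of 4] in auto)
  then show ?thesis using increment_moments(4)[OF assms] by simp
qed

text \<open>\<open>Z\<close> is compared with the finite sum \<open>G\<close> of Brownian increments
  whose coefficients are frozen at the left grid points. The error is paid in plain mean square,
  times the bound \<open>C\<close> of the weight. In \<open>G\<close> the weight meets squared
  increments; Young's inequality followed by w^2 \<le> C w leaves the mean of the weight and the
  fourth moments of the increments. The square of \<open>real (card P * Suc m)\<close> arises once
  from Cauchy-Schwarz for the sum and once from counting its terms.\<close>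

lemma weighted_noise_bound:
  assumes c: "c > 0" and T: "T > 0" and t: "t \<in> {0..T}"
    and P: "finite P" "P \<subseteq> noise_idx n" and m: "T / real (Suc m) \<le> \<eta>"
    and approx: "\<And>r u. r \<in> {0..t} \<Longrightarrow> u \<in> {0..t} \<Longrightarrow> \<bar>r - u\<bar> \<le> \<eta> \<Longrightarrow>
      (\<integral>\<^sup>+p. ennreal ((indicator (noise_idx n) p * (exp (- (c * (t - r))) * y p r) -
          indicator P p * (exp (- (c * (t - u))) * y p u))\<^sup>2) \<partial>count_space UNIV) \<le> ennreal \<delta>"
    and \<delta>: "\<delta> \<ge> 0"
    and L: "\<And>p u. p \<in> P \<Longrightarrow> u \<in> {0..t} \<Longrightarrow> \<bar>y p u\<bar> \<le> L"
    and span: "ito_span (itg (noise_idx n) t (\<lambda>p r \<omega>. exp (- (c * (t - r))) * y p r)) Z"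
    and w: "w \<in> borel_measurable M" "\<And>\<omega>. \<omega> \<in> space M \<Longrightarrow> 0 \<le> w \<omega>" "\<And>\<omega>. \<omega> \<in> space M \<Longrightarrow> w \<omega> \<le> C"
    and e: "(\<integral>\<^sup>+\<omega>. ennreal (w \<omega>) \<partial>M) \<le> ennreal e" "e \<ge> 0" and \<kappa>: "\<kappa> > 0"
  shows "(\<integral>\<^sup>+\<omega>. ennreal (w \<omega> * (Z \<omega>)\<^sup>2) \<partial>M)
     \<le> ennreal (2 * C * (T * \<delta>) + 2 * ((real (card P * Suc m) * L)\<^sup>2 * (\<kappa> * C * e + 3 * T\<^sup>2 / \<kappa>)))"
proof -
  obtain \<omega>0 where \<omega>0: "\<omega>0 \<in> space M" using not_empty by auto
  then have C: "C \<ge> 0" using w(2)[OF \<omega>0] w(3)[OF \<omega>0] by linarith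
  have t0: "t \<ge> 0" using t by simp
  define d where "d = (\<lambda>p q. exp (- (c * (t - grid t m q))) * y p (grid t m q))"
  define D where "D = (\<lambda>p q \<omega>. W (fst p) (snd p) (grid t m (Suc q)) \<omega> - W (fst p) (snd p) (grid t m q) \<omega>)"
  define g where "g = (\<lambda>z::(nat \<times> nat) \<times> real \<times> 'a. \<Sum>p\<in>P. \<Sum>q<Suc m. d p q * cell p (grid t m q) (grid t m (Suc q)) (\<lambda>_. 1) z)"
  define G where "G = (\<lambda>\<omega>. \<Sum>p\<in>P. \<Sum>q<Suc m. d p q * D p q \<omega>)"
  define f where "f = itg (noise_idx n) t (\<lambda>p r (\<omega>::'a). exp (- (c * (t - r))) * y p r)"
  have Pi: "fst p \<ge> 1" "snd p \<ge> 1" if "p \<in> P" for p using P(2) that by (auto simp: noise_idx_def)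
  have g0: "0 \<le> grid t m q" for q using grid_mono[OF t0, of 0 q m] by (simp add: grid_0)
  have gs: "grid t m q \<le> grid t m (Suc q)" for q by (rule grid_mono[OF t0]) simp
  have "ito_span (cell p (grid t m q) (grid t m (Suc q)) (\<lambda>_. 1)) (D p q)" if "p \<in> P" for p q
    using ito_span_cell[of "fst p" "snd p" "grid t m q" "grid t m (Suc q)" "\<lambda>_. 1"] Pi[OF that] g0 gs bounded_on_space_const
    by (simp add: D_def)
  then
  have spanG: "ito_span g G"
    unfolding g_def G_def by (intro cspan_sum cspan_scale ito_span_zero P(1)) auto
  have span': "ito_span (\<lambda>z. f z - g z) (\<lambda>\<omega>. Z \<omega> - G \<omega>)"
    unfolding f_def using span spanG by (rule cspan_diff)
  have [measurable]: "f \<in> borel_measurable ito_measure" "g \<in> borel_measurable ito_measure"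
      "Z \<in> borel_measurable M" "G \<in> borel_measurable M" "w \<in> borel_measurable M"
    using ito_span_sqint[OF span] ito_span_sqint[OF spanG] w(1) by (auto simp: sqint_def f_def)
  have "(\<integral>\<^sup>+\<omega>. ennreal ((Z \<omega> - G \<omega>)\<^sup>2) \<partial>M) = (\<integral>\<^sup>+z. ennreal ((f z - g z)\<^sup>2) \<partial>ito_measure)"
    by (rule ito_span_isometry[OF span'])
  also have "\<dots> = (\<integral>\<^sup>+r. \<integral>\<^sup>+\<omega>. \<integral>\<^sup>+p. ennreal ((f (p, r, \<omega>) - g (p, r, \<omega>))\<^sup>2) \<partial>count_space UNIV \<partial>M \<partial>lborel)"
    by (rule nn_integral_ito(2)) measurable
  also have "\<dots> \<le> (\<integral>\<^sup>+r. ennreal \<delta> * indicator {0..t} r \<partial>lborel)"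
  proof (rule nn_integral_mono_AE)
    show "AE r in lborel. (\<integral>\<^sup>+\<omega>. \<integral>\<^sup>+p. ennreal ((f (p, r, \<omega>) - g (p, r, \<omega>))\<^sup>2) \<partial>count_space UNIV \<partial>M) \<le> ennreal \<delta> * indicator {0..t} r"
      \<comment> \<open>Time 0 lies in no half-open cell of the grid and is discarded as a null
        set.\<close>
      using AE_lborel_singleton[of 0]
    proof eventually_elim
      case (elim r)
      have "(\<integral>\<^sup>+p. ennreal ((f (p, r, \<omega>) - g (p, r, \<omega>))\<^sup>2) \<partial>count_space UNIV) \<le> ennreal \<delta> * indicator {0..t} r" for \<omega>
      proof (cases "r \<in> {0..t}")
        case False
        have "indicator {grid t m q<..grid t m (Suc q)} r = (0::real)" if "q < Suc m" for q
          using grid_bounds[OF t0, of "Suc q" m] g0[of q] that False by (auto simp: indicator_def)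
        then have "g (p, r, \<omega>) = 0" for p by (simp add: g_def cell_def del: sum.lessThan_Suc)
        then show ?thesis using False by (simp add: f_def itg_def)
      next
        case True
        then have r: "r \<in> {0<..t}" using elim by auto
        then obtain q0 where q0: "q0 < Suc m"
          "\<And>q. indicat_real {grid t m q<..grid t m (Suc q)} r = (if q = q0 then 1 else 0)"
          using grid_cell[OF t0, of r m] by auto
        have "indicat_real {grid t m q0<..grid t m (Suc q0)} r = 1" by (simp only: q0(2)) simp
        then have rq0: "r \<in> {grid t m q0<..grid t m (Suc q0)}" by (simp only: indicator_eq_1_iff)
        have "g (p, r, \<omega>) = indicator P p * d p q0" for p
        proof -
          have "g (p, r, \<omega>) = (\<Sum>p'\<in>P. \<Sum>q<Suc m. if q = q0 then d p' q * indicator {p'} p else 0)"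
            unfolding g_def cell_def by (intro sum.cong refl) (auto simp: q0(2))
          also have "\<dots> = (\<Sum>p'\<in>P. d p' q0 * indicator {p'} p)" using q0(1) by (simp add: sum.delta del: sum.lessThan_Suc)
          also have "\<dots> = (\<Sum>p'\<in>P. if p' = p then d p' q0 else 0)" by (intro sum.cong refl) (auto simp: indicator_def)
          also have "\<dots> = indicator P p * d p q0" using P(1) by (simp add: sum.delta indicator_def)
          finally show ?thesis .
        qed
        then have eq: "f (p, r, \<omega>) - g (p, r, \<omega>) = indicator (noise_idx n) p * (exp (- (c * (t - r))) * y p r) -
          indicator P p * (exp (- (c * (t - grid t m q0))) * y p (grid t m q0))" for p
          using True by (simp add: f_def itg_def d_def)
        have "grid t m (Suc q0) - grid t m q0 = t / real (Suc m)" using grid_step[of t m q0] by simp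
        also have "\<dots> \<le> T / real (Suc m)" using t by (intro divide_right_mono) auto
        finally have "\<bar>r - grid t m q0\<bar> \<le> \<eta>" using rq0 m by auto
        then show ?thesis unfolding eq using True grid_bounds[OF t0, of q0 m] q0(1) by (simp add: approx)
      qed
      then have "(\<integral>\<^sup>+\<omega>. \<integral>\<^sup>+p. ennreal ((f (p, r, \<omega>) - g (p, r, \<omega>))\<^sup>2) \<partial>count_space UNIV \<partial>M) \<le> (\<integral>\<^sup>+\<omega>. ennreal \<delta> * indicator {0..t} r \<partial>M)"
        by (intro nn_integral_mono)
      then show ?case by (simp add: emeasure_space_1)
    qed
  qed
  also have "\<dots> = ennreal \<delta> * ennreal t" using t0 by (simp add: nn_integral_cmult_indicator)
  also have "\<dots> \<le> ennreal (T * \<delta>)" using t \<delta> mult_right_mono[of t T \<delta>] by (simp add: ennreal_mult[symmetric] ennreal_leI mult.commute)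
  finally have ZG: "(\<integral>\<^sup>+\<omega>. ennreal ((Z \<omega> - G \<omega>)\<^sup>2) \<partial>M) \<le> ennreal (T * \<delta>)" .

  define I where "I = P \<times> {..<Suc m}"
  define K where "K = real (card P * Suc m)"
  have I: "finite I" "real (card I) = K" using P(1) by (auto simp: I_def K_def card_cartesian_product)
  have d_le: "(d p q)\<^sup>2 \<le> L\<^sup>2" if "(p, q) \<in> I" for p q
  proof -
    have gq: "grid t m q \<in> {0..t}" using that by (intro grid_bounds[OF t0]) (auto simp: I_def)
    have "\<bar>d p q\<bar> \<le> 1 * L"
      unfolding d_def abs_mult using gq that L[of p "grid t m q"] c by (intro mult_mono) (auto simp: I_def)
    then have "\<bar>d p q\<bar>\<^sup>2 \<le> L\<^sup>2" by (intro power_mono) auto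
    then show ?thesis by simp
  qed
  \<comment> \<open>The pointwise form of the estimate: Cauchy-Schwarz over the K terms, then
    Young's inequality in each term, with the squared increment as second factor, so that its fourth
    power appears.\<close>
  have G2: "w \<omega> * (G \<omega>)\<^sup>2 \<le> (\<Sum>(p, q)\<in>I. K * L\<^sup>2 * (\<kappa> * C * w \<omega> + (D p q \<omega>) ^ 4 / \<kappa>))" if \<omega>: "\<omega> \<in> space M" for \<omega>
  proof -
    have "G \<omega> = (\<Sum>i\<in>I. d (fst i) (snd i) * D (fst i) (snd i) \<omega>)"
      unfolding G_def I_def by (simp add: sum.cartesian_product split_beta' del: sum.lessThan_Suc)
    then have "(G \<omega>)\<^sup>2 \<le> (\<Sum>i\<in>I. (d (fst i) (snd i) * D (fst i) (snd i) \<omega>)\<^sup>2) * K"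
      using sum_squared_le_sum_of_squares[of "\<lambda>i. d (fst i) (snd i) * D (fst i) (snd i) \<omega>" I] I(2) by simp
    then have "w \<omega> * (G \<omega>)\<^sup>2 \<le> w \<omega> * ((\<Sum>i\<in>I. (d (fst i) (snd i) * D (fst i) (snd i) \<omega>)\<^sup>2) * K)"
      using w(2)[OF \<omega>] by (rule mult_left_mono)
    also have "\<dots> = (\<Sum>i\<in>I. K * ((d (fst i) (snd i))\<^sup>2 * (w \<omega> * (D (fst i) (snd i) \<omega>)\<^sup>2)))"
      unfolding sum_distrib_left sum_distrib_right
      by (intro sum.cong refl) (simp only: power_mult_distrib mult_ac)
    also have "\<dots> \<le> (\<Sum>i\<in>I. K * (L\<^sup>2 * (\<kappa> * C * w \<omega> + (D (fst i) (snd i) \<omega>) ^ 4 / \<kappa>)))"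
    proof (intro sum_mono mult_left_mono mult_mono)
      fix i assume i: "i \<in> I"
      show "(d (fst i) (snd i))\<^sup>2 \<le> L\<^sup>2" using d_le[of "fst i" "snd i"] i by simp
      have "w \<omega> * (D (fst i) (snd i) \<omega>)\<^sup>2 \<le> \<kappa> * (w \<omega>)\<^sup>2 + ((D (fst i) (snd i) \<omega>)\<^sup>2)\<^sup>2 / \<kappa>"
        by (rule real_mult_le_weighted[OF \<kappa>])
      also have "\<kappa> * (w \<omega>)\<^sup>2 \<le> \<kappa> * (C * w \<omega>)"
        unfolding power2_eq_square
        by (rule mult_left_mono, rule mult_right_mono) (use w(2,3)[OF \<omega>] \<kappa> in simp_all)
      finally show "w \<omega> * (D (fst i) (snd i) \<omega>)\<^sup>2 \<le> \<kappa> * C * w \<omega> + (D (fst i) (snd i) \<omega>) ^ 4 / \<kappa>"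
        by (simp add: mult.assoc power_mult[symmetric])
    qed (use w(2)[OF \<omega>] in \<open>simp_all add: K_def\<close>)
    finally show ?thesis by (simp add: split_beta' mult.assoc)
  qed
  have Dm: "D p q \<in> borel_measurable M" if "(p, q) \<in> I" for p q
    unfolding D_def using Pi[of p] that g0 by (intro borel_measurable_diff W_measurable) (auto simp: I_def)
  have K0: "K \<ge> 0" by (simp add: K_def)
  have "(\<integral>\<^sup>+\<omega>. ennreal (w \<omega> * (G \<omega>)\<^sup>2) \<partial>M) \<le> (\<integral>\<^sup>+\<omega>. (\<Sum>i\<in>I. ennreal (K * L\<^sup>2) * (ennreal (\<kappa> * C) * ennreal (w \<omega>) + ennreal (1 / \<kappa>) * ennreal ((D (fst i) (snd i) \<omega>) ^ 4))) \<partial>M)"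
  proof (rule nn_integral_mono)
    fix \<omega> assume \<omega>: "\<omega> \<in> space M"
    have "ennreal (w \<omega> * (G \<omega>)\<^sup>2) \<le> ennreal (\<Sum>i\<in>I. K * L\<^sup>2 * (\<kappa> * C * w \<omega> + (D (fst i) (snd i) \<omega>) ^ 4 / \<kappa>))"
      using G2[OF \<omega>] by (intro ennreal_leI) (simp add: split_beta')
    also have "\<dots> = (\<Sum>i\<in>I. ennreal (K * L\<^sup>2 * (\<kappa> * C * w \<omega> + (D (fst i) (snd i) \<omega>) ^ 4 / \<kappa>)))"
      using w(2)[OF \<omega>] K0 \<kappa> C by (intro sum_ennreal[symmetric]) auto
    also have "\<dots> = (\<Sum>i\<in>I. ennreal (K * L\<^sup>2) * (ennreal (\<kappa> * C) * ennreal (w \<omega>) + ennreal (1 / \<kappa>) * ennreal ((D (fst i) (snd i) \<omega>) ^ 4)))"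
      using ennreal_lin[of "K * L\<^sup>2" "\<kappa> * C" "w \<omega>" "1 / \<kappa>"] w(2)[OF \<omega>] K0 \<kappa> C by (intro sum.cong refl) simp
    finally show "ennreal (w \<omega> * (G \<omega>)\<^sup>2) \<le> \<dots>" .
  qed
  also have "\<dots> = (\<Sum>i\<in>I. ennreal (K * L\<^sup>2) * (ennreal (\<kappa> * C) * (\<integral>\<^sup>+\<omega>. ennreal (w \<omega>) \<partial>M) + ennreal (1 / \<kappa>) * (\<integral>\<^sup>+\<omega>. ennreal ((D (fst i) (snd i) \<omega>) ^ 4) \<partial>M)))"
  proof (subst nn_integral_sum)
    fix i assume "i \<in> I"
    then have [measurable]: "D (fst i) (snd i) \<in> borel_measurable M" using Dm by simp
    show "(\<lambda>\<omega>. ennreal (K * L\<^sup>2) * (ennreal (\<kappa> * C) * ennreal (w \<omega>) + ennreal (1 / \<kappa>) * ennreal ((D (fst i) (snd i) \<omega>) ^ 4))) \<in> borel_measurable M"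
      by measurable
  next
    show "(\<Sum>i\<in>I. \<integral>\<^sup>+\<omega>. ennreal (K * L\<^sup>2) * (ennreal (\<kappa> * C) * ennreal (w \<omega>) + ennreal (1 / \<kappa>) * ennreal ((D (fst i) (snd i) \<omega>) ^ 4)) \<partial>M) =
      (\<Sum>i\<in>I. ennreal (K * L\<^sup>2) * (ennreal (\<kappa> * C) * (\<integral>\<^sup>+\<omega>. ennreal (w \<omega>) \<partial>M) + ennreal (1 / \<kappa>) * (\<integral>\<^sup>+\<omega>. ennreal ((D (fst i) (snd i) \<omega>) ^ 4) \<partial>M)))"
    proof (intro sum.cong refl)
      fix i assume "i \<in> I"
      then have [measurable]: "D (fst i) (snd i) \<in> borel_measurable M" using Dm by simp
      show "(\<integral>\<^sup>+\<omega>. ennreal (K * L\<^sup>2) * (ennreal (\<kappa> * C) * ennreal (w \<omega>) + ennreal (1 / \<kappa>) * ennreal ((D (fst i) (snd i) \<omega>) ^ 4)) \<partial>M) =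
        ennreal (K * L\<^sup>2) * (ennreal (\<kappa> * C) * (\<integral>\<^sup>+\<omega>. ennreal (w \<omega>) \<partial>M) + ennreal (1 / \<kappa>) * (\<integral>\<^sup>+\<omega>. ennreal ((D (fst i) (snd i) \<omega>) ^ 4) \<partial>M))"
        by (subst nn_integral_cmult, measurable, subst nn_integral_add, measurable, subst nn_integral_cmult, measurable, subst nn_integral_cmult, measurable)
    qed
  qed
  also have "\<dots> \<le> (\<Sum>i\<in>I. ennreal (K * L\<^sup>2) * (ennreal (\<kappa> * C) * ennreal e + ennreal (1 / \<kappa>) * ennreal (3 * T\<^sup>2)))"
  proof (intro sum_mono mult_left_mono add_mono e(1))
    fix i assume i: "i \<in> I"
    have "(\<integral>\<^sup>+\<omega>. ennreal ((D (fst i) (snd i) \<omega>) ^ 4) \<partial>M) = ennreal (3 * (grid t m (Suc (snd i)) - grid t m (snd i))\<^sup>2)"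
      unfolding D_def using i Pi[of "fst i"] g0 gs by (intro expectation_increment4) (auto simp: I_def)
    also have "\<dots> \<le> ennreal (3 * T\<^sup>2)"
    proof (intro ennreal_leI mult_left_mono power_mono)
      have "t / real (Suc m) \<le> t / 1" using t0 by (intro divide_left_mono) auto
      then show "grid t m (Suc (snd i)) - grid t m (snd i) \<le> T" using t unfolding grid_step by simp
      show "0 \<le> grid t m (Suc (snd i)) - grid t m (snd i)" using gs by simp
    qed simp
    finally show "(\<integral>\<^sup>+\<omega>. ennreal ((D (fst i) (snd i) \<omega>) ^ 4) \<partial>M) \<le> ennreal (3 * T\<^sup>2)" .
  qed auto
  also have "\<dots> = ennreal (K * (K * L\<^sup>2 * (\<kappa> * C * e + 3 * T\<^sup>2 / \<kappa>)))"
  proof -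
    have "ennreal (K * L\<^sup>2) * (ennreal (\<kappa> * C) * ennreal e + ennreal (1 / \<kappa>) * ennreal (3 * T\<^sup>2)) = ennreal (K * L\<^sup>2 * (\<kappa> * C * e + 3 * T\<^sup>2 / \<kappa>))"
      using ennreal_lin[of "K * L\<^sup>2" "\<kappa> * C" e "1 / \<kappa>" "3 * T\<^sup>2"] K0 \<kappa> C e(2) by simp
    then have "(\<Sum>i\<in>I. ennreal (K * L\<^sup>2) * (ennreal (\<kappa> * C) * ennreal e + ennreal (1 / \<kappa>) * ennreal (3 * T\<^sup>2)))
       = (\<Sum>i\<in>I. ennreal (K * L\<^sup>2 * (\<kappa> * C * e + 3 * T\<^sup>2 / \<kappa>)))" by simp
    also have "\<dots> = ennreal (\<Sum>i\<in>I. K * L\<^sup>2 * (\<kappa> * C * e + 3 * T\<^sup>2 / \<kappa>))"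
      using K0 \<kappa> C e(2) by (intro sum_ennreal) auto
    finally show ?thesis using I(2) by simp
  qed
  finally
  have wG: "(\<integral>\<^sup>+\<omega>. ennreal (w \<omega> * (G \<omega>)\<^sup>2) \<partial>M) \<le> ennreal ((K * L)\<^sup>2 * (\<kappa> * C * e + 3 * T\<^sup>2 / \<kappa>))"
    by (simp add: power2_eq_square mult_ac)
  have "(\<integral>\<^sup>+\<omega>. ennreal (w \<omega> * (Z \<omega>)\<^sup>2) \<partial>M) \<le> (\<integral>\<^sup>+\<omega>. ennreal (2 * C) * ennreal ((Z \<omega> - G \<omega>)\<^sup>2) + 2 * ennreal (w \<omega> * (G \<omega>)\<^sup>2) \<partial>M)"
  proof (rule nn_integral_mono)
    fix \<omega> assume \<omega>: "\<omega> \<in> space M"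
    have "(Z \<omega>)\<^sup>2 \<le> 2 * (Z \<omega> - G \<omega>)\<^sup>2 + 2 * (G \<omega>)\<^sup>2"
      using real_power2_add_le[of "Z \<omega> - G \<omega>" "G \<omega>"] by simp
    then have "w \<omega> * (Z \<omega>)\<^sup>2 \<le> w \<omega> * (2 * (Z \<omega> - G \<omega>)\<^sup>2 + 2 * (G \<omega>)\<^sup>2)" using w(2)[OF \<omega>] by (rule mult_left_mono)
    also have "\<dots> = w \<omega> * (2 * (Z \<omega> - G \<omega>)\<^sup>2) + 2 * (w \<omega> * (G \<omega>)\<^sup>2)" by (simp add: algebra_simps)
    also have "\<dots> \<le> C * (2 * (Z \<omega> - G \<omega>)\<^sup>2) + 2 * (w \<omega> * (G \<omega>)\<^sup>2)" using w(3)[OF \<omega>] by (intro add_right_mono mult_right_mono) auto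
    finally have "ennreal (w \<omega> * (Z \<omega>)\<^sup>2) \<le> ennreal (2 * C * (Z \<omega> - G \<omega>)\<^sup>2 + 2 * (w \<omega> * (G \<omega>)\<^sup>2))"
      by (intro ennreal_leI) (simp add: mult_ac)
    also have "\<dots> = ennreal (2 * C) * ennreal ((Z \<omega> - G \<omega>)\<^sup>2) + 2 * ennreal (w \<omega> * (G \<omega>)\<^sup>2)"
      using C w(2)[OF \<omega>] by (simp add: ennreal_plus ennreal_mult)
    finally show "ennreal (w \<omega> * (Z \<omega>)\<^sup>2) \<le> ennreal (2 * C) * ennreal ((Z \<omega> - G \<omega>)\<^sup>2) + 2 * ennreal (w \<omega> * (G \<omega>)\<^sup>2)" .
  qed
  also have "\<dots> = ennreal (2 * C) * (\<integral>\<^sup>+\<omega>. ennreal ((Z \<omega> - G \<omega>)\<^sup>2) \<partial>M) + 2 * (\<integral>\<^sup>+\<omega>. ennreal (w \<omega> * (G \<omega>)\<^sup>2) \<partial>M)"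
    by (subst nn_integral_add, measurable, subst nn_integral_cmult, measurable, subst nn_integral_cmult, measurable)
  also have "\<dots> \<le> ennreal (2 * C) * ennreal (T * \<delta>) + 2 * ennreal ((K * L)\<^sup>2 * (\<kappa> * C * e + 3 * T\<^sup>2 / \<kappa>))"
    using ZG wG by (intro add_mono mult_left_mono) auto
  also have "\<dots> = ennreal (2 * C * (T * \<delta>) + 2 * ((K * L)\<^sup>2 * (\<kappa> * C * e + 3 * T\<^sup>2 / \<kappa>)))"
  proof -
    have "0 \<le> (K * L)\<^sup>2 * (\<kappa> * C * e + 3 * T\<^sup>2 / \<kappa>)" using \<kappa> C e(2) by simp
    moreover have "0 \<le> T * \<delta>" "0 \<le> 2 * C" using T \<delta> C by simp_all
    ultimately show ?thesis by (simp only: ennreal_plus mult_nonneg_nonneg ennreal_mult ennreal_numeral zero_le_numeral)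
  qed
  finally show ?thesis unfolding K_def .
qed

end

text \<open>Component n of the vector A_{i,i+j} y for p = (i, j); meaningful for p in
  \<open>noise_idx n\<close>.\<close>

definition nz :: "nat \<Rightarrow> nat \<times> nat \<Rightarrow> (nat \<Rightarrow> real) \<Rightarrow> real" where
  "nz n p y = (if fst p = n then - y (n + snd p) else y (fst p))"

text \<open>Different motions acting on mode n read different components of y: the index read is n +
  j > n or i < n. The sum over the motions is therefore dominated by the square sum of y without
  multiplicity.\<close>

lemma noise_idx_sum_le:
  assumes b: "\<And>p. p \<in> noise_idx n \<Longrightarrow> b p \<le> K" and K: "K \<ge> 0"
  shows "(\<integral>\<^sup>+p. ennreal (indicator (noise_idx n) p * (b p * (nz n p y)\<^sup>2)) \<partial>count_space UNIV) \<le> ennreal K * (\<Sum>k. ennreal ((y k)\<^sup>2))"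
proof -
  define kk where "kk = (\<lambda>p. if fst p = n then n + snd p else fst p)"
  have inj: "inj_on kk (noise_idx n)"
    by (auto simp: inj_on_def kk_def noise_idx_def split: if_splits)
  have "(\<integral>\<^sup>+p. ennreal (indicator (noise_idx n) p * (b p * (nz n p y)\<^sup>2)) \<partial>count_space UNIV)
     \<le> (\<integral>\<^sup>+p. ennreal K * (ennreal ((y (kk p))\<^sup>2) * indicator (noise_idx n) p) \<partial>count_space UNIV)"
  proof (rule nn_integral_mono)
    fix p
    show "ennreal (indicator (noise_idx n) p * (b p * (nz n p y)\<^sup>2)) \<le> ennreal K * (ennreal ((y (kk p))\<^sup>2) * indicator (noise_idx n) p)"
    proof (cases "p \<in> noise_idx n")
      case True
      have "(nz n p y)\<^sup>2 = (y (kk p))\<^sup>2" by (simp add: nz_def kk_def)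
      moreover have "b p * (y (kk p))\<^sup>2 \<le> K * (y (kk p))\<^sup>2" using b[OF True] by (rule mult_right_mono) simp
      ultimately show ?thesis using True K by (simp add: ennreal_mult[symmetric] ennreal_leI)
    qed simp
  qed
  also have "\<dots> = ennreal K * (\<integral>\<^sup>+p. ennreal ((y (kk p))\<^sup>2) * indicator (noise_idx n) p \<partial>count_space UNIV)"
    by (rule nn_integral_cmult) simp
  finally have 1: "(\<integral>\<^sup>+p. ennreal (indicator (noise_idx n) p * (b p * (nz n p y)\<^sup>2)) \<partial>count_space UNIV)
     \<le> ennreal K * (\<integral>\<^sup>+p. ennreal ((y (kk p))\<^sup>2) * indicator (noise_idx n) p \<partial>count_space UNIV)" .
  have "(\<integral>\<^sup>+p. ennreal ((y (kk p))\<^sup>2) * indicator (noise_idx n) p \<partial>count_space UNIV)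
     = (\<integral>\<^sup>+p. ennreal ((y (kk p))\<^sup>2) \<partial>count_space (noise_idx n))"
    by (rule nn_integral_count_space_indicator[symmetric]) simp
  also have "\<dots> = (\<integral>\<^sup>+k. ennreal ((y k)\<^sup>2) \<partial>count_space (kk ` noise_idx n))"
    by (rule nn_integral_bij_count_space[OF inj_on_imp_bij_betw[OF inj]])
  also have "\<dots> \<le> (\<integral>\<^sup>+k. ennreal ((y k)\<^sup>2) \<partial>count_space UNIV)"
  proof -
    have "(\<integral>\<^sup>+k. ennreal ((y k)\<^sup>2) \<partial>count_space (kk ` noise_idx n))
        = (\<integral>\<^sup>+k. ennreal ((y k)\<^sup>2) * indicator (kk ` noise_idx n) k \<partial>count_space UNIV)"
      by (rule nn_integral_count_space_indicator) simp
    also have "\<dots> \<le> (\<integral>\<^sup>+k. ennreal ((y k)\<^sup>2) \<partial>count_space UNIV)"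
      by (intro nn_integral_mono) (simp add: indicator_def)
    finally show ?thesis .
  qed
  also have "\<dots> = (\<Sum>k. ennreal ((y k)\<^sup>2))" by (rule nn_integral_count_space_nat)
  finally show ?thesis using 1 by (elim order.trans) (rule mult_left_mono, simp_all)
qed

lemma powr_neg_le_one:
  assumes "a \<ge> 0" "j \<ge> 1" shows "real j powr (- a) \<le> 1"
  using powr_mono[of "- a" 0 "real j"] assms by simp

lemma noise_coeff_le:
  fixes lam :: real
  assumes lam: "lam > 1" and p: "p \<in> noise_idx n"
  shows "(lam ^ fst p)\<^sup>2 \<le> lam ^ (2 * n)"
proof -
  have "(lam ^ fst p)\<^sup>2 = lam ^ (2 * fst p)" by (simp only: power2_eq_square mult_2 power_add)
  also have "\<dots> \<le> lam ^ (2 * n)" using lam p by (intro power_increasing) (auto simp: noise_idx_def)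
  finally show ?thesis .
qed

lemma ennreal_lin3:
  assumes "0 \<le> a" "0 \<le> x" "0 \<le> b" "0 \<le> y" "0 \<le> c" "0 \<le> z"
  shows "ennreal a * ennreal x + ennreal b * ennreal y + ennreal c * ennreal z = ennreal (a * x + b * y + c * z)"
  using assms by (simp add: ennreal_mult ennreal_plus)

text \<open>The sum is split at j = m. For j \<le> m both noises are present, and only differences
  of components with index up to n + m occur. For j > m the two noises are bounded separately
  through the small coefficient j^(-\<alpha>); this includes j > N, where the approximating equation
  carries no noise. Each of x and y contributes 2 s A.\<close>

lemma noise_diff_sum_le:
  assumes lam: "lam > 1" and \<alpha>: "\<alpha> > 0" and mN: "m \<le> N" and s: "0 \<le> s" "\<And>j. j > m \<Longrightarrow> (real j powr (- \<alpha>))\<^sup>2 \<le> s"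
    and x: "(\<Sum>k. ennreal ((x k)\<^sup>2)) \<le> ennreal A" and y: "(\<Sum>k. ennreal ((y k)\<^sup>2)) \<le> ennreal A" and A: "A \<ge> 0"
  shows "(\<integral>\<^sup>+p. ennreal (indicator (noise_idx n) p * (lam ^ fst p * real (snd p) powr (- \<alpha>) *
       ((if snd p \<le> N then nz n p x else 0) - nz n p y))\<^sup>2) \<partial>count_space UNIV)
     \<le> ennreal (lam ^ (2 * n) * ((\<Sum>k\<le>n + m. (x k - y k)\<^sup>2) + 4 * s * A))"
proof -
  define z where "z = (\<lambda>k. if k \<le> n + m then x k - y k else 0)"
  define b where "b = (\<lambda>p. if snd p \<le> m then (lam ^ fst p * real (snd p) powr (- \<alpha>))\<^sup>2 else 0)"
  define b' where "b' = (\<lambda>p. if snd p \<le> m then 0 else 2 * (lam ^ fst p * real (snd p) powr (- \<alpha>))\<^sup>2)"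
  have j1: "(real (snd p) powr (- \<alpha>))\<^sup>2 \<le> 1" if "p \<in> noise_idx n" for p
    using powr_neg_le_one[of \<alpha> "snd p"] that \<alpha> by (intro power_le_one) (auto simp: noise_idx_def)
  have lam0: "lam ^ (2 * n) \<ge> 0" using lam by simp
  have b_le: "b p \<le> lam ^ (2 * n)" if p: "p \<in> noise_idx n" for p
  proof -
    have "(lam ^ fst p)\<^sup>2 * (real (snd p) powr (- \<alpha>))\<^sup>2 \<le> lam ^ (2 * n) * 1"
      using noise_coeff_le[OF lam p] j1[OF p] lam0 by (intro mult_mono) auto
    then show ?thesis using lam0 by (simp add: b_def power_mult_distrib)
  qed
  have b'_le: "b' p \<le> 2 * lam ^ (2 * n) * s" if p: "p \<in> noise_idx n" for p
  proof (cases "snd p \<le> m")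
    case True
    then show ?thesis using lam0 s(1) by (simp add: b'_def)
  next
    case False
    then have "(lam ^ fst p)\<^sup>2 * (real (snd p) powr (- \<alpha>))\<^sup>2 \<le> lam ^ (2 * n) * s"
      using noise_coeff_le[OF lam p] s lam0 by (intro mult_mono) auto
    then show ?thesis using False by (simp add: b'_def power_mult_distrib)
  qed
  have pt: "indicator (noise_idx n) p * (lam ^ fst p * real (snd p) powr (- \<alpha>) * ((if snd p \<le> N then nz n p x else 0) - nz n p y))\<^sup>2
     \<le> indicator (noise_idx n) p * (b p * (nz n p z)\<^sup>2) + indicator (noise_idx n) p * (b' p * (nz n p x)\<^sup>2) + indicator (noise_idx n) p * (b' p * (nz n p y)\<^sup>2)" for p
  proof (cases "p \<in> noise_idx n")
    case True
    show ?thesis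
    proof (cases "snd p \<le> m")
      case le: True
      have "nz n p z = nz n p x - nz n p y" using le True by (auto simp: nz_def z_def noise_idx_def)
      then show ?thesis using le mN True by (simp add: b_def b'_def power_mult_distrib)
    next
      case False
      have "((if snd p \<le> N then nz n p x else 0) - nz n p y)\<^sup>2 \<le> 2 * (nz n p x)\<^sup>2 + 2 * (nz n p y)\<^sup>2"
        using real_power2_add_le[of "if snd p \<le> N then nz n p x else 0" "- nz n p y"] by (auto split: if_splits intro: order.trans)
      then have "(lam ^ fst p * real (snd p) powr (- \<alpha>))\<^sup>2 * ((if snd p \<le> N then nz n p x else 0) - nz n p y)\<^sup>2
        \<le> (lam ^ fst p * real (snd p) powr (- \<alpha>))\<^sup>2 * (2 * (nz n p x)\<^sup>2 + 2 * (nz n p y)\<^sup>2)" by (rule mult_left_mono) simp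
      then show ?thesis using False True
        by (simp only: b_def b'_def if_False indicator_simps power_mult_distrib[of "lam ^ fst p * real (snd p) powr (- \<alpha>)"]) (simp add: algebra_simps)
    qed
  qed simp
  have b0: "b p \<ge> 0" "b' p \<ge> 0" for p by (auto simp: b_def b'_def)
  have "(\<integral>\<^sup>+p. ennreal (indicator (noise_idx n) p * (lam ^ fst p * real (snd p) powr (- \<alpha>) *
       ((if snd p \<le> N then nz n p x else 0) - nz n p y))\<^sup>2) \<partial>count_space UNIV)
     \<le> (\<integral>\<^sup>+p. ennreal (indicator (noise_idx n) p * (b p * (nz n p z)\<^sup>2)) + ennreal (indicator (noise_idx n) p * (b' p * (nz n p x)\<^sup>2))
         + ennreal (indicator (noise_idx n) p * (b' p * (nz n p y)\<^sup>2)) \<partial>count_space UNIV)"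
    using pt b0 by (intro nn_integral_mono) (simp add: ennreal_plus[symmetric] ennreal_leI del: ennreal_plus)
  also have "\<dots> = (\<integral>\<^sup>+p. ennreal (indicator (noise_idx n) p * (b p * (nz n p z)\<^sup>2)) \<partial>count_space UNIV)
      + (\<integral>\<^sup>+p. ennreal (indicator (noise_idx n) p * (b' p * (nz n p x)\<^sup>2)) \<partial>count_space UNIV)
      + (\<integral>\<^sup>+p. ennreal (indicator (noise_idx n) p * (b' p * (nz n p y)\<^sup>2)) \<partial>count_space UNIV)"
    by (simp add: nn_integral_add)
  also have "\<dots> \<le> ennreal (lam ^ (2 * n)) * (\<Sum>k. ennreal ((z k)\<^sup>2)) + ennreal (2 * lam ^ (2 * n) * s) * (\<Sum>k. ennreal ((x k)\<^sup>2))
      + ennreal (2 * lam ^ (2 * n) * s) * (\<Sum>k. ennreal ((y k)\<^sup>2))"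
    using b_le b'_le lam0 s by (intro add_mono noise_idx_sum_le) auto
  also have "(\<Sum>k. ennreal ((z k)\<^sup>2)) = (\<Sum>k\<le>n + m. ennreal ((z k)\<^sup>2))"
    by (rule suminf_finite) (auto simp: z_def)
  also have "\<dots> = ennreal (\<Sum>k\<le>n + m. (x k - y k)\<^sup>2)"
    by (subst sum_ennreal) (auto simp: z_def)
  also have "ennreal (lam ^ (2 * n)) * ennreal (\<Sum>k\<le>n + m. (x k - y k)\<^sup>2) + ennreal (2 * lam ^ (2 * n) * s) * (\<Sum>k. ennreal ((x k)\<^sup>2))
      + ennreal (2 * lam ^ (2 * n) * s) * (\<Sum>k. ennreal ((y k)\<^sup>2)) \<le>
      ennreal (lam ^ (2 * n)) * ennreal (\<Sum>k\<le>n + m. (x k - y k)\<^sup>2) + ennreal (2 * lam ^ (2 * n) * s) * ennreal A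
      + ennreal (2 * lam ^ (2 * n) * s) * ennreal A"
    using x y by (intro add_mono mult_left_mono) auto
  also have "\<dots> = ennreal (lam ^ (2 * n) * (\<Sum>k\<le>n + m. (x k - y k)\<^sup>2) + (2 * lam ^ (2 * n) * s) * A + (2 * lam ^ (2 * n) * s) * A)"
    using lam0 s A by (intro ennreal_lin3) (auto intro: sum_nonneg)
  also have "\<dots> = ennreal (lam ^ (2 * n) * ((\<Sum>k\<le>n + m. (x k - y k)\<^sup>2) + 4 * s * A))"
    by (rule arg_cong[where f = ennreal]) (simp add: algebra_simps)
  finally show ?thesis .
qed

section \<open>Uniform approximation by finitely many increments\<close>

lemma exp_diff_le:
  fixes x y :: real
  assumes "x \<le> 0" "y \<le> 0" shows "\<bar>exp x - exp y\<bar> \<le> \<bar>x - y\<bar>"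
proof -
  have *: "exp a - exp b \<le> a - b" if "b \<le> a" "a \<le> 0" for a b :: real
  proof -
    have "exp a - exp b = exp a * (1 - exp (b - a))" by (simp add: algebra_simps flip: exp_add)
    also have "\<dots> \<le> 1 * (a - b)"
    proof (rule mult_mono)
      show "1 - exp (b - a) \<le> a - b" using exp_ge_add_one_self[of "b - a"] by linarith
    qed (use that in auto)
    finally show ?thesis by simp
  qed
  show ?thesis
  proof (cases "y \<le> x")
    case True
    then have "exp y \<le> exp x" by simp
    then show ?thesis using *[of y x] assms True by linarith
  next
    case False
    then have "exp x \<le> exp y" by simp
    then show ?thesis using *[of x y] assms False by linarith
  qed
qed

text \<open>One modulus \<open>\<eta>\<close> serves all end times t, because the kernel is at most
  1 and exp has Lipschitz constant 1 on the nonpositive half-line. The budget is \<delta> for the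
  indices outside \<open>P\<close> and \<delta> for those inside, each of which may err by
  \<open>\<delta>2\<close>.\<close>

lemma noise_uniform_approx:
  assumes c: "c > 0" and T: "T > 0"
    and cont: "\<And>p. p \<in> Q \<Longrightarrow> continuous_on {0..T} (y p)"
    and P: "finite P" "P \<subseteq> Q" and tail: "\<And>r. r \<in> {0..T} \<Longrightarrow>
       (\<integral>\<^sup>+p. ennreal (indicator (Q - P) p * (y p r)\<^sup>2) \<partial>count_space UNIV) \<le> ennreal \<delta>"
    and \<delta>: "\<delta> > 0"
  obtains L \<eta> where "L \<ge> 0" "\<And>p u. p \<in> P \<Longrightarrow> u \<in> {0..T} \<Longrightarrow> \<bar>y p u\<bar> \<le> L" "\<eta> > 0"
    "\<And>t r u. t \<in> {0..T} \<Longrightarrow> r \<in> {0..t} \<Longrightarrow> u \<in> {0..t} \<Longrightarrow> \<bar>r - u\<bar> \<le> \<eta> \<Longrightarrow>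
      (\<integral>\<^sup>+p. ennreal ((indicator Q p * (exp (- (c * (t - r))) * y p r) -
          indicator P p * (exp (- (c * (t - u))) * y p u))\<^sup>2) \<partial>count_space UNIV) \<le> ennreal (2 * \<delta>)"
proof -
  have "\<exists>L. \<forall>p\<in>P. \<forall>u\<in>{0..T}. \<bar>y p u\<bar> \<le> L"
  proof -
    have "\<exists>L. \<forall>u\<in>{0..T}. \<bar>y p u\<bar> \<le> L" if "p \<in> P" for p
    proof -
      have "bounded (y p ` {0..T})" using cont[of p] that P by (intro compact_imp_bounded compact_continuous_image) auto
      then show ?thesis by (auto simp: bounded_iff)
    qed
    then obtain L where L: "\<And>p u. p \<in> P \<Longrightarrow> u \<in> {0..T} \<Longrightarrow> \<bar>y p u\<bar> \<le> L p" by metis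
    have "\<bar>y p u\<bar> \<le> (\<Sum>p\<in>P. \<bar>L p\<bar>)" if "p \<in> P" "u \<in> {0..T}" for p u
      using L[OF that] member_le_sum[of p P "\<lambda>p. \<bar>L p\<bar>"] that P(1) by simp
    then show ?thesis by blast
  qed
  then obtain L0 where L0: "\<And>p u. p \<in> P \<Longrightarrow> u \<in> {0..T} \<Longrightarrow> \<bar>y p u\<bar> \<le> L0" by blast
  define L where "L = \<bar>L0\<bar>"
  have L: "L \<ge> 0" "\<And>p u. p \<in> P \<Longrightarrow> u \<in> {0..T} \<Longrightarrow> \<bar>y p u\<bar> \<le> L"
    unfolding L_def using L0 abs_ge_self[of L0] order.trans by (simp, blast)
  \<comment> \<open>The summand 1 in the denominator covers an empty \<open>P\<close>.\<close>
  define \<delta>2 where "\<delta>2 = sqrt (\<delta> / (real (card P) + 1))"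
  have \<delta>2: "\<delta>2 > 0" "real (card P) * \<delta>2\<^sup>2 \<le> \<delta>"
    using \<delta> by (auto simp: \<delta>2_def real_sqrt_pow2 field_simps)
  have "eventually (\<lambda>\<eta>. \<forall>p\<in>P. \<forall>r\<in>{0..T}. \<forall>u\<in>{0..T}. \<bar>r - u\<bar> \<le> \<eta> \<longrightarrow> \<bar>y p r - y p u\<bar> \<le> \<delta>2 / 2) (at_right 0)"
  proof (rule eventually_ball_finite[OF P(1)], rule ballI)
    fix p assume "p \<in> P"
    then have "uniformly_continuous_on {0..T} (y p)" using cont P by (intro compact_uniformly_continuous) auto
    then obtain d where d: "d > 0" "\<And>r u. r \<in> {0..T} \<Longrightarrow> u \<in> {0..T} \<Longrightarrow> dist u r < d \<Longrightarrow> dist (y p u) (y p r) < \<delta>2 / 2"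
      unfolding uniformly_continuous_on_def using \<delta>2(1) by (metis half_gt_zero)
    have "\<forall>r\<in>{0..T}. \<forall>u\<in>{0..T}. \<bar>r - u\<bar> \<le> \<eta> \<longrightarrow> \<bar>y p r - y p u\<bar> \<le> \<delta>2 / 2" if "\<eta> < d" for \<eta>
      using d(2) that by (fastforce simp: dist_real_def intro: less_imp_le)
    then show "eventually (\<lambda>\<eta>. \<forall>r\<in>{0..T}. \<forall>u\<in>{0..T}. \<bar>r - u\<bar> \<le> \<eta> \<longrightarrow> \<bar>y p r - y p u\<bar> \<le> \<delta>2 / 2) (at_right 0)"
      unfolding eventually_at_right_field using d(1) by blast
  qed
  moreover have "eventually (\<lambda>\<eta>. \<eta> < \<delta>2 / (2 * (c * L + 1))) (at_right 0)"
    unfolding eventually_at_right_field using \<delta>2(1) c L(1) by (intro exI[of _ "\<delta>2 / (2 * (c * L + 1))"]) (auto simp: add_nonneg_pos)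
  moreover have "eventually (\<lambda>\<eta>. \<eta> > (0::real)) (at_right 0)" by (rule eventually_at_right_less)
  ultimately have "eventually (\<lambda>\<eta>. \<eta> > 0 \<and> \<eta> < \<delta>2 / (2 * (c * L + 1)) \<and> (\<forall>p\<in>P. \<forall>r\<in>{0..T}. \<forall>u\<in>{0..T}. \<bar>r - u\<bar> \<le> \<eta> \<longrightarrow> \<bar>y p r - y p u\<bar> \<le> \<delta>2 / 2)) (at_right 0)"
    by eventually_elim auto
  from eventually_happens'[OF _ this] obtain \<eta> where \<eta>: "\<eta> > 0" "\<eta> < \<delta>2 / (2 * (c * L + 1))"
    "\<And>p r u. p \<in> P \<Longrightarrow> r \<in> {0..T} \<Longrightarrow> u \<in> {0..T} \<Longrightarrow> \<bar>r - u\<bar> \<le> \<eta> \<Longrightarrow> \<bar>y p r - y p u\<bar> \<le> \<delta>2 / 2"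
    using trivial_limit_at_right_real by blast
  have cL: "c * L * \<eta> \<le> \<delta>2 / 2"
  proof -
    have pos: "0 < c * L + 1" using c L(1) by (simp add: add_nonneg_pos)
    have "c * L * \<eta> \<le> (c * L + 1) * \<eta>" using \<eta>(1) by (intro mult_right_mono) auto
    also have "\<dots> \<le> (c * L + 1) * (\<delta>2 / (2 * (c * L + 1)))" using \<eta>(2) pos by (intro mult_left_mono) auto
    also have "\<dots> = \<delta>2 / 2"
    proof -
      have "x * (d / (2 * x)) = d / 2" if "x > 0" for x d :: real using that by simp
      from this[OF pos] show ?thesis .
    qed
    finally show ?thesis .
  qed
  have main: "(\<integral>\<^sup>+p. ennreal ((indicator Q p * (exp (- (c * (t - r))) * y p r) -
          indicator P p * (exp (- (c * (t - u))) * y p u))\<^sup>2) \<partial>count_space UNIV) \<le> ennreal (2 * \<delta>)"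
    if t: "t \<in> {0..T}" and r: "r \<in> {0..t}" and u: "u \<in> {0..t}" and ru: "\<bar>r - u\<bar> \<le> \<eta>" for t r u
  proof -
    have in_T: "r \<in> {0..T}" "u \<in> {0..T}" using t r u by auto
    have close: "(exp (- (c * (t - r))) * y p r - exp (- (c * (t - u))) * y p u)\<^sup>2 \<le> \<delta>2\<^sup>2" if p: "p \<in> P" for p
    proof -
      have "exp (- (c * (t - r))) * y p r - exp (- (c * (t - u))) * y p u
         = exp (- (c * (t - r))) * (y p r - y p u) + (exp (- (c * (t - r))) - exp (- (c * (t - u)))) * y p u"
        by (simp add: algebra_simps)
      also have "\<bar>\<dots>\<bar> \<le> \<bar>exp (- (c * (t - r))) * (y p r - y p u)\<bar> + \<bar>(exp (- (c * (t - r))) - exp (- (c * (t - u)))) * y p u\<bar>"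
        by (rule abs_triangle_ineq)
      also have "\<bar>exp (- (c * (t - r))) * (y p r - y p u)\<bar> \<le> 1 * (\<delta>2 / 2)"
        unfolding abs_mult using \<eta>(3)[OF p in_T ru] r c by (intro mult_mono) auto
      also have "\<bar>(exp (- (c * (t - r))) - exp (- (c * (t - u)))) * y p u\<bar> \<le> (c * \<eta>) * L"
      proof -
        have "\<bar>exp (- (c * (t - r))) - exp (- (c * (t - u)))\<bar> \<le> \<bar>- (c * (t - r)) - (- (c * (t - u)))\<bar>"
          using c r u by (intro exp_diff_le) auto
        also have "- (c * (t - r)) - (- (c * (t - u))) = c * (r - u)" by (simp add: algebra_simps)
        also have "\<bar>c * (r - u)\<bar> \<le> c * \<eta>" using c ru by (simp add: abs_mult)
        finally show ?thesis unfolding abs_mult using L(2)[OF p in_T(2)] c \<eta>(1) by (intro mult_mono) auto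
      qed
      finally have "\<bar>exp (- (c * (t - r))) * y p r - exp (- (c * (t - u))) * y p u\<bar> \<le> \<delta>2"
        using cL by (simp add: mult_ac)
      then have "\<bar>exp (- (c * (t - r))) * y p r - exp (- (c * (t - u))) * y p u\<bar>\<^sup>2 \<le> \<delta>2\<^sup>2" by (rule power_mono) simp
      then show ?thesis by simp
    qed
    have "(\<integral>\<^sup>+p. ennreal ((indicator Q p * (exp (- (c * (t - r))) * y p r) -
          indicator P p * (exp (- (c * (t - u))) * y p u))\<^sup>2) \<partial>count_space UNIV)
      \<le> (\<integral>\<^sup>+p. ennreal (indicator (Q - P) p * (y p r)\<^sup>2) + ennreal (\<delta>2\<^sup>2) * indicator P p \<partial>count_space UNIV)"
    proof (rule nn_integral_mono)
      fix p
      have e1: "(exp (- (c * (t - r))))\<^sup>2 \<le> 1" using r c by (intro power_le_one) auto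
      show "ennreal ((indicator Q p * (exp (- (c * (t - r))) * y p r) - indicator P p * (exp (- (c * (t - u))) * y p u))\<^sup>2)
        \<le> ennreal (indicator (Q - P) p * (y p r)\<^sup>2) + ennreal (\<delta>2\<^sup>2) * indicator P p"
      proof (cases "p \<in> P")
        case True
        then show ?thesis using close[OF True] P by (auto simp: ennreal_leI)
      next
        case False
        have "(exp (- (c * (t - r))) * y p r)\<^sup>2 \<le> 1 * (y p r)\<^sup>2"
          unfolding power_mult_distrib using e1 by (rule mult_right_mono) simp
        then show ?thesis using False by (cases "p \<in> Q") (simp_all add: ennreal_leI)
      qed
    qed
    also have "\<dots> = (\<integral>\<^sup>+p. ennreal (indicator (Q - P) p * (y p r)\<^sup>2) \<partial>count_space UNIV) + (\<integral>\<^sup>+p. ennreal (\<delta>2\<^sup>2) * indicator P p \<partial>count_space UNIV)"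
      by (rule nn_integral_add) auto
    also have "(\<integral>\<^sup>+p. ennreal (\<delta>2\<^sup>2) * indicator P p \<partial>count_space UNIV) = ennreal (\<delta>2\<^sup>2) * ennreal (real (card P))"
      using P(1) by (simp add: nn_integral_cmult_indicator emeasure_count_space ennreal_of_nat_eq_real_of_nat)
    also have "\<dots> \<le> ennreal \<delta>" using \<delta>2(2) by (simp add: ennreal_mult[symmetric] ennreal_leI mult.commute)
    also have "(\<integral>\<^sup>+p. ennreal (indicator (Q - P) p * (y p r)\<^sup>2) \<partial>count_space UNIV) \<le> ennreal \<delta>"
      by (rule tail[OF in_T(1)])
    also have "ennreal \<delta> + ennreal \<delta> = ennreal (2 * \<delta>)" using \<delta> by (simp add: ennreal_plus[symmetric] del: ennreal_plus)
    finally show ?thesis by (simp add: add_mono)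
  qed
  show thesis by (rule that[OF L \<eta>(1) main])
qed

text \<open>The threshold e comes from deterministic data before a probability space is introduced,
  so it is the same for all spaces. \<open>P\<close> and the mesh are chosen to make the
  approximation error small; \<kappa> is then chosen so large that the fourth moment term is small
  for this fixed number of increments; e is chosen last, small against \<kappa>.\<close>

lemma weighted_noise_small:
  assumes c: "c > 0" and T: "T > 0" and C: "C \<ge> 0"
    and cont: "\<And>p. p \<in> noise_idx n \<Longrightarrow> continuous_on {0..T} (y p)"
    and tail: "\<And>\<delta>. \<delta> > 0 \<Longrightarrow> \<exists>P. finite P \<and> P \<subseteq> noise_idx n \<and> (\<forall>r\<in>{0..T}.
       (\<integral>\<^sup>+p. ennreal (indicator (noise_idx n - P) p * (y p r)\<^sup>2) \<partial>count_space UNIV) \<le> ennreal \<delta>)"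
    and \<delta>: "\<delta> > 0"
  shows "\<exists>e>0. \<forall>(M :: 'a measure) F W t Z w. bm_family M F W \<longrightarrow> t \<in> {0..T} \<longrightarrow>
    cspan (bm_family.ito_measure M) M (bm_family.simple_pairs M F W)
      (itg (noise_idx n) t (\<lambda>p r \<omega>. exp (- (c * (t - r))) * y p r)) Z \<longrightarrow>
    w \<in> borel_measurable M \<longrightarrow> (\<forall>\<omega>\<in>space M. 0 \<le> w \<omega> \<and> w \<omega> \<le> C) \<longrightarrow> (\<integral>\<^sup>+\<omega>. ennreal (w \<omega>) \<partial>M) \<le> ennreal e \<longrightarrow>
    (\<integral>\<^sup>+\<omega>. ennreal (w \<omega> * (Z \<omega>)\<^sup>2) \<partial>M) \<le> ennreal \<delta>"
proof -
  \<comment> \<open>A positive substitute for \<open>C\<close> in denominators, since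
    \<open>C\<close> may be zero.\<close>
  define X where "X = C + 1"
  have X: "X > 0" "C / X \<le> 1" using C by (auto simp: X_def)
  define \<delta>1 where "\<delta>1 = \<delta> / (8 * X * T)"
  have \<delta>1: "\<delta>1 > 0" using \<delta> X T by (simp add: \<delta>1_def)
  obtain P where P: "finite P" "P \<subseteq> noise_idx n" "\<And>r. r \<in> {0..T} \<Longrightarrow>
       (\<integral>\<^sup>+p. ennreal (indicator (noise_idx n - P) p * (y p r)\<^sup>2) \<partial>count_space UNIV) \<le> ennreal \<delta>1"
    using tail[OF \<delta>1] by blast
  obtain L \<eta> where L: "L \<ge> 0" "\<And>p u. p \<in> P \<Longrightarrow> u \<in> {0..T} \<Longrightarrow> \<bar>y p u\<bar> \<le> L" and \<eta>: "\<eta> > 0"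
    and approx: "\<And>t r u. t \<in> {0..T} \<Longrightarrow> r \<in> {0..t} \<Longrightarrow> u \<in> {0..t} \<Longrightarrow> \<bar>r - u\<bar> \<le> \<eta> \<Longrightarrow>
      (\<integral>\<^sup>+p. ennreal ((indicator (noise_idx n) p * (exp (- (c * (t - r))) * y p r) -
          indicator P p * (exp (- (c * (t - u))) * y p u))\<^sup>2) \<partial>count_space UNIV) \<le> ennreal (2 * \<delta>1)"
    using noise_uniform_approx[OF c T cont P(1,2) P(3) \<delta>1] by blast
  have "eventually (\<lambda>m. T / real (Suc m) < \<eta>) sequentially"
    using order_tendstoD(2)[OF tendsto_grid_step \<eta>] .
  then obtain m where m: "T / real (Suc m) \<le> \<eta>" by (auto simp: eventually_sequentially intro: less_imp_le)
  define B where "B = (real (card P * Suc m) * L)\<^sup>2 + 1"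
  have B: "B > 0" by (simp add: B_def add_nonneg_pos)
  define \<kappa> where "\<kappa> = 24 * B * T\<^sup>2 / \<delta>"
  have \<kappa>: "\<kappa> > 0" using B T \<delta> by (simp add: \<kappa>_def)
  define e where "e = \<delta> / (8 * B * \<kappa> * X)"
  have e: "e > 0" using B \<kappa> X \<delta> by (simp add: e_def)
  \<comment> \<open>Half of \<delta> pays for replacing \<open>Z\<close> by increments, a quarter
    for each of the two terms of Young's inequality.\<close>
  have total: "2 * C * (T * (2 * \<delta>1)) + 2 * ((real (card P * Suc m) * L)\<^sup>2 * (\<kappa> * C * e + 3 * T\<^sup>2 / \<kappa>)) \<le> \<delta>"
  proof -
    have "2 * C * (T * (2 * \<delta>1)) = \<delta> / 2 * (C / X)" using X T by (simp add: \<delta>1_def)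
    also have "\<dots> \<le> \<delta> / 2 * 1" using X \<delta> by (intro mult_left_mono) auto
    finally have 1: "2 * C * (T * (2 * \<delta>1)) \<le> \<delta> / 2" by simp
    have "\<kappa> * C * e = \<delta> / (8 * B) * (C / X)" using \<kappa> B X by (simp add: e_def mult_ac)
    also have "\<dots> \<le> \<delta> / (8 * B) * 1" using X \<delta> B by (intro mult_left_mono) auto
    finally have 2: "\<kappa> * C * e \<le> \<delta> / (8 * B)" by simp
    have 3: "3 * T\<^sup>2 / \<kappa> = \<delta> / (8 * B)" using B T \<delta> by (simp add: \<kappa>_def)
    have "(real (card P * Suc m) * L)\<^sup>2 * (\<kappa> * C * e + 3 * T\<^sup>2 / \<kappa>) \<le> B * (\<delta> / (8 * B) + \<delta> / (8 * B))"
    proof (rule mult_mono)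
      show "(real (card P * Suc m) * L)\<^sup>2 \<le> B" by (simp add: B_def)
      show "\<kappa> * C * e + 3 * T\<^sup>2 / \<kappa> \<le> \<delta> / (8 * B) + \<delta> / (8 * B)" using 2 3 by simp
      show "0 \<le> \<kappa> * C * e + 3 * T\<^sup>2 / \<kappa>" using \<kappa> C e by (intro add_nonneg_nonneg) auto
    qed (use B in simp)
    also have "\<dots> = \<delta> / 4" using B by simp
    finally show ?thesis using 1 by linarith
  qed
  show ?thesis
  proof (intro exI[of _ e] conjI e allI impI)
    fix M :: "'a measure" and F W t Z w
    assume bm: "bm_family M F W" and t: "t \<in> {0..T}"
      and span: "cspan (bm_family.ito_measure M) M (bm_family.simple_pairs M F W)
        (itg (noise_idx n) t (\<lambda>p r \<omega>. exp (- (c * (t - r))) * y p r)) Z"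
      and w: "w \<in> borel_measurable M" "\<forall>\<omega>\<in>space M. 0 \<le> w \<omega> \<and> w \<omega> \<le> C"
      and we: "(\<integral>\<^sup>+\<omega>. ennreal (w \<omega>) \<partial>M) \<le> ennreal e"
    interpret bm_family M F W by (rule bm)
    have "(\<integral>\<^sup>+\<omega>. ennreal (w \<omega> * (Z \<omega>)\<^sup>2) \<partial>M)
      \<le> ennreal (2 * C * (T * (2 * \<delta>1)) + 2 * ((real (card P * Suc m) * L)\<^sup>2 * (\<kappa> * C * e + 3 * T\<^sup>2 / \<kappa>)))"
    proof (rule weighted_noise_bound[OF c T t P(1,2) m approx[OF t] _ _ span w(1) _ _ we])
      show "\<bar>y p u\<bar> \<le> L" if "p \<in> P" "u \<in> {0..t}" for p u using L(2)[of p u] that t by auto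
    qed (use w(2) \<delta>1 e \<kappa> in auto)
    also have "\<dots> \<le> ennreal \<delta>" using total by (rule ennreal_leI)
    finally show "(\<integral>\<^sup>+\<omega>. ennreal (w \<omega> * (Z \<omega>)\<^sup>2) \<partial>M) \<le> ennreal \<delta>" .
  qed
qed

section \<open>The noise terms of the two equations\<close>

lemma tendsto_0_ennreal_le:
  fixes f g :: "nat \<Rightarrow> ennreal"
  assumes "g \<longlonglongrightarrow> 0" "\<And>n. f n \<le> g n" shows "f \<longlonglongrightarrow> 0"
  using assms by (intro tendsto_sandwich[of "\<lambda>_. 0" f sequentially g]) auto

lemma L2_sums_scale:
  assumes J: "\<And>j. j \<ge> 1 \<Longrightarrow> J j \<in> borel_measurable M" and JZ: "L2_sums M J Z"
  shows "L2_sums M (\<lambda>j \<omega>. a * J j \<omega>) (\<lambda>\<omega>. a * Z \<omega>)"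
proof -
  have Z: "Z \<in> borel_measurable M" and l: "(\<lambda>m. \<integral>\<^sup>+ \<omega>. ennreal ((Z \<omega> - (\<Sum>j=1..m. J j \<omega>))\<^sup>2) \<partial>M) \<longlonglongrightarrow> 0"
    using JZ by (auto simp: L2_sums_def)
  have eq: "(\<integral>\<^sup>+ \<omega>. ennreal ((a * Z \<omega> - (\<Sum>j=1..m. a * J j \<omega>))\<^sup>2) \<partial>M) = ennreal (a\<^sup>2) * (\<integral>\<^sup>+ \<omega>. ennreal ((Z \<omega> - (\<Sum>j=1..m. J j \<omega>))\<^sup>2) \<partial>M)" for m
  proof -
    have "(a * Z \<omega> - (\<Sum>j=1..m. a * J j \<omega>))\<^sup>2 = a\<^sup>2 * (Z \<omega> - (\<Sum>j=1..m. J j \<omega>))\<^sup>2" for \<omega>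
      unfolding sum_distrib_left[symmetric] right_diff_distrib[symmetric] power_mult_distrib ..
    then have "(\<integral>\<^sup>+ \<omega>. ennreal ((a * Z \<omega> - (\<Sum>j=1..m. a * J j \<omega>))\<^sup>2) \<partial>M) = (\<integral>\<^sup>+ \<omega>. ennreal (a\<^sup>2) * ennreal ((Z \<omega> - (\<Sum>j=1..m. J j \<omega>))\<^sup>2) \<partial>M)"
      by (simp add: ennreal_mult)
    also have "\<dots> = ennreal (a\<^sup>2) * (\<integral>\<^sup>+ \<omega>. ennreal ((Z \<omega> - (\<Sum>j=1..m. J j \<omega>))\<^sup>2) \<partial>M)"
    proof (rule nn_integral_cmult)
      have "(\<lambda>\<omega>. \<Sum>j=1..m. J j \<omega>) \<in> borel_measurable M" by (intro borel_measurable_sum J) auto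
      then show "(\<lambda>\<omega>. ennreal ((Z \<omega> - (\<Sum>j=1..m. J j \<omega>))\<^sup>2)) \<in> borel_measurable M" using Z by measurable
    qed
    finally show ?thesis .
  qed
  have "(\<lambda>m. ennreal (a\<^sup>2) * (\<integral>\<^sup>+ \<omega>. ennreal ((Z \<omega> - (\<Sum>j=1..m. J j \<omega>))\<^sup>2) \<partial>M)) \<longlonglongrightarrow> ennreal (a\<^sup>2) * 0"
    using l by (intro ennreal_tendsto_cmult) auto
  then show ?thesis
    unfolding L2_sums_def eq using Z by simp
qed

text \<open>The partial sums are almost surely constant from K on, so the L2 limit is that constant.
  On a fixed mode all but one of the series in the mild equation are of this kind.\<close>

lemma L2_sums_finite_AE:
  assumes J: "\<And>j. j \<ge> 1 \<Longrightarrow> J j \<in> borel_measurable M" and JZ: "L2_sums M J Z"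
    and zero: "\<And>j. j > K \<Longrightarrow> AE \<omega> in M. J j \<omega> = 0"
  shows "AE \<omega> in M. Z \<omega> = (\<Sum>j=1..K. J j \<omega>)"
proof -
  have Z: "Z \<in> borel_measurable M" and l: "(\<lambda>m. \<integral>\<^sup>+ \<omega>. ennreal ((Z \<omega> - (\<Sum>j=1..m. J j \<omega>))\<^sup>2) \<partial>M) \<longlonglongrightarrow> 0"
    using JZ by (auto simp: L2_sums_def)
  have "AE \<omega> in M. \<forall>j\<in>{K<..}. J j \<omega> = 0"
    using zero by (intro AE_ball_countable') auto
  then have c: "(\<integral>\<^sup>+ \<omega>. ennreal ((Z \<omega> - (\<Sum>j=1..m. J j \<omega>))\<^sup>2) \<partial>M) = (\<integral>\<^sup>+ \<omega>. ennreal ((Z \<omega> - (\<Sum>j=1..K. J j \<omega>))\<^sup>2) \<partial>M)" if "m \<ge> K" for m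
  proof (intro nn_integral_cong_AE, eventually_elim)
    case (elim \<omega>)
    have "(\<Sum>j=1..m. J j \<omega>) = (\<Sum>j=1..K. J j \<omega>)"
      using that elim by (intro sum.mono_neutral_right) auto
    then show ?case by simp
  qed
  have "(\<lambda>m. \<integral>\<^sup>+ \<omega>. ennreal ((Z \<omega> - (\<Sum>j=1..m. J j \<omega>))\<^sup>2) \<partial>M) \<longlonglongrightarrow> (\<integral>\<^sup>+ \<omega>. ennreal ((Z \<omega> - (\<Sum>j=1..K. J j \<omega>))\<^sup>2) \<partial>M)"
    using c by (intro tendsto_eventually eventually_sequentiallyI[of K])
  then have "(\<integral>\<^sup>+ \<omega>. ennreal ((Z \<omega> - (\<Sum>j=1..K. J j \<omega>))\<^sup>2) \<partial>M) = 0"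
    using l by (rule LIMSEQ_unique)
  moreover have "(\<lambda>\<omega>. \<Sum>j=1..K. J j \<omega>) \<in> borel_measurable M" by (intro borel_measurable_sum J) auto
  then have "(\<lambda>\<omega>. ennreal ((Z \<omega> - (\<Sum>j=1..K. J j \<omega>))\<^sup>2)) \<in> borel_measurable M" using Z by measurable
  ultimately have "AE \<omega> in M. ennreal ((Z \<omega> - (\<Sum>j=1..K. J j \<omega>))\<^sup>2) = 0"
    by (subst (asm) nn_integral_0_iff_AE) auto
  then show ?thesis by eventually_elim simp
qed

lemma Hs_norm_sq_component:
  "ennreal (lam powr (2 * real (Suc n) * s) * (x (Suc n))\<^sup>2) \<le> Hs_norm_sq lam s x"
proof -
  define g where "g = (\<lambda>n. ennreal (lam powr (2 * real (Suc n) * s) * (x (Suc n))\<^sup>2))"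
  have "g n \<le> suminf g" using sum_le_suminf[OF summableI, of "{n}" g] by simp
  then show ?thesis unfolding g_def Hs_norm_sq_def .
qed

lemma L2_Hs_sums_component:
  assumes lam: "lam > 0" and n: "n \<ge> 1" and Z: "L2_Hs_sums lam s M Y Z" and Y: "\<And>j. j \<ge> 1 \<Longrightarrow> (\<lambda>\<omega>. Y j \<omega> n) \<in> borel_measurable M"
  shows "L2_sums M (\<lambda>j \<omega>. Y j \<omega> n) (\<lambda>\<omega>. Z \<omega> n)"
proof -
  obtain k where k: "n = Suc k" using n by (cases n) auto
  define q where "q = lam powr (2 * real (Suc k) * s)"
  have q: "q > 0" using lam by (simp add: q_def)
  have Zm: "(\<lambda>\<omega>. Z \<omega> n) \<in> borel_measurable M" using Z by (simp add: L2_Hs_sums_def)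
  have le: "(\<integral>\<^sup>+ \<omega>. ennreal ((Z \<omega> n - (\<Sum>j=1..m. Y j \<omega> n))\<^sup>2) \<partial>M)
     \<le> ennreal (1 / q) * (\<integral>\<^sup>+ \<omega>. Hs_norm_sq lam s (\<lambda>n. Z \<omega> n - (\<Sum>j=1..m. Y j \<omega> n)) \<partial>M)" for m
  proof -
    have sm: "(\<lambda>\<omega>. \<Sum>j=1..m. Y j \<omega> n) \<in> borel_measurable M" by (intro borel_measurable_sum Y) auto
    have "(\<integral>\<^sup>+ \<omega>. ennreal ((Z \<omega> n - (\<Sum>j=1..m. Y j \<omega> n))\<^sup>2) \<partial>M) =
      (\<integral>\<^sup>+ \<omega>. ennreal (1 / q) * ennreal (q * (Z \<omega> n - (\<Sum>j=1..m. Y j \<omega> n))\<^sup>2) \<partial>M)"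
      using q by (intro nn_integral_cong) (simp add: ennreal_mult[symmetric])
    also have "\<dots> = ennreal (1 / q) * (\<integral>\<^sup>+ \<omega>. ennreal (q * (Z \<omega> n - (\<Sum>j=1..m. Y j \<omega> n))\<^sup>2) \<partial>M)"
      using Zm sm by (intro nn_integral_cmult) measurable
    also have "\<dots> \<le> ennreal (1 / q) * (\<integral>\<^sup>+ \<omega>. Hs_norm_sq lam s (\<lambda>n. Z \<omega> n - (\<Sum>j=1..m. Y j \<omega> n)) \<partial>M)"
      using Hs_norm_sq_component[of lam k s] unfolding q_def k by (intro mult_left_mono nn_integral_mono) auto
    finally show ?thesis .
  qed
  have "(\<lambda>m. ennreal (1 / q) * (\<integral>\<^sup>+ \<omega>. Hs_norm_sq lam s (\<lambda>n. Z \<omega> n - (\<Sum>j=1..m. Y j \<omega> n)) \<partial>M)) \<longlonglongrightarrow> ennreal (1 / q) * 0"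
    using Z by (intro ennreal_tendsto_cmult) (simp_all add: L2_Hs_sums_def)
  then have "(\<lambda>m. ennreal (1 / q) * (\<integral>\<^sup>+ \<omega>. Hs_norm_sq lam s (\<lambda>n. Z \<omega> n - (\<Sum>j=1..m. Y j \<omega> n)) \<partial>M)) \<longlonglongrightarrow> 0"
    by simp
  then have "(\<lambda>m. \<integral>\<^sup>+ \<omega>. ennreal ((Z \<omega> n - (\<Sum>j=1..m. Y j \<omega> n))\<^sup>2) \<partial>M) \<longlonglongrightarrow> 0"
    by (rule tendsto_0_ennreal_le[OF _ le])
  then show ?thesis unfolding L2_sums_def using Zm by simp
qed

lemma mat_apply_skew:
  assumes "j \<ge> 1"
  shows "mat_apply (skew_mat i (i + j)) x n = (if i = n then - x (n + j) else if i + j = n then x i else 0)"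
proof -
  have "mat_apply (skew_mat i (i + j)) x n = (\<Sum>k\<in>{i, i + j}. skew_mat i (i + j) n k * x k)"
    unfolding mat_apply_def by (rule suminf_finite) (auto simp: skew_mat_def)
  also have "\<dots> = skew_mat i (i + j) n i * x i + skew_mat i (i + j) n (i + j) * x (i + j)"
    using assms by simp
  also have "\<dots> = (if i = n then - x (n + j) else if i + j = n then x i else 0)"
    using assms by (auto simp: skew_mat_def)
  finally show ?thesis .
qed

lemma mat_apply_skew_nz:
  assumes "i \<ge> 1" "j \<ge> 1"
  shows "mat_apply (skew_mat i (i + j)) x n = indicator (noise_idx n) (i, j) * nz n (i, j) x"
  using assms by (auto simp: mat_apply_skew noise_idx_def nz_def indicator_def)

section \<open>The noise acting on a fixed mode\<close>

context bm_family
begin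

lemma itg_norm_le:
  assumes meas: "itg (noise_idx n) t f \<in> borel_measurable ito_measure"
    and bound: "\<And>r. r \<in> {0..t} \<Longrightarrow>
      (\<integral>\<^sup>+\<omega>. \<integral>\<^sup>+p. ennreal (indicator (noise_idx n) p * (f p r \<omega>)\<^sup>2) \<partial>count_space UNIV \<partial>M) \<le> g r"
  shows "(\<integral>\<^sup>+z. ennreal ((itg (noise_idx n) t f z)\<^sup>2) \<partial>ito_measure) \<le> (\<integral>\<^sup>+r\<in>{0..t}. g r \<partial>lborel)"
proof -
  have "(\<integral>\<^sup>+z. ennreal ((itg (noise_idx n) t f z)\<^sup>2) \<partial>ito_measure)
     = (\<integral>\<^sup>+r. \<integral>\<^sup>+\<omega>. \<integral>\<^sup>+p. ennreal ((itg (noise_idx n) t f (p, r, \<omega>))\<^sup>2) \<partial>count_space UNIV \<partial>M \<partial>lborel)"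
    by (rule nn_integral_ito(2)) (use meas in measurable)
  also have "\<dots> \<le> (\<integral>\<^sup>+r\<in>{0..t}. g r \<partial>lborel)"
  proof (rule nn_integral_mono)
    fix r
    show "(\<integral>\<^sup>+\<omega>. \<integral>\<^sup>+p. ennreal ((itg (noise_idx n) t f (p, r, \<omega>))\<^sup>2) \<partial>count_space UNIV \<partial>M) \<le> g r * indicator {0..t} r"
    proof (cases "r \<in> {0..t}")
      case True
      have "(itg (noise_idx n) t f (p, r, \<omega>))\<^sup>2 = indicator (noise_idx n) p * (f p r \<omega>)\<^sup>2" for p \<omega>
        using True by (simp add: itg_def indicator_def)
      then show ?thesis using bound[OF True] True by simp
    next
      case False
      then show ?thesis by (simp add: itg_def)
    qed
  qed
  finally show ?thesis .
qed

lemma itg_scale_span: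
  assumes ij: "i \<ge> 1" "j \<ge> 1" and t: "t \<ge> 0" and f: "has_ito_integral M F (W i j) g t Y"
    and eq: "\<And>r \<omega>. r \<in> {0..t} \<Longrightarrow> f (i, j) r \<omega> = a * g r \<omega>"
  shows "ito_span (itg {(i, j)} t f) (\<lambda>\<omega>. a * Y \<omega>)"
proof -
  have "(\<lambda>z. a * itg {(i, j)} t (\<lambda>_. g) z) = itg {(i, j)} t f"
    by (auto simp: itg_def fun_eq_iff indicator_def eq)
  with cspan_scale[OF has_ito_integral_span[OF ij t f], of a] show ?thesis by simp
qed

lemma has_ito_integral_zero_AE:
  assumes ij: "i \<ge> 1" "j \<ge> 1" and t: "t \<ge> 0" and f: "has_ito_integral M F (W i j) g t Y"
    and g: "\<And>r \<omega>. r \<in> {0..t} \<Longrightarrow> g r \<omega> = 0"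
  shows "AE \<omega> in M. Y \<omega> = 0"
proof -
  have "itg {(i, j)} t (\<lambda>_. g) = (\<lambda>_. 0)" using g by (auto simp: itg_def fun_eq_iff indicator_def)
  with ito_span_isometry[OF has_ito_integral_span[OF ij t f]]
  have "(\<integral>\<^sup>+\<omega>. ennreal ((Y \<omega>)\<^sup>2) \<partial>M) = 0" by simp
  moreover have "Y \<in> borel_measurable M" using f by (simp add: has_ito_integral_def)
  then have "(\<lambda>\<omega>. ennreal ((Y \<omega>)\<^sup>2)) \<in> borel_measurable M" by measurable
  ultimately have "AE \<omega> in M. ennreal ((Y \<omega>)\<^sup>2) = 0" by (subst (asm) nn_integral_0_iff_AE) auto
  then show ?thesis by eventually_elim simp
qed

text \<open>On mode n the double series collapses: i > n contributes nothing, i < n contributes the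
  single term j = n - i, and i = n contributes the whole series over j. What remains has the shape
  treated by \<open>noise_span\<close>. Vanishing terms are detected through the isometry, since the
  integral of a zero integrand is zero only almost surely.\<close>

lemma mild_noise_span:
  fixes Yt :: "real \<Rightarrow> nat \<Rightarrow> real"
  assumes lam: "lam > 1" and \<alpha>: "\<alpha> > 0" and t: "t \<ge> 0" and n: "n \<ge> 1" and \<nu>: "\<nu> > 0"
    and Yt: "\<And>r. r \<in> {0..t} \<Longrightarrow> (\<Sum>k. ennreal ((Yt r k)\<^sup>2)) \<le> ennreal A" "A \<ge> 0"
    and I: "\<And>i j n. i \<ge> 1 \<Longrightarrow> j \<ge> 1 \<Longrightarrow> has_ito_integral M F (W i j)
           (\<lambda>r _. exp_S lam (\<nu> * (t - r)) (mat_apply (skew_mat i (i + j)) (Yt r)) n) t (\<lambda>\<omega>. I i j \<omega> n)"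
    and G: "\<And>i. i \<ge> 1 \<Longrightarrow> L2_Hs_sums lam s M (\<lambda>j \<omega> n. real j powr (- \<alpha>) * I i j \<omega> n) (G i)"
    and Z: "L2_Hs_sums lam s M (\<lambda>i \<omega> n. lam ^ i * G i \<omega> n) Z"
  shows "ito_span (itg (noise_idx n) t (\<lambda>p r \<omega>. exp (- (\<nu> * lam ^ (2 * n) * (t - r))) *
      (lam ^ fst p * real (snd p) powr (- \<alpha>) * nz n p (Yt r)))) (\<lambda>\<omega>. Z \<omega> n)"
proof -
  define f where "f = (\<lambda>p r (\<omega>::'a). exp (- (\<nu> * lam ^ (2 * n) * (t - r))) * (lam ^ fst p * real (snd p) powr (- \<alpha>) * nz n p (Yt r)))"
  define Y where "Y = (\<lambda>p \<omega>. (lam ^ fst p * real (snd p) powr (- \<alpha>)) * I (fst p) (snd p) \<omega> n)"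
  have lam0: "lam > 0" using lam by simp
  have integrand: "exp_S lam (\<nu> * (t - r)) (mat_apply (skew_mat i (i + j)) (Yt r)) n
      = exp (- (\<nu> * lam ^ (2 * n) * (t - r))) * (indicator (noise_idx n) (i, j) * nz n (i, j) (Yt r))" if "i \<ge> 1" "j \<ge> 1" for i j r
    using mat_apply_skew_nz[OF that, of "Yt r" n] by (simp add: exp_S_def mult_ac)
  have Im: "(\<lambda>\<omega>. I i j \<omega> n) \<in> borel_measurable M" if "i \<ge> 1" "j \<ge> 1" for i j
    using I[OF that, of n] by (simp add: has_ito_integral_def)
  have I0: "AE \<omega> in M. I i j \<omega> n = 0" if "i \<ge> 1" "j \<ge> 1" "(i, j) \<notin> noise_idx n" for i j
    using that by (intro has_ito_integral_zero_AE[OF that(1,2) t I]) (auto simp: integrand)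
  have Gm: "(\<lambda>\<omega>. G i \<omega> n) \<in> borel_measurable M" if "i \<ge> 1" for i
    using G[OF that] by (simp add: L2_Hs_sums_def)
  have Gs: "L2_sums M (\<lambda>j \<omega>. real j powr (- \<alpha>) * I i j \<omega> n) (\<lambda>\<omega>. G i \<omega> n)" if "i \<ge> 1" for i
    by (rule L2_Hs_sums_component[OF lam0 n G[OF that]], rule borel_measurable_times[OF borel_measurable_const Im[OF that]])
  have Zs: "L2_sums M (\<lambda>i \<omega>. lam ^ i * G i \<omega> n) (\<lambda>\<omega>. Z \<omega> n)"
    by (rule L2_Hs_sums_component[OF lam0 n Z], rule borel_measurable_times[OF borel_measurable_const Gm])
  have G_gt: "AE \<omega> in M. G i \<omega> n = 0" if "i > n" for i
  proof -
    have i1: "i \<ge> 1" using that by simp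
    have z: "AE \<omega> in M. real j powr (- \<alpha>) * I i j \<omega> n = 0" if "j > 0" for j
      using I0[of i j] i1 that \<open>i > n\<close> by (auto simp: noise_idx_def)
    have "AE \<omega> in M. G i \<omega> n = (\<Sum>j=1..0. real j powr (- \<alpha>) * I i j \<omega> n)"
      by (rule L2_sums_finite_AE[OF _ Gs[OF i1] z], rule borel_measurable_times[OF borel_measurable_const Im[OF i1]])
    then show ?thesis by simp
  qed
  have G_lt: "AE \<omega> in M. lam ^ i * G i \<omega> n = Y (i, n - i) \<omega>" if i: "i \<in> {1..<n}" for i
  proof -
    have i1: "i \<ge> 1" using i by simp
    have z0: "AE \<omega> in M. real j powr (- \<alpha>) * I i j \<omega> n = 0" if "j \<ge> 1" "j \<noteq> n - i" for j
      using I0[of i j] i that by (auto simp: noise_idx_def)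
    have z: "AE \<omega> in M. real j powr (- \<alpha>) * I i j \<omega> n = 0" if "j > n - i" for j
      using that z0[of j] by simp
    have 1: "AE \<omega> in M. G i \<omega> n = (\<Sum>j=1..n - i. real j powr (- \<alpha>) * I i j \<omega> n)"
      by (rule L2_sums_finite_AE[OF _ Gs[OF i1] z], rule borel_measurable_times[OF borel_measurable_const Im[OF i1]])
    have 2: "AE \<omega> in M. \<forall>j\<in>{1..<n - i}. real j powr (- \<alpha>) * I i j \<omega> n = 0"
      by (intro AE_ball_countable') (use z0 in auto)
    from 1 2 show ?thesis
    proof eventually_elim
      case (elim \<omega>)
      have "{1..n - i} = insert (n - i) {1..<n - i}" using i by auto
      then have "(\<Sum>j=1..n - i. real j powr (- \<alpha>) * I i j \<omega> n) = real (n - i) powr (- \<alpha>) * I i (n - i) \<omega> n"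
        using elim(2) by simp
      then show ?case using elim(1) by (simp add: Y_def)
    qed
  qed
  have "AE \<omega> in M. Z \<omega> n = (\<Sum>i=1..n. lam ^ i * G i \<omega> n)"
  proof (rule L2_sums_finite_AE[OF _ Zs])
    show "AE \<omega> in M. lam ^ i * G i \<omega> n = 0" if "n < i" for i using G_gt[OF that] by eventually_elim simp
  qed (rule borel_measurable_times[OF borel_measurable_const Gm])
  moreover have "AE \<omega> in M. \<forall>i\<in>{1..<n}. lam ^ i * G i \<omega> n = Y (i, n - i) \<omega>"
    using G_lt by (intro AE_ball_countable') auto
  ultimately have Zeq: "AE \<omega> in M. Z \<omega> n = (\<Sum>i=1..<n. Y (i, n - i) \<omega>) + lam ^ n * G n \<omega> n"
  proof eventually_elim
    case (elim \<omega>)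
    have "{1..n} = insert n {1..<n}" using n by auto
    then have "(\<Sum>i=1..n. lam ^ i * G i \<omega> n) = lam ^ n * G n \<omega> n + (\<Sum>i=1..<n. lam ^ i * G i \<omega> n)" by simp
    also have "(\<Sum>i=1..<n. lam ^ i * G i \<omega> n) = (\<Sum>i=1..<n. Y (i, n - i) \<omega>)" using elim(2) by (intro sum.cong) auto
    finally show ?case using elim(1) by simp
  qed
  have Yspan: "ito_span (itg {p} t f) (Y p)" if p: "p \<in> noise_idx n" for p
  proof -
    obtain i j where ij: "p = (i, j)" "i \<ge> 1" "j \<ge> 1" using p by (auto simp: noise_idx_def)
    show ?thesis unfolding ij(1) Y_def fst_conv snd_conv
      by (rule itg_scale_span[OF ij(2,3) t I[OF ij(2,3), of n]]) (use p ij in \<open>simp add: f_def integrand\<close>)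
  qed
  have fm: "itg (noise_idx n) t f \<in> borel_measurable ito_measure"
  proof (rule itg_measurable)
    fix p assume p: "p \<in> noise_idx n"
    obtain i j where ij: "p = (i, j)" "i \<ge> 1" "j \<ge> 1" using p by (auto simp: noise_idx_def)
    have "(\<lambda>z. (lam ^ i * real j powr (- \<alpha>)) * (indicator {0..t} (fst z) * (\<lambda>r _. exp_S lam (\<nu> * (t - r)) (mat_apply (skew_mat i (i + j)) (Yt r)) n) (fst z) (snd z))) \<in> borel_measurable (lborel \<Otimes>\<^sub>M M)"
      by (rule borel_measurable_times[OF borel_measurable_const has_ito_integral_measurable[OF t I[OF ij(2,3), of n]]])
    then show "(\<lambda>z. indicator {0..t} (fst z) * f p (fst z) (snd z)) \<in> borel_measurable (lborel \<Otimes>\<^sub>M M)"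
      unfolding f_def ij(1) integrand[OF ij(2,3)] indicator_simps(1)[OF p[unfolded ij(1)]]
      by (simp only: mult_1_left fst_conv snd_conv mult_ac)
  qed
  have fin: "(\<integral>\<^sup>+z. ennreal ((itg (noise_idx n) t f z)\<^sup>2) \<partial>ito_measure) < \<infinity>"
  proof -
    have "(\<integral>\<^sup>+z. ennreal ((itg (noise_idx n) t f z)\<^sup>2) \<partial>ito_measure) \<le> (\<integral>\<^sup>+r\<in>{0..t}. ennreal (lam ^ (2 * n)) * ennreal A \<partial>lborel)"
    proof (rule itg_norm_le[OF fm])
      fix r assume r: "r \<in> {0..t}"
      have "(\<integral>\<^sup>+p. ennreal (indicator (noise_idx n) p * (f p r \<omega>)\<^sup>2) \<partial>count_space UNIV) \<le> ennreal (lam ^ (2 * n)) * ennreal A" for \<omega>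
      proof -
        have "(f p r \<omega>)\<^sup>2 = (exp (- (\<nu> * lam ^ (2 * n) * (t - r))))\<^sup>2 * (lam ^ fst p * real (snd p) powr (- \<alpha>))\<^sup>2 * (nz n p (Yt r))\<^sup>2" for p
          by (simp only: f_def power_mult_distrib mult.assoc)
        moreover have "(\<integral>\<^sup>+p. ennreal (indicator (noise_idx n) p * (((exp (- (\<nu> * lam ^ (2 * n) * (t - r))))\<^sup>2 * (lam ^ fst p * real (snd p) powr (- \<alpha>))\<^sup>2) * (nz n p (Yt r))\<^sup>2)) \<partial>count_space UNIV)
            \<le> ennreal (lam ^ (2 * n)) * (\<Sum>k. ennreal ((Yt r k)\<^sup>2))"
        proof (rule noise_idx_sum_le)
          fix p assume p: "p \<in> noise_idx n"
          have "(exp (- (\<nu> * lam ^ (2 * n) * (t - r))))\<^sup>2 \<le> 1" using r \<nu> lam by (intro power_le_one) auto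
          moreover have "(real (snd p) powr (- \<alpha>))\<^sup>2 \<le> 1"
            using powr_neg_le_one[of \<alpha> "snd p"] p \<alpha> by (intro power_le_one) (auto simp: noise_idx_def)
          ultimately have "(exp (- (\<nu> * lam ^ (2 * n) * (t - r))))\<^sup>2 * ((lam ^ fst p)\<^sup>2 * (real (snd p) powr (- \<alpha>))\<^sup>2) \<le> 1 * (lam ^ (2 * n) * 1)"
            using noise_coeff_le[OF lam p] lam by (intro mult_mono) auto
          then show "(exp (- (\<nu> * lam ^ (2 * n) * (t - r))))\<^sup>2 * (lam ^ fst p * real (snd p) powr (- \<alpha>))\<^sup>2 \<le> lam ^ (2 * n)"
            by (simp only: power_mult_distrib mult_1_left mult_1_right)
        qed (use lam in simp)
        ultimately have "(\<integral>\<^sup>+p. ennreal (indicator (noise_idx n) p * (f p r \<omega>)\<^sup>2) \<partial>count_space UNIV) \<le> ennreal (lam ^ (2 * n)) * (\<Sum>k. ennreal ((Yt r k)\<^sup>2))"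
          by simp
        also have "\<dots> \<le> ennreal (lam ^ (2 * n)) * ennreal A" by (intro mult_left_mono Yt(1) r) simp
        finally show ?thesis .
      qed
      then have "(\<integral>\<^sup>+\<omega>. \<integral>\<^sup>+p. ennreal (indicator (noise_idx n) p * (f p r \<omega>)\<^sup>2) \<partial>count_space UNIV \<partial>M) \<le> (\<integral>\<^sup>+\<omega>. ennreal (lam ^ (2 * n)) * ennreal A \<partial>M)"
        by (intro nn_integral_mono)
      then show "(\<integral>\<^sup>+\<omega>. \<integral>\<^sup>+p. ennreal (indicator (noise_idx n) p * (f p r \<omega>)\<^sup>2) \<partial>count_space UNIV \<partial>M) \<le> ennreal (lam ^ (2 * n)) * ennreal A"
        by (simp add: emeasure_space_1)
    qed
    also have "\<dots> = ennreal (lam ^ (2 * n)) * ennreal A * ennreal t"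
      using t by (subst nn_integral_cmult_indicator) auto
    also have "\<dots> < \<infinity>" by (simp add: ennreal_mult_less_top)
    finally show ?thesis .
  qed
  have Jn: "L2_sums M (\<lambda>j. Y (n, j)) (\<lambda>\<omega>. lam ^ n * G n \<omega> n)"
    using L2_sums_scale[OF _ Gs[OF n], of "lam ^ n"] Im n unfolding Y_def by (simp add: mult.assoc)
  have "ito_span (itg (noise_idx n) t f) (\<lambda>\<omega>. (\<Sum>i=1..<n. Y (i, n - i) \<omega>) + lam ^ n * G n \<omega> n)"
    by (rule noise_span[OF n Yspan Jn fin])
  then have "ito_span (itg (noise_idx n) t f) (\<lambda>\<omega>. Z \<omega> n)"
    by (rule cspan_AE_cong) (use fm Zeq Z in \<open>auto simp: L2_Hs_sums_def\<close>)
  then show ?thesis unfolding f_def .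
qed

text \<open>The factor -lam^n in front of the series is moved into the integrand. The noise then has
  the form lam^i \<theta>_j \<open>nz\<close>, with the same index set and the same signs as in the
  mild equation, so that the two noises can be subtracted.\<close>

lemma weak_noise_span:
  fixes X :: "real \<Rightarrow> 'a \<Rightarrow> nat \<Rightarrow> real"
  assumes lam: "lam > 1" and t: "t \<ge> 0" and n: "n \<ge> 1"
    and \<theta>: "\<And>j. \<bar>\<theta> j\<bar> \<le> 1"
    and X: "AE \<omega> in M. \<forall>r\<in>{0..t}. (\<Sum>k. ennreal ((X r \<omega> k)\<^sup>2)) \<le> ennreal A" "A \<ge> 0"
    and I: "\<And>j. j \<in> {1..<n} \<Longrightarrow> has_ito_integral M F (W j (n - j)) (\<lambda>r \<omega>. lam ^ j * \<theta> (n - j) * X r \<omega> j) t (I j)"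
    and J: "\<And>j. j \<ge> 1 \<Longrightarrow> has_ito_integral M F (W n j) (\<lambda>r \<omega>. \<theta> j * X r \<omega> (n + j)) t (J j)"
    and Z: "L2_sums M J Z"
  shows "ito_span (itg (noise_idx n) t (\<lambda>p r \<omega>. lam ^ fst p * \<theta> (snd p) * nz n p (X r \<omega>)))
    (\<lambda>\<omega>. (\<Sum>i=1..<n. I i \<omega>) - lam ^ n * Z \<omega>)"
proof -
  define f where "f = (\<lambda>p r \<omega>. lam ^ fst p * \<theta> (snd p) * nz n p (X r \<omega>))"
  define Y where "Y = (\<lambda>p \<omega>. if fst p = n then - (lam ^ n) * J (snd p) \<omega> else 1 * I (fst p) \<omega>)"
  have cases: "(\<exists>j\<ge>1. p = (n, j)) \<or> (\<exists>i\<in>{1..<n}. p = (i, n - i))" if "p \<in> noise_idx n" for p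
    using that by (auto simp: noise_idx_def)
  have Yspan: "ito_span (itg {p} t f) (Y p)" if p: "p \<in> noise_idx n" for p
    using cases[OF p]
  proof
    assume "\<exists>j\<ge>1. p = (n, j)"
    then obtain j where j: "j \<ge> 1" "p = (n, j)" by blast
    show ?thesis unfolding j(2) Y_def fst_conv snd_conv if_P[OF refl]
      by (rule itg_scale_span[OF n j(1) t J[OF j(1)]]) (simp add: f_def nz_def)
  next
    assume "\<exists>i\<in>{1..<n}. p = (i, n - i)"
    then obtain i where i: "i \<in> {1..<n}" "p = (i, n - i)" by blast
    then have i': "1 \<le> i" "1 \<le> n - i" "i \<noteq> n" by auto
    show ?thesis unfolding i(2) Y_def fst_conv snd_conv if_not_P[OF i'(3)]
      by (rule itg_scale_span[OF i'(1,2) t I[OF i(1)]]) (use i' in \<open>simp add: f_def nz_def\<close>)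
  qed
  have fm: "itg (noise_idx n) t f \<in> borel_measurable ito_measure"
  proof (rule itg_measurable)
    fix p assume p: "p \<in> noise_idx n"
    show "(\<lambda>z. indicator {0..t} (fst z) * f p (fst z) (snd z)) \<in> borel_measurable (lborel \<Otimes>\<^sub>M M)"
      using cases[OF p]
    proof
      assume "\<exists>j\<ge>1. p = (n, j)"
      then obtain j where j: "j \<ge> 1" "p = (n, j)" by blast
      have "(\<lambda>z. (- (lam ^ n)) * (indicator {0..t} (fst z) * (\<lambda>r \<omega>. \<theta> j * X r \<omega> (n + j)) (fst z) (snd z))) \<in> borel_measurable (lborel \<Otimes>\<^sub>M M)"
        by (rule borel_measurable_times[OF borel_measurable_const has_ito_integral_measurable[OF t J[OF j(1)]]])
      then show ?thesis by (simp add: f_def nz_def j mult_ac)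
    next
      assume "\<exists>i\<in>{1..<n}. p = (i, n - i)"
      then obtain i where i: "i \<in> {1..<n}" "p = (i, n - i)" by blast
      then show ?thesis using has_ito_integral_measurable[OF t I[OF i(1)]] by (simp add: f_def nz_def mult_ac)
    qed
  qed
  have fin: "(\<integral>\<^sup>+z. ennreal ((itg (noise_idx n) t f z)\<^sup>2) \<partial>ito_measure) < \<infinity>"
  proof -
    have "(\<integral>\<^sup>+z. ennreal ((itg (noise_idx n) t f z)\<^sup>2) \<partial>ito_measure) \<le> (\<integral>\<^sup>+r\<in>{0..t}. ennreal (lam ^ (2 * n)) * ennreal A \<partial>lborel)"
    proof (rule itg_norm_le[OF fm])
      fix r assume r: "r \<in> {0..t}"
      have "AE \<omega> in M. (\<integral>\<^sup>+p. ennreal (indicator (noise_idx n) p * (f p r \<omega>)\<^sup>2) \<partial>count_space UNIV) \<le> ennreal (lam ^ (2 * n)) * ennreal A"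
        using X(1)
      proof eventually_elim
        case (elim \<omega>)
        have "(f p r \<omega>)\<^sup>2 = (lam ^ fst p * \<theta> (snd p))\<^sup>2 * (nz n p (X r \<omega>))\<^sup>2" for p
          by (simp only: f_def power_mult_distrib mult.assoc)
        moreover have "(\<integral>\<^sup>+p. ennreal (indicator (noise_idx n) p * ((lam ^ fst p * \<theta> (snd p))\<^sup>2 * (nz n p (X r \<omega>))\<^sup>2)) \<partial>count_space UNIV)
            \<le> ennreal (lam ^ (2 * n)) * (\<Sum>k. ennreal ((X r \<omega> k)\<^sup>2))"
        proof (rule noise_idx_sum_le)
          fix p assume p: "p \<in> noise_idx n"
          have "(\<theta> (snd p))\<^sup>2 \<le> 1" using \<theta>[of "snd p"] by (simp add: abs_square_le_1)
          then have "(lam ^ fst p)\<^sup>2 * (\<theta> (snd p))\<^sup>2 \<le> lam ^ (2 * n) * 1"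
            using noise_coeff_le[OF lam p] lam by (intro mult_mono) auto
          then show "(lam ^ fst p * \<theta> (snd p))\<^sup>2 \<le> lam ^ (2 * n)"
            by (simp only: power_mult_distrib mult_1_right)
        qed (use lam in simp)
        ultimately have "(\<integral>\<^sup>+p. ennreal (indicator (noise_idx n) p * (f p r \<omega>)\<^sup>2) \<partial>count_space UNIV) \<le> ennreal (lam ^ (2 * n)) * (\<Sum>k. ennreal ((X r \<omega> k)\<^sup>2))"
          by simp
        also have "\<dots> \<le> ennreal (lam ^ (2 * n)) * ennreal A" using elim r by (intro mult_left_mono) auto
        finally show ?case .
      qed
      then have "(\<integral>\<^sup>+\<omega>. \<integral>\<^sup>+p. ennreal (indicator (noise_idx n) p * (f p r \<omega>)\<^sup>2) \<partial>count_space UNIV \<partial>M) \<le> (\<integral>\<^sup>+\<omega>. ennreal (lam ^ (2 * n)) * ennreal A \<partial>M)"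
        by (intro nn_integral_mono_AE)
      then show "(\<integral>\<^sup>+\<omega>. \<integral>\<^sup>+p. ennreal (indicator (noise_idx n) p * (f p r \<omega>)\<^sup>2) \<partial>count_space UNIV \<partial>M) \<le> ennreal (lam ^ (2 * n)) * ennreal A"
        by (simp add: emeasure_space_1)
    qed
    also have "\<dots> = ennreal (lam ^ (2 * n)) * ennreal A * ennreal t"
      using t by (subst nn_integral_cmult_indicator) auto
    also have "\<dots> < \<infinity>" by (simp add: ennreal_mult_less_top)
    finally show ?thesis .
  qed
  have Jm: "J j \<in> borel_measurable M" if "j \<ge> 1" for j using J[OF that] by (simp add: has_ito_integral_def)
  have Jn: "L2_sums M (\<lambda>j. Y (n, j)) (\<lambda>\<omega>. - (lam ^ n) * Z \<omega>)"
    using L2_sums_scale[OF Jm Z, of "- (lam ^ n)"] unfolding Y_def by simp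
  have "ito_span (itg (noise_idx n) t f) (\<lambda>\<omega>. (\<Sum>i=1..<n. Y (i, n - i) \<omega>) + - (lam ^ n) * Z \<omega>)"
    by (rule noise_span[OF n Yspan Jn fin])
  moreover have "(\<Sum>i=1..<n. Y (i, n - i) \<omega>) = (\<Sum>i=1..<n. I i \<omega>)" for \<omega>
    by (intro sum.cong) (auto simp: Y_def)
  ultimately show ?thesis unfolding f_def by simp
qed

end

section \<open>Weighted sequence norms\<close>

definition wnorm :: "(nat \<Rightarrow> real) \<Rightarrow> (nat \<Rightarrow> real) \<Rightarrow> ennreal" where
  "wnorm \<rho> u = (\<Sum>n. ennreal (\<rho> (Suc n) * (u (Suc n))\<^sup>2))"

lemma suminf_ennreal_mono: "(\<And>n. f n \<le> g n) \<Longrightarrow> (\<Sum>n. f n :: ennreal) \<le> (\<Sum>n. g n)"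
  by (intro suminf_le summableI)

lemma suminf_ennreal_add: "(\<Sum>n. f n + g n :: ennreal) = (\<Sum>n. f n) + (\<Sum>n. g n)"
  by (intro suminf_add[symmetric] summableI)

lemma suminf_ennreal_shift: "(\<Sum>n. f n :: ennreal) = f 0 + (\<Sum>n. f (Suc n))"
  using suminf_offset[OF summableI, of f 1] by (simp add: add.commute)

lemma wnorm_add_le:
  assumes "\<And>n. \<rho> n \<ge> 0"
  shows "wnorm \<rho> (\<lambda>n. u n + v n) \<le> 2 * wnorm \<rho> u + 2 * wnorm \<rho> v"
proof -
  have "wnorm \<rho> (\<lambda>n. u n + v n) \<le> (\<Sum>n. 2 * ennreal (\<rho> (Suc n) * (u (Suc n))\<^sup>2) + 2 * ennreal (\<rho> (Suc n) * (v (Suc n))\<^sup>2))"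
    unfolding wnorm_def
  proof (rule suminf_ennreal_mono)
    fix n
    have "\<rho> (Suc n) * (u (Suc n) + v (Suc n))\<^sup>2 \<le> \<rho> (Suc n) * (2 * (u (Suc n))\<^sup>2 + 2 * (v (Suc n))\<^sup>2)"
      using assms by (intro mult_left_mono real_power2_add_le)
    then have "ennreal (\<rho> (Suc n) * (u (Suc n) + v (Suc n))\<^sup>2) \<le> ennreal (2 * (\<rho> (Suc n) * (u (Suc n))\<^sup>2) + 2 * (\<rho> (Suc n) * (v (Suc n))\<^sup>2))"
      by (intro ennreal_leI) (simp add: algebra_simps)
    also have "\<dots> = 2 * ennreal (\<rho> (Suc n) * (u (Suc n))\<^sup>2) + 2 * ennreal (\<rho> (Suc n) * (v (Suc n))\<^sup>2)"
      using assms by (simp add: ennreal_plus ennreal_mult)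
    finally show "ennreal (\<rho> (Suc n) * (u (Suc n) + v (Suc n))\<^sup>2) \<le> \<dots>" .
  qed
  also have "\<dots> = 2 * wnorm \<rho> u + 2 * wnorm \<rho> v"
    unfolding wnorm_def by (simp only: suminf_ennreal_add ennreal_suminf_cmult)
  finally show ?thesis .
qed

lemma wnorm_mono:
  assumes "\<And>n. n \<ge> 1 \<Longrightarrow> \<rho> n * (u n)\<^sup>2 \<le> \<rho>' n * (v n)\<^sup>2"
  shows "wnorm \<rho> u \<le> wnorm \<rho>' v"
  unfolding wnorm_def using assms by (intro suminf_ennreal_mono ennreal_leI) auto

text \<open>The weights of \<open>H^{-\<beta>}\<close>, lowered on the modes below \<open>m\<close>; they are used to bound the tail of a
  solution uniformly.\<close>

definition rw :: "real \<Rightarrow> real \<Rightarrow> nat \<Rightarrow> nat \<Rightarrow> real" where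
  "rw lam \<beta> m n = lam powr (- \<beta> * (real n + real (max n m)))"

lemma Hs_norm_sq_eq_wnorm: "Hs_norm_sq lam (- \<beta>) u = wnorm (rw lam \<beta> 0) u"
  unfolding Hs_norm_sq_def wnorm_def rw_def by (simp add: mult.commute)

text \<open>Decreasing weights that lose at most the factor lam^2 from one mode to the next. These
  two properties bound both index shifts in the weighted norm, and \<open>B\<close> couples a mode
  only to its two neighbours.\<close>

locale weights =
  fixes lam :: real and \<rho> :: "nat \<Rightarrow> real"
  assumes lam: "lam > 1" and pos: "\<And>n. \<rho> n > 0"
    and dec: "\<And>n. \<rho> (Suc n) \<le> \<rho> n" and slow: "\<And>n. \<rho> n \<le> lam\<^sup>2 * \<rho> (Suc n)"

lemma rw_weights:
  assumes lam: "lam > 1" and \<beta>: "0 < \<beta>" "\<beta> < 1"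
  shows "weights lam (rw lam \<beta> m)"
proof
  show "lam > 1" by fact
  show "0 < rw lam \<beta> m n" for n using lam by (simp add: rw_def)
  show "rw lam \<beta> m (Suc n) \<le> rw lam \<beta> m n" for n
    unfolding rw_def using lam \<beta> by (intro powr_mono) auto
  show "rw lam \<beta> m n \<le> lam\<^sup>2 * rw lam \<beta> m (Suc n)" for n
  proof -
    \<comment> \<open>The exponent changes by \<beta> below m and by 2\<beta> from m on; \<beta> < 1
      keeps the loss within lam^2.\<close>
    have "\<beta> * (real (Suc n) + real (max (Suc n) m)) - \<beta> * (real n + real (max n m)) \<le> \<beta> * 2"
      unfolding right_diff_distrib[symmetric] using \<beta> by (intro mult_left_mono) auto
    also have "\<dots> \<le> 2" using \<beta> by simp
    finally have "- \<beta> * (real n + real (max n m)) \<le> 2 + - \<beta> * (real (Suc n) + real (max (Suc n) m))" by simp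
    then have "lam powr (- \<beta> * (real n + real (max n m))) \<le> lam powr (2 + - \<beta> * (real (Suc n) + real (max (Suc n) m)))"
      using lam by (intro powr_mono) auto
    also have "\<dots> = lam\<^sup>2 * lam powr (- \<beta> * (real (Suc n) + real (max (Suc n) m)))"
      using lam by (subst powr_add) simp
    finally show ?thesis unfolding rw_def .
  qed
qed

lemma rw_le_0: "lam > 1 \<Longrightarrow> \<beta> > 0 \<Longrightarrow> rw lam \<beta> m n \<le> rw lam \<beta> 0 n"
  unfolding rw_def by (intro powr_mono) auto

lemma rw_eq_0: "m \<le> n \<Longrightarrow> rw lam \<beta> m n = rw lam \<beta> 0 n"
  unfolding rw_def by (simp add: max_def)

text \<open>The lowered weights have total mass of order lam^(-\<beta> m). They coincide with the
  weights of H^{-\<beta>} on all modes from m on, so a mean square bound uniform in the modes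
  becomes a small bound for the tail.\<close>

lemma rw_sum_le:
  assumes lam: "lam > 1" and \<beta>: "\<beta> > 0"
  shows "(\<Sum>n. ennreal (rw lam \<beta> m (Suc n))) \<le> ennreal (lam powr (- \<beta> * real m) * (1 / (1 - lam powr (- \<beta>))))"
proof -
  define q where "q = lam powr (- \<beta>)"
  have q: "0 < q" "q < 1" using lam \<beta> by (auto simp: q_def powr_less_one)
  have le: "rw lam \<beta> m (Suc n) \<le> lam powr (- \<beta> * real m) * q ^ n" for n
  proof -
    have "\<beta> * (real m + real n) \<le> \<beta> * (real (Suc n) + real (max (Suc n) m))"
      using \<beta> by (intro mult_left_mono) auto
    then have "- \<beta> * (real (Suc n) + real (max (Suc n) m)) \<le> - \<beta> * real m + - \<beta> * real n"
      by (simp only: distrib_left minus_mult_left[symmetric])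
    then have "rw lam \<beta> m (Suc n) \<le> lam powr (- \<beta> * real m + - \<beta> * real n)"
      unfolding rw_def using lam by (intro powr_mono) auto
    also have "\<dots> = lam powr (- \<beta> * real m) * q ^ n"
      unfolding powr_add q_def using lam by (simp add: powr_realpow[symmetric] powr_powr)
    finally show ?thesis .
  qed
  have "(\<Sum>n. ennreal (rw lam \<beta> m (Suc n))) \<le> (\<Sum>n. ennreal (lam powr (- \<beta> * real m) * q ^ n))"
    using le by (intro suminf_ennreal_mono ennreal_leI)
  also have "\<dots> = ennreal (\<Sum>n. lam powr (- \<beta> * real m) * q ^ n)"
    using q by (intro suminf_ennreal2 summable_mult summable_geometric) auto
  also have "(\<Sum>n. lam powr (- \<beta> * real m) * q ^ n) = lam powr (- \<beta> * real m) * (1 / (1 - q))"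
    using q by (subst suminf_mult) (auto intro: summable_geometric simp: suminf_geometric)
  finally show ?thesis by (simp add: q_def)
qed

context weights
begin

lemma nonneg: "\<rho> n \<ge> 0" using pos[of n] by simp

lemma wnorm_neighbours_le:
  assumes "v 0 = 0"
  shows "(\<Sum>n. ennreal (\<rho> (Suc n) * ((v n)\<^sup>2 + (v (Suc n))\<^sup>2 + (v (Suc (Suc n)))\<^sup>2))) \<le> ennreal (3 * lam\<^sup>2) * wnorm \<rho> v"
proof -
  define a where "a = (\<lambda>n. ennreal (\<rho> (Suc n) * (v (Suc n))\<^sup>2))"
  have l1: "1 \<le> lam\<^sup>2" using lam by (simp add: one_le_power)
  have l1': "x \<le> ennreal (lam\<^sup>2) * x" for x
    using mult_right_mono[OF ennreal_leI[OF l1], of x] by simp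
  have "(\<Sum>n. ennreal (\<rho> (Suc n) * ((v n)\<^sup>2 + (v (Suc n))\<^sup>2 + (v (Suc (Suc n)))\<^sup>2)))
    = (\<Sum>n. ennreal (\<rho> (Suc n) * (v n)\<^sup>2) + a n + ennreal (\<rho> (Suc n) * (v (Suc (Suc n)))\<^sup>2))"
    unfolding a_def using nonneg by (simp add: distrib_left)
  also have "\<dots> = (\<Sum>n. ennreal (\<rho> (Suc n) * (v n)\<^sup>2)) + (\<Sum>n. a n) + (\<Sum>n. ennreal (\<rho> (Suc n) * (v (Suc (Suc n)))\<^sup>2))"
    by (simp only: suminf_ennreal_add)
  also have "\<dots> \<le> ennreal (lam\<^sup>2) * (\<Sum>n. a n) + ennreal (lam\<^sup>2) * (\<Sum>n. a n) + ennreal (lam\<^sup>2) * (\<Sum>n. a n)"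
  proof (intro add_mono l1')
    have "(\<Sum>n. ennreal (\<rho> (Suc n) * (v n)\<^sup>2)) = (\<Sum>n. ennreal (\<rho> (Suc (Suc n)) * (v (Suc n))\<^sup>2))"
      by (subst suminf_ennreal_shift) (simp add: assms)
    also have "\<dots> \<le> (\<Sum>n. a n)"
      unfolding a_def using dec by (intro suminf_ennreal_mono ennreal_leI mult_right_mono) auto
    also have "\<dots> \<le> ennreal (lam\<^sup>2) * (\<Sum>n. a n)" by (rule l1')
    finally show "(\<Sum>n. ennreal (\<rho> (Suc n) * (v n)\<^sup>2)) \<le> ennreal (lam\<^sup>2) * (\<Sum>n. a n)" .
    have "(\<Sum>n. ennreal (\<rho> (Suc n) * (v (Suc (Suc n)))\<^sup>2)) \<le> (\<Sum>n. ennreal (lam\<^sup>2) * a (Suc n))"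
    proof (rule suminf_ennreal_mono)
      fix n
      have "\<rho> (Suc n) * (v (Suc (Suc n)))\<^sup>2 \<le> lam\<^sup>2 * \<rho> (Suc (Suc n)) * (v (Suc (Suc n)))\<^sup>2"
        using slow by (intro mult_right_mono) auto
      then show "ennreal (\<rho> (Suc n) * (v (Suc (Suc n)))\<^sup>2) \<le> ennreal (lam\<^sup>2) * a (Suc n)"
        unfolding a_def using nonneg by (simp add: ennreal_mult[symmetric] ennreal_leI mult.assoc)
    qed
    also have "\<dots> = ennreal (lam\<^sup>2) * (\<Sum>n. a (Suc n))" by (rule ennreal_suminf_cmult)
    also have "\<dots> \<le> ennreal (lam\<^sup>2) * (\<Sum>n. a n)"
      by (subst (2) suminf_ennreal_shift) (intro mult_left_mono, auto)
    finally show "(\<Sum>n. ennreal (\<rho> (Suc n) * (v (Suc (Suc n)))\<^sup>2)) \<le> ennreal (lam\<^sup>2) * (\<Sum>n. a n)" .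
  qed
  also have "\<dots> = (ennreal (lam\<^sup>2) + ennreal (lam\<^sup>2) + ennreal (lam\<^sup>2)) * (\<Sum>n. a n)" by (simp only: distrib_right)
  also have "ennreal (lam\<^sup>2) + ennreal (lam\<^sup>2) + ennreal (lam\<^sup>2) = ennreal (3 * lam\<^sup>2)"
    by (simp add: ennreal_plus[symmetric] del: ennreal_plus)
  finally show ?thesis by (simp add: wnorm_def a_def)
qed

text \<open>The square of g carries lam^(2n) and the convolution returns 1/(\<nu> lam^(2n)). The two
  cancel on every mode with the same constant, so the growth of the coefficients of \<open>B\<close>
  leaves no trace; the neighbouring modes are absorbed by the weights.\<close>

lemma wnorm_conv_le:
  assumes t: "t \<ge> 0" and \<nu>: "\<nu> > 0" and C: "C \<ge> 0"
    and g: "\<And>n. n \<ge> 1 \<Longrightarrow> continuous_on {0..t} (g n)"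
    and v: "\<And>n. continuous_on {0..t} (\<lambda>r. v r n)" "\<And>r. r \<in> {0..t} \<Longrightarrow> v r 0 = 0"
    and le: "\<And>n r. r \<in> {0..t} \<Longrightarrow> (g (Suc n) r)\<^sup>2 \<le> lam ^ (2 * Suc n) * C * ((v r n)\<^sup>2 + (v r (Suc n))\<^sup>2 + (v r (Suc (Suc n)))\<^sup>2)"
  shows "wnorm \<rho> (\<lambda>n. conv (\<nu> * lam ^ (2 * n)) (g n) t) \<le> ennreal (3 * lam\<^sup>2 * C / \<nu>) * (\<integral>\<^sup>+r\<in>{0..t}. wnorm \<rho> (v r) \<partial>lborel)"
proof -
  have lam0: "lam ^ k > 0" for k using lam by simp
  define V where "V = (\<lambda>n r. (v r n)\<^sup>2 + (v r (Suc n))\<^sup>2 + (v r (Suc (Suc n)))\<^sup>2)"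
  have V0: "V n r \<ge> 0" for n r by (simp add: V_def)
  have Vm: "(\<lambda>r. ennreal (\<rho> (Suc n) * V n r) * indicator {0..t} r) \<in> borel_measurable lborel" for n
  proof -
    have "continuous_on {0..t} (\<lambda>r. \<rho> (Suc n) * V n r)" unfolding V_def by (intro continuous_intros v)
    then have "(\<lambda>r. indicator {0..t} r *\<^sub>R (\<rho> (Suc n) * V n r)) \<in> borel_measurable borel"
      by (intro borel_measurable_continuous_on_indicator) auto
    then have "(\<lambda>r. ennreal (indicator {0..t} r *\<^sub>R (\<rho> (Suc n) * V n r))) \<in> borel_measurable lborel" by measurable
    also have "(\<lambda>r. ennreal (indicator {0..t} r *\<^sub>R (\<rho> (Suc n) * V n r))) = (\<lambda>r. ennreal (\<rho> (Suc n) * V n r) * indicator {0..t} r)"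
      by (auto simp: indicator_def fun_eq_iff)
    finally show ?thesis .
  qed
  have "wnorm \<rho> (\<lambda>n. conv (\<nu> * lam ^ (2 * n)) (g n) t)
     \<le> (\<Sum>n. ennreal (C / \<nu>) * (\<integral>\<^sup>+r. ennreal (\<rho> (Suc n) * V n r) * indicator {0..t} r \<partial>lborel))"
    unfolding wnorm_def
  proof (rule suminf_ennreal_mono)
    fix n
    define c where "c = \<nu> * lam ^ (2 * Suc n)"
    have c: "c > 0" unfolding c_def using \<nu> lam0 by (intro mult_pos_pos)
    have "ennreal (\<rho> (Suc n) * (conv c (g (Suc n)) t)\<^sup>2) = ennreal (\<rho> (Suc n)) * ennreal ((conv c (g (Suc n)) t)\<^sup>2)"
      using nonneg by (simp add: ennreal_mult)
    also have "\<dots> \<le> ennreal (\<rho> (Suc n)) * (ennreal (1 / c) * (\<integral>\<^sup>+r\<in>{0..t}. ennreal ((g (Suc n) r)\<^sup>2) \<partial>lborel))"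
      by (intro mult_left_mono conv_power2_le c t g) auto
    also have "\<dots> \<le> ennreal (\<rho> (Suc n)) * (ennreal (1 / c) * (\<integral>\<^sup>+r. ennreal (lam ^ (2 * Suc n) * C / \<rho> (Suc n)) * (ennreal (\<rho> (Suc n) * V n r) * indicator {0..t} r) \<partial>lborel))"
    proof (intro mult_left_mono nn_integral_mono)
      fix r
      show "ennreal ((g (Suc n) r)\<^sup>2) * indicator {0..t} r \<le> ennreal (lam ^ (2 * Suc n) * C / \<rho> (Suc n)) * (ennreal (\<rho> (Suc n) * V n r) * indicator {0..t} r)"
      proof (cases "r \<in> {0..t}")
        case True
        have "lam ^ (2 * Suc n) * C / \<rho> (Suc n) * (\<rho> (Suc n) * V n r) = lam ^ (2 * Suc n) * C * V n r"
          using pos[of "Suc n"] by (simp only: times_divide_eq_left) (simp add: field_simps del: power_Suc mult_Suc_right)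
        moreover have "0 \<le> lam ^ (2 * Suc n) * C / \<rho> (Suc n)" using lam0[of "2 * Suc n"] C pos[of "Suc n"] by (intro divide_nonneg_pos mult_nonneg_nonneg) auto
        moreover have "0 \<le> \<rho> (Suc n) * V n r" using nonneg V0 by (intro mult_nonneg_nonneg)
        ultimately have "ennreal (lam ^ (2 * Suc n) * C / \<rho> (Suc n)) * ennreal (\<rho> (Suc n) * V n r) = ennreal (lam ^ (2 * Suc n) * C * V n r)"
          by (simp only: ennreal_mult[symmetric])
        moreover have "(g (Suc n) r)\<^sup>2 \<le> lam ^ (2 * Suc n) * C * V n r" using le[OF True, of n] by (simp only: V_def)
        ultimately show ?thesis using True by (simp add: ennreal_leI del: power_Suc mult_Suc_right)
      qed simp
    qed auto
    also have "\<dots> = (ennreal (\<rho> (Suc n)) * ennreal (1 / c) * ennreal (lam ^ (2 * Suc n) * C / \<rho> (Suc n))) * (\<integral>\<^sup>+r. ennreal (\<rho> (Suc n) * V n r) * indicator {0..t} r \<partial>lborel)"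
      by (subst nn_integral_cmult[OF Vm]) (simp only: mult.assoc)
    also have "ennreal (\<rho> (Suc n)) * ennreal (1 / c) * ennreal (lam ^ (2 * Suc n) * C / \<rho> (Suc n)) = ennreal (\<rho> (Suc n) * (1 / c) * (lam ^ (2 * Suc n) * C / \<rho> (Suc n)))"
    proof -
      have "0 \<le> lam ^ (2 * Suc n) * C / \<rho> (Suc n)" using lam0[of "2 * Suc n"] C pos[of "Suc n"] by (intro divide_nonneg_pos mult_nonneg_nonneg) auto
      then show ?thesis using nonneg[of "Suc n"] c by (simp only: ennreal_mult[symmetric] mult_nonneg_nonneg divide_nonneg_pos zero_le_one)
    qed
    also have "\<rho> (Suc n) * (1 / c) * (lam ^ (2 * Suc n) * C / \<rho> (Suc n)) = C / \<nu>"
    proof -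
      have "r * (1 / (\<nu> * l)) * (l * C / r) = C / \<nu>" if "r > 0" "l > 0" for r l :: real using that \<nu> by (simp add: field_simps)
      from this[OF pos lam0] show ?thesis unfolding c_def .
    qed
    finally show "ennreal (\<rho> (Suc n) * (conv (\<nu> * lam ^ (2 * Suc n)) (g (Suc n)) t)\<^sup>2)
      \<le> ennreal (C / \<nu>) * (\<integral>\<^sup>+r. ennreal (\<rho> (Suc n) * V n r) * indicator {0..t} r \<partial>lborel)" unfolding c_def .
  qed
  also have "\<dots> = ennreal (C / \<nu>) * (\<integral>\<^sup>+r. (\<Sum>n. ennreal (\<rho> (Suc n) * V n r) * indicator {0..t} r) \<partial>lborel)"
    by (simp only: ennreal_suminf_cmult nn_integral_suminf[OF Vm])
  also have "\<dots> \<le> ennreal (C / \<nu>) * (\<integral>\<^sup>+r. ennreal (3 * lam\<^sup>2) * (wnorm \<rho> (v r) * indicator {0..t} r) \<partial>lborel)"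
  proof (intro mult_left_mono nn_integral_mono)
    fix r
    show "(\<Sum>n. ennreal (\<rho> (Suc n) * V n r) * indicator {0..t} r) \<le> ennreal (3 * lam\<^sup>2) * (wnorm \<rho> (v r) * indicator {0..t} r)"
    proof (cases "r \<in> {0..t}")
      case True
      then show ?thesis using wnorm_neighbours_le[of "v r"] v(2)[OF True] by (simp add: V_def)
    qed simp
  qed simp
  also have "(\<integral>\<^sup>+r. ennreal (3 * lam\<^sup>2) * (wnorm \<rho> (v r) * indicator {0..t} r) \<partial>lborel) = ennreal (3 * lam\<^sup>2) * (\<integral>\<^sup>+r\<in>{0..t}. wnorm \<rho> (v r) \<partial>lborel)"
  proof (rule nn_integral_cmult)
    have vm: "(\<lambda>r. ennreal (\<rho> (Suc n) * (v r (Suc n))\<^sup>2) * indicator {0..t} r) \<in> borel_measurable lborel" for n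
    proof -
      have "continuous_on {0..t} (\<lambda>r. \<rho> (Suc n) * (v r (Suc n))\<^sup>2)" by (intro continuous_intros v)
      then have "(\<lambda>r. indicator {0..t} r *\<^sub>R (\<rho> (Suc n) * (v r (Suc n))\<^sup>2)) \<in> borel_measurable borel"
        by (intro borel_measurable_continuous_on_indicator) auto
      then have "(\<lambda>r. ennreal (indicator {0..t} r *\<^sub>R (\<rho> (Suc n) * (v r (Suc n))\<^sup>2))) \<in> borel_measurable lborel" by measurable
      also have "(\<lambda>r. ennreal (indicator {0..t} r *\<^sub>R (\<rho> (Suc n) * (v r (Suc n))\<^sup>2))) = (\<lambda>r. ennreal (\<rho> (Suc n) * (v r (Suc n))\<^sup>2) * indicator {0..t} r)"
        by (auto simp: indicator_def fun_eq_iff)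
      finally show ?thesis .
    qed
    show "(\<lambda>r. wnorm \<rho> (v r) * indicator {0..t} r) \<in> borel_measurable lborel"
      unfolding wnorm_def ennreal_suminf_multc[symmetric] using vm by (rule borel_measurable_suminf_order)
  qed
  also have "ennreal (C / \<nu>) * (ennreal (3 * lam\<^sup>2) * (\<integral>\<^sup>+r\<in>{0..t}. wnorm \<rho> (v r) \<partial>lborel)) = ennreal (3 * lam\<^sup>2 * C / \<nu>) * (\<integral>\<^sup>+r\<in>{0..t}. wnorm \<rho> (v r) \<partial>lborel)"
    using C \<nu> by (simp add: ennreal_mult[symmetric] mult.assoc[symmetric] mult.commute)
  finally show ?thesis .
qed

end

text \<open>In each product one factor is at most C, which leaves the neighbours of u. The component
  u(n) occurs twice, and (2a + b + c)^2 \<le> 3 (4 a^2 + b^2 + c^2) accounts for the 12.\<close>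

lemma B_sum_power2_le:
  assumes lam: "lam > 1" and P: "\<And>k. \<bar>P k\<bar> \<le> C" and Q: "\<And>k. \<bar>Q k\<bar> \<le> C"
  shows "(B lam u P (Suc n) + B lam Q u (Suc n))\<^sup>2 \<le> lam ^ (2 * Suc n) * (12 * C\<^sup>2) * ((u n)\<^sup>2 + (u (Suc n))\<^sup>2 + (u (Suc (Suc n)))\<^sup>2)"
proof -
  have C: "C \<ge> 0" using P[of 0] by linarith
  define L where "L = lam ^ Suc n"
  have L: "L \<ge> 0" "lam ^ n \<ge> 0" "lam ^ n \<le> L" using lam by (auto simp: L_def)
  have tr: "\<bar>a * x * y\<bar> \<le> L * (C * \<bar>z\<bar>)" if "0 \<le> a" "a \<le> L" "(\<bar>x\<bar> \<le> C \<and> y = z) \<or> (\<bar>y\<bar> \<le> C \<and> x = z)" for a x y z :: real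
  proof -
    have "\<bar>x\<bar> * \<bar>y\<bar> \<le> C * \<bar>z\<bar>"
      using that(3)
    proof
      assume *: "\<bar>x\<bar> \<le> C \<and> y = z"
      then have "\<bar>x\<bar> * \<bar>z\<bar> \<le> C * \<bar>z\<bar>" by (intro mult_right_mono) auto
      then show ?thesis using * by simp
    next
      assume *: "\<bar>y\<bar> \<le> C \<and> x = z"
      then have "\<bar>y\<bar> * \<bar>z\<bar> \<le> C * \<bar>z\<bar>" by (intro mult_right_mono) auto
      then show ?thesis using * by (simp add: mult.commute)
    qed
    then have "a * (\<bar>x\<bar> * \<bar>y\<bar>) \<le> L * (C * \<bar>z\<bar>)" by (rule mult_mono[OF that(2)]) (use L(1) in auto)
    then show ?thesis using that(1) by (simp add: abs_mult mult.assoc)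
  qed
  have "B lam u P (Suc n) + B lam Q u (Suc n) = (lam ^ n * u n * P n + lam ^ n * Q n * u n) - (L * u (Suc n) * P (Suc (Suc n)) + L * Q (Suc n) * u (Suc (Suc n)))"
    by (simp add: B_def L_def)
  also have "\<bar>\<dots>\<bar> \<le> \<bar>lam ^ n * u n * P n\<bar> + \<bar>lam ^ n * Q n * u n\<bar> + \<bar>L * u (Suc n) * P (Suc (Suc n))\<bar> + \<bar>L * Q (Suc n) * u (Suc (Suc n))\<bar>"
    by linarith
  also have "\<dots> \<le> L * (C * \<bar>u n\<bar>) + L * (C * \<bar>u n\<bar>) + L * (C * \<bar>u (Suc n)\<bar>) + L * (C * \<bar>u (Suc (Suc n))\<bar>)"
    using L P Q by (intro add_mono tr) auto
  also have "\<dots> = L * C * (2 * \<bar>u n\<bar> + \<bar>u (Suc n)\<bar> + \<bar>u (Suc (Suc n))\<bar>)" by (simp add: algebra_simps)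
  finally have "\<bar>B lam u P (Suc n) + B lam Q u (Suc n)\<bar>\<^sup>2 \<le> (L * C * (2 * \<bar>u n\<bar> + \<bar>u (Suc n)\<bar> + \<bar>u (Suc (Suc n))\<bar>))\<^sup>2"
    by (rule power_mono) simp
  also have "\<dots> = (L * C)\<^sup>2 * (2 * \<bar>u n\<bar> + \<bar>u (Suc n)\<bar> + \<bar>u (Suc (Suc n))\<bar>)\<^sup>2" by (rule power_mult_distrib)
  also have "\<dots> \<le> (L * C)\<^sup>2 * (12 * ((u n)\<^sup>2 + (u (Suc n))\<^sup>2 + (u (Suc (Suc n)))\<^sup>2))"
  proof (rule mult_left_mono)
    have *: "(2 * a + b + c)\<^sup>2 \<le> 12 * (a\<^sup>2 + b\<^sup>2 + c\<^sup>2)" for a b c :: real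
    proof -
      have "3 * (x\<^sup>2 + y\<^sup>2 + z\<^sup>2) - (x + y + z)\<^sup>2 = (x - y)\<^sup>2 + (x - z)\<^sup>2 + (y - z)\<^sup>2" for x y z :: real
        by (simp add: power2_eq_square algebra_simps)
      from this[of "2 * a" b c] have "(2 * a + b + c)\<^sup>2 \<le> 3 * ((2 * a)\<^sup>2 + b\<^sup>2 + c\<^sup>2)"
        by (smt (verit) zero_le_power2)
      also have "\<dots> \<le> 12 * (a\<^sup>2 + b\<^sup>2 + c\<^sup>2)" by (simp add: power_mult_distrib)
      finally show ?thesis .
    qed
    show "(2 * \<bar>u n\<bar> + \<bar>u (Suc n)\<bar> + \<bar>u (Suc (Suc n))\<bar>)\<^sup>2 \<le> 12 * ((u n)\<^sup>2 + (u (Suc n))\<^sup>2 + (u (Suc (Suc n)))\<^sup>2)"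
      using *[of "\<bar>u n\<bar>" "\<bar>u (Suc n)\<bar>" "\<bar>u (Suc (Suc n))\<bar>"] by simp
  qed simp
  also have "\<dots> = lam ^ (2 * Suc n) * (12 * C\<^sup>2) * ((u n)\<^sup>2 + (u (Suc n))\<^sup>2 + (u (Suc (Suc n)))\<^sup>2)"
    unfolding L_def power_even_eq power_mult_distrib by (simp only: mult_ac)
  finally show ?thesis by simp
qed

text \<open>Joint measurability in time and \<omega>, required for exchanging the time integral of
  the norm with the expectation.\<close>

lemma borel_measurable_wnorm_paths:
  fixes u :: "real \<Rightarrow> 'a \<Rightarrow> nat \<Rightarrow> real"
  assumes T: "T \<ge> 0" and meas: "\<And>n t. t \<in> {0..T} \<Longrightarrow> (\<lambda>\<omega>. u t \<omega> n) \<in> borel_measurable M"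
    and cont: "\<And>n \<omega>. \<omega> \<in> space M \<Longrightarrow> continuous_on {0..T} (\<lambda>t. u t \<omega> n)" and \<rho>: "\<And>n. \<rho> n \<ge> 0"
  shows "(\<lambda>(t, \<omega>). wnorm \<rho> (u t \<omega>) * indicator {0..T} t) \<in> borel_measurable (lborel \<Otimes>\<^sub>M M)"
proof -
  have "(\<lambda>z. ennreal (\<rho> (Suc n) * (indicator {0..T} (fst z) * u (fst z) (snd z) (Suc n))\<^sup>2)) \<in> borel_measurable (lborel \<Otimes>\<^sub>M M)" for n
    using borel_measurable_continuous_paths[OF T meas cont, of "Suc n"] by (simp add: split_beta')
  then have "(\<lambda>z. \<Sum>n. ennreal (\<rho> (Suc n) * (indicator {0..T} (fst z) * u (fst z) (snd z) (Suc n))\<^sup>2)) \<in> borel_measurable (lborel \<Otimes>\<^sub>M M)"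
    by (rule borel_measurable_suminf_order)
  also have "(\<lambda>z. \<Sum>n. ennreal (\<rho> (Suc n) * (indicator {0..T} (fst z) * u (fst z) (snd z) (Suc n))\<^sup>2)) = (\<lambda>(t, \<omega>). wnorm \<rho> (u t \<omega>) * indicator {0..T} t)"
    by (auto simp: fun_eq_iff wnorm_def indicator_def)
  finally show ?thesis .
qed

text \<open>The weight is constant in time and commutes with the pathwise drift estimate, so
  Gronwall's inequality applies to the mean of the weighted norm. It needs this mean to be
  integrable in time, while only the pathwise integral is known to be finite. The weight is
  therefore cut off on the event that this integral exceeds R, and R is removed by monotone
  convergence. The value of \<open>K\<close> is the product of 2 from splitting the norm, 3 lam^2 /
  \<nu> from \<open>wnorm_conv_le\<close> and 12 C^2 from \<open>B_sum_power2_le\<close>.\<close>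

lemma (in prob_space) weighted_gronwall:
  fixes u P Q :: "real \<Rightarrow> 'a \<Rightarrow> nat \<Rightarrow> real"
  assumes wt: "weights lam \<rho>" and T: "T > 0" and \<nu>: "\<nu> > 0" and C: "C > 0" and b: "b \<ge> 0"
    and meas: "\<And>n t. t \<in> {0..T} \<Longrightarrow> (\<lambda>\<omega>. u t \<omega> n) \<in> borel_measurable M"
    and cont: "\<And>n \<omega>. \<omega> \<in> space M \<Longrightarrow> continuous_on {0..T} (\<lambda>t. u t \<omega> n)"
      "\<And>n \<omega>. \<omega> \<in> space M \<Longrightarrow> continuous_on {0..T} (\<lambda>t. P t \<omega> n)"
      "\<And>n \<omega>. \<omega> \<in> space M \<Longrightarrow> continuous_on {0..T} (\<lambda>t. Q t \<omega> n)"
      "\<And>n t. t \<in> {0..T} \<Longrightarrow> (\<lambda>\<omega>. P t \<omega> n) \<in> borel_measurable M"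
      "\<And>n t. t \<in> {0..T} \<Longrightarrow> (\<lambda>\<omega>. Q t \<omega> n) \<in> borel_measurable M"
    and u0: "\<And>t \<omega>. \<omega> \<in> space M \<Longrightarrow> t \<in> {0..T} \<Longrightarrow> u t \<omega> 0 = 0"
    and PQ: "AE \<omega> in M. \<forall>t\<in>{0..T}. \<forall>k. \<bar>P t \<omega> k\<bar> \<le> C \<and> \<bar>Q t \<omega> k\<bar> \<le> C"
    and fin: "AE \<omega> in M. (\<integral>\<^sup>+t\<in>{0..T}. wnorm \<rho> (u t \<omega>) \<partial>lborel) < \<infinity>"
    and w: "w \<in> borel_measurable M" "\<And>\<omega>. \<omega> \<in> space M \<Longrightarrow> 0 \<le> w \<omega>" "\<And>\<omega>. \<omega> \<in> space M \<Longrightarrow> w \<omega> \<le> Cw"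
    and F: "\<And>t. t \<in> {0..T} \<Longrightarrow> (\<integral>\<^sup>+\<omega>. ennreal (w \<omega>) * wnorm \<rho> (\<lambda>n. u t \<omega> n -
       conv (\<nu> * lam ^ (2 * n)) (\<lambda>r. B lam (u r \<omega>) (P r \<omega>) n + B lam (Q r \<omega>) (u r \<omega>) n) t) \<partial>M) \<le> ennreal b"
    and t: "t \<in> {0..T}"
  shows "(\<integral>\<^sup>+\<omega>. ennreal (w \<omega>) * wnorm \<rho> (u t \<omega>) \<partial>M) \<le> ennreal (4 * b * exp (144 * lam\<^sup>2 * C\<^sup>2 / \<nu> * T))"
proof -
  interpret W: weights lam \<rho> by (rule wt)
  have T0: "T \<ge> 0" using T by simp
  note lam = W.lam
  define K where "K = 72 * lam\<^sup>2 * C\<^sup>2 / \<nu>"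
  have K: "K > 0" using lam C \<nu> by (simp add: K_def)
  define v where "v = (\<lambda>t \<omega>. wnorm \<rho> (u t \<omega>) * indicator {0..T} t)"
  have vm: "case_prod v \<in> borel_measurable (lborel \<Otimes>\<^sub>M M)"
    unfolding v_def using borel_measurable_wnorm_paths[OF T0 meas cont(1) W.nonneg] by simp
  have vm': "(\<lambda>(\<omega>, t). v t \<omega>) \<in> borel_measurable (M \<Otimes>\<^sub>M lborel)"
    using measurable_compose[OF measurable_pair_swap' vm] by (simp add: split_beta')
  have wn_m: "(\<lambda>\<omega>. wnorm \<rho> (u s \<omega>)) \<in> borel_measurable M" if "s \<in> {0..T}" for s
    unfolding wnorm_def using meas[OF that] by (intro borel_measurable_suminf_order) measurable
  define I where "I = (\<lambda>\<omega>. \<integral>\<^sup>+s. v s \<omega> \<partial>lborel)"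
  have Im: "I \<in> borel_measurable M" unfolding I_def using vm' by (rule lborel.borel_measurable_nn_integral)
  define wR where "wR = (\<lambda>R \<omega>. ennreal (w \<omega>) * indicator {\<omega>. I \<omega> \<le> of_nat R} \<omega>)"
  have ind_m: "(\<lambda>\<omega>. indicator {\<omega>. I \<omega> \<le> of_nat R} \<omega> :: ennreal) \<in> borel_measurable M" for R :: nat
  proof -
    have "{\<omega> \<in> space M. I \<omega> \<le> of_nat R} \<in> sets M" using Im by measurable
    then have "(indicator {\<omega> \<in> space M. I \<omega> \<le> of_nat R} :: 'a \<Rightarrow> ennreal) \<in> borel_measurable M" by (rule borel_measurable_indicator)
    then show ?thesis by (rule measurable_cong[THEN iffD1, rotated]) (auto simp: indicator_def)
  qed
  have wRm: "wR R \<in> borel_measurable M" for R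
    unfolding wR_def using ind_m w(1) by measurable
  have wR_le: "wR R \<omega> \<le> ennreal (w \<omega>)" for R \<omega> by (auto simp: wR_def indicator_def)
  define \<phi> where "\<phi> = (\<lambda>R s. \<integral>\<^sup>+\<omega>. wR R \<omega> * wnorm \<rho> (u s \<omega>) \<partial>M)"
  interpret PS: pair_sigma_finite lborel M by unfold_locales
  have int_\<phi>: "(\<integral>\<^sup>+r\<in>{0..s}. \<phi> R r \<partial>lborel) = (\<integral>\<^sup>+\<omega>. wR R \<omega> * (\<integral>\<^sup>+r\<in>{0..s}. wnorm \<rho> (u r \<omega>) \<partial>lborel) \<partial>M)" if s: "s \<in> {0..T}" for R s
  proof -
    have eq: "wnorm \<rho> (u r \<omega>) * indicator {0..s} r = v r \<omega> * indicator {0..s} r" for r \<omega>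
      using s by (auto simp: v_def indicator_def)
    have m: "(\<lambda>(r, \<omega>). wR R \<omega> * (v r \<omega> * indicator {0..s} r)) \<in> borel_measurable (lborel \<Otimes>\<^sub>M M)"
      using vm wRm[of R] by measurable
    have "(\<integral>\<^sup>+r\<in>{0..s}. \<phi> R r \<partial>lborel) = (\<integral>\<^sup>+r. \<integral>\<^sup>+\<omega>. wR R \<omega> * (v r \<omega> * indicator {0..s} r) \<partial>M \<partial>lborel)"
    proof (rule nn_integral_cong)
      fix r
      show "\<phi> R r * indicator {0..s} r = (\<integral>\<^sup>+\<omega>. wR R \<omega> * (v r \<omega> * indicator {0..s} r) \<partial>M)"
        using s by (cases "r \<in> {0..s}") (auto simp: \<phi>_def v_def)
    qed
    also have "\<dots> = (\<integral>\<^sup>+\<omega>. \<integral>\<^sup>+r. wR R \<omega> * (v r \<omega> * indicator {0..s} r) \<partial>lborel \<partial>M)"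
      using PS.Fubini'[OF m] by simp
    also have "\<dots> = (\<integral>\<^sup>+\<omega>. wR R \<omega> * (\<integral>\<^sup>+r\<in>{0..s}. wnorm \<rho> (u r \<omega>) \<partial>lborel) \<partial>M)"
    proof (rule nn_integral_cong)
      fix \<omega> assume \<omega>: "\<omega> \<in> space M"
      have "(\<lambda>r. v r \<omega>) \<in> borel_measurable lborel" using measurable_compose[OF measurable_Pair2'[OF \<omega>] vm] by simp
      then have "(\<lambda>r. v r \<omega> * indicator {0..s} r) \<in> borel_measurable lborel" by measurable
      then show "(\<integral>\<^sup>+r. wR R \<omega> * (v r \<omega> * indicator {0..s} r) \<partial>lborel) = wR R \<omega> * (\<integral>\<^sup>+r\<in>{0..s}. wnorm \<rho> (u r \<omega>) \<partial>lborel)"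
        unfolding eq by (rule nn_integral_cmult)
    qed
    finally show ?thesis .
  qed
  have \<phi>_bound: "\<phi> R t \<le> ennreal (2 * (2 * b) * exp (2 * K * T))" for R
  proof (rule gronwall_nn_integral[OF _ K _ _ t])
    show "0 \<le> 2 * b" using b by simp
    have TT: "T \<in> {0..T}" using T by simp
    have "(\<integral>\<^sup>+r\<in>{0..T}. \<phi> R r \<partial>lborel) \<le> (\<integral>\<^sup>+\<omega>. ennreal Cw * of_nat R \<partial>M)"
      unfolding int_\<phi>[OF TT]
    proof (rule nn_integral_mono)
      fix \<omega> assume \<omega>: "\<omega> \<in> space M"
      have I_eq: "(\<integral>\<^sup>+r\<in>{0..T}. wnorm \<rho> (u r \<omega>) \<partial>lborel) = I \<omega>" by (simp add: I_def v_def)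
      show "wR R \<omega> * (\<integral>\<^sup>+r\<in>{0..T}. wnorm \<rho> (u r \<omega>) \<partial>lborel) \<le> ennreal Cw * of_nat R"
        unfolding I_eq wR_def using w(3)[OF \<omega>] by (cases "I \<omega> \<le> of_nat R") (auto intro!: mult_mono ennreal_leI)
    qed
    also have "\<dots> < \<infinity>" by (simp add: emeasure_space_1 ennreal_mult_less_top of_nat_less_top)
    finally show "(\<integral>\<^sup>+r\<in>{0..T}. \<phi> R r \<partial>lborel) < \<infinity>" .
    show "\<phi> R s \<le> ennreal (2 * b) + ennreal K * (\<integral>\<^sup>+r\<in>{0..s}. \<phi> R r \<partial>lborel)" if s: "s \<in> {0..T}" for s
    proof -
      define g where "g = (\<lambda>\<omega> n r. B lam (u r \<omega>) (P r \<omega>) n + B lam (Q r \<omega>) (u r \<omega>) n)"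
      define FF where "FF = (\<lambda>\<omega>. wnorm \<rho> (\<lambda>n. u s \<omega> n - conv (\<nu> * lam ^ (2 * n)) (g \<omega> n) s))"
      define J where "J = (\<lambda>\<omega>. \<integral>\<^sup>+r\<in>{0..s}. wnorm \<rho> (u r \<omega>) \<partial>lborel)"
      have Bc: "continuous_on {0..T} (\<lambda>r. B lam (f r \<omega>) (h r \<omega>) n)"
        if "\<And>n. continuous_on {0..T} (\<lambda>r. f r \<omega> n)" "\<And>n. continuous_on {0..T} (\<lambda>r. h r \<omega> n)" for f h :: "real \<Rightarrow> 'a \<Rightarrow> nat \<Rightarrow> real" and \<omega> n
        unfolding B_def using that by (cases "n = 0") (auto intro!: continuous_intros)
      have gc: "continuous_on {0..T} (g \<omega> n)" if "\<omega> \<in> space M" for \<omega> n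
        unfolding g_def using cont that by (intro continuous_on_add Bc)
      have sub: "{0..s} \<subseteq> {0..T}" using s by auto
      have gm: "(\<lambda>\<omega>. g \<omega> n r) \<in> borel_measurable M" if "r \<in> {0..T}" for r n
        unfolding g_def B_def using meas[OF that] cont(4)[OF that] cont(5)[OF that] by (cases "n = 0") simp_all
      have cm: "(\<lambda>\<omega>. conv (\<nu> * lam ^ (2 * n)) (g \<omega> n) s) \<in> borel_measurable M" for n
        by (rule borel_measurable_conv[OF s, of "\<lambda>r \<omega>. g \<omega> n r", OF gm gc])
      have [measurable]: "FF \<in> borel_measurable M"
        unfolding FF_def wnorm_def using cm meas[OF s] by (intro borel_measurable_suminf_order) measurable
      have "J = (\<lambda>\<omega>. \<integral>\<^sup>+r. v r \<omega> * indicator {0..s} r \<partial>lborel)"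
        unfolding J_def v_def using s by (intro ext nn_integral_cong) (auto simp: indicator_def)
      moreover have "(\<lambda>\<omega>. \<integral>\<^sup>+r. v r \<omega> * indicator {0..s} r \<partial>lborel) \<in> borel_measurable M"
        by (rule lborel.borel_measurable_nn_integral) (use vm' in measurable)
      ultimately have [measurable]: "J \<in> borel_measurable M" by simp
      note [measurable] = wRm[of R]
      have "\<phi> R s \<le> (\<integral>\<^sup>+\<omega>. 2 * (wR R \<omega> * FF \<omega>) + ennreal K * (wR R \<omega> * J \<omega>) \<partial>M)"
        unfolding \<phi>_def
      proof (rule nn_integral_mono_AE)
        show "AE \<omega> in M. wR R \<omega> * wnorm \<rho> (u s \<omega>) \<le> 2 * (wR R \<omega> * FF \<omega>) + ennreal K * (wR R \<omega> * J \<omega>)"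
          using PQ AE_space
        proof eventually_elim
          case (elim \<omega>)
          have "wnorm \<rho> (\<lambda>n. conv (\<nu> * lam ^ (2 * n)) (g \<omega> n) s) \<le> ennreal (3 * lam\<^sup>2 * (12 * C\<^sup>2) / \<nu>) * J \<omega>"
            unfolding J_def
          proof (rule W.wnorm_conv_le)
            show "0 \<le> s" using s by simp
            show "continuous_on {0..s} (g \<omega> n)" for n using continuous_on_subset[OF gc[OF elim(2)] sub] .
            show "continuous_on {0..s} (\<lambda>r. u r \<omega> n)" for n using continuous_on_subset[OF cont(1)[OF elim(2)] sub] .
            show "u r \<omega> 0 = 0" if "r \<in> {0..s}" for r using u0[OF elim(2)] that sub by blast
            show "(g \<omega> (Suc n) r)\<^sup>2 \<le> lam ^ (2 * Suc n) * (12 * C\<^sup>2) * ((u r \<omega> n)\<^sup>2 + (u r \<omega> (Suc n))\<^sup>2 + (u r \<omega> (Suc (Suc n)))\<^sup>2)"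
              if "r \<in> {0..s}" for n r
              unfolding g_def using elim(1) that sub by (intro B_sum_power2_le lam) auto
          qed (use \<nu> in auto)
          then have cv: "2 * wnorm \<rho> (\<lambda>n. conv (\<nu> * lam ^ (2 * n)) (g \<omega> n) s) \<le> ennreal K * J \<omega>"
          proof -
            assume a: "wnorm \<rho> (\<lambda>n. conv (\<nu> * lam ^ (2 * n)) (g \<omega> n) s) \<le> ennreal (3 * lam\<^sup>2 * (12 * C\<^sup>2) / \<nu>) * J \<omega>"
            have "ennreal K = 2 * ennreal (3 * lam\<^sup>2 * (12 * C\<^sup>2) / \<nu>)"
            proof -
              have "2 * ennreal (3 * lam\<^sup>2 * (12 * C\<^sup>2) / \<nu>) = ennreal 2 * ennreal (3 * lam\<^sup>2 * (12 * C\<^sup>2) / \<nu>)" by simp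
              also have "\<dots> = ennreal (2 * (3 * lam\<^sup>2 * (12 * C\<^sup>2) / \<nu>))" using \<nu> by (intro ennreal_mult[symmetric]) auto
              finally show ?thesis unfolding K_def by (simp add: mult.assoc)
            qed
            then show ?thesis using mult_left_mono[OF a, of 2] by (simp add: mult.assoc)
          qed
          have "wnorm \<rho> (u s \<omega>) \<le> 2 * FF \<omega> + 2 * wnorm \<rho> (\<lambda>n. conv (\<nu> * lam ^ (2 * n)) (g \<omega> n) s)"
            using wnorm_add_le[of \<rho> "\<lambda>n. u s \<omega> n - conv (\<nu> * lam ^ (2 * n)) (g \<omega> n) s" "\<lambda>n. conv (\<nu> * lam ^ (2 * n)) (g \<omega> n) s"] W.nonneg
            unfolding FF_def by simp
          also have "\<dots> \<le> 2 * FF \<omega> + ennreal K * J \<omega>" using cv by (rule add_left_mono)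
          finally have "wR R \<omega> * wnorm \<rho> (u s \<omega>) \<le> wR R \<omega> * (2 * FF \<omega> + ennreal K * J \<omega>)" by (rule mult_left_mono) simp
          then show ?case by (simp only: distrib_left mult.left_commute)
        qed
      qed
      also have "\<dots> = 2 * (\<integral>\<^sup>+\<omega>. wR R \<omega> * FF \<omega> \<partial>M) + ennreal K * (\<integral>\<^sup>+\<omega>. wR R \<omega> * J \<omega> \<partial>M)"
        by (subst nn_integral_add, measurable, subst nn_integral_cmult, measurable, subst nn_integral_cmult, measurable)
      also have "\<dots> \<le> 2 * ennreal b + ennreal K * (\<integral>\<^sup>+r\<in>{0..s}. \<phi> R r \<partial>lborel)"
      proof (rule add_mono)
        have "(\<integral>\<^sup>+\<omega>. wR R \<omega> * FF \<omega> \<partial>M) \<le> (\<integral>\<^sup>+\<omega>. ennreal (w \<omega>) * FF \<omega> \<partial>M)"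
          by (intro nn_integral_mono mult_right_mono wR_le) simp
        also have "\<dots> \<le> ennreal b" using F[OF s] unfolding FF_def g_def .
        finally show "2 * (\<integral>\<^sup>+\<omega>. wR R \<omega> * FF \<omega> \<partial>M) \<le> 2 * ennreal b" by (rule mult_left_mono) simp
        show "ennreal K * (\<integral>\<^sup>+\<omega>. wR R \<omega> * J \<omega> \<partial>M) \<le> ennreal K * (\<integral>\<^sup>+r\<in>{0..s}. \<phi> R r \<partial>lborel)"
          unfolding int_\<phi>[OF s] J_def ..
      qed
      also have "2 * ennreal b = ennreal (2 * b)" using b by (simp add: ennreal_mult)
      finally show ?thesis .
    qed
  qed
  have inc: "incseq (\<lambda>R \<omega>. wR R \<omega> * wnorm \<rho> (u t \<omega>))"
  proof (rule incseq_SucI, rule le_funI)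
    fix R \<omega>
    have "wR R \<omega> \<le> wR (Suc R) \<omega>"
    proof (cases "I \<omega> \<le> of_nat R")
      case True
      then have "I \<omega> \<le> of_nat (Suc R)" by (rule order.trans) simp
      then show ?thesis using True by (simp add: wR_def)
    qed (simp add: wR_def)
    then show "wR R \<omega> * wnorm \<rho> (u t \<omega>) \<le> wR (Suc R) \<omega> * wnorm \<rho> (u t \<omega>)" by (rule mult_right_mono) simp
  qed
  have "(\<integral>\<^sup>+\<omega>. ennreal (w \<omega>) * wnorm \<rho> (u t \<omega>) \<partial>M) \<le> (\<integral>\<^sup>+\<omega>. (SUP R. wR R \<omega> * wnorm \<rho> (u t \<omega>)) \<partial>M)"
  proof (rule nn_integral_mono_AE)
    show "AE \<omega> in M. ennreal (w \<omega>) * wnorm \<rho> (u t \<omega>) \<le> (SUP R. wR R \<omega> * wnorm \<rho> (u t \<omega>))"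
      using fin
    proof eventually_elim
      case (elim \<omega>)
      have "I \<omega> < \<infinity>" using elim by (simp add: I_def v_def)
      then obtain r where "I \<omega> = ennreal r" "r \<ge> 0" by (cases "I \<omega>") auto
      moreover obtain R :: nat where "r \<le> real R" using real_arch_simple by blast
      ultimately have "I \<omega> \<le> of_nat R" by (simp add: ennreal_of_nat_eq_real_of_nat ennreal_leI)
      then have "ennreal (w \<omega>) * wnorm \<rho> (u t \<omega>) = wR R \<omega> * wnorm \<rho> (u t \<omega>)" by (simp add: wR_def)
      also have "\<dots> \<le> (SUP R. wR R \<omega> * wnorm \<rho> (u t \<omega>))" by (rule SUP_upper) simp
      finally show ?case .
    qed
  qed
  also have "\<dots> = (SUP R. \<integral>\<^sup>+\<omega>. wR R \<omega> * wnorm \<rho> (u t \<omega>) \<partial>M)"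
    using inc wRm wn_m[OF t] by (intro nn_integral_monotone_convergence_SUP borel_measurable_times_ennreal)
  also have "\<dots> \<le> ennreal (2 * (2 * b) * exp (2 * K * T))"
    using \<phi>_bound by (intro SUP_least) (simp add: \<phi>_def)
  also have "2 * (2 * b) * exp (2 * K * T) = 4 * b * exp (144 * lam\<^sup>2 * C\<^sup>2 / \<nu> * T)" by (simp add: K_def)
  finally show ?thesis .
qed

section \<open>Forcing of the rescaled difference\<close>

lemma continuous_on_indefinite_lborel:
  fixes g :: "real \<Rightarrow> real"
  assumes "continuous_on {0..T} g"
  shows "continuous_on {0..T} (\<lambda>s. LINT r:{0..s}|lborel. g r)"
proof -
  have "continuous_on {0..T} (\<lambda>s. integral {0..s} g)"
    using assms by (intro indefinite_integral_continuous_1 integrable_continuous_interval)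
  then show ?thesis
  proof (rule continuous_on_eq)
    fix s assume "s \<in> {0..T}"
    then have "continuous_on {0..s} g" using assms by (auto intro: continuous_on_subset)
    then show "integral {0..s} g = (LINT r:{0..s}|lborel. g r)"
      using set_borel_integral_eq_integral(2)[OF continuous_on_set_integrable_lborel] by metis
  qed
qed

lemma lborel_integral_abs_le:
  fixes g :: "real \<Rightarrow> real"
  assumes s: "s \<ge> 0" and g: "continuous_on {0..s} g" and le: "\<And>r. r \<in> {0..s} \<Longrightarrow> \<bar>g r\<bar> \<le> C"
  shows "\<bar>LINT r:{0..s}|lborel. g r\<bar> \<le> s * C"
proof -
  have "\<bar>LINT r:{0..s}|lborel. g r\<bar> \<le> (LINT r:{0..s}|lborel. \<bar>g r\<bar>)"
    using set_integral_norm_bound[OF continuous_on_set_integrable_lborel[OF g]] by simp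
  also have "\<dots> \<le> (LINT r:{0..s}|lborel. C)"
    using g le by (intro set_integral_mono continuous_on_set_integrable_lborel continuous_intros) auto
  also have "\<dots> = s * C" using s by (simp add: set_lebesgue_integral_def)
  finally show ?thesis .
qed

lemma B_diff_decomp:
  "B lam X X n - B lam Y Y n = B lam (\<lambda>k. X k - Y k) X n + B lam Y (\<lambda>k. X k - Y k) n"
  by (simp add: B_def algebra_simps)

lemma B_left_lin: "B lam (\<lambda>k. a * X k - Z k) Y n = a * B lam X Y n - B lam Z Y n"
  by (simp add: B_def algebra_simps)

lemma B_right_lin: "B lam Y (\<lambda>k. a * X k - Z k) n = a * B lam Y X n - B lam Y Z n"
  by (simp add: B_def algebra_simps)

lemma B_right_diff: "B lam Y (\<lambda>k. X k - Z k) n = B lam Y X n - B lam Y Z n"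
  by (simp add: B_def algebra_simps)

lemma continuous_on_B:
  assumes "\<And>n. continuous_on R (\<lambda>r. f r n)" "\<And>n. continuous_on R (\<lambda>r. h r n)"
  shows "continuous_on R (\<lambda>r. B lam (f r) (h r) n)"
proof (cases "n = 0")
  case False
  then show ?thesis unfolding B_def
    by (simp only: if_False) (intro continuous_on_diff continuous_on_mult continuous_on_const assms)
qed (simp add: B_def)

lemma ennreal_le_suminf: "f k \<le> (\<Sum>k. f k :: ennreal)"
  using sum_le_suminf[OF summableI, of "{k}" f] by simp

lemma ell2_term_le:
  assumes "(\<Sum>k. ennreal ((y k)\<^sup>2)) \<le> ennreal A" "A \<ge> 0"
  shows "\<bar>y k\<bar> \<le> sqrt A"
proof -
  have "ennreal ((y k)\<^sup>2) \<le> (\<Sum>k. ennreal ((y k)\<^sup>2))"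
    by (rule ennreal_le_suminf)
  then have "ennreal ((y k)\<^sup>2) \<le> ennreal A" using assms(1) by (rule order.trans)
  then have "(y k)\<^sup>2 \<le> A" using assms(2) by (simp add: ennreal_le_iff)
  then have "sqrt ((y k)\<^sup>2) \<le> sqrt A" by (rule real_sqrt_le_mono)
  then show ?thesis by simp
qed

lemma abs_B_le:
  assumes lam: "lam > 1" and f: "\<And>k. \<bar>f k\<bar> \<le> C" and g: "\<And>k. \<bar>g k\<bar> \<le> C"
  shows "\<bar>B lam f g n\<bar> \<le> 2 * lam ^ n * C\<^sup>2"
proof (cases "n = 0")
  case True
  then show ?thesis using lam by (simp add: B_def)
next
  case False
  have C: "C \<ge> 0" using f[of 0] by linarith
  have fg: "\<bar>f i * g j\<bar> \<le> C\<^sup>2" for i j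
    unfolding abs_mult power2_eq_square using f g C by (intro mult_mono) auto
  have "\<bar>B lam f g n\<bar> \<le> lam ^ (n - 1) * \<bar>f (n - 1) * g (n - 1)\<bar> + lam ^ n * \<bar>f n * g (n + 1)\<bar>"
    using False lam abs_triangle_ineq4[of "lam ^ (n - 1) * f (n - 1) * g (n - 1)" "lam ^ n * f n * g (n + 1)"]
    by (simp add: B_def abs_mult mult.assoc)
  also have "\<dots> \<le> lam ^ n * C\<^sup>2 + lam ^ n * C\<^sup>2"
    using lam fg by (intro add_mono mult_mono power_increasing) auto
  finally show ?thesis by simp
qed

lemma eps_bounds:
  assumes "N \<ge> 1" shows "0 < eps \<alpha> N" "eps \<alpha> N \<le> 1"
proof -
  have "(\<Sum>j\<in>{1}. real j powr (- 2 * \<alpha>)) \<le> (\<Sum>j=1..N. real j powr (- 2 * \<alpha>))"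
    using assms by (intro sum_mono2) auto
  then have "1 \<le> (\<Sum>j=1..N. real j powr (- 2 * \<alpha>))" by simp
  then show "0 < eps \<alpha> N" "eps \<alpha> N \<le> 1" unfolding eps_def by (simp_all add: inverse_le_1_iff)
qed

lemma det_weak_solution_continuous_on:
  assumes det: "det_weak_solution lam \<nu> x T Y"
  shows "continuous_on {0..T} (\<lambda>t. Y t n)"
proof (cases "n = 0")
  case True
  have "continuous_on {0..T} (\<lambda>t. 0 :: real)" by simp
  then show ?thesis by (rule continuous_on_eq) (use det in \<open>simp add: True det_weak_solution_def\<close>)
next
  case False
  then have "\<forall>t\<in>{0..T}. ((\<lambda>t. Y t n) has_real_derivative (B lam (Y t) (Y t) n + \<nu> * S lam (Y t) n)) (at t within {0..T})"
    using det by (simp add: det_weak_solution_def)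
  then show ?thesis by (intro DERIV_continuous_on[where D = "\<lambda>t. B lam (Y t) (Y t) n + \<nu> * S lam (Y t) n"]) auto
qed

text \<open>One N with its probability space, and one constant \<open>A\<close> for the squared l2
  norms of both solutions. The bounds proved inside display their dependence on N, so that they can
  be used uniformly in N and in the space.\<close>

locale approx_pair = bm_family M F W
  for M :: "'a measure" and F :: "real \<Rightarrow> 'a measure" and W :: "nat \<Rightarrow> nat \<Rightarrow> real \<Rightarrow> 'a \<Rightarrow> real" +
  fixes lam \<nu> \<alpha> \<beta> T A :: real and N :: nat and x :: "nat \<Rightarrow> real"
    and X :: "real \<Rightarrow> 'a \<Rightarrow> nat \<Rightarrow> real" and Y :: "real \<Rightarrow> nat \<Rightarrow> real" and \<xi> :: "real \<Rightarrow> 'a \<Rightarrow> nat \<Rightarrow> real"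
  assumes lam: "lam > 1" and \<nu>: "\<nu> > 0" and \<alpha>: "\<alpha> > 0" and \<beta>: "0 < \<beta>" "\<beta> < 1" and T: "T > 0" and A: "A > 0" and N: "N \<ge> 1"
    and weak: "weak_solution lam \<nu> (theta \<alpha> N) x T M F W X"
    and X_bound: "AE \<omega> in M. \<forall>t\<in>{0..T}. (\<Sum>k. ennreal ((X t \<omega> k)\<^sup>2)) \<le> ennreal A"
    and det: "det_weak_solution lam \<nu> x T Y"
    and Y_bound: "\<And>t. t \<in> {0..T} \<Longrightarrow> (\<Sum>k. ennreal ((Y t k)\<^sup>2)) \<le> ennreal A"
    and mild: "mild_solution lam \<nu> \<alpha> \<beta> T M F W Y \<xi>"
begin

definition c where "c n = \<nu> * lam ^ (2 * n)"
definition sg where "sg = sqrt (eps \<alpha> N)"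
definition D where "D t \<omega> n = X t \<omega> n - Y t n"
definition \<eta> where "\<eta> t \<omega> n = (1 / sg) * D t \<omega> n - \<xi> t \<omega> n"
text \<open>The part of the Ito correction in \<open>S_theta\<close> that goes beyond
  \<open>S\<close>; it stems from the motions with i + j = n, while those with i = n produce
  \<open>S\<close>.\<close>

definition \<Theta> where "\<Theta> n = (\<Sum>j=1..<n. (theta \<alpha> N j)\<^sup>2 * lam ^ (2 * (n - j)))"
definition h where "h n \<omega> r = B lam (X r \<omega>) (X r \<omega>) n - B lam (Y r) (Y r) n - \<nu> * \<Theta> n * X r \<omega> n"
text \<open>The noise of \<open>D\<close>, defined as what the drift leaves over. In this form it is
  continuous in time for every \<omega>, whereas the stochastic integrals represent it only almost
  surely at each fixed time.\<close>

definition mart where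
  "mart n t \<omega> = D t \<omega> n - (LINT r:{0..t}|lborel. h n \<omega> r) + c n * (LINT r:{0..t}|lborel. D r \<omega> n)"

lemma c_pos: "c n > 0" using \<nu> lam by (simp add: c_def)

lemma sg: "sg > 0" "sg \<le> 1" "sg\<^sup>2 = eps \<alpha> N"
  using eps_bounds[OF N, of \<alpha>] by (auto simp: sg_def)

lemma X_measurable: "t \<in> {0..T} \<Longrightarrow> (\<lambda>\<omega>. X t \<omega> n) \<in> borel_measurable M"
  using weak unfolding weak_solution_def by (blast intro: measurable_F)

lemma X_cont: "\<omega> \<in> space M \<Longrightarrow> continuous_on {0..T} (\<lambda>t. X t \<omega> n)"
  using weak unfolding weak_solution_def by blast

lemma X_0: "t \<in> {0..T} \<Longrightarrow> \<omega> \<in> space M \<Longrightarrow> X t \<omega> 0 = 0"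
  using weak unfolding weak_solution_def ell2_def by blast

lemma Y_0: "t \<in> {0..T} \<Longrightarrow> Y t 0 = 0"
  using det unfolding det_weak_solution_def by blast

lemma Y_deriv: "n \<ge> 1 \<Longrightarrow> t \<in> {0..T} \<Longrightarrow>
    ((\<lambda>t. Y t n) has_real_derivative (B lam (Y t) (Y t) n + \<nu> * S lam (Y t) n)) (at t within {0..T})"
  using det unfolding det_weak_solution_def by blast

lemmas Y_cont = det_weak_solution_continuous_on[OF det]

lemma Y_abs: "t \<in> {0..T} \<Longrightarrow> \<bar>Y t k\<bar> \<le> sqrt A"
  using ell2_term_le[OF Y_bound] A by simp

lemma X_abs: "AE \<omega> in M. \<forall>t\<in>{0..T}. \<forall>k. \<bar>X t \<omega> k\<bar> \<le> sqrt A"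
  using X_bound by eventually_elim (use ell2_term_le A in force)

lemma \<xi>_measurable: "t \<in> {0..T} \<Longrightarrow> (\<lambda>\<omega>. \<xi> t \<omega> n) \<in> borel_measurable M"
  using mild unfolding mild_solution_def by blast

lemma \<xi>_Hs: "\<omega> \<in> space M \<Longrightarrow> t \<in> {0..T} \<Longrightarrow> \<xi> t \<omega> \<in> Hs lam (- \<beta>)"
  using mild unfolding mild_solution_def by blast

lemma \<xi>_Hs_cont: "\<omega> \<in> space M \<Longrightarrow> t \<in> {0..T} \<Longrightarrow>
    ((\<lambda>s. Hs_norm_sq lam (- \<beta>) (\<lambda>n. \<xi> s \<omega> n - \<xi> t \<omega> n)) \<longlongrightarrow> 0) (at t within {0..T})"
  using mild unfolding mild_solution_def by blast

lemma \<xi>_0: "\<omega> \<in> space M \<Longrightarrow> t \<in> {0..T} \<Longrightarrow> \<xi> t \<omega> 0 = 0"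
  using \<xi>_Hs by (simp add: Hs_def)

lemma \<xi>_cont:
  assumes \<omega>: "\<omega> \<in> space M"
  shows "continuous_on {0..T} (\<lambda>t. \<xi> t \<omega> n)"
proof (cases n)
  case 0
  have "continuous_on {0..T} (\<lambda>t. 0 :: real)" by simp
  then show ?thesis by (rule continuous_on_eq) (simp add: 0 \<xi>_0[OF \<omega>])
next
  case (Suc k)
  define q where "q = lam powr (2 * real (Suc k) * (- \<beta>))"
  have q: "q > 0" using lam by (simp add: q_def)
  show ?thesis unfolding continuous_on_def
  proof
    fix t assume t: "t \<in> {0..T}"
    have "((\<lambda>s. ennreal (q * (\<xi> s \<omega> n - \<xi> t \<omega> n)\<^sup>2)) \<longlongrightarrow> ennreal 0) (at t within {0..T})"
    proof (rule tendsto_sandwich[where f = "\<lambda>_. 0"])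
      show "\<forall>\<^sub>F s in at t within {0..T}. ennreal (q * (\<xi> s \<omega> n - \<xi> t \<omega> n)\<^sup>2) \<le> Hs_norm_sq lam (- \<beta>) (\<lambda>n. \<xi> s \<omega> n - \<xi> t \<omega> n)"
        using Hs_norm_sq_component[of lam k "- \<beta>" "\<lambda>n. \<xi> _ \<omega> n - \<xi> t \<omega> n"] unfolding q_def Suc by (intro always_eventually allI)
      show "((\<lambda>s. Hs_norm_sq lam (- \<beta>) (\<lambda>n. \<xi> s \<omega> n - \<xi> t \<omega> n)) \<longlongrightarrow> ennreal 0) (at t within {0..T})"
        using \<xi>_Hs_cont[OF \<omega> t] by simp
    qed (auto intro: always_eventually)
    then have "((\<lambda>s. q * (\<xi> s \<omega> n - \<xi> t \<omega> n)\<^sup>2) \<longlongrightarrow> 0) (at t within {0..T})"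
      using q by (subst (asm) tendsto_ennreal_iff) auto
    from tendsto_mult[OF tendsto_const[of "1 / q"] this]
    have "((\<lambda>s. (\<xi> s \<omega> n - \<xi> t \<omega> n)\<^sup>2) \<longlongrightarrow> 0) (at t within {0..T})" using q by simp
    from tendsto_real_sqrt[OF this]
    have "((\<lambda>s. \<bar>\<xi> s \<omega> n - \<xi> t \<omega> n\<bar>) \<longlongrightarrow> 0) (at t within {0..T})" by simp
    then have "((\<lambda>s. \<xi> s \<omega> n - \<xi> t \<omega> n) \<longlongrightarrow> 0) (at t within {0..T})" by (rule tendsto_rabs_zero_cancel)
    then show "((\<lambda>s. \<xi> s \<omega> n) \<longlongrightarrow> \<xi> t \<omega> n) (at t within {0..T})" by (rule LIM_zero_cancel)
  qed
qed

text \<open>Continuity in H^{-\<beta>} bounds the norm near each time, and compactness of the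
  interval \<open>{0..T}\<close> bounds it throughout. This is the pathwise finiteness on which the
  cut-off in \<open>weighted_gronwall\<close> relies.\<close>

lemma \<xi>_integrable:
  assumes \<omega>: "\<omega> \<in> space M"
  shows "(\<integral>\<^sup>+t\<in>{0..T}. wnorm (rw lam \<beta> m) (\<xi> t \<omega>) \<partial>lborel) < \<infinity>"
proof -
  have r0: "rw lam \<beta> m n \<ge> 0" for m n by (simp add: rw_def)
  have loc: "\<exists>U K. open U \<and> t \<in> U \<and> K < \<infinity> \<and> (\<forall>s\<in>U \<inter> {0..T}. wnorm (rw lam \<beta> 0) (\<xi> s \<omega>) \<le> K)" if t: "t \<in> {0..T}" for t
  proof -
    define K where "K = 2 + 2 * wnorm (rw lam \<beta> 0) (\<xi> t \<omega>)"
    have fin: "wnorm (rw lam \<beta> 0) (\<xi> t \<omega>) < \<infinity>" using \<xi>_Hs[OF \<omega> t] by (simp add: Hs_def Hs_norm_sq_eq_wnorm)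
    have K: "K < \<infinity>" unfolding K_def using fin by (simp add: ennreal_mult_less_top)
    have "eventually (\<lambda>s. Hs_norm_sq lam (- \<beta>) (\<lambda>n. \<xi> s \<omega> n - \<xi> t \<omega> n) < 1) (at t within {0..T})"
      using order_tendstoD(2)[OF \<xi>_Hs_cont[OF \<omega> t], of 1] by simp
    then obtain U where U: "open U" "t \<in> U" "\<And>s. s \<in> U \<Longrightarrow> s \<noteq> t \<Longrightarrow> s \<in> {0..T} \<Longrightarrow> wnorm (rw lam \<beta> 0) (\<lambda>n. \<xi> s \<omega> n - \<xi> t \<omega> n) < 1"
      unfolding eventually_at_topological Hs_norm_sq_eq_wnorm by blast
    have "wnorm (rw lam \<beta> 0) (\<xi> s \<omega>) \<le> K" if s: "s \<in> U" "s \<in> {0..T}" for s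
    proof -
      have "wnorm (rw lam \<beta> 0) (\<lambda>n. \<xi> s \<omega> n - \<xi> t \<omega> n) \<le> 1"
      proof (cases "s = t")
        case False
        then show ?thesis using U(3)[OF s(1) _ s(2)] by (simp add: less_imp_le)
      qed (simp add: wnorm_def)
      then have "2 * wnorm (rw lam \<beta> 0) (\<lambda>n. \<xi> s \<omega> n - \<xi> t \<omega> n) \<le> 2 * 1" by (rule mult_left_mono) simp
      moreover have "wnorm (rw lam \<beta> 0) (\<xi> s \<omega>) \<le> 2 * wnorm (rw lam \<beta> 0) (\<lambda>n. \<xi> s \<omega> n - \<xi> t \<omega> n) + 2 * wnorm (rw lam \<beta> 0) (\<xi> t \<omega>)"
        using wnorm_add_le[of "rw lam \<beta> 0" "\<lambda>n. \<xi> s \<omega> n - \<xi> t \<omega> n" "\<xi> t \<omega>"] r0 by simp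
      ultimately show ?thesis unfolding K_def by (metis add_right_mono mult_1_right order.trans)
    qed
    then show ?thesis using U(1,2) K by blast
  qed
  then obtain U K where UK: "\<And>t. t \<in> {0..T} \<Longrightarrow> open (U t) \<and> t \<in> U t \<and> K t < \<infinity> \<and> (\<forall>s\<in>U t \<inter> {0..T}. wnorm (rw lam \<beta> 0) (\<xi> s \<omega>) \<le> K t)"
    by metis
  have "compact {0..T}" by simp
  then obtain C' where C': "C' \<subseteq> {0..T}" "finite C'" "{0..T} \<subseteq> (\<Union>t\<in>C'. U t)"
    by (rule compactE_image[of "{0..T}" "{0..T}" U]) (use UK in auto)
  define K' where "K' = (\<Sum>t\<in>C'. K t)"
  have K': "K' < \<infinity>" unfolding K'_def using UK C' by (auto simp: ennreal_sum_less_top)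
  have "wnorm (rw lam \<beta> m) (\<xi> s \<omega>) \<le> K'" if s: "s \<in> {0..T}" for s
  proof -
    obtain t where t: "t \<in> C'" "s \<in> U t" using C' s by blast
    have "wnorm (rw lam \<beta> m) (\<xi> s \<omega>) \<le> wnorm (rw lam \<beta> 0) (\<xi> s \<omega>)"
      by (intro wnorm_mono mult_right_mono rw_le_0 lam \<beta>) simp
    also have "\<dots> \<le> K t" using UK[of t] t C' s by auto
    also have "\<dots> \<le> K'" unfolding K'_def using t C'(2) by (intro member_le_sum) auto
    finally show ?thesis .
  qed
  then have "(\<integral>\<^sup>+t\<in>{0..T}. wnorm (rw lam \<beta> m) (\<xi> t \<omega>) \<partial>lborel) \<le> (\<integral>\<^sup>+t. K' * indicator {0..T} t \<partial>lborel)"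
    by (intro nn_integral_mono) (auto simp: indicator_def)
  also have "\<dots> = K' * ennreal T" using T by (simp add: nn_integral_cmult_indicator)
  also have "\<dots> < \<infinity>" using K' by (simp add: ennreal_mult_less_top)
  finally show ?thesis .
qed

section \<open>The equation for the difference of the two solutions\<close>

lemma D_cont: "\<omega> \<in> space M \<Longrightarrow> continuous_on {0..T} (\<lambda>t. D t \<omega> n)"
  unfolding D_def by (intro continuous_on_diff X_cont Y_cont)

lemma D_measurable: "t \<in> {0..T} \<Longrightarrow> (\<lambda>\<omega>. D t \<omega> n) \<in> borel_measurable M"
  unfolding D_def using X_measurable by measurable

lemma D_0: "t \<in> {0..T} \<Longrightarrow> \<omega> \<in> space M \<Longrightarrow> D t \<omega> 0 = 0"
  by (simp add: D_def X_0 Y_0)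

lemma D_sum_le: "AE \<omega> in M. \<forall>t\<in>{0..T}. (\<Sum>k. ennreal ((D t \<omega> k)\<^sup>2)) \<le> ennreal (4 * A)"
  using X_bound
proof eventually_elim
  case (elim \<omega>)
  show ?case
  proof
    fix t assume t: "t \<in> {0..T}"
    have "(\<Sum>k. ennreal ((D t \<omega> k)\<^sup>2)) \<le> (\<Sum>k. 2 * ennreal ((X t \<omega> k)\<^sup>2) + 2 * ennreal ((Y t k)\<^sup>2))"
    proof (rule suminf_ennreal_mono)
      fix k
      have "(D t \<omega> k)\<^sup>2 \<le> 2 * (X t \<omega> k)\<^sup>2 + 2 * (Y t k)\<^sup>2" using real_power2_add_le[of "X t \<omega> k" "- Y t k"] by (simp add: D_def)
      then have "ennreal ((D t \<omega> k)\<^sup>2) \<le> ennreal (2 * (X t \<omega> k)\<^sup>2 + 2 * (Y t k)\<^sup>2)" by (rule ennreal_leI)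
      then show "ennreal ((D t \<omega> k)\<^sup>2) \<le> 2 * ennreal ((X t \<omega> k)\<^sup>2) + 2 * ennreal ((Y t k)\<^sup>2)" by (simp add: ennreal_plus ennreal_mult)
    qed
    also have "\<dots> = 2 * (\<Sum>k. ennreal ((X t \<omega> k)\<^sup>2)) + 2 * (\<Sum>k. ennreal ((Y t k)\<^sup>2))"
      by (simp only: suminf_ennreal_add ennreal_suminf_cmult)
    also have "\<dots> \<le> 2 * ennreal A + 2 * ennreal A" using elim t Y_bound by (intro add_mono mult_left_mono) auto
    also have "\<dots> = ennreal 2 * ennreal A + ennreal 2 * ennreal A" by simp
    also have "\<dots> = ennreal (2 * A + 2 * A)" using A by (simp only: ennreal_mult[symmetric] ennreal_plus[symmetric] mult_nonneg_nonneg less_imp_le zero_le_numeral)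
    also have "2 * A + 2 * A = 4 * A" by simp
    finally show "(\<Sum>k. ennreal ((D t \<omega> k)\<^sup>2)) \<le> ennreal (4 * A)" .
  qed
qed

lemma h_cont: "\<omega> \<in> space M \<Longrightarrow> continuous_on {0..T} (h n \<omega>)"
  unfolding h_def by (intro continuous_on_diff continuous_on_B X_cont Y_cont continuous_on_mult_left)

lemma mart_cont: "\<omega> \<in> space M \<Longrightarrow> continuous_on {0..T} (\<lambda>t. mart n t \<omega>)"
  unfolding mart_def
  by (intro continuous_on_add continuous_on_diff continuous_on_mult_left continuous_on_indefinite_lborel D_cont h_cont)

lemma mart_measurable:
  assumes t: "t \<in> {0..T}" shows "mart n t \<in> borel_measurable M"
proof -
  have hm: "(\<lambda>\<omega>. h n \<omega> r) \<in> borel_measurable M" if "r \<in> {0..T}" for r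
    unfolding h_def B_def using X_measurable[OF that] by (cases "n = 0") simp_all
  \<comment> \<open>The convolution with rate 0 is the plain time integral.\<close>
  have "(\<lambda>\<omega>. conv 0 (\<lambda>r. h n \<omega> r) t) \<in> borel_measurable M"
    by (rule borel_measurable_conv[OF t, of "\<lambda>r \<omega>. h n \<omega> r", OF hm h_cont])
  moreover have "(\<lambda>\<omega>. conv 0 (\<lambda>r. D r \<omega> n) t) \<in> borel_measurable M"
    by (rule borel_measurable_conv[OF t, of "\<lambda>r \<omega>. D r \<omega> n", OF D_measurable D_cont])
  ultimately have "(\<lambda>\<omega>. D t \<omega> n - conv 0 (\<lambda>r. h n \<omega> r) t + c n * conv 0 (\<lambda>r. D r \<omega> n) t) \<in> borel_measurable M"
    using D_measurable[OF t, of n] by measurable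
  then show ?thesis by (simp add: mart_def[abs_def] conv_def)
qed

lemma D_duhamel:
  assumes \<omega>: "\<omega> \<in> space M" and t: "t \<in> {0..T}"
  shows "D t \<omega> n = conv (c n) (h n \<omega>) t + (mart n t \<omega> - c n * conv (c n) (\<lambda>s. mart n s \<omega>) t)"
proof (rule duhamel)
  have sub: "{0..t} \<subseteq> {0..T}" using t by auto
  show "continuous_on {0..t} (\<lambda>t. D t \<omega> n)" "continuous_on {0..t} (h n \<omega>)" "continuous_on {0..t} (\<lambda>s. mart n s \<omega>)"
    using continuous_on_subset[OF _ sub] D_cont[OF \<omega>] h_cont[OF \<omega>] mart_cont[OF \<omega>] by blast+
qed (use t in \<open>auto simp: mart_def\<close>)

lemma Y_integral_eq:
  assumes n: "n \<ge> 1" and t: "t \<in> {0..T}"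
  shows "Y t n = x n + (LINT r:{0..t}|lborel. B lam (Y r) (Y r) n) - c n * (LINT r:{0..t}|lborel. Y r n)"
proof -
  have sub: "{0..t} \<subseteq> {0..T}" using t by auto
  have Yc: "continuous_on {0..t} (\<lambda>r. Y r k)" for k using Y_cont sub by (rule continuous_on_subset)
  have Bc: "continuous_on {0..t} (\<lambda>r. B lam (Y r) (Y r) n)" by (intro continuous_on_B Yc)
  have "(\<integral>r. indicator {0..t} r *\<^sub>R (B lam (Y r) (Y r) n - c n * Y r n) \<partial>lborel) = Y t n - Y 0 n"
  proof (rule integral_FTC_Icc)
    fix r assume r: "0 \<le> r" "r \<le> t"
    have "((\<lambda>t. Y t n) has_real_derivative (B lam (Y r) (Y r) n + \<nu> * S lam (Y r) n)) (at r within {0..t})"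
      using Y_deriv[OF n, of r] r t sub by (auto intro: DERIV_subset)
    then show "((\<lambda>t. Y t n) has_vector_derivative (B lam (Y r) (Y r) n - c n * Y r n)) (at r within {0..t})"
      by (simp add: has_real_derivative_iff_has_vector_derivative S_def c_def mult.assoc)
  qed (use t in \<open>auto intro!: continuous_intros Bc Yc\<close>)
  also have "(\<integral>r. indicator {0..t} r *\<^sub>R (B lam (Y r) (Y r) n - c n * Y r n) \<partial>lborel) = (LINT r:{0..t}|lborel. B lam (Y r) (Y r) n - c n * Y r n)"
    by (simp add: set_lebesgue_integral_def)
  also have "\<dots> = (LINT r:{0..t}|lborel. B lam (Y r) (Y r) n) - c n * (LINT r:{0..t}|lborel. Y r n)"
    by (subst set_integral_diff(2)) (auto intro!: continuous_on_set_integrable_lborel continuous_intros Bc Yc)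
  finally show ?thesis using det by (simp add: det_weak_solution_def)
qed

lemma theta_abs: "\<bar>theta \<alpha> N j\<bar> \<le> 1"
proof (cases "1 \<le> j \<and> j \<le> N")
  case True
  then have "sg * real j powr (- \<alpha>) \<le> 1 * 1" using sg powr_neg_le_one[of \<alpha> j] \<alpha> by (intro mult_mono) auto
  then show ?thesis using True sg(1) by (simp add: theta_def sg_def[symmetric] abs_mult)
qed (auto simp: theta_def)

section \<open>The two noises with a common scaling\<close>

definition gX where "gX n p r \<omega> = lam ^ fst p * real (snd p) powr (- \<alpha>) * (if snd p \<le> N then nz n p (X r \<omega>) else 0)"
definition gY where "gY n p r = lam ^ fst p * real (snd p) powr (- \<alpha>) * nz n p (Y r)"

text \<open>Division by \<open>sqrt (2 * \<nu>) * sg\<close> turns the coefficient \<theta>_j into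
  j^(-\<alpha>) for j \<le> N, the coefficient of the limit equation; this is the scaling of
  \<open>gX\<close>. The equation for \<open>X\<close> and the integrated equation for
  \<open>Y\<close> are subtracted, and all drift terms are recognised in
  \<open>mart\<close>.\<close>

lemma mart_span:
  assumes n: "n \<ge> 1" and t: "t \<in> {0..T}"
  shows "ito_span (itg (noise_idx n) t (gX n)) (\<lambda>\<omega>. (1 / (sqrt (2 * \<nu>) * sg)) * mart n t \<omega>)"
proof -
  have t0: "t \<ge> 0" using t by simp
  have sub: "{0..t} \<subseteq> {0..T}" using t by auto
  note main = weak[unfolded weak_solution_def, THEN conjunct2, THEN conjunct2, THEN conjunct2, THEN conjunct2, THEN conjunct2]
  from main[THEN spec, THEN mp, OF n, THEN bspec, OF t]
  obtain I J Z where I': "\<forall>j\<in>{1..<n}. has_ito_integral M F (W j (n - j)) (\<lambda>r \<omega>. lam ^ j * theta \<alpha> N (n - j) * X r \<omega> j) t (I j)"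
    and J': "\<forall>j\<ge>1. has_ito_integral M F (W n j) (\<lambda>r \<omega>. theta \<alpha> N j * X r \<omega> (n + j)) t (J j)"
    and Z: "L2_sums M J Z"
    and eq: "AE \<omega> in M. X t \<omega> n = x n + (LINT s:{0..t}|lborel. B lam (X s \<omega>) (X s \<omega>) n)
           + \<nu> * (LINT s:{0..t}|lborel. S_theta lam (theta \<alpha> N) (X s \<omega>) n)
           + sqrt (2 * \<nu>) * (\<Sum>j=1..<n. I j \<omega>) - sqrt (2 * \<nu>) * lam ^ n * Z \<omega>"
    by (elim exE conjE) (rule that)
  have I: "\<And>j. j \<in> {1..<n} \<Longrightarrow> has_ito_integral M F (W j (n - j)) (\<lambda>r \<omega>. lam ^ j * theta \<alpha> N (n - j) * X r \<omega> j) t (I j)"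
    and J: "\<And>j. j \<ge> 1 \<Longrightarrow> has_ito_integral M F (W n j) (\<lambda>r \<omega>. theta \<alpha> N j * X r \<omega> (n + j)) t (J j)"
    using I' J' by blast+
  have Xb: "AE \<omega> in M. \<forall>r\<in>{0..t}. (\<Sum>k. ennreal ((X r \<omega> k)\<^sup>2)) \<le> ennreal A"
    using X_bound by eventually_elim (use sub in blast)
  have A0: "A \<ge> 0" using A by simp
  have span: "ito_span (itg (noise_idx n) t (\<lambda>p r \<omega>. lam ^ fst p * theta \<alpha> N (snd p) * nz n p (X r \<omega>)))
    (\<lambda>\<omega>. (\<Sum>i=1..<n. I i \<omega>) - lam ^ n * Z \<omega>)"
    by (rule weak_noise_span[where A = A, OF lam t0 n theta_abs Xb A0 I J Z])
  have meq: "AE \<omega> in M. mart n t \<omega> = sqrt (2 * \<nu>) * ((\<Sum>i=1..<n. I i \<omega>) - lam ^ n * Z \<omega>)"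
    using eq AE_space
  proof eventually_elim
    case (elim \<omega>)
    note X_cont[OF elim(2)]
    have Xc: "continuous_on {0..t} (\<lambda>r. X r \<omega> k)" for k using X_cont[OF elim(2)] sub by (rule continuous_on_subset)
    have Yc: "continuous_on {0..t} (\<lambda>r. Y r k)" for k using Y_cont sub by (rule continuous_on_subset)
    have BXc: "continuous_on {0..t} (\<lambda>r. B lam (X r \<omega>) (X r \<omega>) n)" by (intro continuous_on_B Xc)
    have BYc: "continuous_on {0..t} (\<lambda>r. B lam (Y r) (Y r) n)" by (intro continuous_on_B Yc)
    have 1: "(LINT s:{0..t}|lborel. S_theta lam (theta \<alpha> N) (X s \<omega>) n) = - ((lam ^ (2 * n) + \<Theta> n) * (LINT s:{0..t}|lborel. X s \<omega> n))"
    proof -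
      have "(LINT s:{0..t}|lborel. S_theta lam (theta \<alpha> N) (X s \<omega>) n) = (LINT s:{0..t}|lborel. (- (lam ^ (2 * n) + \<Theta> n)) * X s \<omega> n)"
        by (simp only: S_theta_def \<Theta>_def minus_mult_left)
      also have "\<dots> = (- (lam ^ (2 * n) + \<Theta> n)) * (LINT s:{0..t}|lborel. X s \<omega> n)" by simp
      finally show ?thesis by (simp only: minus_mult_left)
    qed
    have 2: "(LINT r:{0..t}|lborel. h n \<omega> r) = (LINT s:{0..t}|lborel. B lam (X s \<omega>) (X s \<omega>) n) - (LINT r:{0..t}|lborel. B lam (Y r) (Y r) n)
       - \<nu> * \<Theta> n * (LINT s:{0..t}|lborel. X s \<omega> n)"
    proof -
      have "(LINT r:{0..t}|lborel. h n \<omega> r) = (LINT r:{0..t}|lborel. B lam (X r \<omega>) (X r \<omega>) n - B lam (Y r) (Y r) n) - (LINT r:{0..t}|lborel. \<nu> * \<Theta> n * X r \<omega> n)"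
        unfolding h_def by (intro set_integral_diff(2) continuous_on_set_integrable_lborel continuous_on_diff continuous_on_mult_left BXc BYc Xc)
      also have "(LINT r:{0..t}|lborel. B lam (X r \<omega>) (X r \<omega>) n - B lam (Y r) (Y r) n) = (LINT s:{0..t}|lborel. B lam (X s \<omega>) (X s \<omega>) n) - (LINT r:{0..t}|lborel. B lam (Y r) (Y r) n)"
        by (intro set_integral_diff(2) continuous_on_set_integrable_lborel BXc BYc)
      finally show ?thesis by simp
    qed
    have 3: "(LINT r:{0..t}|lborel. D r \<omega> n) = (LINT s:{0..t}|lborel. X s \<omega> n) - (LINT r:{0..t}|lborel. Y r n)"
      unfolding D_def by (intro set_integral_diff(2) continuous_on_set_integrable_lborel Xc Yc)
    show ?case
      unfolding mart_def 2 3 unfolding D_def elim(1) 1 Y_integral_eq[OF n t] by (simp add: c_def algebra_simps)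
  qed
  have s2: "sqrt (2 * \<nu>) > 0" using \<nu> by simp
  have "ito_span (\<lambda>z. (1 / sg) * itg (noise_idx n) t (\<lambda>p r \<omega>. lam ^ fst p * theta \<alpha> N (snd p) * nz n p (X r \<omega>)) z)
    (\<lambda>\<omega>. (1 / sg) * ((\<Sum>i=1..<n. I i \<omega>) - lam ^ n * Z \<omega>))"
    by (rule cspan_scale[OF span])
  moreover have "(\<lambda>z. (1 / sg) * itg (noise_idx n) t (\<lambda>p r \<omega>. lam ^ fst p * theta \<alpha> N (snd p) * nz n p (X r \<omega>)) z) = itg (noise_idx n) t (gX n)"
  proof
    fix z
    show "(1 / sg) * itg (noise_idx n) t (\<lambda>p r \<omega>. lam ^ fst p * theta \<alpha> N (snd p) * nz n p (X r \<omega>)) z = itg (noise_idx n) t (gX n) z"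
    proof (cases "fst z \<in> noise_idx n")
      case True
      then have "1 \<le> snd (fst z)" by (auto simp: noise_idx_def)
      then show ?thesis using sg(1) by (simp add: itg_def gX_def theta_def sg_def[symmetric])
    qed (simp add: itg_def)
  qed
  ultimately have sp: "ito_span (itg (noise_idx n) t (gX n)) (\<lambda>\<omega>. (1 / sg) * ((\<Sum>i=1..<n. I i \<omega>) - lam ^ n * Z \<omega>))" by simp
  show ?thesis
  proof (rule cspan_AE_cong[OF sp])
    show "itg (noise_idx n) t (gX n) \<in> borel_measurable ito_measure" using ito_span_sqint[OF sp] by (simp add: sqint_def)
    show "AE \<omega> in M. 1 / (sqrt (2 * \<nu>) * sg) * mart n t \<omega> = 1 / sg * ((\<Sum>i=1..<n. I i \<omega>) - lam ^ n * Z \<omega>)"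
      using meq by eventually_elim (use s2 in simp)
    show "(\<lambda>\<omega>. 1 / (sqrt (2 * \<nu>) * sg) * mart n t \<omega>) \<in> borel_measurable M" using mart_measurable[OF t, of n] by measurable
  qed simp
qed

text \<open>Serves as dominating constant in \<open>ito_span_conv\<close>. It depends on n and on N,
  which is harmless there, because the limit is taken in the time grid for fixed n and N.\<close>

lemma mart_bounded: "\<exists>C. AE \<omega> in M. \<forall>s\<in>{0..T}. \<bar>mart n s \<omega>\<bar> \<le> C"
proof -
  define a where "a = sqrt A"
  define H where "H = 2 * lam ^ n * a\<^sup>2 + 2 * lam ^ n * a\<^sup>2 + \<bar>\<nu> * \<Theta> n\<bar> * a"
  have "AE \<omega> in M. \<forall>s\<in>{0..T}. \<bar>mart n s \<omega>\<bar> \<le> 2 * a + T * H + c n * (T * (2 * a))"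
    using X_abs AE_space
  proof eventually_elim
    case (elim \<omega>)
    show ?case
    proof
      fix s assume s: "s \<in> {0..T}"
      have sub: "{0..s} \<subseteq> {0..T}" and s0: "s \<ge> 0" using s by auto
      have a0: "a \<ge> 0" using A by (simp add: a_def)
      have Dle: "\<bar>D r \<omega> n\<bar> \<le> 2 * a" if "r \<in> {0..T}" for r
      proof -
        have "\<bar>X r \<omega> n\<bar> \<le> a" "\<bar>Y r n\<bar> \<le> a" using elim(1) that Y_abs[OF that] by (auto simp: a_def)
        then show ?thesis unfolding D_def by linarith
      qed
      have hle: "\<bar>h n \<omega> r\<bar> \<le> H" if r: "r \<in> {0..T}" for r
      proof -
        have "\<bar>B lam (X r \<omega>) (X r \<omega>) n\<bar> \<le> 2 * lam ^ n * a\<^sup>2" using elim(1) r unfolding a_def by (intro abs_B_le lam) auto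
        moreover have "\<bar>B lam (Y r) (Y r) n\<bar> \<le> 2 * lam ^ n * a\<^sup>2" using Y_abs[OF r] unfolding a_def by (intro abs_B_le lam) auto
        moreover have "\<bar>\<nu> * \<Theta> n * X r \<omega> n\<bar> \<le> \<bar>\<nu> * \<Theta> n\<bar> * a" unfolding abs_mult[of "\<nu> * \<Theta> n"] using elim(1) r unfolding a_def by (intro mult_left_mono) auto
        ultimately show ?thesis unfolding h_def H_def by linarith
      qed
      have H0: "H \<ge> 0" using hle[OF s] by linarith
      have "\<bar>LINT r:{0..s}|lborel. h n \<omega> r\<bar> \<le> s * H"
        using sub by (intro lborel_integral_abs_le s0 continuous_on_subset[OF h_cont[OF elim(2)] sub] hle) auto
      also have "\<dots> \<le> T * H" using s H0 by (intro mult_right_mono) auto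
      finally have 1: "\<bar>LINT r:{0..s}|lborel. h n \<omega> r\<bar> \<le> T * H" .
      have "\<bar>LINT r:{0..s}|lborel. D r \<omega> n\<bar> \<le> s * (2 * a)"
        using sub by (intro lborel_integral_abs_le s0 continuous_on_subset[OF D_cont[OF elim(2)] sub] Dle) auto
      also have "\<dots> \<le> T * (2 * a)" using s a0 by (intro mult_right_mono) auto
      finally have "c n * \<bar>LINT r:{0..s}|lborel. D r \<omega> n\<bar> \<le> c n * (T * (2 * a))" using c_pos[of n] by (intro mult_left_mono) auto
      then have 2: "\<bar>c n * (LINT r:{0..s}|lborel. D r \<omega> n)\<bar> \<le> c n * (T * (2 * a))" using c_pos[of n] by (simp add: abs_mult)
      show "\<bar>mart n s \<omega>\<bar> \<le> 2 * a + T * H + c n * (T * (2 * a))"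
        using 1 2 Dle[OF s] unfolding mart_def by linarith
    qed
  qed
  then show ?thesis by blast
qed

lemma mart_conv_span:
  assumes n: "n \<ge> 1" and t: "t \<in> {0..T}"
  shows "ito_span (itg (noise_idx n) t (\<lambda>p r \<omega>. exp (- (c n * (t - r))) * gX n p r \<omega>))
    (\<lambda>\<omega>. (1 / (sqrt (2 * \<nu>) * sg)) * (mart n t \<omega> - c n * conv (c n) (\<lambda>s. mart n s \<omega>) t))"
proof -
  define k where "k = 1 / (sqrt (2 * \<nu>) * sg)"
  obtain C where C: "AE \<omega> in M. \<forall>s\<in>{0..T}. \<bar>mart n s \<omega>\<bar> \<le> C" using mart_bounded by blast
  have sub: "{0..t} \<subseteq> {0..T}" using t by auto
  define f where "f = (\<lambda>z. indicator (noise_idx n) (fst z) * gX n (fst z) (fst (snd z)) (snd (snd z)))"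
  have "ito_span (\<lambda>z. indicator {0..t} (fst (snd z)) * (exp (- (c n * (t - fst (snd z)))) * f z))
    (\<lambda>\<omega>. k * mart n t \<omega> - c n * conv (c n) (\<lambda>s. k * mart n s \<omega>) t)"
  proof (rule ito_span_conv[OF c_pos])
    show "t \<ge> 0" using t by simp
    show "ito_span (\<lambda>z. indicator {0..s} (fst (snd z)) * f z) (\<lambda>\<omega>. k * mart n s \<omega>)" if "s \<in> {0..t}" for s
    proof -
      have "s \<in> {0..T}" using that sub by blast
      from mart_span[OF n this] show ?thesis unfolding k_def itg_def f_def by (simp add: mult.left_commute)
    qed
    show "continuous_on {0..t} (\<lambda>s. k * mart n s \<omega>)" if "\<omega> \<in> space M" for \<omega>
      using continuous_on_subset[OF mart_cont[OF that] sub] by (rule continuous_on_mult_left)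
    show "AE \<omega> in M. \<forall>s\<in>{0..t}. \<bar>k * mart n s \<omega>\<bar> \<le> \<bar>k\<bar> * C"
      using C by eventually_elim (use sub in \<open>auto simp: abs_mult intro!: mult_left_mono\<close>)
  qed
  moreover have "(\<lambda>z. indicator {0..t} (fst (snd z)) * (exp (- (c n * (t - fst (snd z)))) * f z)) = itg (noise_idx n) t (\<lambda>p r \<omega>. exp (- (c n * (t - r))) * gX n p r \<omega>)"
    by (simp add: itg_def f_def mult_ac)
  ultimately show ?thesis unfolding k_def conv_cmult by (simp add: right_diff_distrib mult_ac)
qed

lemma \<xi>_forcing:
  assumes t: "t \<in> {0..T}"
  shows "\<exists>Z. (\<forall>n\<ge>1. ito_span (itg (noise_idx n) t (\<lambda>p r \<omega>. exp (- (c n * (t - r))) * gY n p r)) (\<lambda>\<omega>. Z \<omega> n)) \<and>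
    (AE \<omega> in M. \<forall>n. \<xi> t \<omega> n - conv (c n) (\<lambda>r. B lam (\<xi> r \<omega>) (Y r) n + B lam (Y r) (\<xi> r \<omega>) n) t = sqrt (2 * \<nu>) * Z \<omega> n)"
proof -
  from mild[unfolded mild_solution_def, THEN conjunct2, THEN conjunct2, THEN bspec, OF t]
  obtain I G Z where I': "\<forall>i\<ge>1. \<forall>j\<ge>1. \<forall>n. has_ito_integral M F (W i j)
           (\<lambda>r _. exp_S lam (\<nu> * (t - r)) (mat_apply (skew_mat i (i + j)) (Y r)) n) t (\<lambda>\<omega>. I i j \<omega> n)"
    and G': "\<forall>i\<ge>1. L2_Hs_sums lam (- \<beta>) M (\<lambda>j \<omega> n. real j powr (- \<alpha>) * I i j \<omega> n) (G i)"
    and Z: "L2_Hs_sums lam (- \<beta>) M (\<lambda>i \<omega> n. lam ^ i * G i \<omega> n) Z"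
    and eq: "AE \<omega> in M. \<forall>n. \<xi> t \<omega> n =
           (LINT r:{0..t}|lborel. exp_S lam (\<nu> * (t - r)) (\<lambda>k. B lam (\<xi> r \<omega>) (Y r) k + B lam (Y r) (\<xi> r \<omega>) k) n)
           + sqrt (2 * \<nu>) * Z \<omega> n"
    by (elim exE conjE) (rule that)
  have I: "\<And>i j n. i \<ge> 1 \<Longrightarrow> j \<ge> 1 \<Longrightarrow> has_ito_integral M F (W i j)
           (\<lambda>r _. exp_S lam (\<nu> * (t - r)) (mat_apply (skew_mat i (i + j)) (Y r)) n) t (\<lambda>\<omega>. I i j \<omega> n)"
    and G: "\<And>i. i \<ge> 1 \<Longrightarrow> L2_Hs_sums lam (- \<beta>) M (\<lambda>j \<omega> n. real j powr (- \<alpha>) * I i j \<omega> n) (G i)"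
    using I' G' by blast+
  have "ito_span (itg (noise_idx n) t (\<lambda>p r \<omega>. exp (- (c n * (t - r))) * gY n p r)) (\<lambda>\<omega>. Z \<omega> n)" if n: "n \<ge> 1" for n
    unfolding c_def gY_def using mild_noise_span[where A = A, OF lam \<alpha> _ n \<nu> Y_bound _ I G Z] t A by auto
  moreover have "AE \<omega> in M. \<forall>n. \<xi> t \<omega> n - conv (c n) (\<lambda>r. B lam (\<xi> r \<omega>) (Y r) n + B lam (Y r) (\<xi> r \<omega>) n) t = sqrt (2 * \<nu>) * Z \<omega> n"
    using eq
  proof eventually_elim
    case (elim \<omega>)
    have "exp_S lam (\<nu> * (t - r)) f n = exp (- (c n * (t - r))) * f n" for r f n by (simp add: exp_S_def c_def mult_ac)
    then show ?case using elim by (simp add: conv_def)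
  qed
  ultimately show ?thesis by blast
qed

text \<open>By bilinearity B(X, X) - B(Y, Y) = B(D, X) + B(Y, D). Writing D / sg as the sum of
  \<eta> and \<xi>, the drift of \<xi>, which has Y in both places, cancels up to B(\<xi>, X) -
  B(\<xi>, Y) = B(\<xi>, D). The asymmetric choice, X in one slot and Y in the other, keeps the
  drift linear in \<eta> with bounded coefficients and no quadratic remainder.\<close>

lemma \<eta>_forcing:
  assumes t: "t \<in> {0..T}"
  shows "\<exists>\<zeta>. (\<forall>n\<ge>1. ito_span (itg (noise_idx n) t (\<lambda>p r \<omega>. exp (- (c n * (t - r))) * (gX n p r \<omega> - gY n p r))) (\<lambda>\<omega>. \<zeta> \<omega> n)) \<and>
    (AE \<omega> in M. \<forall>n. \<eta> t \<omega> n - conv (c n) (\<lambda>r. B lam (\<eta> r \<omega>) (X r \<omega>) n + B lam (Y r) (\<eta> r \<omega>) n) t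
       = (conv (c n) (\<lambda>r. B lam (\<xi> r \<omega>) (D r \<omega>) n) t + - (1 / sg) * (\<nu> * \<Theta> n) * conv (c n) (\<lambda>r. X r \<omega> n) t) + sqrt (2 * \<nu>) * \<zeta> \<omega> n)"
proof -
  obtain Z where Z: "\<And>n. n \<ge> 1 \<Longrightarrow> ito_span (itg (noise_idx n) t (\<lambda>p r \<omega>. exp (- (c n * (t - r))) * gY n p r)) (\<lambda>\<omega>. Z \<omega> n)"
    and Zeq: "AE \<omega> in M. \<forall>n. \<xi> t \<omega> n - conv (c n) (\<lambda>r. B lam (\<xi> r \<omega>) (Y r) n + B lam (Y r) (\<xi> r \<omega>) n) t = sqrt (2 * \<nu>) * Z \<omega> n"
    using \<xi>_forcing[OF t] by blast
  define k where "k = 1 / (sqrt (2 * \<nu>) * sg)"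
  define mc where "mc = (\<lambda>\<omega> n. mart n t \<omega> - c n * conv (c n) (\<lambda>s. mart n s \<omega>) t)"
  define \<zeta> where "\<zeta> = (\<lambda>\<omega> n. k * mc \<omega> n - Z \<omega> n)"
  have "ito_span (itg (noise_idx n) t (\<lambda>p r \<omega>. exp (- (c n * (t - r))) * (gX n p r \<omega> - gY n p r))) (\<lambda>\<omega>. \<zeta> \<omega> n)" if n: "n \<ge> 1" for n
  proof -
    have "(\<lambda>z. itg (noise_idx n) t (\<lambda>p r \<omega>. exp (- (c n * (t - r))) * gX n p r \<omega>) z - itg (noise_idx n) t (\<lambda>p r \<omega>. exp (- (c n * (t - r))) * gY n p r) z)
      = itg (noise_idx n) t (\<lambda>p r \<omega>. exp (- (c n * (t - r))) * (gX n p r \<omega> - gY n p r))"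
      by (simp add: itg_def right_diff_distrib)
    with cspan_diff[OF mart_conv_span[OF n t] Z[OF n]] show ?thesis by (simp add: \<zeta>_def mc_def k_def)
  qed
  moreover have "AE \<omega> in M. \<forall>n. \<eta> t \<omega> n - conv (c n) (\<lambda>r. B lam (\<eta> r \<omega>) (X r \<omega>) n + B lam (Y r) (\<eta> r \<omega>) n) t
       = (conv (c n) (\<lambda>r. B lam (\<xi> r \<omega>) (D r \<omega>) n) t + - (1 / sg) * (\<nu> * \<Theta> n) * conv (c n) (\<lambda>r. X r \<omega> n) t) + sqrt (2 * \<nu>) * \<zeta> \<omega> n"
    using Zeq AE_space
  proof eventually_elim
    case (elim \<omega>)
    show ?case
    proof
      fix n
      have sub: "{0..t} \<subseteq> {0..T}" using t by auto
      have Xc: "continuous_on {0..t} (\<lambda>r. X r \<omega> k)" for k using X_cont[OF elim(2)] sub by (rule continuous_on_subset)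
      have Yc: "continuous_on {0..t} (\<lambda>r. Y r k)" for k using Y_cont sub by (rule continuous_on_subset)
      have Dc: "continuous_on {0..t} (\<lambda>r. D r \<omega> k)" for k using D_cont[OF elim(2)] sub by (rule continuous_on_subset)
      have xc: "continuous_on {0..t} (\<lambda>r. \<xi> r \<omega> k)" for k using \<xi>_cont[OF elim(2)] sub by (rule continuous_on_subset)
      note Bc = continuous_on_B
      have h: "h n \<omega> r = (B lam (D r \<omega>) (X r \<omega>) n + B lam (Y r) (D r \<omega>) n) - \<nu> * \<Theta> n * X r \<omega> n" for r
        unfolding h_def B_diff_decomp D_def ..
      have dec: "B lam (\<eta> r \<omega>) (X r \<omega>) n + B lam (Y r) (\<eta> r \<omega>) n = (1 / sg) * (B lam (D r \<omega>) (X r \<omega>) n + B lam (Y r) (D r \<omega>) n)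
          - (B lam (\<xi> r \<omega>) (Y r) n + B lam (Y r) (\<xi> r \<omega>) n) - B lam (\<xi> r \<omega>) (D r \<omega>) n" for r
      proof -
        have "B lam (\<eta> r \<omega>) (X r \<omega>) n = (1 / sg) * B lam (D r \<omega>) (X r \<omega>) n - B lam (\<xi> r \<omega>) (X r \<omega>) n"
          unfolding \<eta>_def by (rule B_left_lin)
        moreover have "B lam (Y r) (\<eta> r \<omega>) n = (1 / sg) * B lam (Y r) (D r \<omega>) n - B lam (Y r) (\<xi> r \<omega>) n"
          unfolding \<eta>_def by (rule B_right_lin)
        moreover have "B lam (\<xi> r \<omega>) (D r \<omega>) n = B lam (\<xi> r \<omega>) (X r \<omega>) n - B lam (\<xi> r \<omega>) (Y r) n"
          unfolding D_def by (rule B_right_diff)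
        ultimately show ?thesis by (simp only: distrib_left)
      qed
      define P1 where "P1 = conv (c n) (\<lambda>r. B lam (D r \<omega>) (X r \<omega>) n + B lam (Y r) (D r \<omega>) n) t"
      define P2 where "P2 = conv (c n) (\<lambda>r. B lam (\<xi> r \<omega>) (Y r) n + B lam (Y r) (\<xi> r \<omega>) n) t"
      define P3 where "P3 = conv (c n) (\<lambda>r. B lam (\<xi> r \<omega>) (D r \<omega>) n) t"
      define P4 where "P4 = conv (c n) (\<lambda>r. X r \<omega> n) t"
      have c1: "conv (c n) (h n \<omega>) t = P1 - \<nu> * \<Theta> n * P4"
        unfolding P1_def P4_def h[abs_def]
        by (subst conv_diff) (intro continuous_on_add continuous_on_mult_left Bc Xc Yc Dc, intro continuous_on_mult_left Xc, simp add: conv_cmult)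
      have c2: "conv (c n) (\<lambda>r. B lam (\<eta> r \<omega>) (X r \<omega>) n + B lam (Y r) (\<eta> r \<omega>) n) t = (1 / sg) * P1 - P2 - P3"
        unfolding dec P1_def P2_def P3_def
        by (subst conv_diff, intro continuous_on_diff continuous_on_add continuous_on_mult_left Bc Xc Yc Dc xc, intro Bc xc Dc,
            subst conv_diff, intro continuous_on_add continuous_on_mult_left Bc Xc Yc Dc, intro continuous_on_add Bc xc Yc, simp only: conv_cmult)
      have Deq: "D t \<omega> n = P1 - \<nu> * \<Theta> n * P4 + mc \<omega> n"
        using D_duhamel[OF elim(2) t, of n] unfolding c1 mc_def .
      have xeq: "\<xi> t \<omega> n = P2 + sqrt (2 * \<nu>) * Z \<omega> n" using elim(1) unfolding P2_def by (simp add: algebra_simps)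
      have k: "sqrt (2 * \<nu>) * k = 1 / sg" using \<nu> by (simp add: k_def)
      have "sqrt (2 * \<nu>) * \<zeta> \<omega> n = (1 / sg) * mc \<omega> n - sqrt (2 * \<nu>) * Z \<omega> n"
        unfolding \<zeta>_def right_diff_distrib mult.assoc[symmetric] k ..
      then show "\<eta> t \<omega> n - conv (c n) (\<lambda>r. B lam (\<eta> r \<omega>) (X r \<omega>) n + B lam (Y r) (\<eta> r \<omega>) n) t
       = (P3 + - (1 / sg) * (\<nu> * \<Theta> n) * P4) + sqrt (2 * \<nu>) * \<zeta> \<omega> n"
        unfolding c2 \<eta>_def Deq xeq by (simp add: algebra_simps add_divide_distrib)
    qed
  qed
  ultimately show ?thesis by blast
qed

end

section \<open>Moment estimates\<close>

definition geo :: "real \<Rightarrow> real \<Rightarrow> real" where "geo lam \<beta> = 1 / (1 - lam powr (- \<beta>))"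

lemma geo_pos: "lam > 1 \<Longrightarrow> \<beta> > 0 \<Longrightarrow> geo lam \<beta> > 0"
  by (simp add: geo_def powr_less_one)

definition gron :: "real \<Rightarrow> real \<Rightarrow> real \<Rightarrow> real \<Rightarrow> real" where
  "gron lam \<nu> A T = exp (144 * lam\<^sup>2 * (sqrt A)\<^sup>2 / \<nu> * T)"

text \<open>The weights are summable over the modes because \<beta> > 0, so a mean square bound
  uniform in the modes is enough; the stochastic convolutions offer no decay in n.\<close>

lemma nn_integral_wnorm_le:
  assumes lam: "lam > 1" and \<beta>: "\<beta> > 0" and K: "K \<ge> 0"
    and Z: "\<And>n. n \<ge> 1 \<Longrightarrow> (\<lambda>\<omega>. Z \<omega> n) \<in> borel_measurable M" and w: "w \<in> borel_measurable M"
    and le: "\<And>n. n \<ge> 1 \<Longrightarrow> (\<integral>\<^sup>+\<omega>. ennreal (w \<omega>) * ennreal ((Z \<omega> n)\<^sup>2) \<partial>M) \<le> ennreal K"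
  shows "(\<integral>\<^sup>+\<omega>. ennreal (w \<omega>) * wnorm (rw lam \<beta> m) (Z \<omega>) \<partial>M) \<le> ennreal (K * (geo lam \<beta> * lam powr (- \<beta> * real m)))"
proof -
  have r0: "rw lam \<beta> m n \<ge> 0" for n by (simp add: rw_def)
  note [measurable] = w
  have "(\<integral>\<^sup>+\<omega>. ennreal (w \<omega>) * wnorm (rw lam \<beta> m) (Z \<omega>) \<partial>M)
      = (\<integral>\<^sup>+\<omega>. (\<Sum>n. ennreal (rw lam \<beta> m (Suc n)) * (ennreal (w \<omega>) * ennreal ((Z \<omega> (Suc n))\<^sup>2))) \<partial>M)"
    unfolding wnorm_def ennreal_suminf_cmult[symmetric] using r0 by (simp only: ennreal_mult zero_le_power2 mult.left_commute)
  also have "\<dots> = (\<Sum>n. \<integral>\<^sup>+\<omega>. ennreal (rw lam \<beta> m (Suc n)) * (ennreal (w \<omega>) * ennreal ((Z \<omega> (Suc n))\<^sup>2)) \<partial>M)"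
  proof (rule nn_integral_suminf)
    fix n
    have [measurable]: "(\<lambda>\<omega>. Z \<omega> (Suc n)) \<in> borel_measurable M" by (rule Z) simp
    show "(\<lambda>\<omega>. ennreal (rw lam \<beta> m (Suc n)) * (ennreal (w \<omega>) * ennreal ((Z \<omega> (Suc n))\<^sup>2))) \<in> borel_measurable M" by measurable
  qed
  also have "\<dots> \<le> (\<Sum>n. ennreal K * ennreal (rw lam \<beta> m (Suc n)))"
  proof (rule suminf_ennreal_mono)
    fix n
    have [measurable]: "(\<lambda>\<omega>. Z \<omega> (Suc n)) \<in> borel_measurable M" by (rule Z) simp
    have "(\<integral>\<^sup>+\<omega>. ennreal (rw lam \<beta> m (Suc n)) * (ennreal (w \<omega>) * ennreal ((Z \<omega> (Suc n))\<^sup>2)) \<partial>M)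
       = ennreal (rw lam \<beta> m (Suc n)) * (\<integral>\<^sup>+\<omega>. ennreal (w \<omega>) * ennreal ((Z \<omega> (Suc n))\<^sup>2) \<partial>M)"
      by (rule nn_integral_cmult) measurable
    also have "\<dots> \<le> ennreal (rw lam \<beta> m (Suc n)) * ennreal K" by (intro mult_left_mono le) auto
    finally show "(\<integral>\<^sup>+\<omega>. ennreal (rw lam \<beta> m (Suc n)) * (ennreal (w \<omega>) * ennreal ((Z \<omega> (Suc n))\<^sup>2)) \<partial>M) \<le> ennreal K * ennreal (rw lam \<beta> m (Suc n))"
      by (simp only: mult.commute)
  qed
  also have "\<dots> = ennreal K * (\<Sum>n. ennreal (rw lam \<beta> m (Suc n)))" by (rule ennreal_suminf_cmult)
  also have "\<dots> \<le> ennreal K * ennreal (lam powr (- \<beta> * real m) * (1 / (1 - lam powr (- \<beta>))))"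
    using rw_sum_le[OF lam \<beta>] by (rule mult_left_mono) simp
  also have "\<dots> = ennreal (K * (geo lam \<beta> * lam powr (- \<beta> * real m)))"
    unfolding geo_def using K geo_pos[OF lam \<beta>] by (subst ennreal_mult[symmetric]) (auto simp: geo_def mult.commute)
  finally show ?thesis .
qed

lemma wnorm_scale:
  assumes "\<And>n. \<rho> n \<ge> 0"
  shows "wnorm \<rho> (\<lambda>n. a * u n) = ennreal (a\<^sup>2) * wnorm \<rho> u"
proof -
  have "\<rho> (Suc n) * (a * u (Suc n))\<^sup>2 = a\<^sup>2 * (\<rho> (Suc n) * (u (Suc n))\<^sup>2)" for n
    by (simp only: power_mult_distrib mult.left_commute)
  then show ?thesis unfolding wnorm_def ennreal_suminf_cmult[symmetric]
    by (simp only: ennreal_mult zero_le_power2 mult_nonneg_nonneg assms)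
qed

lemma geometric_rem_sum:
  fixes lam :: real
  assumes "n \<ge> 1"
  shows "(lam\<^sup>2 - 1) * (\<Sum>j=1..<n. lam ^ (2 * (n - j))) = lam ^ (2 * n) - lam\<^sup>2"
  using assms
proof (induction n rule: dec_induct)
  case base
  then show ?case by simp
next
  case (step n)
  have "(\<Sum>j=1..<Suc n. lam ^ (2 * (Suc n - j))) = (\<Sum>j=1..<n. lam ^ (2 * (Suc n - j))) + lam\<^sup>2"
    using step by (simp add: atLeastLessThanSuc)
  also have "(\<Sum>j=1..<n. lam ^ (2 * (Suc n - j))) = (\<Sum>j=1..<n. lam\<^sup>2 * lam ^ (2 * (n - j)))"
  proof (rule sum.cong)
    fix j assume "j \<in> {1..<n}"
    then have "2 * (Suc n - j) = 2 + 2 * (n - j)" by auto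
    then show "lam ^ (2 * (Suc n - j)) = lam\<^sup>2 * lam ^ (2 * (n - j))" by (simp only: power_add)
  qed simp
  also have "\<dots> = lam\<^sup>2 * (\<Sum>j=1..<n. lam ^ (2 * (n - j)))" by (rule sum_distrib_left[symmetric])
  finally have "(lam\<^sup>2 - 1) * (\<Sum>j=1..<Suc n. lam ^ (2 * (Suc n - j))) = lam\<^sup>2 * ((lam\<^sup>2 - 1) * (\<Sum>j=1..<n. lam ^ (2 * (n - j)))) + (lam\<^sup>2 - 1) * lam\<^sup>2"
    by (simp only: distrib_left mult.left_commute)
  also have "\<dots> = lam ^ (2 * Suc n) - lam\<^sup>2"
    unfolding step.IH by (simp add: algebra_simps power2_eq_square)
  finally show ?case .
qed

context approx_pair
begin

section \<open>Stochastic convolutions in mean square\<close>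

lemma rw_w: "weights lam (rw lam \<beta> m)"
  by (rule rw_weights[OF lam \<beta>])

lemma rw0: "rw lam \<beta> m n \<ge> 0"
  by (simp add: rw_def)

text \<open>The isometry with time outermost: the square sum over the motions is bounded at each
  time, and the kernel contributes 1/c. The squared kernel is bounded by the kernel itself, which is
  at most 1; this costs a factor 2 and allows \<open>exp_lborel_integral\<close> to be used.\<close>

lemma noise_norm_le:
  assumes n: "n \<ge> 1" and t: "t \<in> {0..T}" and G: "G \<ge> 0"
    and span: "ito_span (itg (noise_idx n) t (\<lambda>p r \<omega>. exp (- (c n * (t - r))) * g p r \<omega>)) Z"
    and bm: "\<And>r. r \<in> {0..t} \<Longrightarrow> b r \<in> borel_measurable M"
    and b: "\<And>r. r \<in> {0..t} \<Longrightarrow> AE \<omega> in M. (\<integral>\<^sup>+p. ennreal (indicator (noise_idx n) p * (g p r \<omega>)\<^sup>2) \<partial>count_space UNIV) \<le> ennreal (b r \<omega>)"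
    and bG: "\<And>r. r \<in> {0..t} \<Longrightarrow> (\<integral>\<^sup>+\<omega>. ennreal (b r \<omega>) \<partial>M) \<le> ennreal G"
  shows "(\<integral>\<^sup>+\<omega>. ennreal ((Z \<omega>)\<^sup>2) \<partial>M) \<le> ennreal (G / c n)"
proof -
  have t0: "t \<ge> 0" using t by simp
  have "(\<integral>\<^sup>+\<omega>. ennreal ((Z \<omega>)\<^sup>2) \<partial>M) = (\<integral>\<^sup>+z. ennreal ((itg (noise_idx n) t (\<lambda>p r \<omega>. exp (- (c n * (t - r))) * g p r \<omega>) z)\<^sup>2) \<partial>ito_measure)"
    by (rule ito_span_isometry[OF span])
  also have "\<dots> \<le> (\<integral>\<^sup>+r\<in>{0..t}. ennreal (exp (- (c n * (t - r)))) * ennreal G \<partial>lborel)"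
  proof (rule itg_norm_le)
    show "itg (noise_idx n) t (\<lambda>p r \<omega>. exp (- (c n * (t - r))) * g p r \<omega>) \<in> borel_measurable ito_measure"
      using ito_span_sqint[OF span] by (simp add: sqint_def)
    fix r assume r: "r \<in> {0..t}"
    define e where "e = exp (- (c n * (t - r)))"
    have e: "0 \<le> e" "e \<le> 1" using r c_pos[of n] by (auto simp: e_def)
    have "(\<integral>\<^sup>+\<omega>. \<integral>\<^sup>+p. ennreal (indicator (noise_idx n) p * (e * g p r \<omega>)\<^sup>2) \<partial>count_space UNIV \<partial>M) \<le> (\<integral>\<^sup>+\<omega>. ennreal e * ennreal (b r \<omega>) \<partial>M)"
    proof (rule nn_integral_mono_AE)
      show "AE \<omega> in M. (\<integral>\<^sup>+p. ennreal (indicator (noise_idx n) p * (e * g p r \<omega>)\<^sup>2) \<partial>count_space UNIV) \<le> ennreal e * ennreal (b r \<omega>)"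
        using b[OF r]
      proof eventually_elim
        case (elim \<omega>)
        have "(\<integral>\<^sup>+p. ennreal (indicator (noise_idx n) p * (e * g p r \<omega>)\<^sup>2) \<partial>count_space UNIV)
           \<le> (\<integral>\<^sup>+p. ennreal e * ennreal (indicator (noise_idx n) p * (g p r \<omega>)\<^sup>2) \<partial>count_space UNIV)"
        proof (rule nn_integral_mono)
          fix p
          have "e\<^sup>2 \<le> e" using e by (simp add: power2_eq_square mult_left_le)
          then have "e\<^sup>2 * (g p r \<omega>)\<^sup>2 \<le> e * (g p r \<omega>)\<^sup>2" by (rule mult_right_mono) simp
          then have "indicator (noise_idx n) p * (e\<^sup>2 * (g p r \<omega>)\<^sup>2) \<le> indicator (noise_idx n) p * (e * (g p r \<omega>)\<^sup>2)" by (rule mult_left_mono) simp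
          then have "indicator (noise_idx n) p * (e * g p r \<omega>)\<^sup>2 \<le> e * (indicator (noise_idx n) p * (g p r \<omega>)\<^sup>2)"
            by (simp only: power_mult_distrib mult.left_commute)
          then show "ennreal (indicator (noise_idx n) p * (e * g p r \<omega>)\<^sup>2) \<le> ennreal e * ennreal (indicator (noise_idx n) p * (g p r \<omega>)\<^sup>2)"
            using e(1) by (simp add: ennreal_mult[symmetric] ennreal_leI)
        qed
        also have "\<dots> = ennreal e * (\<integral>\<^sup>+p. ennreal (indicator (noise_idx n) p * (g p r \<omega>)\<^sup>2) \<partial>count_space UNIV)"
          by (rule nn_integral_cmult) simp
        also have "\<dots> \<le> ennreal e * ennreal (b r \<omega>)" using elim by (rule mult_left_mono) simp
        finally show ?case .
      qed
    qed
    also have "\<dots> = ennreal e * (\<integral>\<^sup>+\<omega>. ennreal (b r \<omega>) \<partial>M)" using bm[OF r] by (intro nn_integral_cmult) measurable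
    also have "\<dots> \<le> ennreal e * ennreal G" using bG[OF r] by (rule mult_left_mono) simp
    finally show "(\<integral>\<^sup>+\<omega>. \<integral>\<^sup>+p. ennreal (indicator (noise_idx n) p * (exp (- (c n * (t - r))) * g p r \<omega>)\<^sup>2) \<partial>count_space UNIV \<partial>M) \<le> ennreal (exp (- (c n * (t - r)))) * ennreal G"
      unfolding e_def .
  qed
  also have "\<dots> = (\<integral>\<^sup>+r\<in>{0..t}. ennreal (G * exp (- (c n * (t - r)))) \<partial>lborel)"
    using G by (simp add: ennreal_mult[symmetric] mult.commute)
  also have "\<dots> = ennreal (LINT r:{0..t}|lborel. G * exp (- (c n * (t - r))))"
    using G by (intro nn_integral_eq_set_lebesgue continuous_intros) auto
  also have "(LINT r:{0..t}|lborel. G * exp (- (c n * (t - r)))) = G * ((1 - exp (- (c n * t))) / c n)"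
    using exp_lborel_integral[OF c_pos t0] by simp
  also have "\<dots> \<le> G * (1 / c n)" using G c_pos[of n] by (intro mult_left_mono divide_right_mono) auto
  finally show ?thesis by (simp add: ennreal_leI)
qed

lemma noise_span_measurable: "ito_span f Z \<Longrightarrow> Z \<in> borel_measurable M"
  using ito_span_sqint[of f Z] by (simp add: sqint_def)

text \<open>The noise coefficients acting on mode n have squares up to lam^(2n), and the convolution
  divides by c(n) = \<nu> lam^(2n). The bound is therefore the same for all modes.\<close>

lemma gY_noise_le:
  assumes n: "n \<ge> 1" and t: "t \<in> {0..T}"
    and span: "ito_span (itg (noise_idx n) t (\<lambda>p r \<omega>. exp (- (c n * (t - r))) * gY n p r)) Z"
  shows "(\<integral>\<^sup>+\<omega>. ennreal ((Z \<omega>)\<^sup>2) \<partial>M) \<le> ennreal (A / \<nu>)"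
proof -
  have G0: "lam ^ (2 * n) * A \<ge> 0" using lam A by simp
  have "(\<integral>\<^sup>+\<omega>. ennreal ((Z \<omega>)\<^sup>2) \<partial>M) \<le> ennreal (lam ^ (2 * n) * A / c n)"
  proof (rule noise_norm_le[OF n t G0 span, where b = "\<lambda>_ _. lam ^ (2 * n) * A"])
    fix r assume r: "r \<in> {0..t}"
    then have rT: "r \<in> {0..T}" using t by auto
    have "(gY n p r)\<^sup>2 = (lam ^ fst p * real (snd p) powr (- \<alpha>))\<^sup>2 * (nz n p (Y r))\<^sup>2" for p
      by (simp only: gY_def power_mult_distrib)
    moreover have "(\<integral>\<^sup>+p. ennreal (indicator (noise_idx n) p * ((lam ^ fst p * real (snd p) powr (- \<alpha>))\<^sup>2 * (nz n p (Y r))\<^sup>2)) \<partial>count_space UNIV)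
        \<le> ennreal (lam ^ (2 * n)) * (\<Sum>k. ennreal ((Y r k)\<^sup>2))"
    proof (rule noise_idx_sum_le)
      fix p assume p: "p \<in> noise_idx n"
      have "(real (snd p) powr (- \<alpha>))\<^sup>2 \<le> 1"
        using powr_neg_le_one[of \<alpha> "snd p"] p \<alpha> by (intro power_le_one) (auto simp: noise_idx_def)
      then have "(lam ^ fst p)\<^sup>2 * (real (snd p) powr (- \<alpha>))\<^sup>2 \<le> lam ^ (2 * n) * 1"
        using noise_coeff_le[OF lam p] lam by (intro mult_mono) auto
      then show "(lam ^ fst p * real (snd p) powr (- \<alpha>))\<^sup>2 \<le> lam ^ (2 * n)" by (simp only: power_mult_distrib mult_1_right)
    qed (use lam in simp)
    ultimately have "(\<integral>\<^sup>+p. ennreal (indicator (noise_idx n) p * (gY n p r)\<^sup>2) \<partial>count_space UNIV) \<le> ennreal (lam ^ (2 * n)) * (\<Sum>k. ennreal ((Y r k)\<^sup>2))"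
      by simp
    also have "\<dots> \<le> ennreal (lam ^ (2 * n)) * ennreal A" by (intro mult_left_mono Y_bound rT) simp
    also have "\<dots> = ennreal (lam ^ (2 * n) * A)" using lam A by (simp add: ennreal_mult)
    finally show "AE \<omega> in M. (\<integral>\<^sup>+p. ennreal (indicator (noise_idx n) p * (gY n p r)\<^sup>2) \<partial>count_space UNIV) \<le> ennreal (lam ^ (2 * n) * A)"
      by simp
  qed (auto simp: emeasure_space_1)
  also have "lam ^ (2 * n) * A / c n = A / \<nu>" using lam by (simp add: c_def)
  finally show ?thesis .
qed

text \<open>The integrand is random here, so the pathwise bound on the motions is a random variable
  and only its mean is controlled. For j \<le> m closeness of the two solutions is used, for j > m
  smallness of the coefficients.\<close>

lemma \<zeta>_noise_le:
  assumes n: "n \<ge> 1" and t: "t \<in> {0..T}" and d: "d \<ge> 0"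
    and mN: "m \<le> N" and s: "0 \<le> s" "\<And>j. j > m \<Longrightarrow> (real j powr (- \<alpha>))\<^sup>2 \<le> s"
    and D: "\<And>r. r \<in> {0..T} \<Longrightarrow> (\<integral>\<^sup>+\<omega>. ennreal (\<Sum>k\<le>n + m. (D r \<omega> k)\<^sup>2) \<partial>M) \<le> ennreal d"
    and span: "ito_span (itg (noise_idx n) t (\<lambda>p r \<omega>. exp (- (c n * (t - r))) * (gX n p r \<omega> - gY n p r))) Z"
  shows "(\<integral>\<^sup>+\<omega>. ennreal ((Z \<omega>)\<^sup>2) \<partial>M) \<le> ennreal ((d + 4 * s * A) / \<nu>)"
proof -
  have l0: "lam ^ (2 * n) > 0" using lam by simp
  have G0: "lam ^ (2 * n) * (d + 4 * s * A) \<ge> 0" using lam A d s by simp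
  have "(\<integral>\<^sup>+\<omega>. ennreal ((Z \<omega>)\<^sup>2) \<partial>M) \<le> ennreal (lam ^ (2 * n) * (d + 4 * s * A) / c n)"
  proof (rule noise_norm_le[OF n t G0 span, where b = "\<lambda>r \<omega>. lam ^ (2 * n) * ((\<Sum>k\<le>n + m. (D r \<omega> k)\<^sup>2) + 4 * s * A)"])
    fix r assume r: "r \<in> {0..t}"
    then have rT: "r \<in> {0..T}" using t by auto
    have Dm: "(\<lambda>\<omega>. \<Sum>k\<le>n + m. (D r \<omega> k)\<^sup>2) \<in> borel_measurable M"
      by (intro borel_measurable_sum borel_measurable_power D_measurable[OF rT])
    show "(\<lambda>\<omega>. lam ^ (2 * n) * ((\<Sum>k\<le>n + m. (D r \<omega> k)\<^sup>2) + 4 * s * A)) \<in> borel_measurable M" using Dm by measurable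
    show "AE \<omega> in M. (\<integral>\<^sup>+p. ennreal (indicator (noise_idx n) p * (gX n p r \<omega> - gY n p r)\<^sup>2) \<partial>count_space UNIV)
        \<le> ennreal (lam ^ (2 * n) * ((\<Sum>k\<le>n + m. (D r \<omega> k)\<^sup>2) + 4 * s * A))"
      using X_bound
    proof eventually_elim
      case (elim \<omega>)
      have eq: "gX n p r \<omega> - gY n p r = lam ^ fst p * real (snd p) powr (- \<alpha>) * ((if snd p \<le> N then nz n p (X r \<omega>) else 0) - nz n p (Y r))" for p
        by (simp only: gX_def gY_def right_diff_distrib)
      have XA: "(\<Sum>k. ennreal ((X r \<omega> k)\<^sup>2)) \<le> ennreal A" using elim rT by blast
      show ?case
        unfolding eq D_def
      proof (rule noise_diff_sum_le[OF lam \<alpha> mN s(1)])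
        show "(real j powr (- \<alpha>))\<^sup>2 \<le> s" if "j > m" for j using s(2)[OF that] .
      qed (use XA Y_bound[OF rT] A in auto)
    qed
    have "(\<integral>\<^sup>+\<omega>. ennreal (lam ^ (2 * n) * ((\<Sum>k\<le>n + m. (D r \<omega> k)\<^sup>2) + 4 * s * A)) \<partial>M)
        = (\<integral>\<^sup>+\<omega>. ennreal (lam ^ (2 * n)) * (ennreal (\<Sum>k\<le>n + m. (D r \<omega> k)\<^sup>2) + ennreal (4 * s * A)) \<partial>M)"
      using l0 s A by (intro nn_integral_cong) (simp add: ennreal_mult ennreal_plus sum_nonneg)
    also have "\<dots> = ennreal (lam ^ (2 * n)) * (\<integral>\<^sup>+\<omega>. ennreal (\<Sum>k\<le>n + m. (D r \<omega> k)\<^sup>2) + ennreal (4 * s * A) \<partial>M)"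
      by (intro nn_integral_cmult borel_measurable_add measurable_compose[OF Dm measurable_ennreal] borel_measurable_const)
    also have "(\<integral>\<^sup>+\<omega>. ennreal (\<Sum>k\<le>n + m. (D r \<omega> k)\<^sup>2) + ennreal (4 * s * A) \<partial>M) = (\<integral>\<^sup>+\<omega>. ennreal (\<Sum>k\<le>n + m. (D r \<omega> k)\<^sup>2) \<partial>M) + ennreal (4 * s * A)"
      by (subst nn_integral_add[OF measurable_compose[OF Dm measurable_ennreal] borel_measurable_const]) (simp add: emeasure_space_1)
    also have "ennreal (lam ^ (2 * n)) * \<dots> \<le> ennreal (lam ^ (2 * n)) * (ennreal d + ennreal (4 * s * A))"
      using D[OF rT] by (intro mult_left_mono add_right_mono) auto
    also have "\<dots> = ennreal (lam ^ (2 * n) * (d + 4 * s * A))"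
      using l0 s A d by (simp add: ennreal_mult ennreal_plus)
    finally show "(\<integral>\<^sup>+\<omega>. ennreal (lam ^ (2 * n) * ((\<Sum>k\<le>n + m. (D r \<omega> k)\<^sup>2) + 4 * s * A)) \<partial>M) \<le> ennreal (lam ^ (2 * n) * (d + 4 * s * A))" .
  qed
  also have "lam ^ (2 * n) * (d + 4 * s * A) / c n = (d + 4 * s * A) / \<nu>" using lam by (simp add: c_def)
  finally show ?thesis .
qed

lemma D_partial_le: "AE \<omega> in M. \<forall>r\<in>{0..T}. (\<Sum>k\<le>L. (D r \<omega> k)\<^sup>2) \<le> 4 * A"
  using D_sum_le
proof eventually_elim
  case (elim \<omega>)
  show ?case
  proof
    fix r assume r: "r \<in> {0..T}"
    have "ennreal (\<Sum>k\<le>L. (D r \<omega> k)\<^sup>2) = (\<Sum>k\<le>L. ennreal ((D r \<omega> k)\<^sup>2))" by (rule sum_ennreal[symmetric]) simp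
    also have "\<dots> \<le> (\<Sum>k. ennreal ((D r \<omega> k)\<^sup>2))" by (rule sum_le_suminf[OF summableI]) auto
    also have "\<dots> \<le> ennreal (4 * A)" using elim r by blast
    finally show "(\<Sum>k\<le>L. (D r \<omega> k)\<^sup>2) \<le> 4 * A" using A by (subst (asm) ennreal_le_iff) auto
  qed
qed

lemma scaled_noise_wnorm_le:
  assumes w: "w \<in> borel_measurable M" and Z: "\<And>n. n \<ge> 1 \<Longrightarrow> (\<lambda>\<omega>. Z \<omega> n) \<in> borel_measurable M"
    and b: "(\<integral>\<^sup>+\<omega>. ennreal (w \<omega>) * wnorm (rw lam \<beta> m) (Z \<omega>) \<partial>M) \<le> ennreal b" and b0: "b \<ge> 0"
  shows "(\<integral>\<^sup>+\<omega>. ennreal (w \<omega>) * wnorm (rw lam \<beta> m) (\<lambda>n. sqrt (2 * \<nu>) * Z \<omega> n) \<partial>M) \<le> ennreal (2 * \<nu> * b)"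
proof -
  have m: "(\<lambda>\<omega>. wnorm (rw lam \<beta> m) (Z \<omega>)) \<in> borel_measurable M"
    unfolding wnorm_def using Z by (intro borel_measurable_suminf_order) simp
  have s2: "(sqrt (2 * \<nu>))\<^sup>2 = 2 * \<nu>" using \<nu> by simp
  have "(\<integral>\<^sup>+\<omega>. ennreal (w \<omega>) * wnorm (rw lam \<beta> m) (\<lambda>n. sqrt (2 * \<nu>) * Z \<omega> n) \<partial>M)
     = (\<integral>\<^sup>+\<omega>. ennreal (2 * \<nu>) * (ennreal (w \<omega>) * wnorm (rw lam \<beta> m) (Z \<omega>)) \<partial>M)"
    unfolding wnorm_scale[OF rw0] s2 by (simp only: mult.left_commute)
  also have "\<dots> = ennreal (2 * \<nu>) * (\<integral>\<^sup>+\<omega>. ennreal (w \<omega>) * wnorm (rw lam \<beta> m) (Z \<omega>) \<partial>M)"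
    using m w by (intro nn_integral_cmult) measurable
  also have "\<dots> \<le> ennreal (2 * \<nu>) * ennreal b" using b by (rule mult_left_mono) simp
  also have "\<dots> = ennreal (2 * \<nu> * b)" using \<nu> b0 by (simp add: ennreal_mult)
  finally show ?thesis .
qed

text \<open>The weight stays fixed while s runs over the whole interval, so it may depend on the
  solution at later times. The assumption on the forcing ranges over all versions of the stochastic
  convolution, because \<open>\<xi>_forcing\<close> supplies one only existentially. The factor
  2\<nu> is the square of the coefficient of the noise.\<close>

lemma \<xi>_weighted_bound:
  assumes w: "w \<in> borel_measurable M" "\<And>\<omega>. \<omega> \<in> space M \<Longrightarrow> 0 \<le> w \<omega>" "\<And>\<omega>. \<omega> \<in> space M \<Longrightarrow> w \<omega> \<le> Cw" and b0: "b \<ge> 0"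
    and Z: "\<And>s Z. s \<in> {0..T} \<Longrightarrow> (\<And>n. n \<ge> 1 \<Longrightarrow> ito_span (itg (noise_idx n) s (\<lambda>p r \<omega>. exp (- (c n * (s - r))) * gY n p r)) (\<lambda>\<omega>. Z \<omega> n)) \<Longrightarrow>
       (\<integral>\<^sup>+\<omega>. ennreal (w \<omega>) * wnorm (rw lam \<beta> m) (Z \<omega>) \<partial>M) \<le> ennreal b"
    and t: "t \<in> {0..T}"
  shows "(\<integral>\<^sup>+\<omega>. ennreal (w \<omega>) * wnorm (rw lam \<beta> m) (\<xi> t \<omega>) \<partial>M) \<le> ennreal (4 * (2 * \<nu> * b) * gron lam \<nu> A T)"
  unfolding gron_def
proof (rule weighted_gronwall[OF rw_w T \<nu>, where P = "\<lambda>r _. Y r" and Q = "\<lambda>r _. Y r" and Cw = Cw])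
  show "0 < sqrt A" using A by simp
  show "0 \<le> 2 * \<nu> * b" using \<nu> b0 by simp
  show "AE \<omega> in M. \<forall>t\<in>{0..T}. \<forall>k. \<bar>Y t k\<bar> \<le> sqrt A \<and> \<bar>Y t k\<bar> \<le> sqrt A" using Y_abs by simp
  show "AE \<omega> in M. (\<integral>\<^sup>+t\<in>{0..T}. wnorm (rw lam \<beta> m) (\<xi> t \<omega>) \<partial>lborel) < \<infinity>" using \<xi>_integrable by (rule AE_I2)
  fix s assume s: "s \<in> {0..T}"
  obtain Z' where Z': "\<And>n. n \<ge> 1 \<Longrightarrow> ito_span (itg (noise_idx n) s (\<lambda>p r \<omega>. exp (- (c n * (s - r))) * gY n p r)) (\<lambda>\<omega>. Z' \<omega> n)"
    and eq: "AE \<omega> in M. \<forall>n. \<xi> s \<omega> n - conv (c n) (\<lambda>r. B lam (\<xi> r \<omega>) (Y r) n + B lam (Y r) (\<xi> r \<omega>) n) s = sqrt (2 * \<nu>) * Z' \<omega> n"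
    using \<xi>_forcing[OF s] by blast
  have "(\<integral>\<^sup>+\<omega>. ennreal (w \<omega>) * wnorm (rw lam \<beta> m) (\<lambda>n. \<xi> s \<omega> n - conv (\<nu> * lam ^ (2 * n)) (\<lambda>r. B lam (\<xi> r \<omega>) (Y r) n + B lam (Y r) (\<xi> r \<omega>) n) s) \<partial>M)
    = (\<integral>\<^sup>+\<omega>. ennreal (w \<omega>) * wnorm (rw lam \<beta> m) (\<lambda>n. sqrt (2 * \<nu>) * Z' \<omega> n) \<partial>M)"
    by (rule nn_integral_cong_AE) (use eq in eventually_elim, simp add: c_def)
  also have "\<dots> \<le> ennreal (2 * \<nu> * b)"
    by (rule scaled_noise_wnorm_le[OF w(1) _ Z[OF s Z'] b0]) (rule noise_span_measurable[OF Z'])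
  finally show "(\<integral>\<^sup>+\<omega>. ennreal (w \<omega>) * wnorm (rw lam \<beta> m) (\<lambda>n. \<xi> s \<omega> n - conv (\<nu> * lam ^ (2 * n)) (\<lambda>r. B lam (\<xi> r \<omega>) (Y r) n + B lam (Y r) (\<xi> r \<omega>) n) s) \<partial>M) \<le> ennreal (2 * \<nu> * b)" .
qed (use w t \<xi>_measurable \<xi>_cont \<xi>_0 Y_cont in auto)

text \<open>The same Gronwall estimate with lowered weights yields decay in m. As these weights
  agree with those of H^{-\<beta>} from mode m on, this is a tail estimate uniform in time and in
  N.\<close>

lemma \<xi>_bound:
  assumes t: "t \<in> {0..T}"
  shows "(\<integral>\<^sup>+\<omega>. wnorm (rw lam \<beta> m) (\<xi> t \<omega>) \<partial>M) \<le> ennreal (8 * A * geo lam \<beta> * gron lam \<nu> A T * lam powr (- \<beta> * real m))"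
proof -
  have g0: "geo lam \<beta> > 0" using geo_pos lam \<beta> by blast
  have b0: "0 \<le> A / \<nu> * (geo lam \<beta> * lam powr (- \<beta> * real m))" using A \<nu> g0 by simp
  have "(\<integral>\<^sup>+\<omega>. ennreal 1 * wnorm (rw lam \<beta> m) (\<xi> t \<omega>) \<partial>M)
      \<le> ennreal (4 * (2 * \<nu> * (A / \<nu> * (geo lam \<beta> * lam powr (- \<beta> * real m)))) * gron lam \<nu> A T)"
  proof (rule \<xi>_weighted_bound[where Cw = 1, OF _ _ _ b0 _ t])
    fix s Z assume s: "s \<in> {0..T}" and Z: "\<And>n. n \<ge> 1 \<Longrightarrow> ito_span (itg (noise_idx n) s (\<lambda>p r \<omega>. exp (- (c n * (s - r))) * gY n p r)) (\<lambda>\<omega>. Z \<omega> n)"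
    show "(\<integral>\<^sup>+\<omega>. ennreal 1 * wnorm (rw lam \<beta> m) (Z \<omega>) \<partial>M) \<le> ennreal (A / \<nu> * (geo lam \<beta> * lam powr (- \<beta> * real m)))"
    proof (rule nn_integral_wnorm_le[OF lam \<beta>(1)])
      show "(\<integral>\<^sup>+\<omega>. ennreal 1 * ennreal ((Z \<omega> n)\<^sup>2) \<partial>M) \<le> ennreal (A / \<nu>)" if "n \<ge> 1" for n
        using gY_noise_le[OF that s Z[OF that]] by simp
      show "(\<lambda>\<omega>. Z \<omega> n) \<in> borel_measurable M" if "n \<ge> 1" for n using noise_span_measurable[OF Z[OF that]] .
    qed (use A \<nu> in auto)
  qed auto
  also have "4 * (2 * \<nu> * (A / \<nu> * (geo lam \<beta> * lam powr (- \<beta> * real m)))) * gron lam \<nu> A T = 8 * A * geo lam \<beta> * gron lam \<nu> A T * lam powr (- \<beta> * real m)"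
    using \<nu> by (simp add: mult_ac)
  finally show ?thesis by simp
qed

text \<open>A geometric sum bounds \<open>\<Theta> n\<close> by \<open>eps\<close> times
  lam^(2n)/(lam^2 - 1), and the convolution divides by \<nu> lam^(2n). Division by sg turns
  \<open>eps\<close> into its square root, whose square stands in the bound.\<close>

lemma remainder_bound:
  assumes t: "t \<in> {0..T}"
  shows "AE \<omega> in M. wnorm (rw lam \<beta> 0) (\<lambda>n. - (1 / sg) * (\<nu> * \<Theta> n) * conv (c n) (\<lambda>r. X r \<omega> n) t)
     \<le> ennreal (geo lam \<beta> * eps \<alpha> N * (A / (lam\<^sup>2 - 1)\<^sup>2))"
  using X_abs AE_space
proof eventually_elim
  case (elim \<omega>)
  have t0: "t \<ge> 0" using t by simp
  have sub: "{0..t} \<subseteq> {0..T}" using t by auto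
  have l1: "lam\<^sup>2 - 1 > 0" using lam by (simp add: one_less_power)
  define R where "R = sg * sqrt A / (lam\<^sup>2 - 1)"
  have le: "\<bar>- (1 / sg) * (\<nu> * \<Theta> n) * conv (c n) (\<lambda>r. X r \<omega> n) t\<bar> \<le> R" if n: "n \<ge> 1" for n
  proof -
    have \<Theta>0: "\<Theta> n \<ge> 0" unfolding \<Theta>_def using lam by (intro sum_nonneg) auto
    have th: "(theta \<alpha> N j)\<^sup>2 \<le> eps \<alpha> N" for j
    proof (cases "1 \<le> j \<and> j \<le> N")
      case True
      have "(real j powr (- \<alpha>))\<^sup>2 \<le> 1" using powr_neg_le_one[of \<alpha> j] True \<alpha> by (intro power_le_one) auto
      then have "eps \<alpha> N * (real j powr (- \<alpha>))\<^sup>2 \<le> eps \<alpha> N * 1" using eps_bounds[OF N, of \<alpha>] by (intro mult_left_mono) auto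
      then show ?thesis using True sg(3) by (simp add: theta_def sg_def power_mult_distrib)
    next
      case False
      then show ?thesis using eps_bounds[OF N, of \<alpha>] by (auto simp: theta_def)
    qed
    have "\<Theta> n \<le> (\<Sum>j=1..<n. eps \<alpha> N * lam ^ (2 * (n - j)))"
      unfolding \<Theta>_def using th lam by (intro sum_mono mult_right_mono) auto
    also have "\<dots> = eps \<alpha> N * (\<Sum>j=1..<n. lam ^ (2 * (n - j)))" by (rule sum_distrib_left[symmetric])
    finally have "(lam\<^sup>2 - 1) * \<Theta> n \<le> (lam\<^sup>2 - 1) * (eps \<alpha> N * (\<Sum>j=1..<n. lam ^ (2 * (n - j))))" using l1 by (intro mult_left_mono) auto
    also have "\<dots> = eps \<alpha> N * ((lam\<^sup>2 - 1) * (\<Sum>j=1..<n. lam ^ (2 * (n - j))))" by (simp only: mult.left_commute)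
    also have "\<dots> = eps \<alpha> N * (lam ^ (2 * n) - lam\<^sup>2)" by (simp only: geometric_rem_sum[OF n])
    also have "\<dots> \<le> eps \<alpha> N * lam ^ (2 * n)" using eps_bounds[OF N, of \<alpha>] by (intro mult_left_mono) auto
    finally have \<Theta>: "\<Theta> n \<le> eps \<alpha> N * lam ^ (2 * n) / (lam\<^sup>2 - 1)" using l1 by (simp add: pos_le_divide_eq mult.commute)
    have "\<bar>conv (c n) (\<lambda>r. X r \<omega> n) t\<bar> \<le> sqrt A / c n"
      using elim(1) sub by (intro conv_abs_le c_pos t0 continuous_on_subset[OF X_cont[OF elim(2)] sub]) auto
    then have "(1 / sg) * (\<nu> * \<Theta> n) * \<bar>conv (c n) (\<lambda>r. X r \<omega> n) t\<bar> \<le> (1 / sg) * (\<nu> * (eps \<alpha> N * lam ^ (2 * n) / (lam\<^sup>2 - 1))) * (sqrt A / c n)"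
      using \<Theta> \<Theta>0 sg \<nu> eps_bounds[OF N, of \<alpha>] lam l1 by (intro mult_mono) auto
    also have "\<dots> = R"
    proof -
      have "(1 / s) * (v * (s\<^sup>2 * l / q)) * (a / (v * l)) = s * a / q" if "s > 0" "v > 0" "l > 0" "q > 0" for s v l q a :: real
        using that by (simp add: field_simps power2_eq_square)
      from this[OF sg(1) \<nu> _ l1, of "lam ^ (2 * n)" "sqrt A"] lam show ?thesis unfolding R_def c_def sg(3)[symmetric] by simp
    qed
    finally show ?thesis using sg(1) \<nu> \<Theta>0 by (simp add: abs_mult)
  qed
  have R2: "R\<^sup>2 = eps \<alpha> N * (A / (lam\<^sup>2 - 1)\<^sup>2)"
    unfolding R_def power_divide power_mult_distrib sg(3) using A by simp
  have "wnorm (rw lam \<beta> 0) (\<lambda>n. - (1 / sg) * (\<nu> * \<Theta> n) * conv (c n) (\<lambda>r. X r \<omega> n) t) \<le> (\<Sum>n. ennreal (R\<^sup>2) * ennreal (rw lam \<beta> 0 (Suc n)))"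
    unfolding wnorm_def
  proof (rule suminf_ennreal_mono)
    fix n
    define q where "q = - (1 / sg) * (\<nu> * \<Theta> (Suc n)) * conv (c (Suc n)) (\<lambda>r. X r \<omega> (Suc n)) t"
    have "\<bar>q\<bar> \<le> R" unfolding q_def by (rule le) simp
    then have "\<bar>q\<bar>\<^sup>2 \<le> R\<^sup>2" by (rule power_mono) simp
    then have "rw lam \<beta> 0 (Suc n) * q\<^sup>2 \<le> R\<^sup>2 * rw lam \<beta> 0 (Suc n)" using rw0 by (subst mult.commute) (intro mult_right_mono, auto)
    then show "ennreal (rw lam \<beta> 0 (Suc n) * q\<^sup>2) \<le> ennreal (R\<^sup>2) * ennreal (rw lam \<beta> 0 (Suc n))"
      using rw0 by (simp add: ennreal_mult[symmetric] ennreal_leI)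
  qed
  also have "\<dots> = ennreal (R\<^sup>2) * (\<Sum>n. ennreal (rw lam \<beta> 0 (Suc n)))" by (rule ennreal_suminf_cmult)
  also have "\<dots> \<le> ennreal (R\<^sup>2) * ennreal (geo lam \<beta>)"
    using rw_sum_le[OF lam \<beta>(1), of 0] lam by (intro mult_left_mono) (auto simp: geo_def)
  also have "\<dots> = ennreal (geo lam \<beta> * eps \<alpha> N * (A / (lam\<^sup>2 - 1)\<^sup>2))"
    using geo_pos[OF lam \<beta>(1)] A eps_bounds[OF N, of \<alpha>] by (subst ennreal_mult[symmetric]) (auto simp: R2 mult_ac)
  finally show ?case .
qed

text \<open>Mode n of B(\<xi>, D) contains \<xi>_{n-1} D_{n-1} and \<xi>_n D_{n+1}. Attaching to
  \<xi>_k the root of D_k^2 + D_{k+1}^2 covers both products and gives a sequence to which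
  \<open>wnorm_conv_le\<close> applies.\<close>

definition vv where "vv r \<omega> n = \<xi> r \<omega> n * sqrt ((D r \<omega> n)\<^sup>2 + (D r \<omega> (Suc n))\<^sup>2)"

text \<open>The random weight for \<xi>. The cut-off at 4A changes it only on a null set, yet makes
  it bounded at every \<omega>, as the weighted estimates require. The sum reaches
  \<open>Suc m\<close> because mode m of \<open>vv\<close> involves D at m + 1.\<close>

definition Dw where "Dw m r \<omega> = min (4 * A) (\<Sum>k\<le>Suc m. (D r \<omega> k)\<^sup>2)"

lemma vv_power2: "(vv r \<omega> n)\<^sup>2 = (\<xi> r \<omega> n)\<^sup>2 * ((D r \<omega> n)\<^sup>2 + (D r \<omega> (Suc n))\<^sup>2)"
  by (simp add: vv_def power_mult_distrib)

lemma vv_cont: "\<omega> \<in> space M \<Longrightarrow> continuous_on {0..T} (\<lambda>r. vv r \<omega> n)"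
  unfolding vv_def by (intro continuous_on_mult \<xi>_cont continuous_on_real_sqrt continuous_on_add continuous_on_power D_cont)

lemma vv_measurable: "r \<in> {0..T} \<Longrightarrow> (\<lambda>\<omega>. vv r \<omega> n) \<in> borel_measurable M"
  unfolding vv_def using \<xi>_measurable D_measurable by measurable

lemma Dw_bounds:
  assumes r: "r \<in> {0..T}"
  shows "Dw m r \<in> borel_measurable M" "0 \<le> Dw m r \<omega>" "Dw m r \<omega> \<le> 4 * A"
proof -
  have "(\<lambda>\<omega>. \<Sum>k\<le>Suc m. (D r \<omega> k)\<^sup>2) \<in> borel_measurable M"
    by (intro borel_measurable_sum borel_measurable_power D_measurable r)
  then show "Dw m r \<in> borel_measurable M" unfolding Dw_def[abs_def] by measurable
  have "0 \<le> (\<Sum>k\<le>Suc m. (D r \<omega> k)\<^sup>2)" by (rule sum_nonneg) simp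
  then show "0 \<le> Dw m r \<omega>" "Dw m r \<omega> \<le> 4 * A" unfolding Dw_def using A by (auto simp del: sum.atMost_Suc)
qed

text \<open>Up to mode m the factor from D is dominated by the random weight. Beyond m only the
  bound 4A on D is used, and the tail of \<xi>, measured with the lowered weights, has to be small
  instead.\<close>

lemma vv_wnorm_le:
  "AE \<omega> in M. \<forall>r\<in>{0..T}. wnorm (rw lam \<beta> 0) (vv r \<omega>) \<le> ennreal (Dw m r \<omega>) * wnorm (rw lam \<beta> 0) (\<xi> r \<omega>) + ennreal (8 * A) * wnorm (rw lam \<beta> m) (\<xi> r \<omega>)"
proof -
  have "AE \<omega> in M. \<forall>L. \<forall>r\<in>{0..T}. (\<Sum>k\<le>L. (D r \<omega> k)\<^sup>2) \<le> 4 * A"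
    unfolding AE_all_countable using D_partial_le by blast
  then show ?thesis
  proof eventually_elim
    case (elim \<omega>)
    show ?case
    proof
      fix r assume r: "r \<in> {0..T}"
      have "(\<Sum>k\<le>Suc m. (D r \<omega> k)\<^sup>2) \<le> 4 * A" using elim r by blast
      then have Dw: "Dw m r \<omega> = (\<Sum>k\<le>Suc m. (D r \<omega> k)\<^sup>2)" unfolding Dw_def by (simp only: min.absorb2)
      have Dw0: "0 \<le> Dw m r \<omega>" using Dw_bounds(2)[OF r] .
      have "wnorm (rw lam \<beta> 0) (vv r \<omega>) \<le> (\<Sum>n. ennreal (Dw m r \<omega>) * ennreal (rw lam \<beta> 0 (Suc n) * (\<xi> r \<omega> (Suc n))\<^sup>2)
         + ennreal (8 * A) * ennreal (rw lam \<beta> m (Suc n) * (\<xi> r \<omega> (Suc n))\<^sup>2))"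
        unfolding wnorm_def
      proof (rule suminf_ennreal_mono)
        fix n
        define a where "a = rw lam \<beta> 0 (Suc n) * (\<xi> r \<omega> (Suc n))\<^sup>2"
        define a' where "a' = rw lam \<beta> m (Suc n) * (\<xi> r \<omega> (Suc n))\<^sup>2"
        define s where "s = (D r \<omega> (Suc n))\<^sup>2 + (D r \<omega> (Suc (Suc n)))\<^sup>2"
        have a0: "a \<ge> 0" "a' \<ge> 0" using rw0 by (auto simp: a_def a'_def)
        have "rw lam \<beta> 0 (Suc n) * (vv r \<omega> (Suc n))\<^sup>2 = s * a" unfolding vv_power2 a_def s_def by (simp only: mult_ac)
        also have "\<dots> \<le> Dw m r \<omega> * a + 8 * A * a'"
        proof (cases "Suc n \<le> m")
          case True
          have "s = (\<Sum>k\<in>{Suc n, Suc (Suc n)}. (D r \<omega> k)\<^sup>2)" by (simp add: s_def)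
          also have "\<dots> \<le> (\<Sum>k\<le>Suc m. (D r \<omega> k)\<^sup>2)" using True by (intro sum_mono2) auto
          finally have "s * a \<le> Dw m r \<omega> * a" unfolding Dw using a0 by (intro mult_right_mono)
          moreover have "0 \<le> 8 * A * a'" using A a0 by simp
          ultimately show ?thesis by linarith
        next
          case False
          then have aa: "a' = a" unfolding a_def a'_def by (subst rw_eq_0) auto
          have "s = (\<Sum>k\<in>{Suc n, Suc (Suc n)}. (D r \<omega> k)\<^sup>2)" by (simp add: s_def)
          also have "\<dots> \<le> (\<Sum>k\<le>Suc (Suc n). (D r \<omega> k)\<^sup>2)" by (intro sum_mono2) auto
          also have "\<dots> \<le> 4 * A" using elim r by blast
          finally have "s * a \<le> 4 * A * a" using a0 by (intro mult_right_mono)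
          also have "\<dots> \<le> 8 * A * a'" unfolding aa using a0 A by (intro mult_right_mono) auto
          finally show ?thesis using Dw0 a0 mult_nonneg_nonneg[OF Dw0 a0(1)] by linarith
        qed
        finally have "ennreal (rw lam \<beta> 0 (Suc n) * (vv r \<omega> (Suc n))\<^sup>2) \<le> ennreal (Dw m r \<omega> * a + 8 * A * a')" by (rule ennreal_leI)
        also have "\<dots> = ennreal (Dw m r \<omega>) * ennreal a + ennreal (8 * A) * ennreal a'"
          using Dw0 a0 A by (simp add: ennreal_plus ennreal_mult)
        finally show "ennreal (rw lam \<beta> 0 (Suc n) * (vv r \<omega> (Suc n))\<^sup>2) \<le> ennreal (Dw m r \<omega>) * ennreal (rw lam \<beta> 0 (Suc n) * (\<xi> r \<omega> (Suc n))\<^sup>2)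
           + ennreal (8 * A) * ennreal (rw lam \<beta> m (Suc n) * (\<xi> r \<omega> (Suc n))\<^sup>2)" unfolding a_def a'_def .
      qed
      also have "\<dots> = ennreal (Dw m r \<omega>) * wnorm (rw lam \<beta> 0) (\<xi> r \<omega>) + ennreal (8 * A) * wnorm (rw lam \<beta> m) (\<xi> r \<omega>)"
        unfolding wnorm_def suminf_ennreal_add ennreal_suminf_cmult ..
      finally show "wnorm (rw lam \<beta> 0) (vv r \<omega>) \<le> ennreal (Dw m r \<omega>) * wnorm (rw lam \<beta> 0) (\<xi> r \<omega>) + ennreal (8 * A) * wnorm (rw lam \<beta> m) (\<xi> r \<omega>)" .
    qed
  qed
qed

text \<open>The product term is an inhomogeneity and needs no Gronwall argument: each of its two
  summands is dominated by a neighbouring mode of \<open>vv\<close>, so the convolution gain reduces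
  it to the mean of the norm of \<open>vv\<close>.\<close>

lemma conv_B_bound:
  assumes t: "t \<in> {0..T}" and V: "V \<ge> 0"
    and v: "\<And>r. r \<in> {0..T} \<Longrightarrow> (\<integral>\<^sup>+\<omega>. wnorm (rw lam \<beta> 0) (vv r \<omega>) \<partial>M) \<le> ennreal V"
  shows "(\<integral>\<^sup>+\<omega>. wnorm (rw lam \<beta> 0) (\<lambda>n. conv (c n) (\<lambda>r. B lam (\<xi> r \<omega>) (D r \<omega>) n) t) \<partial>M) \<le> ennreal (6 * lam\<^sup>2 / \<nu> * (T * V))"
proof -
  have sub: "{0..t} \<subseteq> {0..T}" using t by auto
  have T0: "T \<ge> 0" using T by simp
  define v where "v = (\<lambda>r \<omega>. wnorm (rw lam \<beta> 0) (vv r \<omega>) * indicator {0..T} r)"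
  have vm: "case_prod v \<in> borel_measurable (lborel \<Otimes>\<^sub>M M)"
    unfolding v_def using borel_measurable_wnorm_paths[OF T0 vv_measurable vv_cont rw0] by simp
  interpret PS: pair_sigma_finite lborel M by unfold_locales
  have "(\<integral>\<^sup>+\<omega>. wnorm (rw lam \<beta> 0) (\<lambda>n. conv (c n) (\<lambda>r. B lam (\<xi> r \<omega>) (D r \<omega>) n) t) \<partial>M) \<le> (\<integral>\<^sup>+\<omega>. ennreal (3 * lam\<^sup>2 * 2 / \<nu>) * (\<integral>\<^sup>+r. v r \<omega> \<partial>lborel) \<partial>M)"
  proof (rule nn_integral_mono)
    fix \<omega> assume \<omega>: "\<omega> \<in> space M"
    interpret W: weights lam "rw lam \<beta> 0" by (rule rw_w)
    have "wnorm (rw lam \<beta> 0) (\<lambda>n. conv (\<nu> * lam ^ (2 * n)) (\<lambda>r. B lam (\<xi> r \<omega>) (D r \<omega>) n) t) \<le> ennreal (3 * lam\<^sup>2 * 2 / \<nu>) * (\<integral>\<^sup>+r\<in>{0..t}. wnorm (rw lam \<beta> 0) (vv r \<omega>) \<partial>lborel)"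
    proof (rule W.wnorm_conv_le)
      show "t \<ge> 0" using t by simp
      show "continuous_on {0..t} (\<lambda>r. B lam (\<xi> r \<omega>) (D r \<omega>) n)" for n
        by (rule continuous_on_subset[OF _ sub]) (intro continuous_on_B \<xi>_cont D_cont \<omega>)
      show "continuous_on {0..t} (\<lambda>r. vv r \<omega> n)" for n by (rule continuous_on_subset[OF vv_cont[OF \<omega>] sub])
      show "vv r \<omega> 0 = 0" if "r \<in> {0..t}" for r using \<xi>_0[OF \<omega>] that sub by (auto simp: vv_def)
      show "(B lam (\<xi> r \<omega>) (D r \<omega>) (Suc n))\<^sup>2 \<le> lam ^ (2 * Suc n) * 2 * ((vv r \<omega> n)\<^sup>2 + (vv r \<omega> (Suc n))\<^sup>2 + (vv r \<omega> (Suc (Suc n)))\<^sup>2)" for n r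
      proof -
        define L where "L = lam ^ Suc n"
        have L: "(lam ^ n)\<^sup>2 \<le> L\<^sup>2" using lam unfolding L_def by (intro power_mono power_increasing) auto
        have "B lam (\<xi> r \<omega>) (D r \<omega>) (Suc n) = lam ^ n * (\<xi> r \<omega> n * D r \<omega> n) + L * (- (\<xi> r \<omega> (Suc n) * D r \<omega> (Suc (Suc n))))"
          by (simp add: B_def L_def)
        then have "(B lam (\<xi> r \<omega>) (D r \<omega>) (Suc n))\<^sup>2 \<le> 2 * (lam ^ n * (\<xi> r \<omega> n * D r \<omega> n))\<^sup>2 + 2 * (L * (- (\<xi> r \<omega> (Suc n) * D r \<omega> (Suc (Suc n)))))\<^sup>2"
          by (simp only: real_power2_add_le)
        also have "\<dots> = 2 * ((lam ^ n)\<^sup>2 * (\<xi> r \<omega> n * D r \<omega> n)\<^sup>2) + 2 * (L\<^sup>2 * (\<xi> r \<omega> (Suc n) * D r \<omega> (Suc (Suc n)))\<^sup>2)"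
          by (simp only: power_mult_distrib power2_minus)
        also have "\<dots> \<le> 2 * (L\<^sup>2 * (vv r \<omega> n)\<^sup>2) + 2 * (L\<^sup>2 * (vv r \<omega> (Suc n))\<^sup>2)"
        proof (intro add_mono mult_left_mono mult_mono L)
          show "(\<xi> r \<omega> n * D r \<omega> n)\<^sup>2 \<le> (vv r \<omega> n)\<^sup>2" unfolding vv_power2 power_mult_distrib by (intro mult_left_mono) auto
          show "(\<xi> r \<omega> (Suc n) * D r \<omega> (Suc (Suc n)))\<^sup>2 \<le> (vv r \<omega> (Suc n))\<^sup>2" unfolding vv_power2 power_mult_distrib by (intro mult_left_mono) auto
        qed auto
        also have "\<dots> = L\<^sup>2 * 2 * ((vv r \<omega> n)\<^sup>2 + (vv r \<omega> (Suc n))\<^sup>2)" by (simp add: algebra_simps)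
        also have "\<dots> \<le> L\<^sup>2 * 2 * ((vv r \<omega> n)\<^sup>2 + (vv r \<omega> (Suc n))\<^sup>2 + (vv r \<omega> (Suc (Suc n)))\<^sup>2)" by (intro mult_left_mono) auto
        finally show ?thesis unfolding L_def power_even_eq .
      qed
    qed (use \<nu> in auto)
    also have "\<dots> \<le> ennreal (3 * lam\<^sup>2 * 2 / \<nu>) * (\<integral>\<^sup>+r. v r \<omega> \<partial>lborel)"
      unfolding v_def using sub by (intro mult_left_mono nn_integral_mono) (auto simp: indicator_def)
    finally show "wnorm (rw lam \<beta> 0) (\<lambda>n. conv (c n) (\<lambda>r. B lam (\<xi> r \<omega>) (D r \<omega>) n) t) \<le> ennreal (3 * lam\<^sup>2 * 2 / \<nu>) * (\<integral>\<^sup>+r. v r \<omega> \<partial>lborel)"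
      unfolding c_def .
  qed
  also have "\<dots> = ennreal (3 * lam\<^sup>2 * 2 / \<nu>) * (\<integral>\<^sup>+\<omega>. \<integral>\<^sup>+r. v r \<omega> \<partial>lborel \<partial>M)"
  proof (rule nn_integral_cmult)
    have "(\<lambda>(\<omega>, r). v r \<omega>) \<in> borel_measurable (M \<Otimes>\<^sub>M lborel)"
      using measurable_compose[OF measurable_pair_swap' vm] by (simp add: split_beta')
    then show "(\<lambda>\<omega>. \<integral>\<^sup>+r. v r \<omega> \<partial>lborel) \<in> borel_measurable M" by (rule lborel.borel_measurable_nn_integral)
  qed
  also have "(\<integral>\<^sup>+\<omega>. \<integral>\<^sup>+r. v r \<omega> \<partial>lborel \<partial>M) = (\<integral>\<^sup>+r. \<integral>\<^sup>+\<omega>. v r \<omega> \<partial>M \<partial>lborel)" by (rule PS.Fubini'[OF vm])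
  also have "ennreal (3 * lam\<^sup>2 * 2 / \<nu>) * \<dots> \<le> ennreal (3 * lam\<^sup>2 * 2 / \<nu>) * (\<integral>\<^sup>+r. ennreal V * indicator {0..T} r \<partial>lborel)"
  proof (intro mult_left_mono nn_integral_mono)
    fix r
    show "(\<integral>\<^sup>+\<omega>. v r \<omega> \<partial>M) \<le> ennreal V * indicator {0..T} r"
      using assms(3)[of r] by (cases "r \<in> {0..T}") (auto simp: v_def)
  qed simp
  also have "(\<integral>\<^sup>+r. ennreal V * indicator {0..T} r \<partial>lborel) = ennreal V * ennreal T" using T by (simp add: nn_integral_cmult_indicator)
  also have "ennreal (3 * lam\<^sup>2 * 2 / \<nu>) * (ennreal V * ennreal T) = ennreal (6 * lam\<^sup>2 / \<nu> * (T * V))"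
    using V T0 \<nu> by (simp add: ennreal_mult[symmetric] mult.commute)
  finally show ?thesis .
qed

end

text \<open>The Gronwall bound for \<eta> as a function of its three sources: e stands for
  \<open>eps\<close> in the Ito correction, V for the product term and q for the difference of the
  noises. It is homogeneous of degree one in the three, hence small as soon as all three
  are.\<close>

definition eta_bd :: "real \<Rightarrow> real \<Rightarrow> real \<Rightarrow> real \<Rightarrow> real \<Rightarrow> real \<Rightarrow> real \<Rightarrow> real \<Rightarrow> real" where
  "eta_bd lam \<nu> \<beta> T A e V q =
     4 * (4 * (6 * lam\<^sup>2 / \<nu> * (T * V)) + 4 * (geo lam \<beta> * e * (A / (lam\<^sup>2 - 1)\<^sup>2)) + 2 * (2 * \<nu> * q)) * gron lam \<nu> A T"

definition xi_bd :: "real \<Rightarrow> real \<Rightarrow> real \<Rightarrow> real \<Rightarrow> real \<Rightarrow> real" where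
  "xi_bd lam \<nu> \<beta> T A = 8 * A * geo lam \<beta> * gron lam \<nu> A T"

text \<open>The value for inputs that do not improve with N. The 12A is the sum of 4A for the random
  weight and 8A for the tail when \<open>vv_bound\<close> is used with m = 0; the last input comes
  from the crude noise bound 8A/\<nu>.\<close>

definition eta_bd1 :: "real \<Rightarrow> real \<Rightarrow> real \<Rightarrow> real \<Rightarrow> real \<Rightarrow> real" where
  "eta_bd1 lam \<nu> \<beta> T A = eta_bd lam \<nu> \<beta> T A 1 (12 * A * xi_bd lam \<nu> \<beta> T A) (8 * A / \<nu> * geo lam \<beta>)"

lemma gron_pos: "gron lam \<nu> A T > 0"
  by (simp add: gron_def)

lemma xi_bd_nonneg: "lam > 1 \<Longrightarrow> \<beta> > 0 \<Longrightarrow> A > 0 \<Longrightarrow> xi_bd lam \<nu> \<beta> T A \<ge> 0"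
  unfolding xi_bd_def using geo_pos[of lam \<beta>] gron_pos[of lam \<nu> A T] by simp

lemma eta_bd_mono:
  assumes "lam > 1" "\<nu> > 0" "\<beta> > 0" "T > 0" "A > 0" "e \<le> e'" "V \<le> V'" "q \<le> q'"
  shows "eta_bd lam \<nu> \<beta> T A e V q \<le> eta_bd lam \<nu> \<beta> T A e' V' q'"
proof -
  have "6 * lam\<^sup>2 / \<nu> * (T * V) \<le> 6 * lam\<^sup>2 / \<nu> * (T * V')" using assms by (intro mult_left_mono) auto
  moreover have "geo lam \<beta> * e * (A / (lam\<^sup>2 - 1)\<^sup>2) \<le> geo lam \<beta> * e' * (A / (lam\<^sup>2 - 1)\<^sup>2)"
    using assms geo_pos[of lam \<beta>] by (intro mult_right_mono mult_left_mono) auto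
  moreover have "2 * \<nu> * q \<le> 2 * \<nu> * q'" using assms by (intro mult_left_mono) auto
  ultimately show ?thesis unfolding eta_bd_def using gron_pos[of lam \<nu> A T]
    by (intro mult_right_mono) auto
qed

lemma eta_bd_scale: "eta_bd lam \<nu> \<beta> T A (a * e) (a * V) (a * q) = a * eta_bd lam \<nu> \<beta> T A e V q"
  unfolding eta_bd_def by (simp only: distrib_left distrib_right mult_ac times_divide_eq_right times_divide_eq_left)

lemma eta_bd_nonneg:
  assumes "lam > 1" "\<nu> > 0" "\<beta> > 0" "T > 0" "A > 0" "e \<ge> 0" "V \<ge> 0" "q \<ge> 0"
  shows "eta_bd lam \<nu> \<beta> T A e V q \<ge> 0"
  using eta_bd_mono[of lam \<nu> \<beta> T A 0 e 0 V 0 q] assms by (simp add: eta_bd_def)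

text \<open>Small on finitely many modes and bounded on all modes suffices for smallness in the
  weighted norm: the high modes are measured with the weights lowered at n0, where a uniform bound
  gains lam^(-\<beta> n0).\<close>

lemma nn_integral_wnorm_split:
  assumes lam: "lam > 1" and \<beta>: "\<beta> > 0" and Ka: "Ka \<ge> 0" and Kb: "Kb \<ge> 0"
    and Z: "\<And>n. n \<ge> 1 \<Longrightarrow> (\<lambda>\<omega>. Z \<omega> n) \<in> borel_measurable M" and w: "w \<in> borel_measurable M"
    and a: "\<And>n. n \<ge> 1 \<Longrightarrow> n \<le> n0 \<Longrightarrow> (\<integral>\<^sup>+\<omega>. ennreal (w \<omega>) * ennreal ((Z \<omega> n)\<^sup>2) \<partial>M) \<le> ennreal Ka"
    and b: "\<And>n. n \<ge> 1 \<Longrightarrow> (\<integral>\<^sup>+\<omega>. ennreal (w \<omega>) * ennreal ((Z \<omega> n)\<^sup>2) \<partial>M) \<le> ennreal Kb"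
  shows "(\<integral>\<^sup>+\<omega>. ennreal (w \<omega>) * wnorm (rw lam \<beta> 0) (Z \<omega>) \<partial>M) \<le> ennreal (Ka * geo lam \<beta> + Kb * (geo lam \<beta> * lam powr (- \<beta> * real n0)))"
proof -
  define U where "U = (\<lambda>\<omega> n. if n \<le> n0 then Z \<omega> n else 0)"
  have g0: "geo lam \<beta> > 0" using geo_pos lam \<beta> by blast
  have r0: "rw lam \<beta> m n \<ge> 0" for m n by (simp add: rw_def)
  have Um: "(\<lambda>\<omega>. U \<omega> n) \<in> borel_measurable M" if "n \<ge> 1" for n using Z[OF that] by (cases "n \<le> n0") (auto simp: U_def)
  have wm: "(\<lambda>\<omega>. ennreal (w \<omega>) * wnorm (rw lam \<beta> m) (V \<omega>)) \<in> borel_measurable M"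
    if "\<And>n. n \<ge> 1 \<Longrightarrow> (\<lambda>\<omega>. V \<omega> n) \<in> borel_measurable M" for V m
  proof -
    have "(\<lambda>\<omega>. wnorm (rw lam \<beta> m) (V \<omega>)) \<in> borel_measurable M"
      unfolding wnorm_def using that by (intro borel_measurable_suminf_order) simp
    then show ?thesis using w by measurable
  qed
  have "(\<integral>\<^sup>+\<omega>. ennreal (w \<omega>) * wnorm (rw lam \<beta> 0) (Z \<omega>) \<partial>M)
     \<le> (\<integral>\<^sup>+\<omega>. ennreal (w \<omega>) * wnorm (rw lam \<beta> 0) (U \<omega>) + ennreal (w \<omega>) * wnorm (rw lam \<beta> n0) (Z \<omega>) \<partial>M)"
  proof (rule nn_integral_mono)
    fix \<omega>
    have "wnorm (rw lam \<beta> 0) (Z \<omega>) \<le> (\<Sum>n. ennreal (rw lam \<beta> 0 (Suc n) * (U \<omega> (Suc n))\<^sup>2) + ennreal (rw lam \<beta> n0 (Suc n) * (Z \<omega> (Suc n))\<^sup>2))"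
      unfolding wnorm_def
    proof (rule suminf_ennreal_mono)
      fix n
      show "ennreal (rw lam \<beta> 0 (Suc n) * (Z \<omega> (Suc n))\<^sup>2) \<le> ennreal (rw lam \<beta> 0 (Suc n) * (U \<omega> (Suc n))\<^sup>2) + ennreal (rw lam \<beta> n0 (Suc n) * (Z \<omega> (Suc n))\<^sup>2)"
        by (cases "Suc n \<le> n0") (simp_all add: U_def rw_eq_0[of n0 "Suc n"])
    qed
    also have "\<dots> = wnorm (rw lam \<beta> 0) (U \<omega>) + wnorm (rw lam \<beta> n0) (Z \<omega>)"
      unfolding wnorm_def by (rule suminf_ennreal_add)
    finally have "ennreal (w \<omega>) * wnorm (rw lam \<beta> 0) (Z \<omega>) \<le> ennreal (w \<omega>) * (wnorm (rw lam \<beta> 0) (U \<omega>) + wnorm (rw lam \<beta> n0) (Z \<omega>))"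
      by (rule mult_left_mono) simp
    then show "ennreal (w \<omega>) * wnorm (rw lam \<beta> 0) (Z \<omega>) \<le> ennreal (w \<omega>) * wnorm (rw lam \<beta> 0) (U \<omega>) + ennreal (w \<omega>) * wnorm (rw lam \<beta> n0) (Z \<omega>)"
      by (simp only: distrib_left)
  qed
  also have "\<dots> = (\<integral>\<^sup>+\<omega>. ennreal (w \<omega>) * wnorm (rw lam \<beta> 0) (U \<omega>) \<partial>M) + (\<integral>\<^sup>+\<omega>. ennreal (w \<omega>) * wnorm (rw lam \<beta> n0) (Z \<omega>) \<partial>M)"
    by (rule nn_integral_add[OF wm[of U, OF Um] wm[of Z, OF Z]])
  also have "\<dots> \<le> ennreal (Ka * (geo lam \<beta> * lam powr (- \<beta> * real 0))) + ennreal (Kb * (geo lam \<beta> * lam powr (- \<beta> * real n0)))"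
  proof (intro add_mono nn_integral_wnorm_le[OF lam \<beta>] Ka Kb Um Z w b)
    show "(\<integral>\<^sup>+\<omega>. ennreal (w \<omega>) * ennreal ((U \<omega> n)\<^sup>2) \<partial>M) \<le> ennreal Ka" if "n \<ge> 1" for n
      using a[OF that] by (cases "n \<le> n0") (simp_all add: U_def)
  qed
  also have "\<dots> = ennreal (Ka * geo lam \<beta> + Kb * (geo lam \<beta> * lam powr (- \<beta> * real n0)))"
    using Ka Kb g0 lam by (subst ennreal_plus[symmetric]) auto
  finally show ?thesis .
qed

context approx_pair
begin

lemma vv_bound:
  assumes r: "r \<in> {0..T}" and a: "a \<ge> 0"
    and Dwx: "(\<integral>\<^sup>+\<omega>. ennreal (Dw m r \<omega>) * wnorm (rw lam \<beta> 0) (\<xi> r \<omega>) \<partial>M) \<le> ennreal a"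
  shows "(\<integral>\<^sup>+\<omega>. wnorm (rw lam \<beta> 0) (vv r \<omega>) \<partial>M) \<le> ennreal (a + 8 * A * (xi_bd lam \<nu> \<beta> T A * lam powr (- \<beta> * real m)))"
proof -
  have xm: "(\<lambda>\<omega>. wnorm (rw lam \<beta> k) (\<xi> r \<omega>)) \<in> borel_measurable M" for k
    unfolding wnorm_def using \<xi>_measurable[OF r] by (intro borel_measurable_suminf_order) simp
  have K0: "xi_bd lam \<nu> \<beta> T A \<ge> 0" using xi_bd_nonneg lam \<beta>(1) A by blast
  have "(\<integral>\<^sup>+\<omega>. wnorm (rw lam \<beta> 0) (vv r \<omega>) \<partial>M)
    \<le> (\<integral>\<^sup>+\<omega>. ennreal (Dw m r \<omega>) * wnorm (rw lam \<beta> 0) (\<xi> r \<omega>) + ennreal (8 * A) * wnorm (rw lam \<beta> m) (\<xi> r \<omega>) \<partial>M)"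
  proof (rule nn_integral_mono_AE)
    show "AE \<omega> in M. wnorm (rw lam \<beta> 0) (vv r \<omega>) \<le> ennreal (Dw m r \<omega>) * wnorm (rw lam \<beta> 0) (\<xi> r \<omega>) + ennreal (8 * A) * wnorm (rw lam \<beta> m) (\<xi> r \<omega>)"
      using vv_wnorm_le[of m] by eventually_elim (use r in blast)
  qed
  also have "\<dots> = (\<integral>\<^sup>+\<omega>. ennreal (Dw m r \<omega>) * wnorm (rw lam \<beta> 0) (\<xi> r \<omega>) \<partial>M) + (\<integral>\<^sup>+\<omega>. ennreal (8 * A) * wnorm (rw lam \<beta> m) (\<xi> r \<omega>) \<partial>M)"
    by (intro nn_integral_add borel_measurable_times_ennreal xm measurable_compose[OF Dw_bounds(1)[OF r, of m] measurable_ennreal] borel_measurable_const)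
  also have "(\<integral>\<^sup>+\<omega>. ennreal (8 * A) * wnorm (rw lam \<beta> m) (\<xi> r \<omega>) \<partial>M) = ennreal (8 * A) * (\<integral>\<^sup>+\<omega>. wnorm (rw lam \<beta> m) (\<xi> r \<omega>) \<partial>M)"
    using xm by (rule nn_integral_cmult)
  also have "(\<integral>\<^sup>+\<omega>. ennreal (Dw m r \<omega>) * wnorm (rw lam \<beta> 0) (\<xi> r \<omega>) \<partial>M) + \<dots>
      \<le> ennreal a + ennreal (8 * A) * ennreal (xi_bd lam \<nu> \<beta> T A * lam powr (- \<beta> * real m))"
    using \<xi>_bound[OF r, of m] unfolding xi_bd_def by (intro add_mono Dwx mult_left_mono) auto
  also have "\<dots> = ennreal (a + 8 * A * (xi_bd lam \<nu> \<beta> T A * lam powr (- \<beta> * real m)))"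
    using a A K0 by (simp add: ennreal_plus ennreal_mult)
  finally show ?thesis .
qed

section \<open>Bounds for the rescaled difference\<close>

lemma D_wnorm_finite: "AE \<omega> in M. \<forall>t\<in>{0..T}. wnorm (rw lam \<beta> 0) (D t \<omega>) \<le> ennreal (4 * A)"
  using D_sum_le
proof eventually_elim
  case (elim \<omega>)
  show ?case
  proof
    fix t assume t: "t \<in> {0..T}"
    have r1: "rw lam \<beta> 0 n \<le> 1" for n
      unfolding rw_def using lam \<beta> powr_mono[of "- \<beta> * (real n + real (max n 0))" 0 lam] by simp
    have "wnorm (rw lam \<beta> 0) (D t \<omega>) \<le> (\<Sum>n. ennreal ((D t \<omega> (Suc n))\<^sup>2))"
      unfolding wnorm_def using r1 by (intro suminf_ennreal_mono ennreal_leI mult_left_le_one_le) (auto simp: rw0)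
    also have "\<dots> \<le> (\<Sum>n. ennreal ((D t \<omega> n)\<^sup>2))"
      by (subst (2) suminf_ennreal_shift) simp
    finally show "wnorm (rw lam \<beta> 0) (D t \<omega>) \<le> ennreal (4 * A)" using elim t by (blast intro: order.trans)
  qed
qed

text \<open>The constant contains 1/sg^2 and so grows with N, but only finiteness along almost every
  path is required for \<open>weighted_gronwall\<close>.\<close>

lemma \<eta>_integrable: "AE \<omega> in M. (\<integral>\<^sup>+t\<in>{0..T}. wnorm (rw lam \<beta> 0) (\<eta> t \<omega>) \<partial>lborel) < \<infinity>"
  using D_wnorm_finite AE_space
proof eventually_elim
  case (elim \<omega>)
  have T0: "T \<ge> 0" using T by simp
  define K where "K = 2 * (ennreal ((1 / sg)\<^sup>2) * ennreal (4 * A))"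
  have K: "K < \<infinity>" by (simp add: K_def ennreal_mult_less_top)
  have xm: "(\<lambda>t. wnorm (rw lam \<beta> 0) (\<xi> t \<omega>) * indicator {0..T} t) \<in> borel_measurable lborel"
    using measurable_compose[OF measurable_Pair2'[OF elim(2)] borel_measurable_wnorm_paths[OF T0 \<xi>_measurable \<xi>_cont rw0]] by simp
  have "(\<integral>\<^sup>+t\<in>{0..T}. wnorm (rw lam \<beta> 0) (\<eta> t \<omega>) \<partial>lborel)
    \<le> (\<integral>\<^sup>+t. K * indicator {0..T} t + 2 * (wnorm (rw lam \<beta> 0) (\<xi> t \<omega>) * indicator {0..T} t) \<partial>lborel)"
  proof (rule nn_integral_mono)
    fix t :: real
    show "wnorm (rw lam \<beta> 0) (\<eta> t \<omega>) * indicator {0..T} t \<le> K * indicator {0..T} t + 2 * (wnorm (rw lam \<beta> 0) (\<xi> t \<omega>) * indicator {0..T} t)"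
    proof (cases "t \<in> {0..T}")
      case True
      have "wnorm (rw lam \<beta> 0) (\<eta> t \<omega>) = wnorm (rw lam \<beta> 0) (\<lambda>n. (1 / sg) * D t \<omega> n + (- 1) * \<xi> t \<omega> n)"
        by (simp add: \<eta>_def[abs_def])
      also have "\<dots> \<le> 2 * wnorm (rw lam \<beta> 0) (\<lambda>n. (1 / sg) * D t \<omega> n) + 2 * wnorm (rw lam \<beta> 0) (\<lambda>n. (- 1) * \<xi> t \<omega> n)"
        by (rule wnorm_add_le[OF rw0])
      also have "\<dots> = 2 * (ennreal ((1 / sg)\<^sup>2) * wnorm (rw lam \<beta> 0) (D t \<omega>)) + 2 * wnorm (rw lam \<beta> 0) (\<xi> t \<omega>)"
        by (simp only: wnorm_scale[OF rw0]) simp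
      also have "\<dots> \<le> K + 2 * wnorm (rw lam \<beta> 0) (\<xi> t \<omega>)"
        unfolding K_def using elim(1) True by (intro add_right_mono mult_left_mono) auto
      finally show ?thesis using True by simp
    qed simp
  qed
  also have "\<dots> = (\<integral>\<^sup>+t. K * indicator {0..T} t \<partial>lborel) + 2 * (\<integral>\<^sup>+t\<in>{0..T}. wnorm (rw lam \<beta> 0) (\<xi> t \<omega>) \<partial>lborel)"
    using xm by (subst nn_integral_add) (simp_all add: nn_integral_cmult)
  also have "(\<integral>\<^sup>+t. K * indicator {0..T} t \<partial>lborel) = K * ennreal T" using T by (simp add: nn_integral_cmult_indicator)
  also have "K * ennreal T + 2 * (\<integral>\<^sup>+t\<in>{0..T}. wnorm (rw lam \<beta> 0) (\<xi> t \<omega>) \<partial>lborel) < \<infinity>"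
    using K \<xi>_integrable[OF elim(2), of 0] by (simp add: ennreal_mult_less_top)
  finally show ?case .
qed

text \<open>The sizes V and q of the product term and of the noise difference remain parameters,
  because the estimate is used twice: with crude values to obtain a bound uniform in N, and with
  small values once that bound has made \<open>D\<close> small.\<close>

lemma \<eta>_bound:
  assumes t: "t \<in> {0..T}" and V0: "V \<ge> 0" and q0: "q \<ge> 0"
    and V: "\<And>r. r \<in> {0..T} \<Longrightarrow> (\<integral>\<^sup>+\<omega>. wnorm (rw lam \<beta> 0) (vv r \<omega>) \<partial>M) \<le> ennreal V"
    and q: "\<And>s Z. s \<in> {0..T} \<Longrightarrow> (\<And>n. n \<ge> 1 \<Longrightarrow> ito_span (itg (noise_idx n) s (\<lambda>p r \<omega>. exp (- (c n * (s - r))) * (gX n p r \<omega> - gY n p r))) (\<lambda>\<omega>. Z \<omega> n)) \<Longrightarrow>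
       (\<integral>\<^sup>+\<omega>. wnorm (rw lam \<beta> 0) (Z \<omega>) \<partial>M) \<le> ennreal q"
  shows "(\<integral>\<^sup>+\<omega>. wnorm (rw lam \<beta> 0) (\<eta> t \<omega>) \<partial>M) \<le> ennreal (eta_bd lam \<nu> \<beta> T A (eps \<alpha> N) V q)"
proof -
  define R where "R = geo lam \<beta> * eps \<alpha> N * (A / (lam\<^sup>2 - 1)\<^sup>2)"
  define CV where "CV = 6 * lam\<^sup>2 / \<nu> * (T * V)"
  have R0: "R \<ge> 0" unfolding R_def using geo_pos[OF lam \<beta>(1)] eps_bounds[OF N, of \<alpha>] A by simp
  have CV0: "CV \<ge> 0" unfolding CV_def using \<nu> T V0 by simp
  \<comment> \<open>The sum of three terms is split twice, which gives the factors 4, 4 and 2; the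
    noise carries the square 2\<nu> of its coefficient in addition.\<close>
  define b where "b = 4 * CV + 4 * R + 2 * (2 * \<nu> * q)"
  have b0: "b \<ge> 0" unfolding b_def using R0 CV0 q0 \<nu> by simp
  have "(\<integral>\<^sup>+\<omega>. ennreal 1 * wnorm (rw lam \<beta> 0) (\<eta> t \<omega>) \<partial>M) \<le> ennreal (4 * b * exp (144 * lam\<^sup>2 * (sqrt A)\<^sup>2 / \<nu> * T))"
  proof (rule weighted_gronwall[OF rw_w T \<nu> _ b0, where P = X and Q = "\<lambda>r _. Y r" and Cw = 1])
    show "0 < sqrt A" using A by simp
    show "AE \<omega> in M. \<forall>t\<in>{0..T}. \<forall>k. \<bar>X t \<omega> k\<bar> \<le> sqrt A \<and> \<bar>Y t k\<bar> \<le> sqrt A"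
      using X_abs by eventually_elim (use Y_abs in blast)
    show "AE \<omega> in M. (\<integral>\<^sup>+t\<in>{0..T}. wnorm (rw lam \<beta> 0) (\<eta> t \<omega>) \<partial>lborel) < \<infinity>" by (rule \<eta>_integrable)
    show "(\<lambda>\<omega>. \<eta> t \<omega> n) \<in> borel_measurable M" if "t \<in> {0..T}" for n t
      unfolding \<eta>_def using D_measurable[OF that] \<xi>_measurable[OF that] by measurable
    show "continuous_on {0..T} (\<lambda>t. \<eta> t \<omega> n)" if "\<omega> \<in> space M" for n \<omega>
      unfolding \<eta>_def by (intro continuous_on_diff continuous_on_mult_left D_cont \<xi>_cont that)
    show "\<eta> t \<omega> 0 = 0" if "\<omega> \<in> space M" "t \<in> {0..T}" for t \<omega>
      unfolding \<eta>_def using D_0[OF that(2,1)] \<xi>_0[OF that] by simp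
    fix s assume s: "s \<in> {0..T}"
    obtain \<zeta> where \<zeta>: "\<And>n. n \<ge> 1 \<Longrightarrow> ito_span (itg (noise_idx n) s (\<lambda>p r \<omega>. exp (- (c n * (s - r))) * (gX n p r \<omega> - gY n p r))) (\<lambda>\<omega>. \<zeta> \<omega> n)"
      and eq: "AE \<omega> in M. \<forall>n. \<eta> s \<omega> n - conv (c n) (\<lambda>r. B lam (\<eta> r \<omega>) (X r \<omega>) n + B lam (Y r) (\<eta> r \<omega>) n) s
       = (conv (c n) (\<lambda>r. B lam (\<xi> r \<omega>) (D r \<omega>) n) s + - (1 / sg) * (\<nu> * \<Theta> n) * conv (c n) (\<lambda>r. X r \<omega> n) s) + sqrt (2 * \<nu>) * \<zeta> \<omega> n"
      using \<eta>_forcing[OF s] by blast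
    define C where "C = (\<lambda>\<omega> n. conv (c n) (\<lambda>r. B lam (\<xi> r \<omega>) (D r \<omega>) n) s)"
    define Re where "Re = (\<lambda>\<omega> n. - (1 / sg) * (\<nu> * \<Theta> n) * conv (c n) (\<lambda>r. X r \<omega> n) s)"
    define Zn where "Zn = (\<lambda>\<omega> n. sqrt (2 * \<nu>) * \<zeta> \<omega> n)"
    have \<zeta>m: "(\<lambda>\<omega>. \<zeta> \<omega> n) \<in> borel_measurable M" if "n \<ge> 1" for n using noise_span_measurable[OF \<zeta>[OF that]] .
    have Cm: "(\<lambda>\<omega>. C \<omega> n) \<in> borel_measurable M" for n
    proof -
      have "(\<lambda>\<omega>. B lam (\<xi> r \<omega>) (D r \<omega>) n) \<in> borel_measurable M" if "r \<in> {0..T}" for r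
        unfolding B_def using \<xi>_measurable[OF that] D_measurable[OF that] by (cases "n = 0") simp_all
      then show ?thesis unfolding C_def
        by (intro borel_measurable_conv[OF s, of "\<lambda>r \<omega>. B lam (\<xi> r \<omega>) (D r \<omega>) n"] continuous_on_B \<xi>_cont D_cont)
    qed
    have wCm: "(\<lambda>\<omega>. wnorm (rw lam \<beta> 0) (C \<omega>)) \<in> borel_measurable M"
      unfolding wnorm_def using Cm by (intro borel_measurable_suminf_order) simp
    have wZm: "(\<lambda>\<omega>. wnorm (rw lam \<beta> 0) (Zn \<omega>)) \<in> borel_measurable M"
      unfolding wnorm_def Zn_def using \<zeta>m by (intro borel_measurable_suminf_order) simp
    have "(\<integral>\<^sup>+\<omega>. ennreal 1 * wnorm (rw lam \<beta> 0) (\<lambda>n. \<eta> s \<omega> n - conv (\<nu> * lam ^ (2 * n)) (\<lambda>r. B lam (\<eta> r \<omega>) (X r \<omega>) n + B lam (Y r) (\<eta> r \<omega>) n) s) \<partial>M)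
      \<le> (\<integral>\<^sup>+\<omega>. (4 * wnorm (rw lam \<beta> 0) (C \<omega>) + ennreal (4 * R)) + 2 * wnorm (rw lam \<beta> 0) (Zn \<omega>) \<partial>M)"
    proof (rule nn_integral_mono_AE)
      show "AE \<omega> in M. ennreal 1 * wnorm (rw lam \<beta> 0) (\<lambda>n. \<eta> s \<omega> n - conv (\<nu> * lam ^ (2 * n)) (\<lambda>r. B lam (\<eta> r \<omega>) (X r \<omega>) n + B lam (Y r) (\<eta> r \<omega>) n) s)
        \<le> (4 * wnorm (rw lam \<beta> 0) (C \<omega>) + ennreal (4 * R)) + 2 * wnorm (rw lam \<beta> 0) (Zn \<omega>)"
        using eq remainder_bound[OF s]
      proof eventually_elim
        case (elim \<omega>)
        have e: "(\<lambda>n. \<eta> s \<omega> n - conv (\<nu> * lam ^ (2 * n)) (\<lambda>r. B lam (\<eta> r \<omega>) (X r \<omega>) n + B lam (Y r) (\<eta> r \<omega>) n) s) = (\<lambda>n. (C \<omega> n + Re \<omega> n) + Zn \<omega> n)"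
          using elim(1) unfolding C_def Re_def Zn_def c_def by blast
        have "wnorm (rw lam \<beta> 0) (\<lambda>n. (C \<omega> n + Re \<omega> n) + Zn \<omega> n) \<le> 2 * wnorm (rw lam \<beta> 0) (\<lambda>n. C \<omega> n + Re \<omega> n) + 2 * wnorm (rw lam \<beta> 0) (Zn \<omega>)"
          by (rule wnorm_add_le[OF rw0])
        also have "\<dots> \<le> 2 * (2 * wnorm (rw lam \<beta> 0) (C \<omega>) + 2 * wnorm (rw lam \<beta> 0) (Re \<omega>)) + 2 * wnorm (rw lam \<beta> 0) (Zn \<omega>)"
          by (intro add_right_mono mult_left_mono wnorm_add_le[OF rw0]) simp
        also have "\<dots> \<le> 2 * (2 * wnorm (rw lam \<beta> 0) (C \<omega>) + 2 * ennreal R) + 2 * wnorm (rw lam \<beta> 0) (Zn \<omega>)"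
          using elim(2) unfolding Re_def R_def by (intro add_right_mono add_left_mono mult_left_mono) auto
        also have "\<dots> = (4 * wnorm (rw lam \<beta> 0) (C \<omega>) + ennreal (4 * R)) + 2 * wnorm (rw lam \<beta> 0) (Zn \<omega>)"
          using R0 by (simp add: distrib_left ennreal_mult mult.assoc[symmetric])
        finally show ?case unfolding e by simp
      qed
    qed
    also have "\<dots> = 4 * (\<integral>\<^sup>+\<omega>. wnorm (rw lam \<beta> 0) (C \<omega>) \<partial>M) + ennreal (4 * R) + 2 * (\<integral>\<^sup>+\<omega>. wnorm (rw lam \<beta> 0) (Zn \<omega>) \<partial>M)"
      using wCm wZm by (simp add: nn_integral_add nn_integral_cmult emeasure_space_1)
    also have "\<dots> \<le> 4 * ennreal CV + ennreal (4 * R) + 2 * ennreal (2 * \<nu> * q)"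
    proof (intro add_mono mult_left_mono order.refl)
      show "(\<integral>\<^sup>+\<omega>. wnorm (rw lam \<beta> 0) (C \<omega>) \<partial>M) \<le> ennreal CV"
        unfolding C_def CV_def by (rule conv_B_bound[OF s V0 V])
      have "(\<integral>\<^sup>+\<omega>. ennreal 1 * wnorm (rw lam \<beta> 0) (Zn \<omega>) \<partial>M) \<le> ennreal (2 * \<nu> * q)"
        unfolding Zn_def
      proof (rule scaled_noise_wnorm_le[OF _ \<zeta>m _ q0])
        show "(\<integral>\<^sup>+\<omega>. ennreal 1 * wnorm (rw lam \<beta> 0) (\<zeta> \<omega>) \<partial>M) \<le> ennreal q" using q[OF s \<zeta>] by simp
      qed auto
      then show "(\<integral>\<^sup>+\<omega>. wnorm (rw lam \<beta> 0) (Zn \<omega>) \<partial>M) \<le> ennreal (2 * \<nu> * q)" by simp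
    qed auto
    also have "\<dots> = ennreal b"
    proof -
      have "2 * ennreal y = ennreal (2 * y)" "4 * ennreal y = ennreal (4 * y)" if "y \<ge> 0" for y
        using that by (simp_all add: ennreal_mult)
      moreover have "2 * \<nu> * q \<ge> 0" using \<nu> q0 by simp
      ultimately show ?thesis unfolding b_def using CV0 R0 by (simp only: ennreal_plus[symmetric] add_nonneg_nonneg mult_nonneg_nonneg zero_le_numeral)
    qed
    finally show "(\<integral>\<^sup>+\<omega>. ennreal 1 * wnorm (rw lam \<beta> 0) (\<lambda>n. \<eta> s \<omega> n - conv (\<nu> * lam ^ (2 * n)) (\<lambda>r. B lam (\<eta> r \<omega>) (X r \<omega>) n + B lam (Y r) (\<eta> r \<omega>) n) s) \<partial>M) \<le> ennreal b" .
  qed (use t X_measurable X_cont Y_cont in auto)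
  then show ?thesis unfolding eta_bd_def b_def CV_def R_def gron_def by simp
qed

text \<open>With m = 0 and s = 1 no closeness of the two solutions is used; both noises are bounded
  through the l2 bounds alone.\<close>

lemma \<zeta>_noise_le_const:
  assumes n: "n \<ge> 1" and t: "t \<in> {0..T}"
    and span: "ito_span (itg (noise_idx n) t (\<lambda>p r \<omega>. exp (- (c n * (t - r))) * (gX n p r \<omega> - gY n p r))) Z"
  shows "(\<integral>\<^sup>+\<omega>. ennreal ((Z \<omega>)\<^sup>2) \<partial>M) \<le> ennreal (8 * A / \<nu>)"
proof -
  have "(\<integral>\<^sup>+\<omega>. ennreal ((Z \<omega>)\<^sup>2) \<partial>M) \<le> ennreal ((4 * A + 4 * 1 * A) / \<nu>)"
  proof (rule \<zeta>_noise_le[OF n t _ _ _ _ _ span, where m = 0])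
    show "(real j powr (- \<alpha>))\<^sup>2 \<le> 1" if "j > 0" for j
      using powr_neg_le_one[of \<alpha> j] that \<alpha> by (intro power_le_one) auto
    fix r assume r: "r \<in> {0..T}"
    have "(\<integral>\<^sup>+\<omega>. ennreal (\<Sum>k\<le>n + 0. (D r \<omega> k)\<^sup>2) \<partial>M) \<le> (\<integral>\<^sup>+\<omega>. ennreal (4 * A) \<partial>M)"
    proof (rule nn_integral_mono_AE)
      show "AE \<omega> in M. ennreal (\<Sum>k\<le>n + 0. (D r \<omega> k)\<^sup>2) \<le> ennreal (4 * A)"
        using D_partial_le[of "n + 0"] by eventually_elim (use r in \<open>blast intro: ennreal_leI\<close>)
    qed
    then show "(\<integral>\<^sup>+\<omega>. ennreal (\<Sum>k\<le>n + 0. (D r \<omega> k)\<^sup>2) \<partial>M) \<le> ennreal (4 * A)" by (simp add: emeasure_space_1)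
  qed (use A in auto)
  then show ?thesis by simp
qed

lemma \<eta>_bound1:
  assumes t: "t \<in> {0..T}"
  shows "(\<integral>\<^sup>+\<omega>. wnorm (rw lam \<beta> 0) (\<eta> t \<omega>) \<partial>M) \<le> ennreal (eta_bd1 lam \<nu> \<beta> T A)"
proof -
  have g0: "geo lam \<beta> > 0" using geo_pos lam \<beta> by blast
  have K0: "xi_bd lam \<nu> \<beta> T A \<ge> 0" using xi_bd_nonneg lam \<beta>(1) A by blast
  have V: "(\<integral>\<^sup>+\<omega>. wnorm (rw lam \<beta> 0) (vv r \<omega>) \<partial>M) \<le> ennreal (12 * A * xi_bd lam \<nu> \<beta> T A)" if r: "r \<in> {0..T}" for r
  proof -
    have xm: "(\<lambda>\<omega>. wnorm (rw lam \<beta> 0) (\<xi> r \<omega>)) \<in> borel_measurable M"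
      unfolding wnorm_def using \<xi>_measurable[OF r] by (intro borel_measurable_suminf_order) simp
    have "(\<integral>\<^sup>+\<omega>. ennreal (Dw 0 r \<omega>) * wnorm (rw lam \<beta> 0) (\<xi> r \<omega>) \<partial>M) \<le> (\<integral>\<^sup>+\<omega>. ennreal (4 * A) * wnorm (rw lam \<beta> 0) (\<xi> r \<omega>) \<partial>M)"
      using Dw_bounds(3)[OF r] by (intro nn_integral_mono mult_right_mono ennreal_leI) auto
    also have "\<dots> = ennreal (4 * A) * (\<integral>\<^sup>+\<omega>. wnorm (rw lam \<beta> 0) (\<xi> r \<omega>) \<partial>M)" by (rule nn_integral_cmult[OF xm])
    also have "\<dots> \<le> ennreal (4 * A) * ennreal (xi_bd lam \<nu> \<beta> T A)"
      using \<xi>_bound[OF r, of 0] lam unfolding xi_bd_def by (intro mult_left_mono) auto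
    also have "\<dots> = ennreal (4 * A * xi_bd lam \<nu> \<beta> T A)" using A K0 by (simp add: ennreal_mult)
    finally have "(\<integral>\<^sup>+\<omega>. wnorm (rw lam \<beta> 0) (vv r \<omega>) \<partial>M) \<le> ennreal (4 * A * xi_bd lam \<nu> \<beta> T A + 8 * A * (xi_bd lam \<nu> \<beta> T A * lam powr (- \<beta> * real 0)))"
      using A K0 by (intro vv_bound[OF r]) auto
    then show ?thesis using lam by (simp add: mult.assoc)
  qed
  have "(\<integral>\<^sup>+\<omega>. wnorm (rw lam \<beta> 0) (\<eta> t \<omega>) \<partial>M) \<le> ennreal (eta_bd lam \<nu> \<beta> T A (eps \<alpha> N) (12 * A * xi_bd lam \<nu> \<beta> T A) (8 * A / \<nu> * geo lam \<beta>))"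
  proof (rule \<eta>_bound[OF t _ _ V])
    fix s Z assume s: "s \<in> {0..T}" and Z: "\<And>n. n \<ge> 1 \<Longrightarrow> ito_span (itg (noise_idx n) s (\<lambda>p r \<omega>. exp (- (c n * (s - r))) * (gX n p r \<omega> - gY n p r))) (\<lambda>\<omega>. Z \<omega> n)"
    have "(\<integral>\<^sup>+\<omega>. ennreal 1 * wnorm (rw lam \<beta> 0) (Z \<omega>) \<partial>M) \<le> ennreal (8 * A / \<nu> * (geo lam \<beta> * lam powr (- \<beta> * real 0)))"
    proof (rule nn_integral_wnorm_le[OF lam \<beta>(1)])
      show "(\<integral>\<^sup>+\<omega>. ennreal 1 * ennreal ((Z \<omega> n)\<^sup>2) \<partial>M) \<le> ennreal (8 * A / \<nu>)" if "n \<ge> 1" for n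
        using \<zeta>_noise_le_const[OF that s Z[OF that]] by simp
      show "(\<lambda>\<omega>. Z \<omega> n) \<in> borel_measurable M" if "n \<ge> 1" for n using noise_span_measurable[OF Z[OF that]] .
    qed (use A \<nu> in auto)
    then show "(\<integral>\<^sup>+\<omega>. wnorm (rw lam \<beta> 0) (Z \<omega>) \<partial>M) \<le> ennreal (8 * A / \<nu> * geo lam \<beta>)" using lam by simp
  qed (use A K0 \<nu> g0 in auto)
  also have "\<dots> \<le> ennreal (eta_bd1 lam \<nu> \<beta> T A)"
    unfolding eta_bd1_def using eps_bounds[OF N, of \<alpha>] by (intro ennreal_leI eta_bd_mono lam \<nu> \<beta>(1) T A order.refl)
  finally show ?thesis .
qed

text \<open>D is sg times the sum of \<eta> and \<xi>, and both are bounded in mean square uniformly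
  in N, so a factor \<open>eps\<close> is gained. The weights decrease, so dividing by the weight at
  L controls all modes up to L.\<close>

lemma D_bound:
  assumes r: "r \<in> {0..T}"
  shows "(\<integral>\<^sup>+\<omega>. ennreal (\<Sum>k\<le>L. (D r \<omega> k)\<^sup>2) \<partial>M)
    \<le> ennreal (eps \<alpha> N * ((2 * eta_bd1 lam \<nu> \<beta> T A + 2 * xi_bd lam \<nu> \<beta> T A) / rw lam \<beta> 0 L))"
proof -
  define a where "a = rw lam \<beta> 0 L"
  have a: "a > 0" using lam by (simp add: a_def rw_def)
  have g0: "geo lam \<beta> > 0" using geo_pos lam \<beta> by blast
  have K0: "xi_bd lam \<nu> \<beta> T A \<ge> 0" using xi_bd_nonneg lam \<beta>(1) A by blast
  have K1: "eta_bd1 lam \<nu> \<beta> T A \<ge> 0"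
    unfolding eta_bd1_def using lam \<nu> \<beta>(1) T A K0 g0 by (intro eta_bd_nonneg) auto
  have e0: "eps \<alpha> N > 0" using eps_bounds[OF N, of \<alpha>] by simp
  have xm: "(\<lambda>\<omega>. wnorm (rw lam \<beta> 0) (\<xi> r \<omega>)) \<in> borel_measurable M"
    unfolding wnorm_def using \<xi>_measurable[OF r] by (intro borel_measurable_suminf_order) simp
  have em: "(\<lambda>\<omega>. wnorm (rw lam \<beta> 0) (\<eta> r \<omega>)) \<in> borel_measurable M"
    unfolding wnorm_def \<eta>_def using \<xi>_measurable[OF r] D_measurable[OF r] by (intro borel_measurable_suminf_order) simp
  have dec: "rw lam \<beta> 0 L \<le> rw lam \<beta> 0 k" if "k \<le> L" for k
    unfolding rw_def using lam \<beta> that by (intro powr_mono) auto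
  have "(\<integral>\<^sup>+\<omega>. ennreal (\<Sum>k\<le>L. (D r \<omega> k)\<^sup>2) \<partial>M)
    \<le> (\<integral>\<^sup>+\<omega>. ennreal (eps \<alpha> N / a) * (2 * wnorm (rw lam \<beta> 0) (\<eta> r \<omega>) + 2 * wnorm (rw lam \<beta> 0) (\<xi> r \<omega>)) \<partial>M)"
  proof (rule nn_integral_mono)
    fix \<omega> assume \<omega>: "\<omega> \<in> space M"
    have "a * (\<Sum>k\<le>L. (D r \<omega> k)\<^sup>2) \<le> (\<Sum>k<L. rw lam \<beta> 0 (Suc k) * (D r \<omega> (Suc k))\<^sup>2)"
    proof -
      have "(\<Sum>k\<le>L. (D r \<omega> k)\<^sup>2) = (\<Sum>k<L. (D r \<omega> (Suc k))\<^sup>2)"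
        using D_0[OF r \<omega>] by (simp add: sum.atMost_shift)
      then show ?thesis unfolding a_def
        by (simp only: sum_distrib_left) (intro sum_mono mult_right_mono dec, auto)
    qed
    then have "ennreal (a * (\<Sum>k\<le>L. (D r \<omega> k)\<^sup>2)) \<le> ennreal (\<Sum>k<L. rw lam \<beta> 0 (Suc k) * (D r \<omega> (Suc k))\<^sup>2)" by (rule ennreal_leI)
    also have "\<dots> = (\<Sum>k<L. ennreal (rw lam \<beta> 0 (Suc k) * (D r \<omega> (Suc k))\<^sup>2))" using rw0 by (intro sum_ennreal[symmetric]) simp
    also have "\<dots> \<le> wnorm (rw lam \<beta> 0) (D r \<omega>)" unfolding wnorm_def by (rule sum_le_suminf[OF summableI]) auto
    also have "\<dots> = ennreal (eps \<alpha> N) * wnorm (rw lam \<beta> 0) (\<lambda>n. \<eta> r \<omega> n + \<xi> r \<omega> n)"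
    proof -
      have "D r \<omega> = (\<lambda>n. sg * (\<eta> r \<omega> n + \<xi> r \<omega> n))" using sg(1) by (simp add: \<eta>_def)
      then have "wnorm (rw lam \<beta> 0) (D r \<omega>) = wnorm (rw lam \<beta> 0) (\<lambda>n. sg * (\<eta> r \<omega> n + \<xi> r \<omega> n))" by (rule arg_cong)
      then show ?thesis unfolding wnorm_scale[OF rw0] sg(3) .
    qed
    also have "\<dots> \<le> ennreal (eps \<alpha> N) * (2 * wnorm (rw lam \<beta> 0) (\<eta> r \<omega>) + 2 * wnorm (rw lam \<beta> 0) (\<xi> r \<omega>))"
      by (intro mult_left_mono wnorm_add_le rw0) simp
    finally have "ennreal (1 / a) * ennreal (a * (\<Sum>k\<le>L. (D r \<omega> k)\<^sup>2)) \<le> ennreal (1 / a) * (ennreal (eps \<alpha> N) * (2 * wnorm (rw lam \<beta> 0) (\<eta> r \<omega>) + 2 * wnorm (rw lam \<beta> 0) (\<xi> r \<omega>)))"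
      by (rule mult_left_mono) simp
    moreover have "ennreal (1 / a) * ennreal (a * (\<Sum>k\<le>L. (D r \<omega> k)\<^sup>2)) = ennreal (\<Sum>k\<le>L. (D r \<omega> k)\<^sup>2)"
    proof -
      have "0 \<le> a * (\<Sum>k\<le>L. (D r \<omega> k)\<^sup>2)" using a by (intro mult_nonneg_nonneg sum_nonneg) auto
      then show ?thesis using a by (subst ennreal_mult[symmetric]) simp_all
    qed
    moreover have "ennreal (1 / a) * (ennreal (eps \<alpha> N) * y) = ennreal (eps \<alpha> N / a) * y" for y
      unfolding mult.assoc[symmetric] using a e0 by (subst ennreal_mult[symmetric]) auto
    ultimately show "ennreal (\<Sum>k\<le>L. (D r \<omega> k)\<^sup>2) \<le> ennreal (eps \<alpha> N / a) * (2 * wnorm (rw lam \<beta> 0) (\<eta> r \<omega>) + 2 * wnorm (rw lam \<beta> 0) (\<xi> r \<omega>))"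
      by simp
  qed
  also have "\<dots> = ennreal (eps \<alpha> N / a) * (2 * (\<integral>\<^sup>+\<omega>. wnorm (rw lam \<beta> 0) (\<eta> r \<omega>) \<partial>M) + 2 * (\<integral>\<^sup>+\<omega>. wnorm (rw lam \<beta> 0) (\<xi> r \<omega>) \<partial>M))"
    using em xm by (simp add: nn_integral_cmult nn_integral_add)
  also have "\<dots> \<le> ennreal (eps \<alpha> N / a) * (2 * ennreal (eta_bd1 lam \<nu> \<beta> T A) + 2 * ennreal (xi_bd lam \<nu> \<beta> T A))"
    using \<xi>_bound[OF r, of 0] \<eta>_bound1[OF r] lam unfolding xi_bd_def by (intro mult_left_mono add_mono) auto
  also have "2 * ennreal (eta_bd1 lam \<nu> \<beta> T A) + 2 * ennreal (xi_bd lam \<nu> \<beta> T A) = ennreal (2 * eta_bd1 lam \<nu> \<beta> T A + 2 * xi_bd lam \<nu> \<beta> T A)"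
    using K0 K1 by (simp add: ennreal_plus ennreal_mult)
  also have "ennreal (eps \<alpha> N / a) * \<dots> = ennreal (eps \<alpha> N * ((2 * eta_bd1 lam \<nu> \<beta> T A + 2 * xi_bd lam \<nu> \<beta> T A) / a))"
    using a e0 K0 K1 by (subst ennreal_mult[symmetric]) auto
  finally show ?thesis unfolding a_def .
qed

end

section \<open>The limit\<close>

lemma tendsto_powr_neg_power2:
  assumes "a > 0" shows "(\<lambda>m. K * (real (Suc m) powr (- a))\<^sup>2) \<longlonglongrightarrow> 0"
proof -
  have "(\<lambda>m. real (Suc m) powr (- a)) \<longlonglongrightarrow> 0"
    using LIMSEQ_Suc[OF tendsto_neg_powr[OF _ filterlim_real_sequentially, of "- a"]] assms by simp
  from tendsto_mult[OF tendsto_const tendsto_power[OF this, of 2]] show ?thesis by simp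
qed

lemma ex_powr_neg_power2_le:
  assumes "a > 0" "\<delta> > 0" shows "\<exists>m. K * (real (Suc m) powr (- a))\<^sup>2 \<le> \<delta>"
proof -
  have "\<forall>\<^sub>F m in sequentially. K * (real (Suc m) powr (- a))\<^sup>2 < \<delta>"
    using order_tendstoD(2)[OF tendsto_powr_neg_power2[OF assms(1)] assms(2)] .
  then show ?thesis unfolding eventually_sequentially by (meson less_imp_le order.refl)
qed

lemma ex_powr_real_le:
  assumes lam: "lam > 1" and \<beta>: "\<beta> > 0" and \<delta>: "\<delta> > 0" shows "\<exists>m. K * lam powr (- \<beta> * real m) \<le> \<delta>"
proof -
  define q where "q = lam powr (- \<beta>)"
  have q: "0 < q" "q < 1" using lam \<beta> by (auto simp: q_def powr_less_one)
  have eq: "lam powr (- \<beta> * real m) = q ^ m" for m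
    using lam by (simp add: q_def powr_realpow[symmetric] powr_powr)
  have "(\<lambda>m. K * q ^ m) \<longlonglongrightarrow> K * 0" using q by (intro tendsto_mult tendsto_const LIMSEQ_realpow_zero) auto
  then have "\<forall>\<^sub>F m in sequentially. K * q ^ m < \<delta>" using order_tendstoD(2)[of _ "K * 0"] \<delta> by simp
  then show ?thesis unfolding eventually_sequentially eq by (meson less_imp_le order.refl)
qed

text \<open>The sum of the j^(-2\<alpha>) is at least N times its last term, that is N^(1 -
  2\<alpha>), which diverges for \<alpha> < 1/2.\<close>

lemma tendsto_eps:
  assumes "\<alpha> < 1 / 2" "\<alpha> > 0" shows "eps \<alpha> \<longlonglongrightarrow> 0"
proof (rule tendsto_sandwich[where f = "\<lambda>_. 0" and h = "\<lambda>N. real N powr (2 * \<alpha> - 1)"])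
  show "\<forall>\<^sub>F N in sequentially. eps \<alpha> N \<le> real N powr (2 * \<alpha> - 1)"
  proof (rule eventually_sequentiallyI[of 1])
    fix N :: nat assume N: "1 \<le> N"
    have "real N powr (1 - 2 * \<alpha>) = (\<Sum>j=1..N. real N powr (- 2 * \<alpha>))"
      using N by (simp add: powr_diff powr_minus divide_inverse)
    also have "\<dots> \<le> (\<Sum>j=1..N. real j powr (- 2 * \<alpha>))" using assms by (intro sum_mono powr_mono2') auto
    finally have "inverse (\<Sum>j=1..N. real j powr (- 2 * \<alpha>)) \<le> inverse (real N powr (1 - 2 * \<alpha>))"
      using N by (intro le_imp_inverse_le) auto
    then show "eps \<alpha> N \<le> real N powr (2 * \<alpha> - 1)" by (simp add: eps_def powr_minus[symmetric])
  qed
  show "\<forall>\<^sub>F N in sequentially. 0 \<le> eps \<alpha> N" by (simp add: eps_def sum_nonneg)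
  show "(\<lambda>N. real N powr (2 * \<alpha> - 1)) \<longlonglongrightarrow> 0"
    using assms by (intro tendsto_neg_powr filterlim_real_sequentially) auto
qed simp

text \<open>The integrand of the noise of \<xi> involves only the deterministic solution, which
  allows one threshold e for all probability spaces. The motions with j > m are negligible uniformly
  in time through the coefficient j^(-\<alpha>), so finitely many motions remain.\<close>

lemma weighted_drift_noise_small:
  fixes Y :: "real \<Rightarrow> nat \<Rightarrow> real"
  assumes lam: "lam > 1" and \<nu>: "\<nu> > 0" and \<alpha>: "\<alpha> > 0" and T: "T > 0" and A: "A > 0"
    and Yc: "\<And>k. continuous_on {0..T} (\<lambda>t. Y t k)"
    and Y: "\<And>t. t \<in> {0..T} \<Longrightarrow> (\<Sum>k. ennreal ((Y t k)\<^sup>2)) \<le> ennreal A"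
    and \<delta>: "\<delta> > 0"
  shows "\<exists>e>0. \<forall>(M :: 'a measure) F W t Z w. bm_family M F W \<longrightarrow> t \<in> {0..T} \<longrightarrow>
    cspan (bm_family.ito_measure M) M (bm_family.simple_pairs M F W)
      (itg (noise_idx n) t (\<lambda>p r \<omega>. exp (- (\<nu> * lam ^ (2 * n) * (t - r))) * (lam ^ fst p * real (snd p) powr (- \<alpha>) * nz n p (Y r)))) Z \<longrightarrow>
    w \<in> borel_measurable M \<longrightarrow> (\<forall>\<omega>\<in>space M. 0 \<le> w \<omega> \<and> w \<omega> \<le> 4 * A) \<longrightarrow> (\<integral>\<^sup>+\<omega>. ennreal (w \<omega>) \<partial>M) \<le> ennreal e \<longrightarrow>
    (\<integral>\<^sup>+\<omega>. ennreal (w \<omega> * (Z \<omega>)\<^sup>2) \<partial>M) \<le> ennreal \<delta>"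
proof (rule weighted_noise_small[where y = "\<lambda>p r. lam ^ fst p * real (snd p) powr (- \<alpha>) * nz n p (Y r)"])
  show "\<nu> * lam ^ (2 * n) > 0" using \<nu> lam by simp
  show "4 * A \<ge> 0" using A by simp
  show "continuous_on {0..T} (\<lambda>r. lam ^ fst p * real (snd p) powr (- \<alpha>) * nz n p (Y r))" for p
    unfolding nz_def by (cases "fst p = n") (simp_all, (intro continuous_on_mult_left continuous_on_minus Yc)+)
  fix \<delta>' :: real assume \<delta>': "\<delta>' > 0"
  obtain m where m: "lam ^ (2 * n) * A * (real (Suc m) powr (- \<alpha>))\<^sup>2 \<le> \<delta>'" using ex_powr_neg_power2_le[OF \<alpha> \<delta>'] by blast
  define P where "P = {p \<in> noise_idx n. snd p \<le> m}"
  define b where "b = (\<lambda>p. if snd p \<le> m then 0 else (lam ^ fst p * real (snd p) powr (- \<alpha>))\<^sup>2)"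
  define K where "K = lam ^ (2 * n) * (real (Suc m) powr (- \<alpha>))\<^sup>2"
  have K0: "K \<ge> 0" using lam by (simp add: K_def)
  have "P \<subseteq> {..n} \<times> {..m}" by (auto simp: P_def noise_idx_def)
  then have fin: "finite P" by (rule finite_subset) simp
  have bK: "b p \<le> K" if p: "p \<in> noise_idx n" for p
  proof (cases "snd p \<le> m")
    case True
    then show ?thesis using K0 by (simp add: b_def)
  next
    case False
    then have "(real (snd p) powr (- \<alpha>))\<^sup>2 \<le> (real (Suc m) powr (- \<alpha>))\<^sup>2"
      using \<alpha> by (intro power_mono powr_mono2') auto
    then have "(lam ^ fst p)\<^sup>2 * (real (snd p) powr (- \<alpha>))\<^sup>2 \<le> K"
      unfolding K_def using noise_coeff_le[OF lam p] lam by (intro mult_mono) auto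
    then show ?thesis using False by (simp add: b_def power_mult_distrib)
  qed
  have "(\<integral>\<^sup>+p. ennreal (indicator (noise_idx n - P) p * (lam ^ fst p * real (snd p) powr (- \<alpha>) * nz n p (Y r))\<^sup>2) \<partial>count_space UNIV) \<le> ennreal \<delta>'"
    if r: "r \<in> {0..T}" for r
  proof -
    have eq: "indicator (noise_idx n - P) p * (lam ^ fst p * real (snd p) powr (- \<alpha>) * nz n p (Y r))\<^sup>2 = indicator (noise_idx n) p * (b p * (nz n p (Y r))\<^sup>2)" for p
      by (simp add: indicator_def P_def b_def power_mult_distrib)
    have "(\<integral>\<^sup>+p. ennreal (indicator (noise_idx n) p * (b p * (nz n p (Y r))\<^sup>2)) \<partial>count_space UNIV) \<le> ennreal K * (\<Sum>k. ennreal ((Y r k)\<^sup>2))"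
      by (rule noise_idx_sum_le[OF bK K0])
    also have "\<dots> \<le> ennreal K * ennreal A" using Y[OF r] by (rule mult_left_mono) simp
    also have "\<dots> \<le> ennreal \<delta>'" using m K0 A by (simp add: ennreal_mult[symmetric] K_def mult_ac ennreal_leI)
    finally show ?thesis unfolding eq .
  qed
  then show "\<exists>P. finite P \<and> P \<subseteq> noise_idx n \<and> (\<forall>r\<in>{0..T}.
       (\<integral>\<^sup>+p. ennreal (indicator (noise_idx n - P) p * (lam ^ fst p * real (snd p) powr (- \<alpha>) * nz n p (Y r))\<^sup>2) \<partial>count_space UNIV) \<le> ennreal \<delta>')"
    using fin by (intro exI[of _ P]) (auto simp: P_def)
qed (use T \<delta> in auto)

text \<open>Only finitely many modes will need a small weighted moment, so the minimum of their
  thresholds is still positive.\<close>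

lemma weighted_drift_noise_small_upto:
  fixes Y :: "real \<Rightarrow> nat \<Rightarrow> real"
  assumes lam: "lam > 1" and \<nu>: "\<nu> > 0" and \<alpha>: "\<alpha> > 0" and T: "T > 0" and A: "A > 0"
    and Yc: "\<And>k. continuous_on {0..T} (\<lambda>t. Y t k)"
    and Y: "\<And>t. t \<in> {0..T} \<Longrightarrow> (\<Sum>k. ennreal ((Y t k)\<^sup>2)) \<le> ennreal A"
    and \<delta>: "\<delta> > 0"
  shows "\<exists>e>0. \<forall>n\<le>n1. \<forall>(M :: 'a measure) F W t Z w. bm_family M F W \<longrightarrow> t \<in> {0..T} \<longrightarrow>
    cspan (bm_family.ito_measure M) M (bm_family.simple_pairs M F W)
      (itg (noise_idx n) t (\<lambda>p r \<omega>. exp (- (\<nu> * lam ^ (2 * n) * (t - r))) * (lam ^ fst p * real (snd p) powr (- \<alpha>) * nz n p (Y r)))) Z \<longrightarrow>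
    w \<in> borel_measurable M \<longrightarrow> (\<forall>\<omega>\<in>space M. 0 \<le> w \<omega> \<and> w \<omega> \<le> 4 * A) \<longrightarrow> (\<integral>\<^sup>+\<omega>. ennreal (w \<omega>) \<partial>M) \<le> ennreal e \<longrightarrow>
    (\<integral>\<^sup>+\<omega>. ennreal (w \<omega> * (Z \<omega>)\<^sup>2) \<partial>M) \<le> ennreal \<delta>" (is "\<exists>e>0. \<forall>n\<le>n1. ?P e n")
proof -
  have *: "\<exists>e. e > 0 \<and> ?P e n" for n by (rule weighted_drift_noise_small[OF lam \<nu> \<alpha> T A Yc Y \<delta>])
  define E where "E = (\<lambda>n. SOME e. e > 0 \<and> ?P e n)"
  have E': "E n > 0 \<and> ?P (E n) n" for n unfolding E_def by (rule someI_ex) (rule *)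
  note E = E'[THEN conjunct1] E'[THEN conjunct2]
  define e where "e = Min (E ` {..n1})"
  have "e > 0" using E(1) by (auto simp: e_def)
  moreover have "?P e n" if n: "n \<le> n1" for n
  proof (intro allI impI)
    fix M :: "'a measure" and F W t Z w
    assume *: "bm_family M F W" "t \<in> {0..T}"
      "cspan (bm_family.ito_measure M) M (bm_family.simple_pairs M F W)
      (itg (noise_idx n) t (\<lambda>p r \<omega>. exp (- (\<nu> * lam ^ (2 * n) * (t - r))) * (lam ^ fst p * real (snd p) powr (- \<alpha>) * nz n p (Y r)))) Z"
      "w \<in> borel_measurable M" "\<forall>\<omega>\<in>space M. 0 \<le> w \<omega> \<and> w \<omega> \<le> 4 * A" and "(\<integral>\<^sup>+\<omega>. ennreal (w \<omega>) \<partial>M) \<le> ennreal e"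
    moreover have "ennreal e \<le> ennreal (E n)" unfolding e_def using n by (intro ennreal_leI Min_le) auto
    ultimately have "(\<integral>\<^sup>+\<omega>. ennreal (w \<omega>) \<partial>M) \<le> ennreal (E n)" by (blast intro: order.trans)
    from E(2)[rule_format, OF *(1,2,3,4) *(5)[rule_format] this]
    show "(\<integral>\<^sup>+\<omega>. ennreal (w \<omega> * (Z \<omega>)\<^sup>2) \<partial>M) \<le> ennreal \<delta>" .
  qed
  ultimately show ?thesis by blast
qed

context approx_pair
begin

text \<open>Here the uniform bound on \<eta> pays off: \<open>D_bound\<close> makes the mean of the
  weight \<open>Dw\<close> at most e1, so the weighted noise is at most \<delta>1 on the modes up to
  n1. On the remaining modes the weight is bounded by 4A and the tail of the weights supplies the
  smallness.\<close>

lemma \<xi>_weighted_small: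
  assumes r: "r \<in> {0..T}" and \<delta>1: "\<delta>1 \<ge> 0"
    and small: "\<And>n s Z w. n \<ge> 1 \<Longrightarrow> n \<le> n1 \<Longrightarrow> s \<in> {0..T} \<Longrightarrow>
      ito_span (itg (noise_idx n) s (\<lambda>p r \<omega>. exp (- (c n * (s - r))) * gY n p r)) Z \<Longrightarrow> w \<in> borel_measurable M \<Longrightarrow>
      (\<forall>\<omega>\<in>space M. 0 \<le> w \<omega> \<and> w \<omega> \<le> 4 * A) \<Longrightarrow> (\<integral>\<^sup>+\<omega>. ennreal (w \<omega>) \<partial>M) \<le> ennreal e1 \<Longrightarrow>
      (\<integral>\<^sup>+\<omega>. ennreal (w \<omega> * (Z \<omega>)\<^sup>2) \<partial>M) \<le> ennreal \<delta>1"
    and e1: "eps \<alpha> N * ((2 * eta_bd1 lam \<nu> \<beta> T A + 2 * xi_bd lam \<nu> \<beta> T A) / rw lam \<beta> 0 (Suc m)) \<le> e1"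
  shows "(\<integral>\<^sup>+\<omega>. ennreal (Dw m r \<omega>) * wnorm (rw lam \<beta> 0) (\<xi> r \<omega>) \<partial>M)
    \<le> ennreal (4 * (2 * \<nu> * (\<delta>1 * geo lam \<beta> + 4 * A * (A / \<nu>) * (geo lam \<beta> * lam powr (- \<beta> * real n1)))) * gron lam \<nu> A T)"
proof (rule \<xi>_weighted_bound[OF Dw_bounds(1)[OF r] Dw_bounds(2)[OF r] Dw_bounds(3)[OF r] _ _ r])
  have g0: "geo lam \<beta> > 0" using geo_pos lam \<beta> by blast
  show "0 \<le> \<delta>1 * geo lam \<beta> + 4 * A * (A / \<nu>) * (geo lam \<beta> * lam powr (- \<beta> * real n1))" using \<delta>1 A \<nu> g0 by simp
  fix s Z assume s: "s \<in> {0..T}" and Z: "\<And>n. n \<ge> 1 \<Longrightarrow> ito_span (itg (noise_idx n) s (\<lambda>p r \<omega>. exp (- (c n * (s - r))) * gY n p r)) (\<lambda>\<omega>. Z \<omega> n)"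
  have Zm: "(\<lambda>\<omega>. Z \<omega> n) \<in> borel_measurable M" if "n \<ge> 1" for n using noise_span_measurable[OF Z[OF that]] .
  show "(\<integral>\<^sup>+\<omega>. ennreal (Dw m r \<omega>) * wnorm (rw lam \<beta> 0) (Z \<omega>) \<partial>M) \<le> ennreal (\<delta>1 * geo lam \<beta> + 4 * A * (A / \<nu>) * (geo lam \<beta> * lam powr (- \<beta> * real n1)))"
  proof (rule nn_integral_wnorm_split[OF lam \<beta>(1) \<delta>1 _ Zm Dw_bounds(1)[OF r]])
    show "0 \<le> 4 * A * (A / \<nu>)" using A \<nu> by simp
    fix n :: nat assume n: "n \<ge> 1"
    have Zn: "(\<lambda>\<omega>. ennreal ((Z \<omega> n)\<^sup>2)) \<in> borel_measurable M" using Zm[OF n] by simp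
    have "(\<integral>\<^sup>+\<omega>. ennreal (Dw m r \<omega>) * ennreal ((Z \<omega> n)\<^sup>2) \<partial>M) \<le> (\<integral>\<^sup>+\<omega>. ennreal (4 * A) * ennreal ((Z \<omega> n)\<^sup>2) \<partial>M)"
      using Dw_bounds(3)[OF r] by (intro nn_integral_mono mult_right_mono ennreal_leI) auto
    also have "\<dots> = ennreal (4 * A) * (\<integral>\<^sup>+\<omega>. ennreal ((Z \<omega> n)\<^sup>2) \<partial>M)" by (rule nn_integral_cmult[OF Zn])
    also have "\<dots> \<le> ennreal (4 * A) * ennreal (A / \<nu>)" by (intro mult_left_mono gY_noise_le[OF n s Z[OF n]]) simp
    also have "\<dots> = ennreal (4 * A * (A / \<nu>))" using A \<nu> by (intro ennreal_mult[symmetric]) auto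
    finally show "(\<integral>\<^sup>+\<omega>. ennreal (Dw m r \<omega>) * ennreal ((Z \<omega> n)\<^sup>2) \<partial>M) \<le> ennreal (4 * A * (A / \<nu>))" .
    assume n1: "n \<le> n1"
    have "(\<integral>\<^sup>+\<omega>. ennreal (Dw m r \<omega>) \<partial>M) \<le> (\<integral>\<^sup>+\<omega>. ennreal (\<Sum>k\<le>Suc m. (D r \<omega> k)\<^sup>2) \<partial>M)"
      unfolding Dw_def by (intro nn_integral_mono ennreal_leI min.cobounded2)
    also have "\<dots> \<le> ennreal e1" using D_bound[OF r, of "Suc m"] ennreal_leI[OF e1] by (rule order.trans)
    finally have "(\<integral>\<^sup>+\<omega>. ennreal (Dw m r \<omega> * (Z \<omega> n)\<^sup>2) \<partial>M) \<le> ennreal \<delta>1"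
      using Dw_bounds[OF r, of m] by (intro small[OF n n1 s Z[OF n]]) auto
    then show "(\<integral>\<^sup>+\<omega>. ennreal (Dw m r \<omega>) * ennreal ((Z \<omega> n)\<^sup>2) \<partial>M) \<le> ennreal \<delta>1"
      using Dw_bounds(2)[OF r] by (simp only: ennreal_mult zero_le_power2)
  qed
qed

text \<open>Three scales: n0 separates the modes, m separates the noise indices j, and once both are
  fixed the components of D up to n0 + m are small for large N by \<open>D_bound\<close>.\<close>

lemma \<zeta>_wnorm_le:
  assumes s: "s \<in> {0..T}" and m: "m \<le> N"
    and Z: "\<And>n. n \<ge> 1 \<Longrightarrow> ito_span (itg (noise_idx n) s (\<lambda>p r \<omega>. exp (- (c n * (s - r))) * (gX n p r \<omega> - gY n p r))) (\<lambda>\<omega>. Z \<omega> n)"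
  shows "(\<integral>\<^sup>+\<omega>. wnorm (rw lam \<beta> 0) (Z \<omega>) \<partial>M) \<le> ennreal
    ((eps \<alpha> N * ((2 * eta_bd1 lam \<nu> \<beta> T A + 2 * xi_bd lam \<nu> \<beta> T A) / rw lam \<beta> 0 (n0 + m)) + 4 * (real (Suc m) powr (- \<alpha>))\<^sup>2 * A) / \<nu> * geo lam \<beta>
      + 8 * A / \<nu> * (geo lam \<beta> * lam powr (- \<beta> * real n0)))"
proof -
  define d where "d = eps \<alpha> N * ((2 * eta_bd1 lam \<nu> \<beta> T A + 2 * xi_bd lam \<nu> \<beta> T A) / rw lam \<beta> 0 (n0 + m))"
  have g0: "geo lam \<beta> > 0" using geo_pos lam \<beta> by blast
  have K0: "xi_bd lam \<nu> \<beta> T A \<ge> 0" using xi_bd_nonneg lam \<beta>(1) A by blast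
  have K1: "eta_bd1 lam \<nu> \<beta> T A \<ge> 0"
    unfolding eta_bd1_def using lam \<nu> \<beta>(1) T A K0 g0 by (intro eta_bd_nonneg) auto
  have d0: "d \<ge> 0" unfolding d_def using eps_bounds[OF N, of \<alpha>] K0 K1 rw0 by simp
  have Zm: "(\<lambda>\<omega>. Z \<omega> n) \<in> borel_measurable M" if "n \<ge> 1" for n using noise_span_measurable[OF Z[OF that]] .
  have "(\<integral>\<^sup>+\<omega>. ennreal 1 * wnorm (rw lam \<beta> 0) (Z \<omega>) \<partial>M) \<le> ennreal ((d + 4 * (real (Suc m) powr (- \<alpha>))\<^sup>2 * A) / \<nu> * geo lam \<beta>
      + 8 * A / \<nu> * (geo lam \<beta> * lam powr (- \<beta> * real n0)))"
  proof (rule nn_integral_wnorm_split[OF lam \<beta>(1) _ _ Zm])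
    show "0 \<le> (d + 4 * (real (Suc m) powr (- \<alpha>))\<^sup>2 * A) / \<nu>" "0 \<le> 8 * A / \<nu>" using d0 A \<nu> by simp_all
    fix n :: nat assume n: "n \<ge> 1"
    show "(\<integral>\<^sup>+\<omega>. ennreal 1 * ennreal ((Z \<omega> n)\<^sup>2) \<partial>M) \<le> ennreal (8 * A / \<nu>)"
      using \<zeta>_noise_le_const[OF n s Z[OF n]] by simp
    assume n0: "n \<le> n0"
    have "(\<integral>\<^sup>+\<omega>. ennreal ((Z \<omega> n)\<^sup>2) \<partial>M) \<le> ennreal ((d + 4 * (real (Suc m) powr (- \<alpha>))\<^sup>2 * A) / \<nu>)"
    proof (rule \<zeta>_noise_le[OF n s d0 m _ _ _ Z[OF n]])
      show "(real j powr (- \<alpha>))\<^sup>2 \<le> (real (Suc m) powr (- \<alpha>))\<^sup>2" if "j > m" for j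
        using that \<alpha> by (intro power_mono powr_mono2') auto
      fix r assume r: "r \<in> {0..T}"
      have "(\<integral>\<^sup>+\<omega>. ennreal (\<Sum>k\<le>n + m. (D r \<omega> k)\<^sup>2) \<partial>M) \<le> (\<integral>\<^sup>+\<omega>. ennreal (\<Sum>k\<le>n0 + m. (D r \<omega> k)\<^sup>2) \<partial>M)"
        using n0 by (intro nn_integral_mono ennreal_leI sum_mono2) auto
      also have "\<dots> \<le> ennreal d" unfolding d_def by (rule D_bound[OF r])
      finally show "(\<integral>\<^sup>+\<omega>. ennreal (\<Sum>k\<le>n + m. (D r \<omega> k)\<^sup>2) \<partial>M) \<le> ennreal d" .
    qed simp
    then show "(\<integral>\<^sup>+\<omega>. ennreal 1 * ennreal ((Z \<omega> n)\<^sup>2) \<partial>M) \<le> ennreal ((d + 4 * (real (Suc m) powr (- \<alpha>))\<^sup>2 * A) / \<nu>)" by simp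
  qed (assumption, rule borel_measurable_const)
  then show ?thesis unfolding d_def by simp
qed

end

text \<open>N0 is found before the probability spaces, from the deterministic solution and the
  constants. The tail cut-offs m, n1, n0 and m' and the threshold e1 are fixed first, so that
  finitely many conditions on \<open>eps\<close> remain for N.\<close>

lemma approx_pair_uniform_limit:
  fixes Y :: "real \<Rightarrow> nat \<Rightarrow> real"
  assumes lam: "lam > 1" and \<nu>: "\<nu> > 0" and \<alpha>: "0 < \<alpha>" "\<alpha> < 1 / 2" and \<beta>: "0 < \<beta>" "\<beta> < 1" and T: "T > 0" and A: "A > 0"
    and Yc: "\<And>k. continuous_on {0..T} (\<lambda>t. Y t k)"
    and Y: "\<And>t. t \<in> {0..T} \<Longrightarrow> (\<Sum>k. ennreal ((Y t k)\<^sup>2)) \<le> ennreal A"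
    and \<delta>: "\<delta> > 0"
  shows "\<exists>N0. \<forall>N\<ge>N0. \<forall>(M :: 'a measure) F W x X \<xi> t. approx_pair M F W lam \<nu> \<alpha> \<beta> T A N x X Y \<xi> \<longrightarrow> t \<in> {0..T} \<longrightarrow>
    (\<integral>\<^sup>+\<omega>. wnorm (rw lam \<beta> 0) (\<lambda>n. (X t \<omega> n - Y t n) / sqrt (eps \<alpha> N) - \<xi> t \<omega> n) \<partial>M) \<le> ennreal \<delta>"
proof -
  define cc where "cc = eta_bd lam \<nu> \<beta> T A 1 1 1"
  define g where "g = geo lam \<beta>"
  define G where "G = gron lam \<nu> A T"
  define X0 where "X0 = xi_bd lam \<nu> \<beta> T A"
  define K where "K = 2 * eta_bd1 lam \<nu> \<beta> T A + 2 * X0"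
  have g: "g > 0" unfolding g_def using geo_pos lam \<beta> by blast
  have G: "G > 0" unfolding G_def by (rule gron_pos)
  have c0: "cc \<ge> 0" unfolding cc_def using lam \<nu> \<beta> T A by (intro eta_bd_nonneg) auto
  \<comment> \<open>All three inputs of \<open>eta_bd\<close> will be at most \<kappa>, and by
    homogeneity the outcome is at most \<kappa> cc \<le> \<delta>; the summand 1 keeps the divisor
    positive.\<close>
  define \<kappa> where "\<kappa> = \<delta> / (cc + 1)"
  have \<kappa>: "\<kappa> > 0" "\<kappa> * cc \<le> \<delta>" using c0 \<delta> by (auto simp: \<kappa>_def pos_divide_le_eq)
  obtain m where m: "8 * A * X0 * lam powr (- \<beta> * real m) \<le> \<kappa> / 2"
    using ex_powr_real_le[OF lam \<beta>(1) half_gt_zero[OF \<kappa>(1)], of "8 * A * X0"] by blast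
  \<comment> \<open>Chosen so that the weighted Gronwall bound for \<xi> with forcing b0 equals
    \<kappa>/2; the other half of \<kappa> is reserved for the tail beyond m.\<close>
  define b0 where "b0 = \<kappa> / (16 * \<nu> * G)"
  have b0: "b0 > 0" "4 * (2 * \<nu> * b0) * G = \<kappa> / 2" using \<kappa> \<nu> G by (auto simp: b0_def)
  obtain n1 where n1: "4 * A * (A / \<nu>) * g * lam powr (- \<beta> * real n1) \<le> b0 / 2"
    using ex_powr_real_le[OF lam \<beta>(1) half_gt_zero[OF b0(1)], of "4 * A * (A / \<nu>) * g"] by blast
  define \<delta>1 where "\<delta>1 = b0 / (2 * g)"
  have \<delta>1: "\<delta>1 > 0" "\<delta>1 * g = b0 / 2" using b0 g by (auto simp: \<delta>1_def)
  obtain e1 where e1: "e1 > 0" and small: "\<forall>n\<le>n1. \<forall>(M :: 'a measure) F W t Z w. bm_family M F W \<longrightarrow> t \<in> {0..T} \<longrightarrow>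
    cspan (bm_family.ito_measure M) M (bm_family.simple_pairs M F W)
      (itg (noise_idx n) t (\<lambda>p r \<omega>. exp (- (\<nu> * lam ^ (2 * n) * (t - r))) * (lam ^ fst p * real (snd p) powr (- \<alpha>) * nz n p (Y r)))) Z \<longrightarrow>
    w \<in> borel_measurable M \<longrightarrow> (\<forall>\<omega>\<in>space M. 0 \<le> w \<omega> \<and> w \<omega> \<le> 4 * A) \<longrightarrow> (\<integral>\<^sup>+\<omega>. ennreal (w \<omega>) \<partial>M) \<le> ennreal e1 \<longrightarrow>
    (\<integral>\<^sup>+\<omega>. ennreal (w \<omega> * (Z \<omega>)\<^sup>2) \<partial>M) \<le> ennreal \<delta>1"
    using weighted_drift_noise_small_upto[OF lam \<nu> \<alpha>(1) T A Yc Y \<delta>1(1)] by blast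
  obtain n0 where n0: "8 * A / \<nu> * g * lam powr (- \<beta> * real n0) \<le> \<kappa> / 2"
    using ex_powr_real_le[OF lam \<beta>(1) half_gt_zero[OF \<kappa>(1)], of "8 * A / \<nu> * g"] by blast
  obtain m' where m': "4 * A / \<nu> * g * (real (Suc m') powr (- \<alpha>))\<^sup>2 \<le> \<kappa> / 4"
    using ex_powr_neg_power2_le[OF \<alpha>(1), of "\<kappa> / 4" "4 * A / \<nu> * g"] \<kappa>(1) by fastforce
  \<comment> \<open>The factor k will depend only on quantities fixed before N, so each condition
    holds for all large N.\<close>
  have lim: "\<forall>\<^sub>F N in sequentially. eps \<alpha> N * k < e" if "e > 0" for k e
    using order_tendstoD(2)[OF tendsto_mult_left_zero[OF tendsto_eps[OF \<alpha>(2,1)]] that] .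
  have "\<forall>\<^sub>F N in sequentially. m' \<le> N \<and> eps \<alpha> N * 1 < \<kappa> \<and> eps \<alpha> N * (K / rw lam \<beta> 0 (Suc m)) < e1
      \<and> eps \<alpha> N * (K / rw lam \<beta> 0 (n0 + m') / \<nu> * g) < \<kappa> / 4"
    using \<kappa> e1 by (intro eventually_conj lim eventually_ge_at_top) auto
  then obtain N0 where N0: "\<And>N. N \<ge> N0 \<Longrightarrow> m' \<le> N \<and> eps \<alpha> N * 1 < \<kappa> \<and> eps \<alpha> N * (K / rw lam \<beta> 0 (Suc m)) < e1
      \<and> eps \<alpha> N * (K / rw lam \<beta> 0 (n0 + m') / \<nu> * g) < \<kappa> / 4"
    unfolding eventually_sequentially by blast
  show ?thesis
  proof (intro exI[of _ N0] allI impI)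
    fix N M F W x X \<xi> t
    assume NN: "N \<ge> N0" and ap: "approx_pair (M :: 'a measure) F W lam \<nu> \<alpha> \<beta> T A N x X Y \<xi>" and t: "t \<in> {0..T}"
    interpret approx_pair M F W lam \<nu> \<alpha> \<beta> T A N x X Y \<xi> by (rule ap)
    have bm: "bm_family M F W" ..
    note N' = N0[OF NN]
    have V: "(\<integral>\<^sup>+\<omega>. wnorm (rw lam \<beta> 0) (vv r \<omega>) \<partial>M) \<le> ennreal \<kappa>" if r: "r \<in> {0..T}" for r
    proof -
      have "(\<integral>\<^sup>+\<omega>. ennreal (Dw m r \<omega>) * wnorm (rw lam \<beta> 0) (\<xi> r \<omega>) \<partial>M)
        \<le> ennreal (4 * (2 * \<nu> * (\<delta>1 * geo lam \<beta> + 4 * A * (A / \<nu>) * (geo lam \<beta> * lam powr (- \<beta> * real n1)))) * gron lam \<nu> A T)"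
      proof (rule \<xi>_weighted_small[OF r less_imp_le[OF \<delta>1(1)]])
        show "eps \<alpha> N * ((2 * eta_bd1 lam \<nu> \<beta> T A + 2 * xi_bd lam \<nu> \<beta> T A) / rw lam \<beta> 0 (Suc m)) \<le> e1"
          using N' unfolding K_def X0_def by simp
        show "(\<integral>\<^sup>+\<omega>. ennreal (w \<omega> * (Z \<omega>)\<^sup>2) \<partial>M) \<le> ennreal \<delta>1"
          if "n \<le> n1" "s \<in> {0..T}" "ito_span (itg (noise_idx n) s (\<lambda>p r \<omega>. exp (- (approx_pair.c lam \<nu> n * (s - r))) * gY n p r)) Z"
            "w \<in> borel_measurable M" "\<forall>\<omega>\<in>space M. 0 \<le> w \<omega> \<and> w \<omega> \<le> 4 * A" "(\<integral>\<^sup>+\<omega>. ennreal (w \<omega>) \<partial>M) \<le> ennreal e1" for n s Z w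
          using small[rule_format, of n M F W s Z w] that bm unfolding c_def gY_def by blast
      qed
      also have "\<dots> \<le> ennreal (\<kappa> / 2)"
      proof -
        have "\<delta>1 * geo lam \<beta> + 4 * A * (A / \<nu>) * (geo lam \<beta> * lam powr (- \<beta> * real n1)) \<le> b0"
          using n1 \<delta>1(2) unfolding g_def by (simp only: mult.assoc)
        then have "4 * (2 * \<nu> * (\<delta>1 * geo lam \<beta> + 4 * A * (A / \<nu>) * (geo lam \<beta> * lam powr (- \<beta> * real n1)))) * G \<le> 4 * (2 * \<nu> * b0) * G"
          using \<nu> G by (intro mult_right_mono mult_left_mono) auto
        then show ?thesis unfolding b0(2) unfolding G_def by (rule ennreal_leI)
      qed
      finally have "(\<integral>\<^sup>+\<omega>. wnorm (rw lam \<beta> 0) (vv r \<omega>) \<partial>M) \<le> ennreal (\<kappa> / 2 + 8 * A * (xi_bd lam \<nu> \<beta> T A * lam powr (- \<beta> * real m)))"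
        using \<kappa> by (intro vv_bound[OF r]) auto
      also have "\<dots> \<le> ennreal \<kappa>" using m unfolding X0_def mult.assoc by (intro ennreal_leI) simp
      finally show ?thesis .
    qed
    have q: "(\<integral>\<^sup>+\<omega>. wnorm (rw lam \<beta> 0) (Z \<omega>) \<partial>M) \<le> ennreal \<kappa>"
      if s: "s \<in> {0..T}" and Z: "\<And>n. n \<ge> 1 \<Longrightarrow> ito_span (itg (noise_idx n) s (\<lambda>p r \<omega>. exp (- (approx_pair.c lam \<nu> n * (s - r))) * (gX n p r \<omega> - gY n p r))) (\<lambda>\<omega>. Z \<omega> n)" for s Z
    proof -
      have "m' \<le> N" using N' by blast
      from \<zeta>_wnorm_le[OF s this Z, where ?n0.0 = n0]
      have "(\<integral>\<^sup>+\<omega>. wnorm (rw lam \<beta> 0) (Z \<omega>) \<partial>M) \<le> ennreal ((eps \<alpha> N * (K / rw lam \<beta> 0 (n0 + m')) + 4 * (real (Suc m') powr (- \<alpha>))\<^sup>2 * A) / \<nu> * g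
        + 8 * A / \<nu> * (g * lam powr (- \<beta> * real n0)))" unfolding K_def X0_def g_def .
      also have "\<dots> \<le> ennreal \<kappa>"
      proof (rule ennreal_leI)
        have "(eps \<alpha> N * (K / rw lam \<beta> 0 (n0 + m')) + 4 * (real (Suc m') powr (- \<alpha>))\<^sup>2 * A) / \<nu> * g
          = eps \<alpha> N * (K / rw lam \<beta> 0 (n0 + m') / \<nu> * g) + 4 * A / \<nu> * g * (real (Suc m') powr (- \<alpha>))\<^sup>2"
          by (simp only: add_divide_distrib distrib_right distrib_left times_divide_eq_right times_divide_eq_left mult_ac)
        moreover have "8 * A / \<nu> * (g * lam powr (- \<beta> * real n0)) \<le> \<kappa> / 2" using n0 by (simp only: mult.assoc)
        ultimately show "(eps \<alpha> N * (K / rw lam \<beta> 0 (n0 + m')) + 4 * (real (Suc m') powr (- \<alpha>))\<^sup>2 * A) / \<nu> * g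
          + 8 * A / \<nu> * (g * lam powr (- \<beta> * real n0)) \<le> \<kappa>" using m' N' by linarith
      qed
      finally show ?thesis .
    qed
    have "(\<integral>\<^sup>+\<omega>. wnorm (rw lam \<beta> 0) (\<eta> t \<omega>) \<partial>M) \<le> ennreal (eta_bd lam \<nu> \<beta> T A (eps \<alpha> N) \<kappa> \<kappa>)"
      by (rule \<eta>_bound[OF t less_imp_le[OF \<kappa>(1)] less_imp_le[OF \<kappa>(1)] V q])
    also have "\<dots> \<le> ennreal (eta_bd lam \<nu> \<beta> T A (\<kappa> * 1) (\<kappa> * 1) (\<kappa> * 1))"
      using N' lam \<nu> \<beta> T A by (intro ennreal_leI eta_bd_mono) auto
    also have "\<dots> \<le> ennreal \<delta>" unfolding eta_bd_scale using \<kappa>(2) by (intro ennreal_leI) (simp add: cc_def)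
    finally have "(\<integral>\<^sup>+\<omega>. wnorm (rw lam \<beta> 0) (\<eta> t \<omega>) \<partial>M) \<le> ennreal \<delta>" .
    moreover have "\<eta> t \<omega> = (\<lambda>n. (X t \<omega> n - Y t n) / sqrt (eps \<alpha> N) - \<xi> t \<omega> n)" for \<omega>
      by (rule ext) (simp add: \<eta>_def D_def sg_def)
    ultimately show "(\<integral>\<^sup>+\<omega>. wnorm (rw lam \<beta> 0) (\<lambda>n. (X t \<omega> n - Y t n) / sqrt (eps \<alpha> N) - \<xi> t \<omega> n) \<partial>M) \<le> ennreal \<delta>" by simp
  qed
qed

section \<open>Bounds on the given solutions and conclusion\<close>

lemma ell2_suminf:
  assumes "u \<in> ell2"
  shows "(\<Sum>k. ennreal ((u k)\<^sup>2)) = ennreal ((ell2_norm u)\<^sup>2)"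
proof -
  have s: "summable (\<lambda>n. (u n)\<^sup>2)" using assms by (simp add: ell2_def)
  have "(\<Sum>k. ennreal ((u k)\<^sup>2)) = ennreal (\<Sum>k. (u k)\<^sup>2)" using s by (intro suminf_ennreal2) auto
  also have "(\<Sum>k. (u k)\<^sup>2) = (ell2_norm u)\<^sup>2" unfolding ell2_norm_def using s by (simp add: suminf_nonneg)
  finally show ?thesis .
qed

text \<open>The \<open>\<ell>\<^sup>2\<close> bound of a deterministic solution, assumed for almost every time only, extends to every
  time because it passes to the limit in the finite partial sums.\<close>

lemma det_weak_solution_bound:
  assumes det: "det_weak_solution lam \<nu> x T Y" and T: "T > 0"
  shows "\<exists>A\<ge>0. \<forall>t\<in>{0..T}. (\<Sum>k. ennreal ((Y t k)\<^sup>2)) \<le> ennreal A"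
proof -
  obtain C where "AE t in restrict_space lborel {0..T}. Y t \<in> ell2 \<and> ell2_norm (Y t) \<le> C"
    using det unfolding det_weak_solution_def by blast
  then have ae: "AE t in lborel. t \<in> {0..T} \<longrightarrow> Y t \<in> ell2 \<and> ell2_norm (Y t) \<le> C"
    by (subst (asm) AE_restrict_space_iff) auto
  have partial: "(\<Sum>k<K. (Y t k)\<^sup>2) \<le> C\<^sup>2" if t: "t \<in> {0..T}" for t K
  proof (rule ccontr)
    assume "\<not> (\<Sum>k<K. (Y t k)\<^sup>2) \<le> C\<^sup>2"
    then have gt: "C\<^sup>2 < (\<Sum>k<K. (Y t k)\<^sup>2)" by simp
    have "continuous_on {0..T} (\<lambda>t. \<Sum>k<K. (Y t k)\<^sup>2)"
      by (intro continuous_on_sum continuous_on_power det_weak_solution_continuous_on[OF det])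
    then have "((\<lambda>s. \<Sum>k<K. (Y s k)\<^sup>2) \<longlongrightarrow> (\<Sum>k<K. (Y t k)\<^sup>2)) (at t within {0..T})"
      using t by (simp add: continuous_on_def)
    then have "\<forall>\<^sub>F s in at t within {0..T}. C\<^sup>2 < (\<Sum>k<K. (Y s k)\<^sup>2)" using gt by (rule order_tendstoD(1))
    then obtain d where d: "d > 0" "\<And>s. s \<in> {0..T} \<Longrightarrow> s \<noteq> t \<Longrightarrow> dist s t < d \<Longrightarrow> C\<^sup>2 < (\<Sum>k<K. (Y s k)\<^sup>2)"
      unfolding eventually_at by blast
    \<comment> \<open>The neighbourhood of t is cut to \<open>{0..T}\<close>. It has positive length
      even if t is an end point, so the almost everywhere bound cannot fail on all of it.\<close>
    define a b where "a = max 0 (t - d)" and "b = min T (t + d)"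
    have ab: "a < b" using d(1) t T by (auto simp: a_def b_def)
    have "AE s in lborel. s \<notin> {a<..<b}"
      using ae
    proof eventually_elim
      case (elim s)
      show ?case
      proof
        assume s: "s \<in> {a<..<b}"
        then have sT: "s \<in> {0..T}" and sd: "dist s t < d" by (auto simp: a_def b_def dist_real_def)
        have gs: "C\<^sup>2 < (\<Sum>k<K. (Y s k)\<^sup>2)" using d(2)[OF sT _ sd] gt by (cases "s = t") auto
        have e: "Y s \<in> ell2" "ell2_norm (Y s) \<le> C" using elim sT by auto
        have "(\<Sum>k<K. (Y s k)\<^sup>2) \<le> (\<Sum>k. (Y s k)\<^sup>2)" using e(1) by (intro sum_le_suminf) (auto simp: ell2_def)
        also have "\<dots> = (ell2_norm (Y s))\<^sup>2" using e(1) by (simp add: ell2_norm_def ell2_def suminf_nonneg)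
        also have "\<dots> \<le> C\<^sup>2" using e by (intro power_mono) (auto simp: ell2_norm_def ell2_def suminf_nonneg)
        finally show False using gs by simp
      qed
    qed
    then have "emeasure lborel {a<..<b} = 0" by (subst (asm) AE_iff_measurable[where N = "{a<..<b}"]) auto
    then show False using ab by simp
  qed
  have "(\<Sum>k. ennreal ((Y t k)\<^sup>2)) \<le> ennreal (C\<^sup>2)" if t: "t \<in> {0..T}" for t
  proof (rule suminf_le_const[OF summableI])
    fix K
    show "(\<Sum>k<K. ennreal ((Y t k)\<^sup>2)) \<le> ennreal (C\<^sup>2)" using partial[OF t, of K] by (simp add: sum_ennreal ennreal_leI)
  qed
  then show ?thesis by (intro exI[of _ "C\<^sup>2"]) auto
qed

lemma tendsto_0_ennrealI:
  fixes f :: "nat \<Rightarrow> ennreal"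
  assumes "\<And>\<delta>. \<delta> > 0 \<Longrightarrow> \<exists>N0. \<forall>N\<ge>N0. f N \<le> ennreal \<delta>"
  shows "f \<longlonglongrightarrow> 0"
proof (rule order_tendstoI)
  fix a :: ennreal assume a: "0 < a"
  obtain \<delta> where \<delta>: "\<delta> > 0" "ennreal \<delta> < a"
  proof (cases a)
    case (real r)
    then show ?thesis using a by (intro that[of "r / 2"]) (auto intro!: ennreal_lessI)
  qed (auto intro: that[of 1])
  obtain N0 where "\<And>N. N \<ge> N0 \<Longrightarrow> f N \<le> ennreal \<delta>" using assms[OF \<delta>(1)] by blast
  then show "\<forall>\<^sub>F N in sequentially. f N < a" using \<delta>(2) by (intro eventually_sequentiallyI[of N0]) (auto intro: order.strict_trans1)
qed simp

theorem theorem1p6: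
  fixes lam \<nu> \<alpha>\<^sub>1 \<beta> T :: real
    and x :: "nat \<Rightarrow> real"
    and M :: "nat \<Rightarrow> 'a measure"
    and F :: "nat \<Rightarrow> real \<Rightarrow> 'a measure"
    and W :: "nat \<Rightarrow> nat \<Rightarrow> nat \<Rightarrow> real \<Rightarrow> 'a \<Rightarrow> real"
    and X :: "nat \<Rightarrow> real \<Rightarrow> 'a \<Rightarrow> nat \<Rightarrow> real"
    and X_tilde :: "real \<Rightarrow> nat \<Rightarrow> real"
    and \<xi> :: "nat \<Rightarrow> real \<Rightarrow> 'a \<Rightarrow> nat \<Rightarrow> real"
  assumes "lam > 1" and "\<nu> > 0" and "x \<in> ell2"
    and "0 < \<alpha>\<^sub>1" and "\<alpha>\<^sub>1 < 1 / 2"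
    and "0 < \<beta>" and "\<beta> < 1" and "T > 0"
    and "\<And>N. N \<ge> 1 \<Longrightarrow>
      Linf_weak_solution lam \<nu> (theta \<alpha>\<^sub>1 N) x T (M N) (F N) (W N) (X N)"
    and "\<And>N. N \<ge> 1 \<Longrightarrow>
      AE \<omega> in M N. \<forall>t\<in>{0..T}. ell2_norm (X N t \<omega>) \<le> ell2_norm x"
    and "det_weak_solution lam \<nu> x T X_tilde"
    and "\<And>N. N \<ge> 1 \<Longrightarrow>
      mild_solution lam \<nu> \<alpha>\<^sub>1 \<beta> T (M N) (F N) (W N) X_tilde (\<xi> N)"
  shows "(\<lambda>N. SUP t\<in>{0..T}. \<integral>\<^sup>+ \<omega>.
      Hs_norm_sq lam (- \<beta>)
        (\<lambda>n. (X N t \<omega> n - X_tilde t n) / sqrt (eps \<alpha>\<^sub>1 N) - \<xi> N t \<omega> n) \<partial>M N)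
    \<longlonglongrightarrow> 0"
proof -
  note det = assms(11)
  obtain A1 where A1: "A1 \<ge> 0" "\<And>t. t \<in> {0..T} \<Longrightarrow> (\<Sum>k. ennreal ((X_tilde t k)\<^sup>2)) \<le> ennreal A1"
    using det_weak_solution_bound[OF det assms(8)] by blast
  \<comment> \<open>One constant for both solutions; the summand 1 makes it positive even for x =
    0.\<close>
  define A where "A = A1 + (ell2_norm x)\<^sup>2 + 1"
  have A: "A > 0" "A1 \<le> A" "(ell2_norm x)\<^sup>2 \<le> A" using A1(1) by (auto simp: A_def add_nonneg_pos)
  have Y: "(\<Sum>k. ennreal ((X_tilde t k)\<^sup>2)) \<le> ennreal A" if "t \<in> {0..T}" for t
    using A1(2)[OF that] ennreal_leI[OF A(2)] by (rule order.trans)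
  have ap: "approx_pair (M N) (F N) (W N) lam \<nu> \<alpha>\<^sub>1 \<beta> T A N x (X N) X_tilde (\<xi> N)" if N: "N \<ge> 1" for N
  proof -
    have weak: "weak_solution lam \<nu> (theta \<alpha>\<^sub>1 N) x T (M N) (F N) (W N) (X N)"
      using assms(9)[OF N] by (simp add: Linf_weak_solution_def)
    have "AE \<omega> in M N. \<forall>t\<in>{0..T}. (\<Sum>k. ennreal ((X N t \<omega> k)\<^sup>2)) \<le> ennreal A"
      using assms(10)[OF N] AE_space
    proof eventually_elim
      case (elim \<omega>)
      show ?case
      proof
        fix t assume t: "t \<in> {0..T}"
        have e: "X N t \<omega> \<in> ell2" using weak elim(2) t unfolding weak_solution_def by blast
        have "(ell2_norm (X N t \<omega>))\<^sup>2 \<le> (ell2_norm x)\<^sup>2"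
          using elim(1) t e by (intro power_mono) (auto simp: ell2_norm_def ell2_def suminf_nonneg)
        then show "(\<Sum>k. ennreal ((X N t \<omega> k)\<^sup>2)) \<le> ennreal A"
          unfolding ell2_suminf[OF e] using A(3) by (intro ennreal_leI) linarith
      qed
    qed
    note X_bound = this
    have fps: "filtered_prob_space (M N) (F N)" and ibf: "indep_brownian_family (M N) (F N) (W N)"
      using weak unfolding weak_solution_def by blast+
    show ?thesis
    proof
      show "(\<Sum>k. ennreal ((X_tilde t k)\<^sup>2)) \<le> ennreal A" if "t \<in> {0..T}" for t using Y[OF that] .
    qed (fact fps ibf assms A N weak X_bound det assms(12)[OF N])+
  qed
  show ?thesis
    unfolding Hs_norm_sq_eq_wnorm
  proof (rule tendsto_0_ennrealI)
    fix \<delta> :: real assume \<delta>: "\<delta> > 0"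
    obtain N0 where N0: "\<forall>N\<ge>N0. \<forall>(M :: 'a measure) F W x X \<xi> t. approx_pair M F W lam \<nu> \<alpha>\<^sub>1 \<beta> T A N x X X_tilde \<xi> \<longrightarrow> t \<in> {0..T} \<longrightarrow>
      (\<integral>\<^sup>+\<omega>. wnorm (rw lam \<beta> 0) (\<lambda>n. (X t \<omega> n - X_tilde t n) / sqrt (eps \<alpha>\<^sub>1 N) - \<xi> t \<omega> n) \<partial>M) \<le> ennreal \<delta>"
      using approx_pair_uniform_limit[OF assms(1,2,4,5,6,7,8) A(1) det_weak_solution_continuous_on[OF det] Y \<delta>] by blast
    show "\<exists>N0. \<forall>N\<ge>N0. (SUP t\<in>{0..T}. \<integral>\<^sup>+ \<omega>. wnorm (rw lam \<beta> 0)
        (\<lambda>n. (X N t \<omega> n - X_tilde t n) / sqrt (eps \<alpha>\<^sub>1 N) - \<xi> N t \<omega> n) \<partial>M N) \<le> ennreal \<delta>"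
    proof (intro exI[of _ "max 1 N0"] allI impI SUP_least)
      fix N t assume "max 1 N0 \<le> N" and t: "t \<in> {0..T}"
      then have "N \<ge> 1" "N \<ge> N0" by auto
      then show "(\<integral>\<^sup>+ \<omega>. wnorm (rw lam \<beta> 0) (\<lambda>n. (X N t \<omega> n - X_tilde t n) / sqrt (eps \<alpha>\<^sub>1 N) - \<xi> N t \<omega> n) \<partial>M N) \<le> ennreal \<delta>"
        using N0 ap t by blast
    qed
  qed
qed

end
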